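(* There is a constant $C>0$, independent of $h$ and $\varepsilon$, such that for all $0\le\varepsilon\le\varepsilon_0$, $$\sup_{\boldsymbol0\ne(\boldsymbol\psi,s)\in V_h\times R_h}\frac{b_1(\boldsymbol\psi,\boldsymbol q)+b_2(s,\boldsymbol q)}{\|(\boldsymbol\psi,s)\|_\varepsilon}\ \ge\ C\,\|\boldsymbol q\|_\varepsilon\qquad\forall\,\boldsymbol q\in Q_h.$$
   Context: Let $\Omega\subset\mathbb R^3$ be a bounded polyhedral domain. $(\cdot,\cdot)$ and $\|\cdot\|_0$ are the $L^2(\Omega)$ inner product and norm (scalar or vector). Fix $\varepsilon_0>0$ and let $0\le\varepsilon\le\varepsilon_0$. Spaces and norms: $V=H_0^1(\Omega;\mathbb R^3)$ if $\varepsilon>0$ and $V=L^2(\Omega;\mathbb R^3)$ if $\varepsilon=0$, with $\|\boldsymbol\psi\|_\varepsilon^2=\varepsilon^2\|\nabla\boldsymbol\psi\|_0^2+\|\boldsymbol\psi\|_0^2$ (the first term being absent if $\varepsilon=0$); $R=L_0^2(\Omega)$ (mean-zero $L^2$ functions); $\|(\boldsymbol\psi,s)\|_\varepsilon^2=\|\boldsymbol\psi\|_\varepsilon^2+\|s\|_0^2$. $Q=H_0(\mathrm{div};\Omega)$ (fields in $H(\mathrm{div};\Omega)$ with vanishing normal trace) if $\varepsilon>0$ and $Q=H_0(\mathrm{div};\Omega)\cap H(\mathrm{curl};\Omega)$ if $\varepsilon=0$. The pairing $\langle\boldsymbol\psi,\operatorname{curl}\boldsymbol q\rangle$ for $(\boldsymbol\psi,\boldsymbol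 q)\in V\times Q$ equals $(\operatorname{curl}\boldsymbol\psi,\boldsymbol q)$ if $\varepsilon>0$ and $(\boldsymbol\psi,\operatorname{curl}\boldsymbol q)$ if $\varepsilon=0$, and $$\|\boldsymbol q\|_\varepsilon^2=\Big(\sup_{\boldsymbol0\ne\boldsymbol\psi\in V}\frac{\langle\boldsymbol\psi,\operatorname{curl}\boldsymbol q\rangle}{\|\boldsymbol\psi\|_\varepsilon}\Big)^2+\|\operatorname{div}\boldsymbol q\|_0^2 .$$ Bilinear forms: $b_1(\boldsymbol\psi,\boldsymbol q)=\langle\boldsymbol\psi,\operatorname{curl}\boldsymbol q\rangle$, $b_2(s,\boldsymbol q)=(s,\operatorname{div}\boldsymbol q)$. Meshes: $\{\mathcal T_h\}_{h>0}$ is a shape-regular, quasi-uniform family of conforming tetrahedral triangulations of $\Omega$, $h=\max_{K\in\mathcal T_h}\operatorname{diam}K$. With $B_4(K)=P_4(K)\cap H_0^1(K)$ (quartic bubbles), set $V_h=\{\boldsymbol\psi\in V:\boldsymbol\psi|_K\in[P_1(K)\oplus B_4(K)]^3\ \forall K\in\mathcal T_h\}$, $R_h=\{s\in R: s|_K\in P_0(K)\ \forall K\in\mathcal T_h\}$, $Q_h=\{\boldsymbol q\in H_0(\mathrm{div};\Omega)\cap H^1(\Omega;\mathbb R^3):\boldsymbol q|_K\in P_1(K;\mathbb R^3)\ \forall K\in\mathcal T_h\}$. *)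

theory Defs
  imports "HOL-Analysis.Analysis"
begin

type_synonym R3 = "real^3"

section \<open>Lebesgue spaces and test functions\<close>

text \<open>Elements of function spaces are represented by functions on the whole of \<open>R3\<close>, of which only
  the values almost everywhere in the domain matter; ``non-zero'' therefore always means ``not almost
  everywhere zero''.  The value type is \<open>real\<close> for scalar and \<open>R3\<close> for vector fields.\<close>

definition L2 :: "R3 set \<Rightarrow> (R3 \<Rightarrow> 'a::euclidean_space) set" where
  "L2 \<Omega> = {f \<in> borel_measurable (lebesgue_on \<Omega>). integrable (lebesgue_on \<Omega>) (\<lambda>x. (norm (f x))\<^sup>2)}"

definition l2_inner :: "R3 set \<Rightarrow> (R3 \<Rightarrow> 'a::euclidean_space) \<Rightarrow> (R3 \<Rightarrow> 'a) \<Rightarrow> real" where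
  "l2_inner \<Omega> f g = (LINT x|lebesgue_on \<Omega>. f x \<bullet> g x)"

definition l2_norm :: "R3 set \<Rightarrow> (R3 \<Rightarrow> 'a::euclidean_space) \<Rightarrow> real" where
  "l2_norm \<Omega> f = sqrt (l2_inner \<Omega> f f)"

definition ae_zero :: "R3 set \<Rightarrow> (R3 \<Rightarrow> 'a::euclidean_space) \<Rightarrow> bool" where
  "ae_zero \<Omega> f \<longleftrightarrow> (AE x in lebesgue_on \<Omega>. f x = 0)"

definition L2_mean0 :: "R3 set \<Rightarrow> (R3 \<Rightarrow> real) set" where
  "L2_mean0 \<Omega> = {s \<in> L2 \<Omega>. (LINT x|lebesgue_on \<Omega>. s x) = 0}"

definition pd :: "3 \<Rightarrow> (R3 \<Rightarrow> real) \<Rightarrow> R3 \<Rightarrow> real" where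
  "pd i f x = frechet_derivative f (at x) (axis i 1)"

definition smooth :: "(R3 \<Rightarrow> real) \<Rightarrow> bool" where
  "smooth f \<longleftrightarrow> (\<forall>is. foldr pd is f differentiable_on UNIV)"

definition test_fun :: "R3 set \<Rightarrow> (R3 \<Rightarrow> real) set" where
  "test_fun \<Omega> = {\<phi>. smooth \<phi> \<and> (\<exists>K. compact K \<and> K \<subseteq> \<Omega> \<and> (\<forall>x. x \<notin> K \<longrightarrow> \<phi> x = 0))}"

definition test_field :: "R3 set \<Rightarrow> (R3 \<Rightarrow> R3) set" where
  "test_field \<Omega> = {\<phi>. \<forall>i. (\<lambda>x. \<phi> x $ i) \<in> test_fun \<Omega>}"

section \<open>Weak derivatives\<close>

text \<open>The operators below select one representative of the weak derivative, which is unique up to null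
  sets; the value is meaningful only if a weak derivative in \<open>L2\<close> exists.\<close>

definition is_weak_partial :: "R3 set \<Rightarrow> 3 \<Rightarrow> (R3 \<Rightarrow> real) \<Rightarrow> (R3 \<Rightarrow> real) \<Rightarrow> bool" where
  "is_weak_partial \<Omega> i u v \<longleftrightarrow>
     v \<in> L2 \<Omega> \<and> (\<forall>\<phi>\<in>test_fun \<Omega>. l2_inner \<Omega> u (pd i \<phi>) = - l2_inner \<Omega> v \<phi>)"

definition weak_partial :: "R3 set \<Rightarrow> 3 \<Rightarrow> (R3 \<Rightarrow> real) \<Rightarrow> R3 \<Rightarrow> real" where
  "weak_partial \<Omega> i u = (SOME v. is_weak_partial \<Omega> i u v)"

definition weak_grad :: "R3 set \<Rightarrow> (R3 \<Rightarrow> real) \<Rightarrow> R3 \<Rightarrow> R3" where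
  "weak_grad \<Omega> u x = (\<chi> i. weak_partial \<Omega> i u x)"

definition is_weak_div :: "R3 set \<Rightarrow> (R3 \<Rightarrow> R3) \<Rightarrow> (R3 \<Rightarrow> real) \<Rightarrow> bool" where
  "is_weak_div \<Omega> q d \<longleftrightarrow>
     d \<in> L2 \<Omega> \<and> (\<forall>\<phi>\<in>test_fun \<Omega>. l2_inner \<Omega> q (\<lambda>x. \<chi> i. pd i \<phi> x) = - l2_inner \<Omega> d \<phi>)"

definition weak_div :: "R3 set \<Rightarrow> (R3 \<Rightarrow> R3) \<Rightarrow> R3 \<Rightarrow> real" where
  "weak_div \<Omega> q = (SOME d. is_weak_div \<Omega> q d)"

definition curl :: "(R3 \<Rightarrow> R3) \<Rightarrow> R3 \<Rightarrow> R3" where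
  "curl \<phi> x = (let D = (\<lambda>i j. pd i (\<lambda>y. \<phi> y $ j) x) in
     vector [D 2 3 - D 3 2, D 3 1 - D 1 3, D 1 2 - D 2 1])"

definition is_weak_curl :: "R3 set \<Rightarrow> (R3 \<Rightarrow> R3) \<Rightarrow> (R3 \<Rightarrow> R3) \<Rightarrow> bool" where
  "is_weak_curl \<Omega> q c \<longleftrightarrow>
     c \<in> L2 \<Omega> \<and> (\<forall>\<phi>\<in>test_field \<Omega>. l2_inner \<Omega> q (curl \<phi>) = l2_inner \<Omega> c \<phi>)"

definition weak_curl :: "R3 set \<Rightarrow> (R3 \<Rightarrow> R3) \<Rightarrow> R3 \<Rightarrow> R3" where
  "weak_curl \<Omega> q = (SOME c. is_weak_curl \<Omega> q c)"

section \<open>Sobolev spaces\<close>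

definition H1 :: "R3 set \<Rightarrow> (R3 \<Rightarrow> real) set" where
  "H1 \<Omega> = {u \<in> L2 \<Omega>. \<forall>i. \<exists>v. is_weak_partial \<Omega> i u v}"

definition H1_norm :: "R3 set \<Rightarrow> (R3 \<Rightarrow> real) \<Rightarrow> real" where
  "H1_norm \<Omega> u = sqrt ((l2_norm \<Omega> u)\<^sup>2 + (l2_norm \<Omega> (weak_grad \<Omega> u))\<^sup>2)"

definition H01 :: "R3 set \<Rightarrow> (R3 \<Rightarrow> real) set" where
  "H01 \<Omega> = {u \<in> H1 \<Omega>. \<forall>e>0. \<exists>\<phi>\<in>test_fun \<Omega>. H1_norm \<Omega> (\<lambda>x. u x - \<phi> x) < e}"

definition H1_field :: "R3 set \<Rightarrow> (R3 \<Rightarrow> R3) set" where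
  "H1_field \<Omega> = {u. \<forall>i. (\<lambda>x. u x $ i) \<in> H1 \<Omega>}"

definition H01_field :: "R3 set \<Rightarrow> (R3 \<Rightarrow> R3) set" where
  "H01_field \<Omega> = {u. \<forall>i. (\<lambda>x. u x $ i) \<in> H01 \<Omega>}"

definition grad_norm :: "R3 set \<Rightarrow> (R3 \<Rightarrow> R3) \<Rightarrow> real" where
  "grad_norm \<Omega> u = sqrt (\<Sum>i\<in>UNIV. (l2_norm \<Omega> (weak_grad \<Omega> (\<lambda>x. u x $ i)))\<^sup>2)"

definition Hdiv :: "R3 set \<Rightarrow> (R3 \<Rightarrow> R3) set" where
  "Hdiv \<Omega> = {q \<in> L2 \<Omega>. \<exists>d. is_weak_div \<Omega> q d}"

definition Hcurl :: "R3 set \<Rightarrow> (R3 \<Rightarrow> R3) set" where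
  "Hcurl \<Omega> = {q \<in> L2 \<Omega>. \<exists>c. is_weak_curl \<Omega> q c}"

text \<open>The normal trace of \<open>q \<in> Hdiv \<Omega>\<close> is the functional
  \<open>\<phi> \<mapsto> (q, grad \<phi>) + (div q, \<phi>)\<close> on \<open>H1 \<Omega>\<close>.\<close>

definition normal_trace :: "R3 set \<Rightarrow> (R3 \<Rightarrow> R3) \<Rightarrow> (R3 \<Rightarrow> real) \<Rightarrow> real" where
  "normal_trace \<Omega> q \<phi> = l2_inner \<Omega> q (weak_grad \<Omega> \<phi>) + l2_inner \<Omega> (weak_div \<Omega> q) \<phi>"

definition H0div :: "R3 set \<Rightarrow> (R3 \<Rightarrow> R3) set" where
  "H0div \<Omega> = {q \<in> Hdiv \<Omega>. \<forall>\<phi>\<in>H1 \<Omega>. normal_trace \<Omega> q \<phi> = 0}"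

section \<open>The spaces, norms and bilinear forms depending on the parameter\<close>

definition V_sp :: "R3 set \<Rightarrow> real \<Rightarrow> (R3 \<Rightarrow> R3) set" where
  "V_sp \<Omega> \<epsilon> = (if \<epsilon> > 0 then H01_field \<Omega> else L2 \<Omega>)"

definition Q_sp :: "R3 set \<Rightarrow> real \<Rightarrow> (R3 \<Rightarrow> R3) set" where
  "Q_sp \<Omega> \<epsilon> = (if \<epsilon> > 0 then H0div \<Omega> else H0div \<Omega> \<inter> Hcurl \<Omega>)"

definition V_norm :: "R3 set \<Rightarrow> real \<Rightarrow> (R3 \<Rightarrow> R3) \<Rightarrow> real" where
  "V_norm \<Omega> \<epsilon> \<psi> =
     sqrt ((if \<epsilon> > 0 then \<epsilon>\<^sup>2 * (grad_norm \<Omega> \<psi>)\<^sup>2 else 0) + (l2_norm \<Omega> \<psi>)\<^sup>2)"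

definition VR_norm :: "R3 set \<Rightarrow> real \<Rightarrow> (R3 \<Rightarrow> R3) \<Rightarrow> (R3 \<Rightarrow> real) \<Rightarrow> real" where
  "VR_norm \<Omega> \<epsilon> \<psi> s = sqrt ((V_norm \<Omega> \<epsilon> \<psi>)\<^sup>2 + (l2_norm \<Omega> s)\<^sup>2)"

definition b1 :: "R3 set \<Rightarrow> real \<Rightarrow> (R3 \<Rightarrow> R3) \<Rightarrow> (R3 \<Rightarrow> R3) \<Rightarrow> real" where
  "b1 \<Omega> \<epsilon> \<psi> q =
     (if \<epsilon> > 0 then l2_inner \<Omega> (weak_curl \<Omega> \<psi>) q else l2_inner \<Omega> \<psi> (weak_curl \<Omega> q))"

definition b2 :: "R3 set \<Rightarrow> (R3 \<Rightarrow> real) \<Rightarrow> (R3 \<Rightarrow> R3) \<Rightarrow> real" where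
  "b2 \<Omega> s q = l2_inner \<Omega> s (weak_div \<Omega> q)"

text \<open>The supremum is a real one: for \<open>q \<in> Q_sp \<Omega> \<epsilon>\<close> the quotients are bounded, by a multiple of
  \<open>l2_norm \<Omega> q / \<epsilon>\<close> if \<open>\<epsilon> > 0\<close> and by the norm of \<open>weak_curl \<Omega> q\<close> if \<open>\<epsilon> = 0\<close>.\<close>

definition Q_norm :: "R3 set \<Rightarrow> real \<Rightarrow> (R3 \<Rightarrow> R3) \<Rightarrow> real" where
  "Q_norm \<Omega> \<epsilon> q =
     sqrt ((SUP \<psi>\<in>{\<psi> \<in> V_sp \<Omega> \<epsilon>. \<not> ae_zero \<Omega> \<psi>}. b1 \<Omega> \<epsilon> \<psi> q / V_norm \<Omega> \<epsilon> \<psi>)\<^sup>2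
           + (l2_norm \<Omega> (weak_div \<Omega> q))\<^sup>2)"

section \<open>Polyhedral domains and triangulations\<close>

text \<open>The condition \<open>interior (closure \<Omega>) = \<Omega>\<close> says that the domain lies on one side of its boundary
  only (no slits), so that it is determined by the union of the cells of a triangulation.\<close>

definition polyhedral_domain :: "R3 set \<Rightarrow> bool" where
  "polyhedral_domain \<Omega> \<longleftrightarrow>
     open \<Omega> \<and> connected \<Omega> \<and> \<Omega> \<noteq> {} \<and> bounded \<Omega> \<and>
     interior (closure \<Omega>) = \<Omega> \<and>
     (\<exists>P. finite P \<and> (\<forall>p\<in>P. polytope p) \<and> closure \<Omega> = \<Union>P)"

definition conforming_triangulation :: "R3 set \<Rightarrow> R3 set set \<Rightarrow> bool" where
  "conforming_triangulation \<Omega> \<T> \<longleftrightarrow>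
     triangulation \<T> \<and> (\<forall>K\<in>\<T>. 3 simplex K) \<and> \<Union>\<T> = closure \<Omega>"

definition mesh_size :: "R3 set set \<Rightarrow> real" where
  "mesh_size \<T> = Max (diameter ` \<T>)"

definition inball_diameter :: "R3 set \<Rightarrow> real" where
  "inball_diameter K = Sup {2 * r | r. r \<ge> 0 \<and> (\<exists>x. cball x r \<subseteq> K)}"

definition shape_regular :: "real set \<Rightarrow> (real \<Rightarrow> R3 set set) \<Rightarrow> bool" where
  "shape_regular H \<T> \<longleftrightarrow>
     (\<exists>\<sigma>>0. \<forall>h\<in>H. \<forall>K\<in>\<T> h. diameter K \<le> \<sigma> * inball_diameter K)"

definition quasi_uniform :: "real set \<Rightarrow> (real \<Rightarrow> R3 set set) \<Rightarrow> bool" where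
  "quasi_uniform H \<T> \<longleftrightarrow>
     (\<exists>\<tau>>0. \<forall>h\<in>H. \<forall>K\<in>\<T> h. mesh_size (\<T> h) \<le> \<tau> * diameter K)"

section \<open>Finite element spaces\<close>

definition P_deg :: "nat \<Rightarrow> (R3 \<Rightarrow> real) set" where
  "P_deg k = {p. \<exists>c. p = (\<lambda>x. \<Sum>(i, j, l)\<in>{(i, j, l). i + j + l \<le> k}.
                            c i j l * (x $ 1) ^ i * (x $ 2) ^ j * (x $ 3) ^ l)}"

definition B4 :: "R3 set \<Rightarrow> (R3 \<Rightarrow> real) set" where
  "B4 K = P_deg 4 \<inter> H01 (interior K)"

text \<open>A restriction to a cell \<open>K\<close> belongs to a local space if it agrees almost everywhere on \<open>K\<close> with a
  member of that space; thus the functions may be discontinuous across the faces.\<close>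

definition V_h :: "R3 set \<Rightarrow> real \<Rightarrow> R3 set set \<Rightarrow> (R3 \<Rightarrow> R3) set" where
  "V_h \<Omega> \<epsilon> \<T> = {\<psi> \<in> V_sp \<Omega> \<epsilon>. \<forall>K\<in>\<T>. \<forall>i. \<exists>p\<in>P_deg 1. \<exists>b\<in>B4 K.
                   AE x in lebesgue_on K. \<psi> x $ i = p x + b x}"

definition R_h :: "R3 set \<Rightarrow> R3 set set \<Rightarrow> (R3 \<Rightarrow> real) set" where
  "R_h \<Omega> \<T> = {s \<in> L2_mean0 \<Omega>. \<forall>K\<in>\<T>. \<exists>p\<in>P_deg 0. AE x in lebesgue_on K. s x = p x}"

definition Q_h :: "R3 set \<Rightarrow> R3 set set \<Rightarrow> (R3 \<Rightarrow> R3) set" where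
  "Q_h \<Omega> \<T> = {q \<in> H0div \<Omega> \<inter> H1_field \<Omega>. \<forall>K\<in>\<T>. \<forall>i. \<exists>p\<in>P_deg 1.
                   AE x in lebesgue_on K. q x $ i = p x}"

end

theory Submission
  imports Defs
begin

text \<open>For \<open>q\<close> in \<open>Q_h\<close> the curl \<open>c\<close> and the divergence \<open>d\<close> are constant on every cell, and \<open>d\<close> has mean
  zero because the normal trace vanishes; so the test function \<open>(0, d)\<close> gives the divergence part of the
  norm, and for \<open>\<epsilon> = 0\<close> the test function \<open>(c, 0)\<close> gives the rest.  For \<open>\<epsilon> > 0\<close> the pairing of a field
  \<open>\<psi>\<close> with \<open>c\<close> only depends on the integrals of \<open>\<psi>\<close> over the cells, so it suffices to find, for every test
  function, a discrete function with the same cell integrals that is bounded in \<open>L2\<close> and in \<open>H1\<close>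
  separately (a Fortin operator); the general \<open>\<psi>\<close> follows by density.

  The operator is a Clement-type interpolant plus a multiple of the bubble on every cell.  Its nodal
  value at an interior vertex is the average over a ball around the vertex of radius proportional to
  \<open>h\<close>; at a boundary vertex the ball is taken near the vertex but outside the domain, where the test
  function, extended by zero, has the average zero.  Hence one estimate serves all vertices: the error at
  \<open>x\<close> is bounded by the mean square of \<open>\<phi> x - \<phi> (x + w)\<close> over \<open>\<bar>w\<bar> \<le> C h\<close>, and the \<open>L2\<close> norm of
  \<open>\<phi> - \<phi> (\<cdot> + w)\<close> is at most \<open>\<bar>w\<bar>\<close> times that of the gradient.\<close>

text \<open>The obstacle is uniformity in \<open>\<epsilon>\<close>. The weighted norm degenerates
  to the \<open>L2\<close> norm as \<open>\<epsilon>\<close> tends to 0, so a Fortin operator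
  bounded in \<open>H1\<close> alone would not do; with separate bounds for values and for gradients
  one constant serves every weight. The \<open>L2\<close> bound rules out point values and traces,
  hence averages over balls. The bubble has one coefficient per cell and component, just enough to
  prescribe the cell integral, and it vanishes on the faces, so continuity and boundary values
  survive the correction. There is no scaling to a reference cell: constants come from a ball of
  radius \<open>\<gamma> * h\<close> inscribed in each cell, on which ranges of affine functions are
  compared. The final constant is \<open>1 / sqrt (3 * Cf + 1)\<close>: \<open>Cf\<close> adds the
  constants of the value and the gradient bound, 3 is the price of density, 1 is the divergence
  part. Weak derivatives are chosen representatives and \<open>H01\<close> is a closure of test
  functions, so conformity of the discrete functions has to be earned: a Lipschitz, piecewise C1
  function that vanishes outside the domain is truncated near the value 0 and then
  mollified.\<close>

section \<open>The Cauchy-Schwarz inequality for integrals\<close>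

lemma integrable_inner_of_squares:
  fixes f g :: "'a \<Rightarrow> 'b::euclidean_space"
  assumes [measurable]: "f \<in> borel_measurable M" "g \<in> borel_measurable M"
    and f: "integrable M (\<lambda>x. (norm (f x))\<^sup>2)" and g: "integrable M (\<lambda>x. (norm (g x))\<^sup>2)"
  shows "integrable M (\<lambda>x. f x \<bullet> g x)"
proof (rule Bochner_Integration.integrable_bound)
  show "integrable M (\<lambda>x. (norm (f x))\<^sup>2 + (norm (g x))\<^sup>2)" using f g by simp
  have "\<bar>f x \<bullet> g x\<bar> \<le> (norm (f x))\<^sup>2 + (norm (g x))\<^sup>2" for x
  proof -
    have "\<bar>f x \<bullet> g x\<bar> \<le> norm (f x) * norm (g x)" by (rule Cauchy_Schwarz_ineq2)
    moreover have "2 * (norm (f x) * norm (g x)) \<le> (norm (f x))\<^sup>2 + (norm (g x))\<^sup>2"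
      using sum_squares_bound[of "norm (f x)" "norm (g x)"] by simp
    moreover have "0 \<le> norm (f x) * norm (g x)" by simp
    ultimately show ?thesis by linarith
  qed
  then show "AE x in M. norm (f x \<bullet> g x) \<le> norm ((norm (f x))\<^sup>2 + (norm (g x))\<^sup>2)" by auto
qed measurable

text \<open>The integral of \<open>(norm (f x - t *\<^sub>R g x))^2\<close> is a non-negative
  polynomial in t of degree at most two, which limits its discriminant.\<close>

lemma integral_Cauchy_Schwarz:
  fixes f g :: "'a \<Rightarrow> 'b::euclidean_space"
  assumes mf: "f \<in> borel_measurable M" and mg: "g \<in> borel_measurable M"
    and f: "integrable M (\<lambda>x. (norm (f x))\<^sup>2)" and g: "integrable M (\<lambda>x. (norm (g x))\<^sup>2)"
  shows "(\<integral>x. f x \<bullet> g x \<partial>M)\<^sup>2 \<le> (\<integral>x. (norm (f x))\<^sup>2 \<partial>M) * (\<integral>x. (norm (g x))\<^sup>2 \<partial>M)"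
proof -
  define A where "A = (\<integral>x. (norm (f x))\<^sup>2 \<partial>M)"
  define B where "B = (\<integral>x. f x \<bullet> g x \<partial>M)"
  define C where "C = (\<integral>x. (norm (g x))\<^sup>2 \<partial>M)"
  have fg: "integrable M (\<lambda>x. f x \<bullet> g x)" by (rule integrable_inner_of_squares[OF mf mg f g])
  have q: "0 \<le> A - 2 * t * B + t\<^sup>2 * C" for t
  proof -
    have "0 \<le> (\<integral>x. (norm (f x - t *\<^sub>R g x))\<^sup>2 \<partial>M)" by simp
    also have "\<dots> = (\<integral>x. (norm (f x))\<^sup>2 - (2 * t) * (f x \<bullet> g x) + t\<^sup>2 * (norm (g x))\<^sup>2 \<partial>M)"
      by (rule arg_cong[where f="integral\<^sup>L M"])
         (auto simp: fun_eq_iff power2_norm_eq_inner inner_diff inner_commute algebra_simps power2_eq_square[of t])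
    also have "\<dots> = A - 2 * t * B + t\<^sup>2 * C"
      using f g fg by (simp add: A_def B_def C_def)
    finally show ?thesis .
  qed
  have C0: "0 \<le> C" unfolding C_def by simp
  have A0: "0 \<le> A" unfolding A_def by simp
  show ?thesis
  proof (cases "C = 0")
    case True
    have "B = 0"
    proof (rule ccontr)
      assume "B \<noteq> 0"
      \<comment> \<open>A linear polynomial with non-zero slope takes negative values; at this t the
        value is -1.\<close>
      then show False using q[of "(A + 1) / (2 * B)"] True A0 by (simp add: field_simps)
    qed
    then show ?thesis using A0 C0 unfolding A_def B_def C_def by simp
  next
    case False
    then have "C > 0" using C0 by simp
    \<comment> \<open>t = B / C is the minimiser of the quadratic.\<close>
    have "0 \<le> (A - 2 * (B/C) * B + (B/C)\<^sup>2 * C) * C" using q[of "B/C"] C0 by simp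
    also have "\<dots> = A * C - B\<^sup>2" using \<open>C > 0\<close> by (simp add: field_simps power2_eq_square)
    finally show ?thesis unfolding A_def B_def C_def by simp
  qed
qed

section \<open>Square integrable functions\<close>

lemma L2_D:
  assumes "f \<in> L2 \<Omega>"
  shows "f \<in> borel_measurable (lebesgue_on \<Omega>)" "integrable (lebesgue_on \<Omega>) (\<lambda>x. (norm (f x))\<^sup>2)"
  using assms by (auto simp: L2_def)

lemma L2_inner_integrable:
  assumes "f \<in> L2 \<Omega>" "g \<in> L2 \<Omega>" shows "integrable (lebesgue_on \<Omega>) (\<lambda>x. f x \<bullet> g x)"
  using assms by (auto simp: L2_def intro: integrable_inner_of_squares)

lemma l2_norm_nonneg [simp]: "0 \<le> l2_norm \<Omega> f"
  by (simp add: l2_norm_def l2_inner_def)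

lemma l2_norm_squared: "(l2_norm \<Omega> f)\<^sup>2 = (LINT x|lebesgue_on \<Omega>. (norm (f x))\<^sup>2)"
  by (simp add: l2_norm_def l2_inner_def power2_norm_eq_inner)

lemma l2_inner_Cauchy_Schwarz:
  assumes "f \<in> L2 \<Omega>" "g \<in> L2 \<Omega>"
  shows "\<bar>l2_inner \<Omega> f g\<bar> \<le> l2_norm \<Omega> f * l2_norm \<Omega> g"
proof -
  have "(l2_inner \<Omega> f g)\<^sup>2 \<le> (l2_norm \<Omega> f * l2_norm \<Omega> g)\<^sup>2"
    unfolding l2_inner_def power_mult_distrib l2_norm_squared
    using L2_D[OF assms(1)] L2_D[OF assms(2)] by (intro integral_Cauchy_Schwarz)
  then show ?thesis using abs_le_square_iff[of "l2_inner \<Omega> f g" "l2_norm \<Omega> f * l2_norm \<Omega> g"]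
    by simp
qed

lemma norm_add_squared_le:
  fixes a b :: "'a::real_normed_vector"
  shows "(norm (a + b))\<^sup>2 \<le> 2 * (norm a)\<^sup>2 + 2 * (norm b)\<^sup>2"
proof -
  have "(norm (a + b))\<^sup>2 \<le> (norm a + norm b)\<^sup>2"
    by (intro power_mono norm_triangle_ineq) simp
  also have "\<dots> \<le> 2 * (norm a)\<^sup>2 + 2 * (norm b)\<^sup>2"
    using sum_squares_bound[of "norm a" "norm b"] by (simp add: power2_sum)
  finally show ?thesis .
qed

lemma L2_add:
  assumes "f \<in> L2 \<Omega>" "g \<in> L2 \<Omega>" shows "(\<lambda>x. f x + g x) \<in> L2 \<Omega>"
proof -
  have "integrable (lebesgue_on \<Omega>) (\<lambda>x. (norm (f x + g x))\<^sup>2)"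
  proof (rule Bochner_Integration.integrable_bound)
    show "integrable (lebesgue_on \<Omega>) (\<lambda>x. 2 * (norm (f x))\<^sup>2 + 2 * (norm (g x))\<^sup>2)"
      using assms by (simp add: L2_def)
    show "AE x in lebesgue_on \<Omega>. norm ((norm (f x + g x))\<^sup>2) \<le> norm (2 * (norm (f x))\<^sup>2 + 2 * (norm (g x))\<^sup>2)"
      using norm_add_squared_le by (auto intro!: AE_I2)
    show "(\<lambda>x. (norm (f x + g x))\<^sup>2) \<in> borel_measurable (lebesgue_on \<Omega>)"
      using assms by (auto simp: L2_def)
  qed
  then show ?thesis using assms by (auto simp: L2_def)
qed

lemma L2_scaleR:
  assumes "f \<in> L2 \<Omega>" shows "(\<lambda>x. c *\<^sub>R f x) \<in> L2 \<Omega>"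
  using assms by (auto simp: L2_def power_mult_distrib)

lemma L2_minus: assumes "f \<in> L2 \<Omega>" shows "(\<lambda>x. - f x) \<in> L2 \<Omega>"
  using L2_scaleR[OF assms, of "-1"] by simp

lemma L2_diff:
  assumes "f \<in> L2 \<Omega>" "g \<in> L2 \<Omega>" shows "(\<lambda>x. f x - g x) \<in> L2 \<Omega>"
  using L2_add[OF assms(1) L2_minus[OF assms(2)]] by simp

lemma L2_sum:
  assumes "\<And>i. i \<in> I \<Longrightarrow> f i \<in> L2 \<Omega>" "finite I" shows "(\<lambda>x. \<Sum>i\<in>I. f i x) \<in> L2 \<Omega>"
  using assms(2,1)
proof (induction I rule: finite_induct)
  case empty then show ?case by (simp add: L2_def)
next
  case (insert i I)
  then show ?case using L2_add[of "f i" \<Omega> "\<lambda>x. \<Sum>i\<in>I. f i x"] by simp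
qed

lemma l2_norm_add_squared:
  assumes "f \<in> L2 \<Omega>" "g \<in> L2 \<Omega>"
  shows "(l2_norm \<Omega> (\<lambda>x. f x + g x))\<^sup>2 \<le> 2 * (l2_norm \<Omega> f)\<^sup>2 + 2 * (l2_norm \<Omega> g)\<^sup>2"
proof -
  have "(LINT x|lebesgue_on \<Omega>. (norm (f x + g x))\<^sup>2)
      \<le> (LINT x|lebesgue_on \<Omega>. 2 * (norm (f x))\<^sup>2 + 2 * (norm (g x))\<^sup>2)"
    using L2_add[OF assms] assms by (intro integral_mono norm_add_squared_le) (auto simp: L2_def)
  also have "\<dots> = 2 * (LINT x|lebesgue_on \<Omega>. (norm (f x))\<^sup>2) + 2 * (LINT x|lebesgue_on \<Omega>. (norm (g x))\<^sup>2)"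
    using assms by (simp add: L2_def)
  finally show ?thesis by (simp add: l2_norm_squared)
qed

lemma l2_norm_cong_AE:
  assumes "AE x in lebesgue_on \<Omega>. f x = g x" "f \<in> borel_measurable (lebesgue_on \<Omega>)"
    "g \<in> borel_measurable (lebesgue_on \<Omega>)"
  shows "l2_norm \<Omega> f = l2_norm \<Omega> g"
proof -
  have "(LINT x|lebesgue_on \<Omega>. (norm (f x))\<^sup>2) = (LINT x|lebesgue_on \<Omega>. (norm (g x))\<^sup>2)"
    using assms by (intro integral_cong_AE) auto
  then have "(l2_norm \<Omega> f)\<^sup>2 = (l2_norm \<Omega> g)\<^sup>2" by (simp add: l2_norm_squared)
  then show ?thesis by (simp add: power2_eq_iff_nonneg)
qed

lemma l2_norm_eq_0_iff:
  assumes "f \<in> L2 \<Omega>" shows "l2_norm \<Omega> f = 0 \<longleftrightarrow> ae_zero \<Omega> f"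
proof -
  have "l2_norm \<Omega> f = 0 \<longleftrightarrow> (l2_norm \<Omega> f)\<^sup>2 = 0" by simp
  also have "\<dots> \<longleftrightarrow> (AE x in lebesgue_on \<Omega>. (norm (f x))\<^sup>2 = 0)"
    unfolding l2_norm_squared using assms by (intro integral_nonneg_eq_0_iff_AE) (auto simp: L2_def)
  finally show ?thesis by (simp add: ae_zero_def)
qed

lemma L2_component:
  fixes f :: "R3 \<Rightarrow> R3"
  assumes "f \<in> L2 \<Omega>" shows "(\<lambda>x. f x $ i) \<in> L2 \<Omega>"
proof -
  have [measurable]: "f \<in> borel_measurable (lebesgue_on \<Omega>)" using assms by (simp add: L2_def)
  have m: "(\<lambda>x. f x $ i) \<in> borel_measurable (lebesgue_on \<Omega>)" 
    by (rule borel_measurable_continuous_on[of "\<lambda>x. x $ i"]) (auto intro!: continuous_intros)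
  have "integrable (lebesgue_on \<Omega>) (\<lambda>x. (norm (f x $ i))\<^sup>2)"
  proof (rule Bochner_Integration.integrable_bound)
    show "integrable (lebesgue_on \<Omega>) (\<lambda>x. (norm (f x))\<^sup>2)" using assms by (simp add: L2_def)
    show "AE x in lebesgue_on \<Omega>. norm ((norm (f x $ i))\<^sup>2) \<le> norm ((norm (f x))\<^sup>2)"
    proof (rule AE_I2)
      fix x show "norm ((norm (f x $ i))\<^sup>2) \<le> norm ((norm (f x))\<^sup>2)"
        using power_mono[OF component_le_norm_cart[of "f x" i], of 2] by simp
    qed
    show "(\<lambda>x. (norm (f x $ i))\<^sup>2) \<in> borel_measurable (lebesgue_on \<Omega>)" using m by measurable
  qed
  then show ?thesis using m by (auto simp: L2_def)
qed

lemma L2_vec: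
  fixes f :: "R3 \<Rightarrow> R3"
  assumes "\<And>i. (\<lambda>x. f x $ i) \<in> L2 \<Omega>" shows "f \<in> L2 \<Omega>"
proof -
  have eq: "f = (\<lambda>x. \<Sum>i\<in>UNIV. (f x $ i) *\<^sub>R axis i 1)"
    by (simp add: fun_eq_iff basis_expansion scalar_mult_eq_scaleR[symmetric])
  have "(\<lambda>x. (f x $ i) *\<^sub>R (axis i 1 :: R3)) \<in> L2 \<Omega>" for i
    using assms[of i] by (auto simp: L2_def power_mult_distrib)
  then show ?thesis by (subst eq) (intro L2_sum, auto)
qed

lemma l2_norm_vec_squared:
  fixes f :: "R3 \<Rightarrow> R3"
  assumes "f \<in> L2 \<Omega>"
  shows "(l2_norm \<Omega> f)\<^sup>2 = (\<Sum>i\<in>UNIV. (l2_norm \<Omega> (\<lambda>x. f x $ i))\<^sup>2)"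
proof -
  have "(norm (f x))\<^sup>2 = (\<Sum>i\<in>UNIV. (norm (f x $ i))\<^sup>2)" for x
    by (simp add: norm_vec_def L2_set_def sum_nonneg)
  then show ?thesis using L2_component[OF assms]
    by (simp add: l2_norm_squared L2_def Bochner_Integration.integral_sum)
qed

lemma l2_inner_vec:
  fixes f g :: "R3 \<Rightarrow> R3"
  assumes "f \<in> L2 \<Omega>" "g \<in> L2 \<Omega>"
  shows "l2_inner \<Omega> f g = (\<Sum>i\<in>UNIV. l2_inner \<Omega> (\<lambda>x. f x $ i) (\<lambda>x. g x $ i))"
  using L2_inner_integrable[OF L2_component[OF assms(1)] L2_component[OF assms(2)]]
  by (simp add: l2_inner_def inner_vec_def Bochner_Integration.integral_sum)

lemma l2_inner_add:
  assumes "f \<in> L2 \<Omega>" "g \<in> L2 \<Omega>" "k \<in> L2 \<Omega>"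
  shows "l2_inner \<Omega> (\<lambda>x. f x + g x) k = l2_inner \<Omega> f k + l2_inner \<Omega> g k"
  unfolding l2_inner_def inner_add_left
  by (rule Bochner_Integration.integral_add) (use assms L2_inner_integrable in auto)

lemma l2_inner_diff:
  assumes "f \<in> L2 \<Omega>" "g \<in> L2 \<Omega>" "k \<in> L2 \<Omega>"
  shows "l2_inner \<Omega> (\<lambda>x. f x - g x) k = l2_inner \<Omega> f k - l2_inner \<Omega> g k"
  unfolding l2_inner_def inner_diff_left
  by (rule Bochner_Integration.integral_diff) (use assms L2_inner_integrable in auto)

lemma l2_inner_minus: "l2_inner \<Omega> (\<lambda>x. - f x) g = - l2_inner \<Omega> f g"
  by (simp add: l2_inner_def)

lemma l2_inner_commute: "l2_inner \<Omega> f g = l2_inner \<Omega> g f"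
  by (simp add: l2_inner_def inner_commute)

lemma l2_inner_cong_AE:
  assumes "AE x in lebesgue_on \<Omega>. f x = g x" "f \<in> borel_measurable (lebesgue_on \<Omega>)"
    "g \<in> borel_measurable (lebesgue_on \<Omega>)" "k \<in> borel_measurable (lebesgue_on \<Omega>)"
  shows "l2_inner \<Omega> f k = l2_inner \<Omega> g k"
  unfolding l2_inner_def using assms by (intro integral_cong_AE) auto

lemma L2_AE_bounded:
  fixes f :: "R3 \<Rightarrow> 'a::euclidean_space"
  assumes "\<Omega> \<in> lmeasurable" "f \<in> borel_measurable (lebesgue_on \<Omega>)"
    and "AE x in lebesgue_on \<Omega>. norm (f x) \<le> B"
  shows "f \<in> L2 \<Omega>"
proof -
  interpret finite_measure "lebesgue_on \<Omega>" by (rule finite_measure_lebesgue_on[OF assms(1)])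
  have "AE x in lebesgue_on \<Omega>. norm ((norm (f x))\<^sup>2) \<le> B\<^sup>2"
    using assms(3) by eventually_elim (simp add: power_mono)
  then have "integrable (lebesgue_on \<Omega>) (\<lambda>x. (norm (f x))\<^sup>2)"
    using assms(2) by (intro integrable_const_bound[where B="B\<^sup>2"]) auto
  then show ?thesis using assms(2) by (simp add: L2_def)
qed

lemma L2_bounded:
  fixes f :: "R3 \<Rightarrow> 'a::euclidean_space"
  assumes "\<Omega> \<in> lmeasurable" "f \<in> borel_measurable (lebesgue_on \<Omega>)"
    and "\<And>x. x \<in> \<Omega> \<Longrightarrow> norm (f x) \<le> B"
  shows "f \<in> L2 \<Omega>"
  by (rule L2_AE_bounded[OF assms(1,2)], rule AE_I2) (use assms(3) in auto)

lemma L2_integrable: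
  fixes f :: "R3 \<Rightarrow> real"
  assumes "\<Omega> \<in> lmeasurable" "f \<in> L2 \<Omega>" shows "integrable (lebesgue_on \<Omega>) f"
proof -
  have "(\<lambda>x. 1::real) \<in> L2 \<Omega>" using assms(1) by (intro L2_bounded[where B=1]) auto
  from L2_inner_integrable[OF assms(2) this] show ?thesis by simp
qed

lemma L2_subset:
  assumes "f \<in> L2 \<Omega>" "A \<subseteq> \<Omega>" "A \<in> sets lebesgue" "\<Omega> \<in> sets lebesgue" shows "f \<in> L2 A"
proof -
  have m: "f \<in> borel_measurable (lebesgue_on A)"
    using L2_D(1)[OF assms(1)] assms(2) by (rule measurable_restrict_mono)
  have "integrable (lebesgue_on \<Omega>) (\<lambda>x. indicator A x *\<^sub>R (norm (f x))\<^sup>2)"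
    using L2_D(2)[OF assms(1)] assms by (intro integrable_mult_indicator) (auto simp: sets_restrict_space_iff)
  then have "integrable lebesgue (\<lambda>x. indicator \<Omega> x *\<^sub>R indicator A x *\<^sub>R (norm (f x))\<^sup>2)"
    using assms by (subst (asm) integrable_restrict_space) auto
  moreover have "(\<lambda>x. indicator \<Omega> x *\<^sub>R indicator A x *\<^sub>R (norm (f x))\<^sup>2) = (\<lambda>x. indicator A x *\<^sub>R (norm (f x))\<^sup>2)"
    using assms(2) by (auto simp: indicator_def fun_eq_iff)
  ultimately have "integrable (lebesgue_on A) (\<lambda>x. (norm (f x))\<^sup>2)"
    using assms by (subst integrable_restrict_space) auto
  with m show ?thesis by (simp add: L2_def)
qed

section \<open>Smooth bump functions\<close>

text \<open>With s = 1 / t this is p(s) e^(-s), extended by zero. The polynomial factor makes the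
  family closed under differentiation.\<close>

definition expinv :: "real poly \<Rightarrow> real \<Rightarrow> real" where
  "expinv p t = (if t > 0 then poly p (1 / t) * exp (- 1 / t) else 0)"

lemma poly_exp_tendsto_0: "((\<lambda>x. poly p x * exp (- x)) \<longlongrightarrow> (0::real)) at_top"
proof -
  have "((\<lambda>x. \<Sum>i\<le>degree p. coeff p i * (x ^ i / exp x)) \<longlongrightarrow> (\<Sum>i\<le>degree p. coeff p i * 0)) at_top"
    by (intro tendsto_intros tendsto_power_div_exp_0)
  then show ?thesis by (simp add: poly_altdef exp_minus field_simps sum_divide_distrib)
qed

text \<open>The chain rule in s = 1 / t gives s^2 (p - p') e^(-s), hence the factor
  \<open>[:0, 0, 1:]\<close>; at 0 the exponential beats every power of s.\<close>

lemma expinv_has_derivative: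
  "(expinv p has_real_derivative expinv ([:0, 0, 1:] * (p - pderiv p)) t) (at t)"
proof (cases t "0::real" rule: linorder_cases)
  case less
  have "((\<lambda>_. 0) has_real_derivative 0) (at t)" by simp
  then have "(expinv p has_real_derivative 0) (at t)"
    by (rule has_field_derivative_transform_within_open[of _ _ _ "{..<0}"]) (use less in \<open>auto simp: expinv_def\<close>)
  then show ?thesis using less by (simp add: expinv_def)
next
  case greater
  have "((\<lambda>t. poly p (1 / t) * exp (- 1 / t)) has_real_derivative
     poly ([:0, 0, 1:] * (p - pderiv p)) (1 / t) * exp (- 1 / t)) (at t)"
    using greater by (auto intro!: derivative_eq_intros DERIV_chain'[OF _ poly_DERIV] simp: field_simps power2_eq_square)
  then have "(expinv p has_real_derivative poly ([:0, 0, 1:] * (p - pderiv p)) (1 / t) * exp (- 1 / t)) (at t)"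
    by (rule has_field_derivative_transform_within_open[of _ _ _ "{0<..}"]) (use greater in \<open>auto simp: expinv_def\<close>)
  then show ?thesis using greater by (simp add: expinv_def)
next
  case equal
  \<comment> \<open>In s = 1 / h the quotient is s p(s) e^(-s), hence the shifted polynomial
    \<open>pCons 0 p\<close>.\<close>
  have "((\<lambda>h. expinv p h / h) \<longlongrightarrow> 0) (at_right 0)"
    unfolding filterlim_at_right_to_top
  proof (rule Lim_transform_eventually[OF poly_exp_tendsto_0[of "pCons 0 p"]])
    show "\<forall>\<^sub>F x in at_top. poly (pCons 0 p) x * exp (- x) = expinv p (inverse x) / inverse x"
      using eventually_gt_at_top[of 0] by eventually_elim (auto simp: expinv_def field_simps)
  qed
  moreover have "((\<lambda>h. expinv p h / h) \<longlongrightarrow> 0) (at_left 0)"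
    by (rule tendsto_eventually) (auto simp: eventually_at_filter expinv_def)
  ultimately have "((\<lambda>h. expinv p h / h) \<longlongrightarrow> 0) (at 0)" by (intro filterlim_split_at)
  then show ?thesis using equal by (simp add: DERIV_def expinv_def)
qed

lemma pd_eqI: "(f has_derivative D) (at x) \<Longrightarrow> pd i f x = D (axis i 1)"
  unfolding pd_def by (metis frechet_derivative_at)

lemma has_derivative_pd:
  assumes "f differentiable at x"
  shows "(f has_derivative (\<lambda>h. \<Sum>i\<in>UNIV. h $ i * pd i f x)) (at x)"
proof -
  from assms obtain D where D: "(f has_derivative D) (at x)" by (auto simp: differentiable_def)
  then interpret linear D by (rule has_derivative_linear)
  have "D h = (\<Sum>i\<in>UNIV. h $ i * pd i f x)" for h
  proof -
    have "D h = D (\<Sum>i\<in>UNIV. h $ i *\<^sub>R axis i 1)"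
      by (simp add: basis_expansion scalar_mult_eq_scaleR[symmetric])
    also have "\<dots> = (\<Sum>i\<in>UNIV. h $ i * D (axis i 1))" by (simp add: sum scale)
    finally show ?thesis using pd_eqI[OF D] by simp
  qed
  then show ?thesis using D by (metis (no_types, lifting) ext)
qed

lemma pd_const [simp]: "pd i (\<lambda>x. c) x = 0"
  by (rule pd_eqI[THEN trans]) auto

lemma pd_add:
  assumes "f differentiable at x" "g differentiable at x"
  shows "pd i (\<lambda>x. f x + g x) x = pd i f x + pd i g x"
  using pd_eqI[OF has_derivative_add[OF has_derivative_pd[OF assms(1)] has_derivative_pd[OF assms(2)]], of i]
  by (simp add: axis_def if_distrib if_distribR sum.delta cong: if_cong)

lemma pd_mult:
  assumes "f differentiable at x" "g differentiable at x"
  shows "pd i (\<lambda>x. f x * g x) x = f x * pd i g x + pd i f x * g x"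
  using pd_eqI[OF has_derivative_mult[OF has_derivative_pd[OF assms(1)] has_derivative_pd[OF assms(2)]], of i]
  by (simp add: axis_def if_distrib if_distribR sum.delta cong: if_cong)

text \<open>\<open>smooth\<close> asks for iterated partial derivatives of every order. A class
  closed under \<open>pd\<close> reduces all orders to the first, and it contains just what bumps
  need: profiles in one variable, constants, sums and products.\<close>

inductive elem_smooth :: "(R3 \<Rightarrow> real) \<Rightarrow> bool" where
  expinv: "elem_smooth (\<lambda>x. expinv p (\<alpha> * x $ i + \<gamma>))"
| const: "elem_smooth (\<lambda>x. c)"
| add: "elem_smooth f \<Longrightarrow> elem_smooth g \<Longrightarrow> elem_smooth (\<lambda>x. f x + g x)"
| mult: "elem_smooth f \<Longrightarrow> elem_smooth g \<Longrightarrow> elem_smooth (\<lambda>x. f x * g x)"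

lemma elem_smooth_pd:
  assumes "elem_smooth f"
  shows "f differentiable at x" "elem_smooth (pd i f)"
proof -
  have "(\<forall>x. f differentiable at x) \<and> (\<forall>i. elem_smooth (pd i f))" using assms
  proof induction
    case (expinv p \<alpha> i \<gamma>)
    let ?q = "[:0, 0, 1:] * (p - pderiv p)"
    have D: "((\<lambda>x. expinv p (\<alpha> * x $ i + \<gamma>)) has_derivative (\<lambda>h. expinv ?q (\<alpha> * x $ i + \<gamma>) * (\<alpha> * h $ i))) (at x)" for x
    proof -
      have "((\<lambda>x. \<alpha> * x $ i + \<gamma>) has_derivative (\<lambda>h. \<alpha> * h $ i)) (at x)"
        by (auto intro!: derivative_eq_intros bounded_linear.has_derivative[OF bounded_linear_vec_nth])
      from has_derivative_compose[OF this, of "expinv p" "\<lambda>t. expinv ?q (\<alpha> * x $ i + \<gamma>) * t"]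
      show ?thesis using expinv_has_derivative[of p] by (simp add: has_field_derivative_def)
    qed
    have "pd j (\<lambda>x. expinv p (\<alpha> * x $ i + \<gamma>)) = (\<lambda>x. expinv ?q (\<alpha> * x $ i + \<gamma>) * (\<alpha> * axis j 1 $ i))" for j
      using pd_eqI[OF D] by blast
    then show ?case using D by (auto simp: differentiable_def intro: elem_smooth.intros)
  next
    case (const c)
    have "pd i (\<lambda>x. c) = (\<lambda>x. 0)" for i by auto
    then show ?case by (auto intro: elem_smooth.intros)
  next
    case (add f g)
    have "pd i (\<lambda>x. f x + g x) = (\<lambda>x. pd i f x + pd i g x)" for i
      using add by (auto simp: pd_add)
    then show ?case using add by (auto intro: elem_smooth.intros)
  next
    case (mult f g)
    have "pd i (\<lambda>x. f x * g x) = (\<lambda>x. f x * pd i g x + pd i f x * g x)" for i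
      using mult by (auto simp: pd_mult)
    then show ?case using mult by (auto intro!: elem_smooth.intros)
  qed
  then show "f differentiable at x" "elem_smooth (pd i f)" by auto
qed

lemma elem_smooth_imp_smooth:
  assumes "elem_smooth f" shows "smooth f"
proof -
  have "elem_smooth (foldr pd is f)" for "is"
    by (induction "is") (use assms elem_smooth_pd(2) in auto)
  then show ?thesis
    by (auto simp: smooth_def differentiable_on_def intro!: differentiable_at_withinI elem_smooth_pd(1))
qed

lemma elem_smooth_prod:
  assumes "\<And>i. i \<in> I \<Longrightarrow> elem_smooth (f i)" shows "elem_smooth (\<lambda>x. \<Prod>i\<in>I. f i x)"
  using assms by (induction I rule: infinite_finite_induct) (auto intro: elem_smooth.intros)

text \<open>For m > 0 positive exactly on the open box; a large m sharpens the profile, and in the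
  limit the indicator of the box appears.\<close>

definition bump :: "real \<Rightarrow> R3 \<Rightarrow> R3 \<Rightarrow> R3 \<Rightarrow> real" where
  "bump m a b x = (\<Prod>i\<in>UNIV. expinv 1 (m * x $ i + - m * a $ i) * expinv 1 (- m * x $ i + m * b $ i))"

lemma elem_smooth_bump: "elem_smooth (bump m a b)"
  unfolding bump_def[abs_def] by (intro elem_smooth_prod elem_smooth.intros)

lemma smooth_bump: "smooth (bump m a b)"
  by (rule elem_smooth_imp_smooth[OF elem_smooth_bump])

lemma expinv_1: "expinv 1 t = (if t > 0 then exp (- 1 / t) else 0)"
  by (simp add: expinv_def)

lemma bump_eq_0: assumes "m > 0" "x \<notin> box a b" shows "bump m a b x = 0"
proof -
  obtain i where "x $ i \<le> a $ i \<or> x $ i \<ge> b $ i" using assms(2) by (auto simp: mem_box_cart not_less)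
  then have "m * x $ i + - m * a $ i \<le> 0 \<or> - m * x $ i + m * b $ i \<le> 0" using assms(1) by auto
  then have "expinv 1 (m * x $ i + - m * a $ i) * expinv 1 (- m * x $ i + m * b $ i) = 0"
    by (auto simp: expinv_1)
  then show ?thesis unfolding bump_def by (intro prod_zero) auto
qed

lemma bump_nonneg: "0 \<le> bump m a b x" 
  by (auto simp: bump_def expinv_1 intro!: prod_nonneg)

lemma bump_le_1: "bump m a b x \<le> 1"
  unfolding bump_def by (intro prod_le_1 conjI mult_le_one) (auto simp: expinv_1)

lemma bump_pos: assumes "m > 0" "x \<in> box a b" shows "0 < bump m a b x"
  unfolding bump_def 
  by (intro prod_pos mult_pos_pos) (use assms in \<open>auto simp: expinv_1 mem_box_cart\<close>)

lemma bump_test_fun: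
  assumes "m > 0" "cbox a b \<subseteq> \<Omega>" shows "bump m a b \<in> test_fun \<Omega>"
proof -
  have "bump m a b x = 0" if "x \<notin> cbox a b" for x
    using bump_eq_0[OF assms(1)] box_subset_cbox that by blast
  then show ?thesis unfolding test_fun_def using assms(2) smooth_bump
    by (intro CollectI conjI exI[of _ "cbox a b"]) (auto intro: compact_cbox)
qed

text \<open>Inside the box every factor is exp(-1 / (n s)) with a fixed s > 0 and tends to 1;
  outside all bumps are 0.\<close>

lemma bump_tendsto_indicator:
  "(\<lambda>n. bump (real (Suc n)) a b x) \<longlonglongrightarrow> indicator (box a b) x"
proof (cases "x \<in> box a b")
  case False
  then show ?thesis by (simp add: bump_eq_0)
next
  case True
  have L: "(\<lambda>n. expinv 1 (real (Suc n) * s)) \<longlonglongrightarrow> 1" if "s > 0" for s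
  proof -
    have "(\<lambda>n. exp (- (1 / s) * (1 / real (Suc n)))) \<longlonglongrightarrow> exp (- (1 / s) * 0)"
      by (intro tendsto_intros lim_1_over_n LIMSEQ_Suc[OF lim_1_over_n])
    moreover have "real (Suc n) * s > 0" for n using that by simp
    ultimately show ?thesis unfolding expinv_1 by (simp add: mult.commute del: of_nat_Suc)
  qed
  have "(\<lambda>n. \<Prod>i\<in>UNIV. expinv 1 (real (Suc n) * (x $ i - a $ i)) * expinv 1 (real (Suc n) * (b $ i - x $ i)))
     \<longlonglongrightarrow> (\<Prod>i\<in>(UNIV::3 set). 1 * 1)"
    by (intro tendsto_prod tendsto_mult L) (use True in \<open>auto simp: mem_box_cart\<close>)
  then show ?thesis using True by (simp add: bump_def algebra_simps)
qed

section \<open>The fundamental lemma of the calculus of variations\<close>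

text \<open>Positive and negative part of v are densities of two measures that agree on boxes, an
  intersection-stable generator of the Borel sets; so the measures agree, and then the
  densities.\<close>

lemma AE_zero_if_box_integrals_zero:
  fixes v :: "R3 \<Rightarrow> real"
  assumes v: "integrable lborel v" and 0: "\<And>a b. (\<integral>x. indicator (box a b) x * v x \<partial>lborel) = 0"
  shows "AE x in lborel. v x = 0"
proof -
  let ?E = "range (\<lambda>(a, b). box a b :: R3 set)"
  define p where "p x = ennreal (v x)" for x
  define q where "q x = ennreal (- v x)" for x
  have [measurable]: "v \<in> borel_measurable borel" using v by auto
  have [measurable]: "p \<in> borel_measurable borel" "q \<in> borel_measurable borel"
    unfolding p_def q_def by measurable
  have fin: "(\<integral>\<^sup>+x. p x \<partial>lborel) \<noteq> \<infinity>" "(\<integral>\<^sup>+x. q x \<partial>lborel) \<noteq> \<infinity>"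
    using v unfolding p_def q_def real_integrable_def by auto
  have box_eq: "(\<integral>\<^sup>+x. p x * indicator (box a b) x \<partial>lborel) = (\<integral>\<^sup>+x. q x * indicator (box a b) x \<partial>lborel)" for a b
  proof -
    have I: "integrable lborel (\<lambda>x. indicator (box a b) x * v x)"
      using integrable_mult_indicator[OF _ v, of "box a b"] by simp
    have e: "(\<integral>\<^sup>+x. p x * indicator (box a b) x \<partial>lborel) = (\<integral>\<^sup>+x. ennreal (indicator (box a b) x * v x) \<partial>lborel)"
      "(\<integral>\<^sup>+x. q x * indicator (box a b) x \<partial>lborel) = (\<integral>\<^sup>+x. ennreal (- (indicator (box a b) x * v x)) \<partial>lborel)"
      unfolding p_def q_def by (auto intro!: nn_integral_cong simp: indicator_def)
    have "enn2real (\<integral>\<^sup>+x. p x * indicator (box a b) x \<partial>lborel) = enn2real (\<integral>\<^sup>+x. q x * indicator (box a b) x \<partial>lborel)"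
      using real_lebesgue_integral_def[OF I] 0[of a b] by (simp add: e)
    moreover have "(\<integral>\<^sup>+x. p x * indicator (box a b) x \<partial>lborel) < \<infinity>" "(\<integral>\<^sup>+x. q x * indicator (box a b) x \<partial>lborel) < \<infinity>"
      using I unfolding e real_integrable_def by (auto simp: top.not_eq_extremum)
    ultimately show ?thesis by (metis ennreal_enn2real infinity_ennreal_def)
  qed
  have "density lborel p = density lborel q"
  proof (rule measure_eqI_generator_eq[where E="?E" and \<Omega>=UNIV and A="\<lambda>n::nat. box (- (real n *\<^sub>R One)) (real n *\<^sub>R One)"])
    show "Int_stable ?E" by (auto simp: Int_stable_def box_Int_box)
    show "emeasure (density lborel p) X = emeasure (density lborel q) X" if "X \<in> ?E" for X
      using that box_eq by (auto simp: emeasure_density)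
    show "emeasure (density lborel p) (box (- (real n *\<^sub>R One)) (real n *\<^sub>R One)) \<noteq> \<infinity>" for n
    proof -
      have "emeasure (density lborel p) (box (- (real n *\<^sub>R One)) (real n *\<^sub>R One)) \<le> (\<integral>\<^sup>+x. p x \<partial>lborel)"
        by (auto simp: emeasure_density intro!: nn_integral_mono simp: indicator_def)
      then show ?thesis using fin(1) by (auto simp: top_unique)
    qed
  qed (auto simp: borel_eq_box UN_box_eq_UNIV)
  then have "AE x in lborel. p x = q x"
    using fin by (subst (asm) finite_density_unique) auto
  \<comment> \<open>The positive and the negative part of a number agree only if both
    vanish.\<close>
  then show ?thesis
    by eventually_elim (auto simp: p_def q_def ennreal_eq_0_iff split: if_splits,
       metis ennreal_eq_0_iff ennreal_inj linorder_le_cases neg_le_0_iff_le order_antisym_conv)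
qed

text \<open>The indicator of a box is not a test function but a bounded limit of the bumps on that
  box; dominated convergence carries the orthogonality over.\<close>

lemma integral_box_zero_if_orthogonal:
  fixes v :: "R3 \<Rightarrow> real"
  assumes "open \<Omega>" and v: "v \<in> L2 \<Omega>" and 0: "\<And>\<phi>. \<phi> \<in> test_fun \<Omega> \<Longrightarrow> l2_inner \<Omega> v \<phi> = 0"
    and sub: "cbox a b \<subseteq> \<Omega>"
  shows "integrable lebesgue (\<lambda>x. indicator (box a b) x * v x)"
    and "(LINT x|lebesgue. indicator (box a b) x * v x) = 0"
proof -
  have sub': "box a b \<subseteq> \<Omega>" using sub box_subset_cbox by blast
  have \<Omega>: "\<Omega> \<in> sets lebesgue" using \<open>open \<Omega>\<close> by auto
  have "v \<in> L2 (box a b)" using v sub' \<Omega> by (intro L2_subset[OF v]) auto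
  from L2_integrable[OF _ this] show I: "integrable lebesgue (\<lambda>x. indicator (box a b) x * v x)"
    by (auto simp: integrable_restrict_space)
  define B where "B n = bump (real (Suc n)) a b" for n
  have B0: "(LINT x|lebesgue. (indicator (box a b) x * v x) * B n x) = 0" for n
  proof -
    have "l2_inner \<Omega> v (B n) = (LINT x|lebesgue. indicator \<Omega> x *\<^sub>R (v x * B n x))"
      unfolding l2_inner_def using \<Omega> by (subst integral_restrict_space) auto
    also have "\<dots> = (LINT x|lebesgue. (indicator (box a b) x * v x) * B n x)"
      using sub' bump_eq_0[of "real (Suc n)" _ a b]
      by (intro Bochner_Integration.integral_cong) (auto simp: indicator_def B_def)
    finally show ?thesis using 0[OF bump_test_fun[OF _ sub], of "real (Suc n)"] by (simp add: B_def)
  qed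
  have "(\<lambda>n. LINT x|lebesgue. (indicator (box a b) x * v x) * B n x)
     \<longlonglongrightarrow> (LINT x|lebesgue. indicator (box a b) x * v x)"
  proof (rule integral_dominated_convergence)
    show "integrable lebesgue (\<lambda>x. \<bar>indicator (box a b) x * v x\<bar>)" using I by (rule integrable_abs)
    have "B n \<in> borel_measurable borel" for n
      unfolding B_def by (intro borel_measurable_continuous_onI continuous_at_imp_continuous_on ballI
          differentiable_imp_continuous_within elem_smooth_pd(1)[OF elem_smooth_bump])
    then have [measurable]: "B n \<in> borel_measurable lebesgue" for n
      by (intro measurable_completion) auto
    have [measurable]: "(\<lambda>x. indicator (box a b) x * v x) \<in> borel_measurable lebesgue" using I by auto
    show "(\<lambda>x. (indicator (box a b) x * v x) * B n x) \<in> borel_measurable lebesgue" for n by measurable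
    show "(\<lambda>x. indicator (box a b) x * v x) \<in> borel_measurable lebesgue" by measurable
    show "AE x in lebesgue. (\<lambda>n. (indicator (box a b) x * v x) * B n x) \<longlonglongrightarrow> indicator (box a b) x * v x"
    proof (rule AE_I2)
      fix x
      have "(\<lambda>n. (indicator (box a b) x * v x) * B n x) \<longlonglongrightarrow> (indicator (box a b) x * v x) * indicator (box a b) x"
        unfolding B_def by (intro tendsto_mult tendsto_const bump_tendsto_indicator)
      then show "(\<lambda>n. (indicator (box a b) x * v x) * B n x) \<longlonglongrightarrow> indicator (box a b) x * v x"
        by (cases "x \<in> box a b") simp_all
    qed
    show "AE x in lebesgue. norm ((indicator (box a b) x * v x) * B n x) \<le> \<bar>indicator (box a b) x * v x\<bar>" for n
      using bump_nonneg bump_le_1 unfolding B_def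
      by (intro AE_I2) (simp add: abs_mult mult_left_le)
  qed
  then show "(LINT x|lebesgue. indicator (box a b) x * v x) = 0"
    using B0 by (simp add: LIMSEQ_const_iff)
qed

text \<open>Countably many closed boxes with rational corners exhaust the open set, so one of them
  may be fixed. Cut off to it, v is integrable over the whole space, and its integral over every box
  vanishes.\<close>

lemma ae_zero_if_orthogonal_to_test_funs:
  fixes v :: "R3 \<Rightarrow> real"
  assumes "open \<Omega>" and v: "v \<in> L2 \<Omega>" and 0: "\<And>\<phi>. \<phi> \<in> test_fun \<Omega> \<Longrightarrow> l2_inner \<Omega> v \<phi> = 0"
  shows "ae_zero \<Omega> v"
proof -
  have box: "AE x in lebesgue. x \<in> cbox c d \<longrightarrow> v x = 0" if cd: "cbox c d \<subseteq> \<Omega>" for c d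
  proof -
    define w where "w x = indicator (box c d) x * v x" for x
    have w: "integrable lebesgue w"
      unfolding w_def by (rule integral_box_zero_if_orthogonal(1)[OF assms cd])
    \<comment> \<open>v is only Lebesgue measurable, the uniqueness lemma is about Borel measure:
      pass to a Borel representative.\<close>
    then obtain w' where [measurable]: "w' \<in> borel_measurable lborel" and ww': "AE x in lborel. w x = w' x"
      using completion_ex_borel_measurable_real[of w lborel] by auto
    have ww'2: "AE x in lebesgue. w x = w' x" using ww' by (rule AE_completion)
    have w'm: "w' \<in> borel_measurable lebesgue" by (rule measurable_completion) measurable
    have "integrable lebesgue w'"
      using integrable_cong_AE[OF borel_measurable_integrable[OF w] w'm ww'2] w by simp
    then have w'i: "integrable lborel w'" by (simp add: integrable_completion)
    have "AE x in lborel. w' x = 0"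
    proof (rule AE_zero_if_box_integrals_zero[OF w'i])
      fix a b
      \<comment> \<open>An arbitrary box need not lie in the domain, but its intersection with
        \<open>box c d\<close> is again a box and does.\<close>
      obtain a' b' where ab': "box a b \<inter> box c d = box a' b'" using box_Int_box[of a b c d] by blast
      have "(\<integral>x. indicator (box a b) x * w' x \<partial>lborel) = (LINT x|lebesgue. indicator (box a b) x * w' x)"
        by (rule integral_completion[symmetric]) measurable
      also have "\<dots> = (LINT x|lebesgue. indicator (box a b) x * w x)"
        using ww'2 by (intro integral_cong_AE borel_measurable_times borel_measurable_indicator
            borel_measurable_integrable[OF w] w'm) auto
      also have "\<dots> = (LINT x|lebesgue. indicator (box a' b') x * v x)"
        unfolding ab'[symmetric] w_def by (intro Bochner_Integration.integral_cong) (auto simp: indicator_def)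
      also have "\<dots> = 0"
      proof (cases "box a' b' = {}")
        case False
        then have "cbox a' b' = closure (box a' b')" by (simp add: closure_box)
        also have "\<dots> \<subseteq> closure (cbox c d)" using ab' box_subset_cbox by (intro closure_mono) blast
        also have "\<dots> \<subseteq> \<Omega>" using cd by simp
        finally have "cbox a' b' \<subseteq> \<Omega>" .
        from integral_box_zero_if_orthogonal(2)[OF assms this] show ?thesis .
      qed simp
      finally show "(\<integral>x. indicator (box a b) x * w' x \<partial>lborel) = 0" .
    qed
    then have "AE x in lebesgue. w' x = 0" by (rule AE_completion)
    \<comment> \<open>w only sees the open box; the faces form a null set.\<close>
    moreover have "AE x in lebesgue. x \<notin> cbox c d - box c d"
      using negligible_frontier_interval[of c d] by (intro AE_not_in) (simp add: negligible_iff_null_sets)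
    ultimately show ?thesis using ww'2
      by eventually_elim (auto simp: w_def indicator_def)
  qed
  define a' :: "(R3 \<Rightarrow> real \<times> real) \<Rightarrow> R3" where "a' f = (\<Sum>i\<in>Basis. fst (f i) *\<^sub>R i)" for f
  define b' :: "(R3 \<Rightarrow> real \<times> real) \<Rightarrow> R3" where "b' f = (\<Sum>i\<in>Basis. snd (f i) *\<^sub>R i)" for f
  define I where "I = {f\<in>Basis \<rightarrow>\<^sub>E \<rat> \<times> \<rat>. cbox (a' f) (b' f) \<subseteq> \<Omega>}"
  have U: "\<Omega> = (\<Union>f\<in>I. cbox (a' f) (b' f))"
    unfolding I_def a'_def b'_def by (rule open_UNION_cbox[OF \<open>open \<Omega>\<close>])
  have "countable I" unfolding I_def
    by (rule countable_subset[of _ "Basis \<rightarrow>\<^sub>E \<rat> \<times> \<rat>"]) (auto intro!: countable_PiE simp: countable_rat)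
  then have "AE x in lebesgue. \<forall>f\<in>I. x \<in> cbox (a' f) (b' f) \<longrightarrow> v x = 0"
    by (subst AE_ball_countable) (auto simp: I_def intro: box)
  then have "AE x in lebesgue. x \<in> \<Omega> \<longrightarrow> v x = 0"
    by eventually_elim (subst U, auto)
  then show ?thesis unfolding ae_zero_def using \<open>open \<Omega>\<close> by (subst AE_restrict_space_iff) auto
qed

section \<open>Piecewise continuously differentiable functions\<close>

lemma has_derivative_cong_nhds:
  assumes "\<forall>\<^sub>F y in nhds x. f y = g y" "(f has_derivative D) (at x)"
  shows "(g has_derivative D) (at x)"
proof -
  obtain S where "open S" "x \<in> S" "\<And>y. y \<in> S \<Longrightarrow> f y = g y"
    using assms(1) unfolding eventually_nhds by blast
  then show ?thesis using has_derivative_transform_within_open[OF assms(2)] by blast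
qed

lemma has_derivative_cong_nhds_iff:
  assumes "\<forall>\<^sub>F y in nhds x. f y = g y"
  shows "(f has_derivative D) (at x) \<longleftrightarrow> (g has_derivative D) (at x)"
proof -
  have "\<forall>\<^sub>F y in nhds x. g y = f y" using assms by eventually_elim simp
  then show ?thesis using assms has_derivative_cong_nhds by metis
qed

lemma pd_cong:
  assumes "\<forall>\<^sub>F y in nhds x. f y = g y" shows "pd i f x = pd i g x"
  unfolding pd_def frechet_derivative_def using has_derivative_cong_nhds_iff[OF assms] by simp

lemma differentiable_cong_nhds:
  assumes "\<forall>\<^sub>F y in nhds x. f y = g y" shows "f differentiable at x \<longleftrightarrow> g differentiable at x"
  unfolding differentiable_def using has_derivative_cong_nhds_iff[OF assms] by simp

lemma affine_has_derivative: "((\<lambda>x::R3. c + g \<bullet> x) has_derivative (\<lambda>h. g \<bullet> h)) (at x)"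
  by (auto intro!: derivative_eq_intros)

lemma pd_affine: "pd i (\<lambda>x. c + g \<bullet> x) x = g $ i"
  using pd_eqI[OF affine_has_derivative] by (simp add: cart_eq_inner_axis)

lemma pd_cmult:
  assumes "f differentiable at x" shows "pd i (\<lambda>x. c * f x) x = c * pd i f x"
  using pd_mult[of "\<lambda>x. c" x f i] assms by simp

lemma pd_compose_real:
  assumes "f differentiable at x" "(\<Theta> has_real_derivative d) (at (f x))"
  shows "(\<lambda>x. \<Theta> (f x)) differentiable at x" "pd i (\<lambda>x. \<Theta> (f x)) x = d * pd i f x"
proof -
  have D: "((\<lambda>x. \<Theta> (f x)) has_derivative (\<lambda>h. d * (\<Sum>i\<in>UNIV. h $ i * pd i f x))) (at x)"
    using has_derivative_compose[OF has_derivative_pd[OF assms(1)], of \<Theta> "(*) d"] assms(2)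
    by (simp add: has_field_derivative_def)
  then show "(\<lambda>x. \<Theta> (f x)) differentiable at x" by (auto simp: differentiable_def)
  show "pd i (\<lambda>x. \<Theta> (f x)) x = d * pd i f x"
    using pd_eqI[OF D, of i] by (simp add: axis_def if_distrib if_distribR sum.delta cong: if_cong)
qed

definition C1 :: "(R3 \<Rightarrow> real) \<Rightarrow> bool" where
  "C1 f \<longleftrightarrow> (\<forall>x. f differentiable at x) \<and> (\<forall>i. continuous_on UNIV (pd i f))"

lemma C1_continuous_on: "C1 f \<Longrightarrow> continuous_on S f"
  by (auto simp: C1_def intro: continuous_at_imp_continuous_on differentiable_imp_continuous_within)

lemma C1_differentiable: "C1 f \<Longrightarrow> f differentiable at x"
  by (simp add: C1_def)

lemma C1_pd_continuous_on: "C1 f \<Longrightarrow> continuous_on S (pd i f)"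
  by (auto simp: C1_def intro: continuous_on_subset)

lemma C1_affine: "C1 (\<lambda>x. c + g \<bullet> x)"
proof -
  have "pd i (\<lambda>x. c + g \<bullet> x) = (\<lambda>x. g $ i)" for i by (auto simp: pd_affine)
  then show ?thesis using affine_has_derivative by (auto simp: C1_def differentiable_def intro!: exI)
qed

lemma C1_const: "C1 (\<lambda>x. c)"
  using C1_affine[of c 0] by simp

lemma C1_add: assumes "C1 f" "C1 g" shows "C1 (\<lambda>x. f x + g x)"
proof -
  have "pd i (\<lambda>x. f x + g x) = (\<lambda>x. pd i f x + pd i g x)" for i
    using assms by (auto simp: C1_def pd_add)
  then show ?thesis using assms by (auto simp: C1_def intro!: continuous_intros)
qed

lemma C1_mult: assumes "C1 f" "C1 g" shows "C1 (\<lambda>x. f x * g x)"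
proof -
  have "pd i (\<lambda>x. f x * g x) = (\<lambda>x. f x * pd i g x + pd i f x * g x)" for i
    using assms by (auto simp: C1_def pd_mult)
  then show ?thesis using assms C1_continuous_on[OF assms(1)] C1_continuous_on[OF assms(2)]
    by (auto simp: C1_def intro!: continuous_intros)
qed

lemma C1_compose_real:
  assumes "C1 f" "\<And>t. (\<Theta> has_real_derivative \<Theta>' t) (at t)" "continuous_on UNIV \<Theta>'"
  shows "C1 (\<lambda>x. \<Theta> (f x))"
proof -
  have "pd i (\<lambda>x. \<Theta> (f x)) = (\<lambda>x. \<Theta>' (f x) * pd i f x)" for i
    using pd_compose_real(2)[OF C1_differentiable[OF assms(1)] assms(2)] by (rule ext)
  moreover have "continuous_on UNIV (\<lambda>x. \<Theta>' (f x))"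
    using continuous_on_compose2[OF assms(3) C1_continuous_on[OF assms(1)]] by auto
  ultimately show ?thesis using assms pd_compose_real(1)[OF _ assms(2)]
    by (auto simp: C1_def intro!: continuous_intros)
qed

lemma smooth_C1:
  assumes "smooth f" shows "C1 f"
proof -
  have d: "foldr pd is f differentiable at x" for "is" x
    using assms by (auto simp: smooth_def differentiable_on_def)
  have "continuous_on UNIV (pd i f)" for i
    using d[of "[i]"] by (auto intro!: continuous_at_imp_continuous_on differentiable_imp_continuous_within)
  then show ?thesis using d[of "[]"] by (auto simp: C1_def)
qed

section \<open>Test functions, and Lipschitz bounds from partial derivatives\<close>

lemma test_fun_D:
  assumes "\<phi> \<in> test_fun \<Omega>"
  shows "C1 \<phi>" "smooth \<phi>" "\<exists>R>0. \<forall>x. norm x > R \<longrightarrow> \<phi> x = 0"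
    "\<And>x. x \<notin> \<Omega> \<Longrightarrow> \<phi> x = 0" "\<And>x. x \<notin> \<Omega> \<Longrightarrow> pd i \<phi> x = 0"
proof -
  from assms obtain K where K: "smooth \<phi>" "compact K" "K \<subseteq> \<Omega>" "\<And>x. x \<notin> K \<Longrightarrow> \<phi> x = 0"
    by (auto simp: test_fun_def)
  then show "smooth \<phi>" "C1 \<phi>" by (auto intro: smooth_C1)
  show "\<phi> x = 0" if "x \<notin> \<Omega>" for x using that K by auto
  show "pd i \<phi> x = 0" if "x \<notin> \<Omega>" for x
  proof -
    have "open (- K)" using K(2) by (simp add: compact_imp_closed open_Compl)
    then have "\<forall>\<^sub>F y in nhds x. y \<in> - K" using that K(3) by (intro eventually_nhds_in_open) auto
    then have "\<forall>\<^sub>F y in nhds x. \<phi> y = 0" by eventually_elim (use K(4) in auto)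
    from pd_cong[OF this] show ?thesis by simp
  qed
  obtain R where "\<And>x. x \<in> K \<Longrightarrow> norm x \<le> R" "R > 0"
    using compact_imp_bounded[OF K(2)] by (auto simp: bounded_pos)
  then show "\<exists>R>0. \<forall>x. norm x > R \<longrightarrow> \<phi> x = 0" using K(4) by (intro exI[of _ R]) force
qed

lemma test_fun_mono: "\<Omega> \<subseteq> \<Omega>' \<Longrightarrow> test_fun \<Omega> \<subseteq> test_fun \<Omega>'"
proof
  fix \<phi> assume "\<Omega> \<subseteq> \<Omega>'" "\<phi> \<in> test_fun \<Omega>"
  then obtain K where "smooth \<phi>" "compact K" "K \<subseteq> \<Omega>'" "\<forall>x. x \<notin> K \<longrightarrow> \<phi> x = 0"
    unfolding test_fun_def by auto
  then show "\<phi> \<in> test_fun \<Omega>'" unfolding test_fun_def by blast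
qed

text \<open>The factor 3 counts the coordinates of the increment, each bounded by its norm.\<close>

lemma pd_bound_imp_lipschitz:
  assumes "\<And>x. x \<in> S \<Longrightarrow> f differentiable at x" "convex S" "0 \<le> B"
    and "\<And>x i. x \<in> S \<Longrightarrow> \<bar>pd i f x\<bar> \<le> B"
  shows "(3 * B)-lipschitz_on S f"
proof (rule bounded_derivative_imp_lipschitz)
  fix x assume x: "x \<in> S"
  show "(f has_derivative (\<lambda>h. \<Sum>i\<in>UNIV. h $ i * pd i f x)) (at x within S)"
    by (rule has_derivative_at_withinI[OF has_derivative_pd[OF assms(1)[OF x]]])
  show "onorm (\<lambda>h. \<Sum>i\<in>UNIV. h $ i * pd i f x) \<le> 3 * B"
  proof (rule onorm_bound)
    fix h :: R3
    have "\<bar>\<Sum>i\<in>UNIV. h $ i * pd i f x\<bar> \<le> (\<Sum>i\<in>UNIV. \<bar>h $ i * pd i f x\<bar>)" by (rule sum_abs)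
    also have "\<dots> \<le> (\<Sum>i\<in>(UNIV::3 set). norm h * B)"
      using assms(4)[OF x] component_le_norm_cart[of h] by (intro sum_mono) (auto simp: abs_mult intro!: mult_mono)
    finally show "norm (\<Sum>i\<in>UNIV. h $ i * pd i f x) \<le> 3 * B * norm h" by (simp add: algebra_simps)
  qed (use assms in auto)
qed (use assms in auto)

lemma C1_lipschitz_on_compact:
  assumes "C1 f" "compact S" "convex S"
  shows "\<exists>L. L-lipschitz_on S f"
proof -
  have "\<exists>B>0. \<forall>x\<in>S. \<bar>pd i f x\<bar> \<le> B" for i
    using compact_continuous_image[OF C1_pd_continuous_on[OF assms(1)] assms(2), of i]
    by (auto dest!: compact_imp_bounded simp: bounded_pos)
  then obtain B where B: "\<And>i. B i > 0" "\<And>i x. x \<in> S \<Longrightarrow> \<bar>pd i f x\<bar> \<le> B i" by metis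
  have "(3 * (\<Sum>i\<in>UNIV. B i))-lipschitz_on S f"
  proof (rule pd_bound_imp_lipschitz)
    fix x i assume "x \<in> S"
    then have "\<bar>pd i f x\<bar> \<le> B i" by (rule B)
    also have "\<dots> \<le> (\<Sum>i\<in>UNIV. B i)" using B(1) by (intro member_le_sum) (auto intro: less_imp_le)
    finally show "\<bar>pd i f x\<bar> \<le> (\<Sum>i\<in>UNIV. B i)" .
  qed (use assms in \<open>auto simp: C1_def intro!: sum_nonneg less_imp_le[OF B(1)]\<close>)
  then show ?thesis by blast
qed

lemma pd_zero_outside:
  assumes "\<And>x. norm x > R \<Longrightarrow> f x = 0" "norm x > R" shows "pd i f x = 0"
proof -
  have "open {x::R3. norm x > R}" by (auto intro!: open_Collect_less continuous_intros)
  then have "\<forall>\<^sub>F y in nhds x. y \<in> {x. norm x > R}" using assms(2) by (intro eventually_nhds_in_open) auto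
  then have "\<forall>\<^sub>F y in nhds x. f y = 0" by eventually_elim (use assms in auto)
  from pd_cong[OF this] show ?thesis by simp
qed

lemma C1_bounded_support:
  assumes "C1 f" "\<And>x. norm x > R \<Longrightarrow> f x = 0"
  shows "\<exists>B>0. \<forall>i x. \<bar>pd i f x\<bar> \<le> B" "\<exists>L>0. L-lipschitz_on UNIV f"
proof -
  have "\<exists>B>0. \<forall>x\<in>cball 0 R. \<bar>pd i f x\<bar> \<le> B" for i
    using compact_continuous_image[OF C1_pd_continuous_on[OF assms(1)] compact_cball, of i 0 R]
    by (auto dest!: compact_imp_bounded simp: bounded_pos)
  then obtain B where B: "\<And>i. B i > 0" "\<And>i x. x \<in> cball 0 R \<Longrightarrow> \<bar>pd i f x\<bar> \<le> B i" by metis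
  have b: "\<bar>pd i f x\<bar> \<le> (\<Sum>i\<in>UNIV. B i)" for i x
  proof -
    have "\<bar>pd i f x\<bar> \<le> B i" 
      using B(2)[of x i] pd_zero_outside[of R f x i, OF assms(2)] B(1)[of i] by (cases "norm x > R") auto
    also have "\<dots> \<le> (\<Sum>i\<in>UNIV. B i)" using B(1) by (intro member_le_sum) (auto intro: less_imp_le)
    finally show ?thesis .
  qed
  have pos: "0 < (\<Sum>i\<in>UNIV. B i)" using B(1) by (intro sum_pos) auto
  then show "\<exists>B>0. \<forall>i x. \<bar>pd i f x\<bar> \<le> B" using b by blast
  have "(3 * (\<Sum>i\<in>UNIV. B i))-lipschitz_on UNIV f"
    using pos b assms(1) by (intro pd_bound_imp_lipschitz) (auto simp: C1_def)
  then show "\<exists>L>0. L-lipschitz_on UNIV f" using pos by (intro exI[of _ "3 * (\<Sum>i\<in>UNIV. B i)"]) auto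
qed

lemma directional_difference_tendsto:
  assumes "f differentiable at x"
  shows "((\<lambda>t. (f (x + t *\<^sub>R axis i 1) - f x) / t) \<longlongrightarrow> pd i f x) (at 0)"
proof -
  have D: "(f has_derivative (\<lambda>h. \<Sum>i\<in>UNIV. h $ i * pd i f x)) (at x)" by (rule has_derivative_pd[OF assms])
  have "((\<lambda>t. f (x + t *\<^sub>R axis i 1)) has_derivative (\<lambda>t. \<Sum>j\<in>UNIV. (t *\<^sub>R axis i 1) $ j * pd j f x)) (at 0)"
    by (rule has_derivative_compose[of "\<lambda>t. x + t *\<^sub>R axis i 1" "\<lambda>t. t *\<^sub>R axis i 1"])
       (use D in \<open>auto intro!: derivative_eq_intros\<close>)
  then have "((\<lambda>t. f (x + t *\<^sub>R axis i 1)) has_real_derivative pd i f x) (at 0)"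
    unfolding has_field_derivative_def
    by (rule has_derivative_eq_rhs) (auto simp: axis_def if_distrib if_distribR sum.delta mult.commute cong: if_cong)
  then show ?thesis by (simp add: DERIV_def)
qed

section \<open>The class of piecewise C1 functions\<close>

text \<open>A global Lipschitz condition excludes jumps across N, so that the classical partials are
  the weak ones, and it dominates all difference quotients. On N itself \<open>pd\<close> may be an
  unspecified value, which a null set hides. Near any other point u coincides with a function that
  is C1 everywhere, from which the partials inherit their continuity.\<close>

definition piecewise_C1 :: "(R3 \<Rightarrow> real) \<Rightarrow> bool" where
  "piecewise_C1 u \<longleftrightarrow> (\<exists>L. L-lipschitz_on UNIV u) \<and>
     (\<exists>N. closed N \<and> negligible N \<and> (\<forall>x. x \<notin> N \<longrightarrow> (\<exists>F. C1 F \<and> (\<forall>\<^sub>F y in nhds x. u y = F y))))"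

lemma piecewise_C1_E:
  assumes "piecewise_C1 u"
  obtains N L where "closed N" "negligible N" "0 < L" "L-lipschitz_on UNIV u"
    "\<And>x. x \<notin> N \<Longrightarrow> u differentiable at x" "\<And>x i. x \<notin> N \<Longrightarrow> isCont (pd i u) x"
    "\<And>x i. x \<notin> N \<Longrightarrow> \<bar>pd i u x\<bar> \<le> L"
proof -
  obtain N L0 where N: "closed N" "negligible N" "L0-lipschitz_on UNIV u"
    and F: "\<And>x. x \<notin> N \<Longrightarrow> \<exists>F. C1 F \<and> (\<forall>\<^sub>F y in nhds x. u y = F y)"
    using assms by (auto simp: piecewise_C1_def)
  \<comment> \<open>Only to have a strictly positive constant.\<close>
  define L where "L = L0 + 1"
  have L: "0 < L" "L-lipschitz_on UNIV u"
    using lipschitz_on_nonneg[OF N(3)] lipschitz_on_le[OF N(3)] by (auto simp: L_def)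
  have d: "u differentiable at x" if "x \<notin> N" for x
    using F[OF that] differentiable_cong_nhds C1_differentiable by blast
  have "isCont (pd i u) x" if x: "x \<notin> N" for x i
  proof -
    obtain G where G: "C1 G" "\<forall>\<^sub>F y in nhds x. u y = G y" using F[OF x] by blast
    have "isCont (pd i G) x" using G(1) by (auto simp: C1_def continuous_on_eq_continuous_at)
    \<comment> \<open>Equal partials at a nearby point y require equal functions in a neighbourhood
      of y, not just at y.\<close>
    moreover have "\<forall>\<^sub>F y in nhds x. \<forall>\<^sub>F z in nhds y. u z = G z" using G(2) by (simp add: eventually_eventually)
    then have "\<forall>\<^sub>F y in nhds x. pd i u y = pd i G y" by eventually_elim (rule pd_cong)
    ultimately show ?thesis by (simp add: isCont_cong)
  qed
  moreover have "\<bar>pd i u x\<bar> \<le> L" if "x \<notin> N" for x i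
  proof -
    have "((\<lambda>t. (u (x + t *\<^sub>R axis i 1) - u x) / t) \<longlongrightarrow> pd i u x) (at 0)"
      by (rule directional_difference_tendsto[OF d[OF that]])
    then have "((\<lambda>t. \<bar>(u (x + t *\<^sub>R axis i 1) - u x) / t\<bar>) \<longlongrightarrow> \<bar>pd i u x\<bar>) (at 0)" by (rule tendsto_rabs)
    moreover have "\<forall>\<^sub>F t in at 0. \<bar>(u (x + t *\<^sub>R axis i 1) - u x) / t\<bar> \<le> L"
      unfolding eventually_at_filter
    proof (rule always_eventually, intro allI impI)
      fix t :: real assume "t \<noteq> 0"
      have "\<bar>u (x + t *\<^sub>R axis i 1) - u x\<bar> \<le> L * \<bar>t\<bar>"
        using lipschitz_onD[OF L(2), of "x + t *\<^sub>R axis i 1" x] by (simp add: dist_norm)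
      then show "\<bar>(u (x + t *\<^sub>R axis i 1) - u x) / t\<bar> \<le> L" using \<open>t \<noteq> 0\<close> by (simp add: field_simps)
    qed
    ultimately show ?thesis by (rule tendsto_upperbound) simp
  qed
  ultimately show ?thesis using that N L d by blast
qed

lemma piecewise_C1_continuous_on: "piecewise_C1 u \<Longrightarrow> continuous_on S u"
  by (auto simp: piecewise_C1_def intro: continuous_on_subset dest!: lipschitz_on_continuous_on)

lemma AE_not_in_negligible: "negligible N \<Longrightarrow> AE x in lebesgue. x \<notin> N"
  by (intro AE_not_in) (simp add: negligible_iff_null_sets)

text \<open>Set to zero on N the partial is Borel; Lebesgue measure is complete, so the unspecified
  values on N do no harm.\<close>

lemma piecewise_C1_pd_measurable:
  assumes "piecewise_C1 u" shows "pd i u \<in> borel_measurable lebesgue"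
proof -
  obtain N where N: "closed N" "negligible N" "\<And>x i. x \<notin> N \<Longrightarrow> isCont (pd i u) x"
    using assms by (rule piecewise_C1_E) blast
  have "(\<lambda>x. indicator (- N) x *\<^sub>R pd i u x) \<in> borel_measurable borel"
    using N by (intro borel_measurable_continuous_on_indicator continuous_at_imp_continuous_on) auto
  then have "(\<lambda>x. indicator (- N) x *\<^sub>R pd i u x) \<in> borel_measurable lebesgue"
    by (intro measurable_completion) auto
  then show ?thesis
    by (rule borel_measurable_AE) (use AE_not_in_negligible[OF N(2)] in \<open>auto elim!: eventually_mono\<close>)
qed

lemma C1_imp_piecewise_C1:
  assumes "C1 f" "L-lipschitz_on UNIV f" shows "piecewise_C1 f"
  unfolding piecewise_C1_def using assms by (auto intro!: exI[of _ "{}"])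

lemma test_fun_piecewise_C1:
  assumes "\<phi> \<in> test_fun \<Omega>" shows "piecewise_C1 \<phi>"
  using test_fun_D(1,3)[OF assms] C1_bounded_support(2)[of \<phi>] C1_imp_piecewise_C1 by metis

lemma affine_piecewise_C1: "piecewise_C1 (\<lambda>x. c + g \<bullet> x)"
proof (rule C1_imp_piecewise_C1[OF C1_affine])
  show "(norm g)-lipschitz_on UNIV (\<lambda>x. c + g \<bullet> x)"
    by (rule lipschitz_onI) (auto simp: dist_real_def dist_norm Cauchy_Schwarz_ineq2 simp flip: inner_diff_right)
qed

lemma piecewise_C1_add:
  assumes "piecewise_C1 u" "piecewise_C1 v" shows "piecewise_C1 (\<lambda>x. u x + v x)"
proof -
  obtain N L where N: "closed N" "negligible N" "L-lipschitz_on UNIV u"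
    "\<And>x. x \<notin> N \<Longrightarrow> \<exists>F. C1 F \<and> (\<forall>\<^sub>F y in nhds x. u y = F y)"
    using assms(1) by (auto simp: piecewise_C1_def)
  obtain N' L' where N': "closed N'" "negligible N'" "L'-lipschitz_on UNIV v"
    "\<And>x. x \<notin> N' \<Longrightarrow> \<exists>F. C1 F \<and> (\<forall>\<^sub>F y in nhds x. v y = F y)"
    using assms(2) by (auto simp: piecewise_C1_def)
  have "\<exists>F. C1 F \<and> (\<forall>\<^sub>F y in nhds x. u y + v y = F y)" if x: "x \<notin> N \<union> N'" for x
  proof -
    obtain F where "C1 F" "\<forall>\<^sub>F y in nhds x. u y = F y" using N(4)[of x] x by auto
    moreover obtain G where "C1 G" "\<forall>\<^sub>F y in nhds x. v y = G y" using N'(4)[of x] x by auto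
    ultimately show ?thesis
      by (intro exI[of _ "\<lambda>x. F x + G x"] conjI C1_add) (auto elim: eventually_elim2)
  qed
  then show ?thesis unfolding piecewise_C1_def
    using N N' lipschitz_on_add[OF N(3) N'(3)]
    by (intro conjI exI[of _ "N \<union> N'"]) (auto intro: negligible_Un)
qed

section \<open>Integration by parts and weak derivatives\<close>

lemma lborel_integral_translate:
  fixes f :: "R3 \<Rightarrow> real"
  assumes [measurable]: "f \<in> borel_measurable borel"
  shows "(\<integral>x. f (x + c) \<partial>lborel) = (\<integral>x. f x \<partial>lborel)"
proof -
  have "(\<integral>x. f x \<partial>lborel) = (\<integral>x. f x \<partial>distr lborel borel ((+) c))" by (simp add: lborel_distr_plus)
  also have "\<dots> = (\<integral>x. f (c + x) \<partial>lborel)" by (subst integral_distr) auto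
  finally show ?thesis by (simp add: add.commute)
qed

lemma continuous_bounded_support_integrable:
  fixes f :: "R3 \<Rightarrow> real"
  assumes "continuous_on UNIV f" "\<And>x. norm x > R \<Longrightarrow> f x = 0"
  shows "integrable lborel f"
proof -
  have "integrable lborel (\<lambda>x. indicator (cball 0 R) x *\<^sub>R f x)"
    using assms(1) by (intro borel_integrable_compact compact_cball) (auto intro: continuous_on_subset)
  moreover have "(\<lambda>x. indicator (cball 0 R) x *\<^sub>R f x) = f"
    using assms(2) by (auto simp: fun_eq_iff indicator_def not_le)
  ultimately show ?thesis by simp
qed

text \<open>Summation by parts for difference quotients: translation invariance moves the quotient
  from u to \<phi>, and both sides converge by dominated convergence, the Lipschitz constants of u
  and \<phi> supplying the bounds.\<close>

lemma integration_by_parts: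
  assumes u: "piecewise_C1 u" and \<phi>: "C1 \<phi>" and R: "\<And>x. norm x > R \<Longrightarrow> \<phi> x = 0"
  shows "(LINT x|lebesgue. u x * pd i \<phi> x) = - (LINT x|lebesgue. pd i u x * \<phi> x)"
proof -
  obtain N L where N: "closed N" "negligible N" "0 < L" "L-lipschitz_on UNIV u"
    "\<And>x. x \<notin> N \<Longrightarrow> u differentiable at x" "\<And>x i. x \<notin> N \<Longrightarrow> isCont (pd i u) x"
    using u by (rule piecewise_C1_E) blast
  obtain L' where L': "0 < L'" "L'-lipschitz_on UNIV \<phi>" using C1_bounded_support(2)[OF \<phi> R] by auto
  define e :: R3 where "e = axis i 1"
  have ne: "norm e = 1" by (simp add: e_def)
  define t where "t n = inverse (real (Suc n))" for n
  have t: "t n > 0" "t n \<le> 1" for n by (auto simp: t_def field_simps)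
  have t0: "filterlim t (at 0) sequentially"
    unfolding filterlim_at t_def using LIMSEQ_inverse_real_of_nat by auto
  \<comment> \<open>After the translation the quotient of \<phi> has the step \<open>- t n\<close>,
    which produces the minus sign.\<close>
  have t0': "filterlim (\<lambda>n. - t n) (at 0) sequentially"
    unfolding filterlim_at t_def using tendsto_minus[OF LIMSEQ_inverse_real_of_nat] by auto
  have uc: "continuous_on S u" for S using u by (rule piecewise_C1_continuous_on)
  have \<phi>c: "continuous_on S \<phi>" for S using \<phi> by (rule C1_continuous_on)
  have [measurable]: "u \<in> borel_measurable borel" "\<phi> \<in> borel_measurable borel" "pd i \<phi> \<in> borel_measurable borel"
    using uc \<phi>c C1_pd_continuous_on[OF \<phi>] by (auto intro: borel_measurable_continuous_onI)
  define a where "a n = (\<integral>x. (u (x + t n *\<^sub>R e) - u x) / t n * \<phi> x \<partial>lborel)" for n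
  \<comment> \<open>The steps are at most 1, so the shifted \<phi> lives in the ball of radius R +
    1.\<close>
  have shift: "norm x > R" if "norm (x + s *\<^sub>R e) > R + 1" "\<bar>s\<bar> \<le> 1" for x :: R3 and s
    using norm_triangle_ineq[of x "s *\<^sub>R e"] that ne by simp
  have eq: "a n = (\<integral>x. - (u x * ((\<phi> (x + (- t n) *\<^sub>R e) - \<phi> x) / (- t n))) \<partial>lborel)" for n
  proof -
    have i1: "integrable lborel (\<lambda>x. u (x + t n *\<^sub>R e) * \<phi> x)"
      using R by (intro continuous_bounded_support_integrable[of _ R] continuous_intros \<phi>c
          continuous_on_compose2[OF uc[of UNIV]]) auto
    have i2: "integrable lborel (\<lambda>x. u x * \<phi> x)"
      using R by (intro continuous_bounded_support_integrable[of _ R] continuous_intros \<phi>c uc) auto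
    have i3: "integrable lborel (\<lambda>x. u x * \<phi> (x - t n *\<^sub>R e))"
    proof (intro continuous_bounded_support_integrable[of _ "R + 1"] continuous_intros uc continuous_on_compose2[OF \<phi>c[of UNIV]])
      fix x :: R3 assume "norm x > R + 1"
      then have "norm (x - t n *\<^sub>R e) > R" using shift[of "x - t n *\<^sub>R e" "t n"] t[of n] by simp
      then show "u x * \<phi> (x - t n *\<^sub>R e) = 0" using R by simp
    qed auto
    have "a n = (\<integral>x. (u (x + t n *\<^sub>R e) * \<phi> x - u x * \<phi> x) / t n \<partial>lborel)"
      unfolding a_def by (intro Bochner_Integration.integral_cong) (auto simp: field_simps)
    also have "\<dots> = ((\<integral>x. u (x + t n *\<^sub>R e) * \<phi> x \<partial>lborel) - (\<integral>x. u x * \<phi> x \<partial>lborel)) / t n"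
      using i1 i2 by simp
    also have "(\<integral>x. u (x + t n *\<^sub>R e) * \<phi> x \<partial>lborel) = (\<integral>x. u x * \<phi> (x - t n *\<^sub>R e) \<partial>lborel)"
      using lborel_integral_translate[of "\<lambda>x. u x * \<phi> (x - t n *\<^sub>R e)" "t n *\<^sub>R e"] by simp
    also have "((\<integral>x. u x * \<phi> (x - t n *\<^sub>R e) \<partial>lborel) - (\<integral>x. u x * \<phi> x \<partial>lborel)) / t n
       = (\<integral>x. (u x * \<phi> (x - t n *\<^sub>R e) - u x * \<phi> x) / t n \<partial>lborel)"
      using i2 i3 by simp
    also have "\<dots> = (\<integral>x. - (u x * ((\<phi> (x + (- t n) *\<^sub>R e) - \<phi> x) / (- t n))) \<partial>lborel)"
      by (intro Bochner_Integration.integral_cong) (use t[of n] in \<open>auto simp: field_simps\<close>)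
    finally show ?thesis .
  qed
  \<comment> \<open>A Borel version of the partial derivative, for the integrals with respect to
    \<open>lborel\<close>.\<close>
  define g where "g x = indicator (- N) x *\<^sub>R pd i u x" for x
  have ND: "N \<in> null_sets lborel" using N(1,2)
    by (simp add: negligible_iff_null_sets null_sets_completion_iff)
  have gm[measurable]: "g \<in> borel_measurable borel"
  proof -
    have "continuous_on (- N) (pd i u)"
      using N(6) by (intro continuous_at_imp_continuous_on) auto
    then show ?thesis unfolding g_def using N(1) by (intro borel_measurable_continuous_on_indicator) auto
  qed
  have lim1: "a \<longlonglongrightarrow> (\<integral>x. g x * \<phi> x \<partial>lborel)"
    unfolding a_def
  proof (rule integral_dominated_convergence)
    show "integrable lborel (\<lambda>x. L * \<bar>\<phi> x\<bar>)"
      using R by (intro continuous_bounded_support_integrable[of _ R] continuous_intros \<phi>c) auto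
    show "AE x in lborel. (\<lambda>n. (u (x + t n *\<^sub>R e) - u x) / t n * \<phi> x) \<longlonglongrightarrow> g x * \<phi> x"
      using AE_not_in[OF ND]
    proof eventually_elim
      case (elim x)
      have "(\<lambda>n. (u (x + t n *\<^sub>R e) - u x) / t n) \<longlonglongrightarrow> pd i u x"
        unfolding e_def by (rule filterlim_compose[OF directional_difference_tendsto[OF N(5)[OF elim]] t0])
      from tendsto_mult_right[OF this, of "\<phi> x"] show ?case
        using elim by (simp add: g_def del: times_divide_eq_left)
    qed
    show "AE x in lborel. norm ((u (x + t n *\<^sub>R e) - u x) / t n * \<phi> x) \<le> L * \<bar>\<phi> x\<bar>" for n
    proof (rule AE_I2)
      fix x
      have "\<bar>u (x + t n *\<^sub>R e) - u x\<bar> \<le> L * t n"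
        using lipschitz_onD[OF N(4), of "x + t n *\<^sub>R e" x] t[of n] ne by (simp add: dist_norm)
      then have "\<bar>(u (x + t n *\<^sub>R e) - u x) / t n\<bar> \<le> L" using t[of n] by (simp add: field_simps)
      then show "norm ((u (x + t n *\<^sub>R e) - u x) / t n * \<phi> x) \<le> L * \<bar>\<phi> x\<bar>"
        by (simp only: real_norm_def abs_mult) (intro mult_right_mono, auto)
    qed
  qed measurable
  have lim2: "a \<longlonglongrightarrow> (\<integral>x. - (u x * pd i \<phi> x) \<partial>lborel)"
    unfolding eq
  proof (rule integral_dominated_convergence)
    show "integrable lborel (\<lambda>x. indicator (cball 0 (R + 1)) x *\<^sub>R (\<bar>u x\<bar> * L'))"
      by (intro borel_integrable_compact continuous_intros uc) auto
    show "AE x in lborel. (\<lambda>n. - (u x * ((\<phi> (x + (- t n) *\<^sub>R e) - \<phi> x) / (- t n)))) \<longlonglongrightarrow> - (u x * pd i \<phi> x)"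
    proof (rule AE_I2)
      fix x
      have "(\<lambda>n. (\<phi> (x + (- t n) *\<^sub>R e) - \<phi> x) / (- t n)) \<longlonglongrightarrow> pd i \<phi> x"
        unfolding e_def by (rule filterlim_compose[OF directional_difference_tendsto[OF C1_differentiable[OF \<phi>]] t0'])
      then show "(\<lambda>n. - (u x * ((\<phi> (x + (- t n) *\<^sub>R e) - \<phi> x) / (- t n)))) \<longlonglongrightarrow> - (u x * pd i \<phi> x)"
        by (intro tendsto_intros)
    qed
    show "AE x in lborel. norm (- (u x * ((\<phi> (x + (- t n) *\<^sub>R e) - \<phi> x) / (- t n)))) \<le> indicator (cball 0 (R + 1)) x *\<^sub>R (\<bar>u x\<bar> * L')" for n
    proof (rule AE_I2)
      fix x
      show "norm (- (u x * ((\<phi> (x + (- t n) *\<^sub>R e) - \<phi> x) / (- t n)))) \<le> indicator (cball 0 (R + 1)) x *\<^sub>R (\<bar>u x\<bar> * L')"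
      proof (cases "norm x > R + 1")
        case True
        then have "norm (x - t n *\<^sub>R e) > R" using shift[of "x - t n *\<^sub>R e" "t n"] t[of n] by simp
        then show ?thesis using R True by simp
      next
        case False
        have "\<bar>\<phi> (x + (- t n) *\<^sub>R e) - \<phi> x\<bar> \<le> L' * t n"
          using lipschitz_onD[OF L'(2), of "x + (- t n) *\<^sub>R e" x] t[of n] ne by (simp add: dist_norm)
        then have "\<bar>(\<phi> (x + (- t n) *\<^sub>R e) - \<phi> x) / (- t n)\<bar> \<le> L'" using t[of n] by (simp add: field_simps)
        then have "\<bar>u x\<bar> * \<bar>(\<phi> (x + (- t n) *\<^sub>R e) - \<phi> x) / (- t n)\<bar> \<le> \<bar>u x\<bar> * L'" by (intro mult_left_mono) auto
        then show ?thesis using False by (simp add: abs_mult)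
      qed
    qed
  qed measurable
  have "(\<integral>x. g x * \<phi> x \<partial>lborel) = - (\<integral>x. u x * pd i \<phi> x \<partial>lborel)"
    using LIMSEQ_unique[OF lim1 lim2] by simp
  moreover have "(\<integral>x. u x * pd i \<phi> x \<partial>lborel) = (LINT x|lebesgue. u x * pd i \<phi> x)"
    by (rule integral_completion[symmetric]) measurable
  moreover have "(\<integral>x. g x * \<phi> x \<partial>lborel) = (LINT x|lebesgue. g x * \<phi> x)"
    by (rule integral_completion[symmetric]) measurable
  moreover have "(LINT x|lebesgue. g x * \<phi> x) = (LINT x|lebesgue. pd i u x * \<phi> x)"
  proof (rule integral_cong_AE)
    have "\<phi> \<in> borel_measurable lebesgue" "g \<in> borel_measurable lebesgue" by (auto intro!: measurable_completion)
    then show "(\<lambda>x. g x * \<phi> x) \<in> borel_measurable lebesgue" "(\<lambda>x. pd i u x * \<phi> x) \<in> borel_measurable lebesgue"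
      using piecewise_C1_pd_measurable[OF u] by (auto intro!: borel_measurable_times)
    show "AE x in lebesgue. g x * \<phi> x = pd i u x * \<phi> x"
      using AE_not_in_negligible[OF N(2)] by eventually_elim (simp add: g_def)
  qed
  ultimately show ?thesis by simp
qed

lemma piecewise_C1_cmult:
  assumes "piecewise_C1 u" shows "piecewise_C1 (\<lambda>x. c * u x)"
proof -
  obtain N L where N: "closed N" "negligible N" "L-lipschitz_on UNIV u"
    "\<And>x. x \<notin> N \<Longrightarrow> \<exists>F. C1 F \<and> (\<forall>\<^sub>F y in nhds x. u y = F y)"
    using assms(1) by (auto simp: piecewise_C1_def)
  have "\<exists>F. C1 F \<and> (\<forall>\<^sub>F y in nhds x. c * u y = F y)" if x: "x \<notin> N" for x
  proof -
    obtain F where "C1 F" "\<forall>\<^sub>F y in nhds x. u y = F y" using N(4)[of x] x by auto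
    then show ?thesis
      by (intro exI[of _ "\<lambda>x. c * F x"] conjI C1_mult C1_const) (auto elim: eventually_mono)
  qed
  moreover have "(\<bar>c\<bar> * L)-lipschitz_on UNIV (\<lambda>x. c * u x)"
    using lipschitz_on_cmult_real[OF N(3), of c] by simp
  ultimately show ?thesis unfolding piecewise_C1_def using N by blast
qed

lemma piecewise_C1_diff:
  assumes "piecewise_C1 u" "piecewise_C1 v" shows "piecewise_C1 (\<lambda>x. u x - v x)"
  using piecewise_C1_add[OF assms(1) piecewise_C1_cmult[OF assms(2), of "-1"]] by simp

lemma piecewise_C1_AE_differentiable:
  assumes "piecewise_C1 u" shows "AE x in lebesgue. u differentiable at x"
proof -
  obtain N where "negligible N" "\<And>x. x \<notin> N \<Longrightarrow> u differentiable at x"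
    using assms by (rule piecewise_C1_E) blast
  then show ?thesis using AE_not_in_negligible[of N] by (auto elim: eventually_mono)
qed

lemma piecewise_C1_AE_pd_bounded:
  assumes "piecewise_C1 u" shows "\<exists>L. \<forall>i. AE x in lebesgue. \<bar>pd i u x\<bar> \<le> L"
proof -
  obtain N L where "negligible N" "\<And>x i. x \<notin> N \<Longrightarrow> \<bar>pd i u x\<bar> \<le> L"
    using assms by (rule piecewise_C1_E) blast
  then show ?thesis using AE_not_in_negligible[of N] by (intro exI[of _ L]) (auto elim: eventually_mono)
qed

lemma AE_lebesgue_on: "AE x in lebesgue. P x \<Longrightarrow> \<Omega> \<in> sets lebesgue \<Longrightarrow> AE x in lebesgue_on \<Omega>. P x"
  by (subst AE_restrict_space_iff) auto

lemma integral_lebesgue_on_eq: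
  fixes f :: "R3 \<Rightarrow> real"
  assumes "\<Omega> \<in> sets lebesgue" "\<And>x. x \<notin> \<Omega> \<Longrightarrow> f x = 0"
  shows "(LINT x|lebesgue_on \<Omega>. f x) = (LINT x|lebesgue. f x)"
proof -
  have "(LINT x|lebesgue_on \<Omega>. f x) = (LINT x|lebesgue. indicator \<Omega> x *\<^sub>R f x)"
    using assms(1) by (subst integral_restrict_space) auto
  also have "(\<lambda>x. indicator \<Omega> x *\<^sub>R f x) = f" using assms(2) by (auto simp: fun_eq_iff indicator_def)
  finally show ?thesis .
qed

lemma l2_inner_cong:
  assumes "\<And>x. x \<in> \<Omega> \<Longrightarrow> f x = g x" "\<And>x. x \<in> \<Omega> \<Longrightarrow> h x = k x"
  shows "l2_inner \<Omega> f h = l2_inner \<Omega> g k"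
  unfolding l2_inner_def using assms by (intro Bochner_Integration.integral_cong) auto

lemma continuous_borel_measurable_lebesgue:
  fixes f :: "R3 \<Rightarrow> real"
  assumes "continuous_on UNIV f" shows "f \<in> borel_measurable lebesgue"
  using borel_measurable_continuous_onI[OF assms] by (intro measurable_completion) auto

section \<open>Weak partial derivatives and \<open>H1\<close> norms on a bounded open set\<close>

context
  fixes \<Omega> :: "R3 set"
  assumes open_dom: "open \<Omega>" and bounded_dom: "bounded \<Omega>"
begin

lemma dom_lmeasurable: "\<Omega> \<in> lmeasurable" "\<Omega> \<in> sets lebesgue"
  using lmeasurable_open[OF bounded_dom open_dom] by auto

lemma piecewise_C1_bounded_on:
  assumes "piecewise_C1 u" shows "\<exists>B. \<forall>x\<in>\<Omega>. \<bar>u x\<bar> \<le> B"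
proof -
  have "compact (u ` closure \<Omega>)"
    using bounded_dom by (intro compact_continuous_image piecewise_C1_continuous_on[OF assms]) (simp add: compact_closure)
  then have "bounded (u ` closure \<Omega>)" by (rule compact_imp_bounded)
  then obtain B where "\<And>x. x \<in> closure \<Omega> \<Longrightarrow> \<bar>u x\<bar> \<le> B" by (auto simp: bounded_iff)
  then show ?thesis using closure_subset by blast
qed

lemma piecewise_C1_L2:
  assumes "piecewise_C1 u" shows "u \<in> L2 \<Omega>" "pd i u \<in> L2 \<Omega>"
proof -
  obtain B where "\<And>x. x \<in> \<Omega> \<Longrightarrow> \<bar>u x\<bar> \<le> B" using piecewise_C1_bounded_on[OF assms] by blast
  then show "u \<in> L2 \<Omega>" using dom_lmeasurable
    by (intro L2_bounded[of _ _ B] measurable_restrict_space1 continuous_borel_measurable_lebesgue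
        piecewise_C1_continuous_on[OF assms]) auto
  obtain L where "AE x in lebesgue. \<bar>pd i u x\<bar> \<le> L" using piecewise_C1_AE_pd_bounded[OF assms] by blast
  then show "pd i u \<in> L2 \<Omega>" using dom_lmeasurable
    by (intro L2_AE_bounded[of _ _ L] measurable_restrict_space1 piecewise_C1_pd_measurable[OF assms])
       (auto intro: AE_lebesgue_on)
qed

lemma test_fun_L2:
  assumes "\<phi> \<in> test_fun \<Omega>" shows "\<phi> \<in> L2 \<Omega>" "pd i \<phi> \<in> L2 \<Omega>"
  using piecewise_C1_L2[OF test_fun_piecewise_C1[OF assms]] by auto

lemma is_weak_partial_pd:
  assumes u: "piecewise_C1 u" shows "is_weak_partial \<Omega> i u (pd i u)"
  unfolding is_weak_partial_def
proof (intro conjI ballI piecewise_C1_L2[OF u])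
  fix \<phi> assume \<phi>: "\<phi> \<in> test_fun \<Omega>"
  obtain R where R: "\<And>x. norm x > R \<Longrightarrow> \<phi> x = 0" using test_fun_D(3)[OF \<phi>] by blast
  have "l2_inner \<Omega> u (pd i \<phi>) = (LINT x|lebesgue. u x * pd i \<phi> x)"
    unfolding l2_inner_def inner_real_def using dom_lmeasurable test_fun_D(5)[OF \<phi>]
    by (intro integral_lebesgue_on_eq) auto
  also have "\<dots> = - (LINT x|lebesgue. pd i u x * \<phi> x)"
    by (rule integration_by_parts[OF u test_fun_D(1)[OF \<phi>] R])
  also have "(LINT x|lebesgue. pd i u x * \<phi> x) = l2_inner \<Omega> (pd i u) \<phi>"
    unfolding l2_inner_def inner_real_def using dom_lmeasurable test_fun_D(4)[OF \<phi>]
    by (intro integral_lebesgue_on_eq[symmetric]) auto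
  finally show "l2_inner \<Omega> u (pd i \<phi>) = - l2_inner \<Omega> (pd i u) \<phi>" .
qed

lemma AE_eq_if_equal_on_test_funs:
  fixes v w :: "R3 \<Rightarrow> real"
  assumes "v \<in> L2 \<Omega>" "w \<in> L2 \<Omega>" "\<And>\<phi>. \<phi> \<in> test_fun \<Omega> \<Longrightarrow> l2_inner \<Omega> v \<phi> = l2_inner \<Omega> w \<phi>"
  shows "AE x in lebesgue_on \<Omega>. v x = w x"
proof -
  have "ae_zero \<Omega> (\<lambda>x. v x - w x)"
    by (rule ae_zero_if_orthogonal_to_test_funs[OF open_dom L2_diff[OF assms(1,2)]])
       (simp add: l2_inner_diff[OF assms(1,2) test_fun_L2(1)] assms(3))
  then show ?thesis by (simp add: ae_zero_def)
qed

lemma is_weak_partial_unique: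
  assumes "is_weak_partial \<Omega> i u v" "is_weak_partial \<Omega> i u w"
  shows "AE x in lebesgue_on \<Omega>. v x = w x"
  using assms by (intro AE_eq_if_equal_on_test_funs) (auto simp: is_weak_partial_def)

lemma is_weak_partial_weak_partial:
  assumes "is_weak_partial \<Omega> i u v" shows "is_weak_partial \<Omega> i u (weak_partial \<Omega> i u)"
  unfolding weak_partial_def using assms by (rule someI[of "is_weak_partial \<Omega> i u"])

lemma weak_partial_AE:
  assumes "is_weak_partial \<Omega> i u v" shows "AE x in lebesgue_on \<Omega>. weak_partial \<Omega> i u x = v x"
  by (rule is_weak_partial_unique[OF is_weak_partial_weak_partial[OF assms] assms])

lemma weak_partial_L2:
  assumes "is_weak_partial \<Omega> i u v" shows "weak_partial \<Omega> i u \<in> L2 \<Omega>"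
  using is_weak_partial_weak_partial[OF assms] by (simp add: is_weak_partial_def)

text \<open>Makes the norms computable: \<open>weak_grad\<close> picks an unspecified
  representative, and by uniqueness any known weak partials may stand in for it.\<close>

lemma l2_norm_weak_grad_squared:
  assumes "\<And>i. is_weak_partial \<Omega> i u (v i)"
  shows "weak_grad \<Omega> u \<in> L2 \<Omega>"
    "(l2_norm \<Omega> (weak_grad \<Omega> u))\<^sup>2 = (\<Sum>i\<in>UNIV. (l2_norm \<Omega> (v i))\<^sup>2)"
proof -
  have eq: "(\<lambda>x. weak_grad \<Omega> u x $ i) = weak_partial \<Omega> i u" for i by (simp add: weak_grad_def fun_eq_iff)
  show g: "weak_grad \<Omega> u \<in> L2 \<Omega>" using weak_partial_L2[OF assms] by (intro L2_vec) (simp add: eq)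
  have "l2_norm \<Omega> (weak_partial \<Omega> i u) = l2_norm \<Omega> (v i)" for i
    using weak_partial_AE[OF assms, of i] weak_partial_L2[OF assms, of i] assms[of i]
    by (intro l2_norm_cong_AE) (auto simp: is_weak_partial_def L2_def)
  then show "(l2_norm \<Omega> (weak_grad \<Omega> u))\<^sup>2 = (\<Sum>i\<in>UNIV. (l2_norm \<Omega> (v i))\<^sup>2)"
    using l2_norm_vec_squared[OF g] by (simp add: eq)
qed

lemma H1_norm_squared:
  assumes "\<And>i. is_weak_partial \<Omega> i u (v i)"
  shows "(H1_norm \<Omega> u)\<^sup>2 = (l2_norm \<Omega> u)\<^sup>2 + (\<Sum>i\<in>UNIV. (l2_norm \<Omega> (v i))\<^sup>2)"
  unfolding H1_norm_def using l2_norm_weak_grad_squared(2)[OF assms]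
  by (simp add: sum_nonneg)

lemma is_weak_partial_add:
  assumes "u \<in> L2 \<Omega>" "u' \<in> L2 \<Omega>" "is_weak_partial \<Omega> i u v" "is_weak_partial \<Omega> i u' v'"
  shows "is_weak_partial \<Omega> i (\<lambda>x. u x + u' x) (\<lambda>x. v x + v' x)"
  using assms test_fun_L2 by (auto simp: is_weak_partial_def l2_inner_add L2_add)

lemma is_weak_partial_diff:
  assumes "u \<in> L2 \<Omega>" "u' \<in> L2 \<Omega>" "is_weak_partial \<Omega> i u v" "is_weak_partial \<Omega> i u' v'"
  shows "is_weak_partial \<Omega> i (\<lambda>x. u x - u' x) (\<lambda>x. v x - v' x)"
  using assms test_fun_L2 by (auto simp: is_weak_partial_def l2_inner_diff L2_diff)

lemma piecewise_C1_H1: "piecewise_C1 u \<Longrightarrow> u \<in> H1 \<Omega>"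
  using piecewise_C1_L2(1) is_weak_partial_pd unfolding H1_def by blast

lemma H1_norm_add_squared:
  assumes "u \<in> H1 \<Omega>" "u' \<in> H1 \<Omega>"
  shows "(H1_norm \<Omega> (\<lambda>x. u x + u' x))\<^sup>2 \<le> 2 * (H1_norm \<Omega> u)\<^sup>2 + 2 * (H1_norm \<Omega> u')\<^sup>2"
proof -
  obtain v v' where v: "\<And>i. is_weak_partial \<Omega> i u (v i)" "\<And>i. is_weak_partial \<Omega> i u' (v' i)"
    using assms by (auto simp: H1_def) metis
  have L: "u \<in> L2 \<Omega>" "u' \<in> L2 \<Omega>" "\<And>i. v i \<in> L2 \<Omega>" "\<And>i. v' i \<in> L2 \<Omega>"
    using assms v by (auto simp: H1_def is_weak_partial_def)
  have s: "\<And>i. is_weak_partial \<Omega> i (\<lambda>x. u x + u' x) (\<lambda>x. v i x + v' i x)"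
    by (intro is_weak_partial_add L v)
  have "(\<Sum>i\<in>UNIV. (l2_norm \<Omega> (\<lambda>x. v i x + v' i x))\<^sup>2) \<le> (\<Sum>i\<in>UNIV. 2 * (l2_norm \<Omega> (v i))\<^sup>2 + 2 * (l2_norm \<Omega> (v' i))\<^sup>2)"
    by (intro sum_mono l2_norm_add_squared L)
  then show ?thesis
    using l2_norm_add_squared[OF L(1,2)]
    unfolding H1_norm_squared[OF s] H1_norm_squared[OF v(1)] H1_norm_squared[OF v(2)]
    by (simp add: sum.distrib sum_distrib_left[symmetric])
qed

lemma l2_norm_tendsto_0:
  fixes f :: "nat \<Rightarrow> R3 \<Rightarrow> real"
  assumes m: "\<And>n. f n \<in> borel_measurable (lebesgue_on \<Omega>)"
    and lim: "AE x in lebesgue_on \<Omega>. (\<lambda>n. f n x) \<longlonglongrightarrow> 0"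
    and B: "\<And>n. AE x in lebesgue_on \<Omega>. \<bar>f n x\<bar> \<le> B"
  shows "(\<lambda>n. (l2_norm \<Omega> (f n))\<^sup>2) \<longlonglongrightarrow> 0"
proof -
  interpret finite_measure "lebesgue_on \<Omega>" by (rule finite_measure_lebesgue_on[OF dom_lmeasurable(1)])
  have "(\<lambda>n. LINT x|lebesgue_on \<Omega>. (norm (f n x))\<^sup>2) \<longlonglongrightarrow> (LINT x|lebesgue_on \<Omega>. 0)"
  proof (rule integral_dominated_convergence)
    show "integrable (lebesgue_on \<Omega>) (\<lambda>x. B\<^sup>2)" by simp
    show "AE x in lebesgue_on \<Omega>. (\<lambda>n. (norm (f n x))\<^sup>2) \<longlonglongrightarrow> 0"
      using lim by eventually_elim (auto intro!: tendsto_eq_intros)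
    show "AE x in lebesgue_on \<Omega>. norm ((norm (f n x))\<^sup>2) \<le> B\<^sup>2" for n
      using B[of n] by eventually_elim (simp add: abs_le_square_iff[symmetric])
  qed (use m in auto)
  then show ?thesis by (simp add: l2_norm_squared)
qed

text \<open>The common criterion for truncation and mollification: the domain has finite measure, so
  uniformly bounded a.e. convergence is convergence in \<open>L2\<close>.\<close>

lemma H1_norm_diff_tendsto_0:
  assumes u: "piecewise_C1 u" "\<And>n. piecewise_C1 (w n)"
    and lim: "\<And>x. (\<lambda>n. w n x) \<longlonglongrightarrow> u x"
    and limd: "\<And>i. AE x in lebesgue_on \<Omega>. (\<lambda>n. pd i (w n) x) \<longlonglongrightarrow> pd i u x"
    and B: "\<And>n x. x \<in> \<Omega> \<Longrightarrow> \<bar>w n x\<bar> \<le> B" "\<And>n i. AE x in lebesgue. \<bar>pd i (w n) x\<bar> \<le> B"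
  shows "(\<lambda>n. (H1_norm \<Omega> (\<lambda>x. u x - w n x))\<^sup>2) \<longlonglongrightarrow> 0"
proof -
  have s: "is_weak_partial \<Omega> i (\<lambda>x. u x - w n x) (\<lambda>x. pd i u x - pd i (w n) x)" for i n
    by (intro is_weak_partial_diff piecewise_C1_L2 is_weak_partial_pd u)
  obtain B1 where B1: "\<And>x. x \<in> \<Omega> \<Longrightarrow> \<bar>u x\<bar> \<le> B1" using piecewise_C1_bounded_on[OF u(1)] by blast
  obtain L where L: "\<And>i. AE x in lebesgue. \<bar>pd i u x\<bar> \<le> L" using piecewise_C1_AE_pd_bounded[OF u(1)] by blast
  have "(\<lambda>n. (l2_norm \<Omega> (\<lambda>x. u x - w n x))\<^sup>2) \<longlonglongrightarrow> 0"
  proof (rule l2_norm_tendsto_0)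
    show "(\<lambda>x. u x - w n x) \<in> borel_measurable (lebesgue_on \<Omega>)" for n
      using L2_D(1)[OF piecewise_C1_L2(1)[OF u(1)]] L2_D(1)[OF piecewise_C1_L2(1)[OF u(2)[of n]]] by measurable
    show "AE x in lebesgue_on \<Omega>. (\<lambda>n. u x - w n x) \<longlonglongrightarrow> 0"
      using lim by (auto intro!: AE_I2 tendsto_eq_intros)
    show "AE x in lebesgue_on \<Omega>. \<bar>u x - w n x\<bar> \<le> B1 + B" for n
    proof (rule AE_I2)
      fix x assume "x \<in> space (lebesgue_on \<Omega>)"
      then have "x \<in> \<Omega>" by simp
      from B1[OF this] B(1)[OF this, of n] show "\<bar>u x - w n x\<bar> \<le> B1 + B" by linarith
    qed
  qed
  moreover have "(\<lambda>n. (l2_norm \<Omega> (\<lambda>x. pd i u x - pd i (w n) x))\<^sup>2) \<longlonglongrightarrow> 0" for i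
  proof (rule l2_norm_tendsto_0)
    show "(\<lambda>x. pd i u x - pd i (w n) x) \<in> borel_measurable (lebesgue_on \<Omega>)" for n
      using L2_D(1)[OF piecewise_C1_L2(2)[OF u(1), of i]] L2_D(1)[OF piecewise_C1_L2(2)[OF u(2)[of n], of i]] by measurable
    show "AE x in lebesgue_on \<Omega>. (\<lambda>n. pd i u x - pd i (w n) x) \<longlonglongrightarrow> 0"
      using limd[of i] by eventually_elim (auto intro!: tendsto_eq_intros)
    show "AE x in lebesgue_on \<Omega>. \<bar>pd i u x - pd i (w n) x\<bar> \<le> L + B" for n
    proof (rule AE_lebesgue_on[OF _ dom_lmeasurable(2)])
      show "AE x in lebesgue. \<bar>pd i u x - pd i (w n) x\<bar> \<le> L + B"
        using L[of i] B(2)[where n=n and i=i] by eventually_elim linarith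
    qed
  qed
  ultimately have "(\<lambda>n. (l2_norm \<Omega> (\<lambda>x. u x - w n x))\<^sup>2 + (\<Sum>i\<in>UNIV. (l2_norm \<Omega> (\<lambda>x. pd i u x - pd i (w n) x))\<^sup>2))
     \<longlonglongrightarrow> 0 + (\<Sum>i\<in>(UNIV::3 set). 0)"
    by (intro tendsto_add tendsto_sum)
  then show ?thesis unfolding H1_norm_squared[OF s] by simp
qed

end

section \<open>Truncation\<close>

text \<open>\<open>trunc \<delta>\<close> is a continuously differentiable approximation of the identity that vanishes on
  \<open>[-\<delta>, \<delta>]\<close>; being of the form \<open>\<delta> * f (t / \<delta>)\<close>, it has a derivative bounded uniformly in \<open>\<delta>\<close>.\<close>

definition trunc_ratio :: "real \<Rightarrow> real \<Rightarrow> real" where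
  "trunc_ratio \<delta> t = max 0 (t\<^sup>2 - \<delta>\<^sup>2) / (t\<^sup>2 + \<delta>\<^sup>2)"

definition trunc :: "real \<Rightarrow> real \<Rightarrow> real" where
  "trunc \<delta> t = t * (trunc_ratio \<delta> t)\<^sup>2"

text \<open>The quotient rule, rewritten in the ratio so that, apart from the 4, every factor lies
  in the unit interval. The square of the ratio in \<open>trunc\<close> removes the corner at |t| =
  \<delta>.\<close>

definition trunc_deriv :: "real \<Rightarrow> real \<Rightarrow> real" where
  "trunc_deriv \<delta> t = (trunc_ratio \<delta> t)\<^sup>2 + 4 * (t\<^sup>2 / (t\<^sup>2 + \<delta>\<^sup>2)) * trunc_ratio \<delta> t * (1 - trunc_ratio \<delta> t)"

lemma divide_le_1_if: "a \<le> b \<Longrightarrow> 0 \<le> b \<Longrightarrow> a / b \<le> (1::real)"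
  by (cases "b = 0") (simp_all add: divide_le_eq_1)

lemma trunc_ratio_bounds: "0 \<le> trunc_ratio \<delta> t" "trunc_ratio \<delta> t \<le> 1"
proof -
  show "0 \<le> trunc_ratio \<delta> t" by (simp add: trunc_ratio_def)
  have "max 0 (t\<^sup>2 - \<delta>\<^sup>2) \<le> t\<^sup>2 + \<delta>\<^sup>2" by simp
  moreover have "0 \<le> t\<^sup>2 + \<delta>\<^sup>2" by simp
  ultimately show "trunc_ratio \<delta> t \<le> 1" unfolding trunc_ratio_def by (rule divide_le_1_if)
qed

lemma abs_trunc_le: "\<bar>trunc \<delta> t\<bar> \<le> \<bar>t\<bar>"
  using trunc_ratio_bounds[of \<delta> t] by (simp add: trunc_def abs_mult mult_left_le power_le_one)

lemma trunc_eq_0: "\<bar>t\<bar> \<le> \<delta> \<Longrightarrow> trunc \<delta> t = 0"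
  using power_mono[of "\<bar>t\<bar>" \<delta> 2] by (simp add: trunc_def trunc_ratio_def)

lemma max_square_has_derivative: "((\<lambda>s::real. (max 0 s)\<^sup>2) has_real_derivative 2 * max 0 s) (at s)"
proof (cases s "0::real" rule: linorder_cases)
  case less
  have "((\<lambda>_. 0) has_real_derivative 0) (at s)" by simp
  then have "((\<lambda>s::real. (max 0 s)\<^sup>2) has_real_derivative 0) (at s)"
    by (rule has_field_derivative_transform_within_open[of _ _ _ "{..<0}"]) (use less in auto)
  then show ?thesis using less by simp
next
  case greater
  have "((\<lambda>s::real. s\<^sup>2) has_real_derivative 2 * s) (at s)" by (auto intro!: derivative_eq_intros)
  then have "((\<lambda>s::real. (max 0 s)\<^sup>2) has_real_derivative 2 * s) (at s)"
    by (rule has_field_derivative_transform_within_open[of _ _ _ "{0<..}"]) (use greater in auto)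
  then show ?thesis using greater by simp
next
  case equal
  have "((\<lambda>h::real. (max 0 h)\<^sup>2 / h) \<longlongrightarrow> 0) (at 0)"
  proof (rule Lim_null_comparison)
    show "\<forall>\<^sub>F h in at 0. norm ((max 0 h)\<^sup>2 / h) \<le> \<bar>h\<bar>"
      by (auto simp: eventually_at_filter max_def power2_eq_square)
  qed (auto intro!: tendsto_eq_intros)
  then show ?thesis using equal by (simp add: DERIV_def)
qed

lemma trunc_has_derivative:
  assumes "\<delta> > 0" shows "(trunc \<delta> has_real_derivative trunc_deriv \<delta> t) (at t)"
proof -
  have s: "t\<^sup>2 + \<delta>\<^sup>2 > 0" using assms by (simp add: add_nonneg_pos)
  have d1: "((\<lambda>t. t\<^sup>2 - \<delta>\<^sup>2) has_real_derivative 2 * t) (at t)" by (auto intro!: derivative_eq_intros)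
  have d: "((\<lambda>t. (max 0 (t\<^sup>2 - \<delta>\<^sup>2))\<^sup>2) has_real_derivative 2 * max 0 (t\<^sup>2 - \<delta>\<^sup>2) * (2 * t)) (at t)"
    by (rule DERIV_chain2[OF max_square_has_derivative d1])
  define m where "m = max 0 (t\<^sup>2 - \<delta>\<^sup>2)"
  define s where "s = t\<^sup>2 + \<delta>\<^sup>2"
  have s0: "s > 0" using s by (simp add: s_def)
  have ds: "((\<lambda>t. (t\<^sup>2 + \<delta>\<^sup>2)\<^sup>2) has_real_derivative 2 * s * (2 * t)) (at t)"
    unfolding s_def by (auto intro!: derivative_eq_intros)
  have "((\<lambda>t. t * ((max 0 (t\<^sup>2 - \<delta>\<^sup>2))\<^sup>2 / (t\<^sup>2 + \<delta>\<^sup>2)\<^sup>2)) has_real_derivative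
      t * ((2 * m * (2 * t) * s\<^sup>2 - m\<^sup>2 * (2 * s * (2 * t))) / (s\<^sup>2 * s\<^sup>2)) + 1 * (m\<^sup>2 / s\<^sup>2)) (at t)"
  proof (rule DERIV_mult'[OF DERIV_ident, THEN DERIV_cong])
    have "t\<^sup>2 + \<delta>\<^sup>2 \<noteq> 0" using s by linarith
    then have "(t\<^sup>2 + \<delta>\<^sup>2)\<^sup>2 \<noteq> 0" by (rule power_not_zero)
    from DERIV_divide[OF d ds this]
    show "((\<lambda>t. (max 0 (t\<^sup>2 - \<delta>\<^sup>2))\<^sup>2 / (t\<^sup>2 + \<delta>\<^sup>2)\<^sup>2) has_real_derivative
      (2 * m * (2 * t) * s\<^sup>2 - m\<^sup>2 * (2 * s * (2 * t))) / (s\<^sup>2 * s\<^sup>2)) (at t)"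
      by (simp add: m_def s_def)
  qed (simp add: m_def s_def)
  also have "t * ((2 * m * (2 * t) * s\<^sup>2 - m\<^sup>2 * (2 * s * (2 * t))) / (s\<^sup>2 * s\<^sup>2)) + 1 * (m\<^sup>2 / s\<^sup>2)
     = (m / s)\<^sup>2 + 4 * (t\<^sup>2 / s) * (m / s) * (1 - m / s)"
    using s0 by (simp add: field_simps power2_eq_square)
  also have "\<dots> = trunc_deriv \<delta> t" by (simp add: trunc_deriv_def trunc_ratio_def m_def s_def)
  finally show ?thesis by (simp add: trunc_def[abs_def] trunc_ratio_def power_divide)
qed

text \<open>The 5 is 1 + 4: a square of a number in the unit interval, plus four times a product of
  such numbers.\<close>

lemma trunc_deriv_bounds: "0 \<le> trunc_deriv \<delta> t" "trunc_deriv \<delta> t \<le> 5"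
proof -
  define a where "a = trunc_ratio \<delta> t"
  define b where "b = t\<^sup>2 / (t\<^sup>2 + \<delta>\<^sup>2)"
  have a: "0 \<le> a" "a \<le> 1" using trunc_ratio_bounds by (auto simp: a_def)
  have b: "0 \<le> b" "b \<le> 1" unfolding b_def by (simp, intro divide_le_1_if) auto
  have eq: "trunc_deriv \<delta> t = a\<^sup>2 + 4 * b * a * (1 - a)" by (simp add: trunc_deriv_def a_def b_def)
  show "0 \<le> trunc_deriv \<delta> t" unfolding eq using a b by simp
  have "a\<^sup>2 \<le> 1" using a by (simp add: power_le_one)
  moreover have "b * a * (1 - a) \<le> 1" using a b by (intro mult_le_one) auto
  ultimately show "trunc_deriv \<delta> t \<le> 5" unfolding eq by linarith
qed

lemma continuous_on_trunc_deriv: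
  assumes "\<delta> > 0" shows "continuous_on UNIV (trunc_deriv \<delta>)"
proof -
  have "t\<^sup>2 + \<delta>\<^sup>2 \<noteq> 0" for t using assms by (simp add: add_nonneg_pos less_imp_neq[symmetric] add_nonneg_eq_0_iff)
  then show ?thesis unfolding trunc_deriv_def[abs_def] trunc_ratio_def[abs_def]
    by (intro continuous_intros) auto
qed

lemma trunc_lipschitz:
  assumes "\<delta> > 0" shows "5-lipschitz_on UNIV (trunc \<delta>)"
proof (rule bounded_derivative_imp_lipschitz)
  show "(trunc \<delta> has_derivative (*) (trunc_deriv \<delta> t)) (at t within UNIV)" for t
    using trunc_has_derivative[OF assms, of t] by (simp add: has_field_derivative_def)
  show "onorm ((*) (trunc_deriv \<delta> t)) \<le> 5" for t
    using trunc_deriv_bounds[of \<delta> t] by (intro onorm_bound) (auto simp: abs_mult intro!: mult_right_mono)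
qed auto

lemma trunc_ratio_tendsto:
  assumes "t \<noteq> 0" shows "(\<lambda>n. trunc_ratio (inverse (real (Suc n))) t) \<longlonglongrightarrow> 1"
proof -
  have "(\<lambda>n. max 0 (t\<^sup>2 - (inverse (real (Suc n)))\<^sup>2) / (t\<^sup>2 + (inverse (real (Suc n)))\<^sup>2))
     \<longlonglongrightarrow> max 0 (t\<^sup>2 - 0\<^sup>2) / (t\<^sup>2 + 0\<^sup>2)"
    by (intro tendsto_intros LIMSEQ_inverse_real_of_nat) (use assms in auto)
  then show ?thesis using assms by (simp add: trunc_ratio_def)
qed

lemma trunc_tendsto: "(\<lambda>n. trunc (inverse (real (Suc n))) t) \<longlonglongrightarrow> t"
proof (cases "t = 0")
  case False
  have "(\<lambda>n. t * (trunc_ratio (inverse (real (Suc n))) t)\<^sup>2) \<longlonglongrightarrow> t * 1\<^sup>2"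
    by (intro tendsto_intros trunc_ratio_tendsto False)
  then show ?thesis by (simp add: trunc_def)
qed (simp add: trunc_def)

text \<open>At t = 0 the limit is 0 and not the derivative 1 of the identity, every truncation being
  flat near 0. Convergence of the gradients therefore hinges on the gradient vanishing a.e. on the
  zero set.\<close>

lemma trunc_deriv_tendsto:
  "(\<lambda>n. trunc_deriv (inverse (real (Suc n))) t) \<longlonglongrightarrow> (if t = 0 then 0 else 1)"
proof (cases "t = 0")
  case False
  have "(\<lambda>n. (trunc_ratio (inverse (real (Suc n))) t)\<^sup>2 + 4 * (t\<^sup>2 / (t\<^sup>2 + (inverse (real (Suc n)))\<^sup>2)) *
     trunc_ratio (inverse (real (Suc n))) t * (1 - trunc_ratio (inverse (real (Suc n))) t))
     \<longlonglongrightarrow> 1\<^sup>2 + 4 * (t\<^sup>2 / (t\<^sup>2 + 0\<^sup>2)) * 1 * (1 - 1)"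
    by (intro tendsto_intros trunc_ratio_tendsto LIMSEQ_inverse_real_of_nat) (use False in auto)
  then show ?thesis using False by (simp add: trunc_deriv_def)
qed (simp add: trunc_deriv_def trunc_ratio_def)

lemma piecewise_C1_trunc:
  assumes "piecewise_C1 u" "\<delta> > 0"
  shows "piecewise_C1 (\<lambda>x. trunc \<delta> (u x))"
proof -
  obtain N L where N: "closed N" "negligible N" "L-lipschitz_on UNIV u"
    "\<And>x. x \<notin> N \<Longrightarrow> \<exists>F. C1 F \<and> (\<forall>\<^sub>F y in nhds x. u y = F y)"
    using assms(1) by (auto simp: piecewise_C1_def)
  have "\<exists>F. C1 F \<and> (\<forall>\<^sub>F y in nhds x. trunc \<delta> (u y) = F y)" if x: "x \<notin> N" for x
  proof -
    obtain F where "C1 F" "\<forall>\<^sub>F y in nhds x. u y = F y" using N(4)[of x] x by auto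
    then show ?thesis
      by (intro exI[of _ "\<lambda>x. trunc \<delta> (F x)"] conjI
          C1_compose_real[OF _ trunc_has_derivative continuous_on_trunc_deriv] assms(2)) (auto elim: eventually_mono)
  qed
  moreover have "(5 * L)-lipschitz_on UNIV (\<lambda>x. trunc \<delta> (u x))"
    by (rule lipschitz_on_compose2[OF N(3)]) (use trunc_lipschitz[OF assms(2)] lipschitz_on_subset in blast)
  ultimately show ?thesis unfolding piecewise_C1_def using N by blast
qed

lemma pd_trunc_AE:
  assumes "piecewise_C1 u" "\<delta> > 0"
  shows "AE x in lebesgue. pd i (\<lambda>x. trunc \<delta> (u x)) x = trunc_deriv \<delta> (u x) * pd i u x"
  using piecewise_C1_AE_differentiable[OF assms(1)]
  by eventually_elim (rule pd_compose_real(2)[OF _ trunc_has_derivative[OF assms(2)]])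

context
  fixes \<Omega> :: "R3 set"
  assumes open_dom: "open \<Omega>" and bounded_dom: "bounded \<Omega>"
begin

text \<open>The gradients of the truncations converge to the gradient cut off on the zero set, which
  therefore is a weak gradient, too; now use uniqueness.\<close>

lemma pd_zero_on_zero_set:
  assumes u: "piecewise_C1 u"
  shows "AE x in lebesgue_on \<Omega>. u x = 0 \<longrightarrow> pd i u x = 0"
proof -
  note dom = open_dom bounded_dom
  define g where "g x = (if u x = 0 then 0 else pd i u x)" for x
  define w where "w n x = trunc (inverse (real (Suc n))) (u x)" for n x
  have w: "piecewise_C1 (w n)" for n unfolding w_def by (rule piecewise_C1_trunc[OF u]) simp
  have um: "u \<in> borel_measurable lebesgue"
    by (rule continuous_borel_measurable_lebesgue[OF piecewise_C1_continuous_on[OF u]])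
  obtain L where L: "AE x in lebesgue. \<bar>pd i u x\<bar> \<le> L" using piecewise_C1_AE_pd_bounded[OF u] by blast
  obtain B where B: "\<And>x. x \<in> \<Omega> \<Longrightarrow> \<bar>u x\<bar> \<le> B" using piecewise_C1_bounded_on[OF dom u] by blast
  have gm: "g \<in> borel_measurable lebesgue"
    unfolding g_def using um piecewise_C1_pd_measurable[OF u, of i] by measurable
  have gL2: "g \<in> L2 \<Omega>"
  proof (rule L2_AE_bounded[OF dom_lmeasurable(1)[OF dom] measurable_restrict_space1[OF gm]])
    show "AE x in lebesgue_on \<Omega>. norm (g x) \<le> L"
    proof (rule AE_lebesgue_on[OF _ dom_lmeasurable(2)[OF dom]])
      show "AE x in lebesgue. norm (g x) \<le> L" using L by eventually_elim (auto simp: g_def)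
    qed
  qed
  have "is_weak_partial \<Omega> i u g"
    unfolding is_weak_partial_def
  proof (intro conjI ballI gL2)
    fix \<phi> assume \<phi>: "\<phi> \<in> test_fun \<Omega>"
    interpret finite_measure "lebesgue_on \<Omega>" by (rule finite_measure_lebesgue_on[OF dom_lmeasurable(1)[OF dom]])
    have I\<phi>: "integrable (lebesgue_on \<Omega>) \<phi>" "integrable (lebesgue_on \<Omega>) (pd i \<phi>)"
      by (rule L2_integrable[OF dom_lmeasurable(1)[OF dom]], rule test_fun_L2[OF dom \<phi>])+
    have [measurable]: "\<phi> \<in> borel_measurable (lebesgue_on \<Omega>)" "pd i \<phi> \<in> borel_measurable (lebesgue_on \<Omega>)"
      "w n \<in> borel_measurable (lebesgue_on \<Omega>)" "pd i (w n) \<in> borel_measurable (lebesgue_on \<Omega>)"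
      "u \<in> borel_measurable (lebesgue_on \<Omega>)" "g \<in> borel_measurable (lebesgue_on \<Omega>)" for n
      using I\<phi> piecewise_C1_L2[OF dom w[of n]] um gL2 by (auto simp: L2_def intro: measurable_restrict_space1)
    have "(\<lambda>n. LINT x|lebesgue_on \<Omega>. w n x * pd i \<phi> x) \<longlonglongrightarrow> (LINT x|lebesgue_on \<Omega>. u x * pd i \<phi> x)"
    proof (rule integral_dominated_convergence)
      show "integrable (lebesgue_on \<Omega>) (\<lambda>x. B * \<bar>pd i \<phi> x\<bar>)" using I\<phi>(2) by simp
      show "AE x in lebesgue_on \<Omega>. (\<lambda>n. w n x * pd i \<phi> x) \<longlonglongrightarrow> u x * pd i \<phi> x"
        unfolding w_def by (intro AE_I2 tendsto_mult trunc_tendsto tendsto_const)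
      show "AE x in lebesgue_on \<Omega>. norm (w n x * pd i \<phi> x) \<le> B * \<bar>pd i \<phi> x\<bar>" for n
        using B abs_trunc_le[of "inverse (real (Suc n))"]
        by (intro AE_I2) (auto simp: abs_mult w_def intro!: mult_right_mono order_trans[OF abs_trunc_le])
    qed measurable
    moreover have "(\<lambda>n. - (LINT x|lebesgue_on \<Omega>. pd i (w n) x * \<phi> x)) \<longlonglongrightarrow> - (LINT x|lebesgue_on \<Omega>. g x * \<phi> x)"
    proof (intro tendsto_minus, rule integral_dominated_convergence)
      show "integrable (lebesgue_on \<Omega>) (\<lambda>x. (5 * L) * \<bar>\<phi> x\<bar>)" using I\<phi>(1) by simp
      have d: "AE x in lebesgue. \<forall>n. pd i (w n) x = trunc_deriv (inverse (real (Suc n))) (u x) * pd i u x"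
        unfolding AE_all_countable w_def by (intro allI pd_trunc_AE[OF u]) simp
      show "AE x in lebesgue_on \<Omega>. (\<lambda>n. pd i (w n) x * \<phi> x) \<longlonglongrightarrow> g x * \<phi> x"
      proof (rule AE_lebesgue_on[OF _ dom_lmeasurable(2)[OF dom]])
        show "AE x in lebesgue. (\<lambda>n. pd i (w n) x * \<phi> x) \<longlonglongrightarrow> g x * \<phi> x" using d
        proof eventually_elim
          case (elim x)
          have "(\<lambda>n. trunc_deriv (inverse (real (Suc n))) (u x) * pd i u x * \<phi> x) \<longlonglongrightarrow>
             (if u x = 0 then 0 else 1) * pd i u x * \<phi> x"
            by (intro tendsto_mult tendsto_const trunc_deriv_tendsto)
          then show ?case using elim by (simp add: g_def split: if_splits)
        qed
      qed
      show "AE x in lebesgue_on \<Omega>. norm (pd i (w n) x * \<phi> x) \<le> 5 * L * \<bar>\<phi> x\<bar>" for n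
      proof (rule AE_lebesgue_on[OF _ dom_lmeasurable(2)[OF dom]])
        show "AE x in lebesgue. norm (pd i (w n) x * \<phi> x) \<le> 5 * L * \<bar>\<phi> x\<bar>" using d L
        proof eventually_elim
          case (elim x)
          have "\<bar>pd i (w n) x\<bar> \<le> 5 * L"
            using elim trunc_deriv_bounds[of "inverse (real (Suc n))" "u x"]
            by (simp add: abs_mult) (intro mult_mono, auto)
          then show ?case by (simp add: abs_mult mult_right_mono)
        qed
      qed
    qed measurable
    moreover have "(LINT x|lebesgue_on \<Omega>. w n x * pd i \<phi> x) = - (LINT x|lebesgue_on \<Omega>. pd i (w n) x * \<phi> x)" for n
      using is_weak_partial_pd[OF dom w[of n], of i] \<phi> by (simp add: is_weak_partial_def l2_inner_def)
    ultimately show "l2_inner \<Omega> u (pd i \<phi>) = - l2_inner \<Omega> g \<phi>"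
      by (simp add: l2_inner_def LIMSEQ_unique)
  qed
  from is_weak_partial_unique[OF dom this is_weak_partial_pd[OF dom u]]
  show ?thesis by eventually_elim (auto simp: g_def split: if_splits)
qed

end

section \<open>Mollification\<close>

lemma elem_smooth_continuous_on: "elem_smooth g \<Longrightarrow> continuous_on S g"
  using elem_smooth_imp_smooth smooth_C1 C1_continuous_on by blast

lemma pd_reflect:
  assumes "C1 g" shows "pd i (\<lambda>y. g (x - y)) y = - pd i g (x - y)" "(\<lambda>y. g (x - y)) differentiable at y"
proof -
  have "((\<lambda>y. x - y) has_derivative (\<lambda>h. - h)) (at y)" by (auto intro!: derivative_eq_intros)
  from has_derivative_compose[OF this has_derivative_pd[OF C1_differentiable[OF assms]]]
  have D: "((\<lambda>y. g (x - y)) has_derivative (\<lambda>h. \<Sum>i\<in>UNIV. (- h) $ i * pd i g (x - y))) (at y)" .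
  then show "(\<lambda>y. g (x - y)) differentiable at y" by (auto simp: differentiable_def)
  show "pd i (\<lambda>y. g (x - y)) y = - pd i g (x - y)"
    using pd_eqI[OF D, of i] by (simp add: axis_def if_distrib if_distribR sum.delta sum_negf cong: if_cong)
qed

lemma C1_reflect:
  assumes "C1 g" shows "C1 (\<lambda>y. g (x - y))"
proof -
  have "pd i (\<lambda>y. g (x - y)) = (\<lambda>y. - pd i g (x - y))" for i using pd_reflect(1)[OF assms] by (rule ext)
  moreover have "continuous_on UNIV (\<lambda>y. pd i g (x - y))" for i
    by (rule continuous_on_compose2[OF C1_pd_continuous_on[OF assms, of UNIV]]) (auto intro!: continuous_intros)
  ultimately show ?thesis using pd_reflect(2)[OF assms] by (auto simp: C1_def intro!: continuous_on_minus)
qed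

text \<open>A gauge integral over a fixed box, the setting in which the Leibniz rule differentiates
  under the integral. In its use the box contains the support of u, so that it is the full
  convolution.\<close>

definition conv_box :: "R3 \<Rightarrow> R3 \<Rightarrow> (R3 \<Rightarrow> real) \<Rightarrow> (R3 \<Rightarrow> real) \<Rightarrow> R3 \<Rightarrow> real" where
  "conv_box a b u g x = integral (cbox a b) (\<lambda>y. u y * g (x - y))"

lemma conv_box_pd:
  assumes u: "continuous_on UNIV u" and g: "C1 g"
  shows "conv_box a b u g differentiable at x" "pd i (conv_box a b u g) x = conv_box a b u (pd i g) x"
proof -
  \<comment> \<open>The Leibniz rule wants the derivative as a bounded linear map that depends
    continuously on both arguments; it is assembled from the coordinate functionals.\<close>
  define P :: "3 \<Rightarrow> R3 \<Rightarrow>\<^sub>L real" where "P i = Blinfun (\<lambda>h. h $ i)" for i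
  have P: "blinfun_apply (P i) h = h $ i" for i h
    unfolding P_def by (simp add: bounded_linear_Blinfun_apply bounded_linear_vec_nth)
  define D where "D x t = (\<Sum>i\<in>UNIV. (u t * pd i g (x - t)) *\<^sub>R P i)" for x t
  have Dapp: "blinfun_apply (D x t) h = (\<Sum>i\<in>UNIV. h $ i * (u t * pd i g (x - t)))" for x t h
    by (simp add: D_def blinfun.sum_left blinfun.scaleR_left P mult.commute)
  have cu: "continuous_on S (\<lambda>z. u (snd z))" for S :: "(R3 \<times> R3) set"
    by (intro continuous_on_compose2[OF u] continuous_intros) auto
  have cg: "continuous_on S (\<lambda>z. pd i g (fst z - snd z))" for i and S :: "(R3 \<times> R3) set"
    by (intro continuous_on_compose2[OF C1_pd_continuous_on[OF g, of UNIV]] continuous_intros) auto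
  have cD: "continuous_on (UNIV \<times> cbox a b) (\<lambda>(x, t). D x t)"
    unfolding D_def split_beta by (intro continuous_intros cu cg)
  have cDx: "continuous_on (cbox a b) (D x)" for x
  proof -
    have "continuous_on (cbox a b) (\<lambda>t. (\<lambda>(x, t). D x t) (x, t))"
      by (rule continuous_on_compose2[OF cD]) (auto intro!: continuous_intros)
    then show ?thesis by simp
  qed
  have gd: "((\<lambda>x. g (x - t)) has_derivative (\<lambda>h. \<Sum>i\<in>UNIV. h $ i * pd i g (x - t))) (at x)" for x t
  proof -
    have "((\<lambda>x. x - t) has_derivative (\<lambda>h. h)) (at x)" by (auto intro!: derivative_eq_intros)
    from has_derivative_compose[OF this has_derivative_pd[OF C1_differentiable[OF g]]] show ?thesis .
  qed
  have "((\<lambda>x. integral (cbox a b) (\<lambda>t. u t * g (x - t))) has_derivative integral (cbox a b) (D x)) (at x within UNIV)"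
  proof (rule leibniz_rule[OF _ _ cD])
    show "((\<lambda>x. u t * g (x - t)) has_derivative blinfun_apply (D x t)) (at x within UNIV)" for x t
      using has_derivative_mult_right[OF gd, of "u t"]
      by (simp add: Dapp[abs_def] sum_distrib_left algebra_simps)
    show "(\<lambda>t. u t * g (x - t)) integrable_on cbox a b" for x
      by (intro integrable_continuous continuous_intros continuous_on_subset[OF u]
          continuous_on_compose2[OF C1_continuous_on[OF g, of UNIV]]) auto
  qed auto
  then have H: "(conv_box a b u g has_derivative blinfun_apply (integral (cbox a b) (D x))) (at x)"
    by (simp add: conv_box_def[abs_def])
  then show "conv_box a b u g differentiable at x" unfolding differentiable_def by blast
  have "pd i (conv_box a b u g) x = integral (cbox a b) (\<lambda>t. blinfun_apply (D x t) (axis i 1))"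
    unfolding pd_eqI[OF H] by (intro blinfun_apply_integral integrable_continuous cDx)
  then show "pd i (conv_box a b u g) x = conv_box a b u (pd i g) x"
    by (simp add: Dapp conv_box_def axis_def if_distrib if_distribR sum.delta cong: if_cong)
qed

text \<open>All derivatives fall on the kernel, which comes from a class closed under
  \<open>pd\<close>; of u only continuity enters.\<close>

lemma smooth_conv_box:
  assumes u: "continuous_on UNIV u" and g: "elem_smooth g" shows "smooth (conv_box a b u g)"
proof -
  have e: "elem_smooth (foldr pd is g)" for "is"
    by (induction "is") (use g elem_smooth_pd(2) in auto)
  then have c: "C1 (foldr pd is g)" for "is" by (intro smooth_C1 elem_smooth_imp_smooth)
  have eq: "foldr pd is (conv_box a b u g) = conv_box a b u (foldr pd is g)" for "is"
    by (induction "is") (auto intro!: ext conv_box_pd(2)[OF u c])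
  show ?thesis unfolding smooth_def eq differentiable_on_def
    using conv_box_pd(1)[OF u c] by (auto intro: differentiable_at_withinI)
qed

section \<open>The smoothing kernel and averages with respect to it\<close>

text \<open>r is the half side of a cube, which sits in the ball of radius \<open>3 * r\<close>;
  hence the factor 3 in all statements on supports.\<close>

definition mollifier :: "real \<Rightarrow> R3 \<Rightarrow> real" where
  "mollifier r x = bump 1 (\<chi> i. - r) (\<chi> i. r) x / (\<integral>y. bump 1 (\<chi> i. - r) (\<chi> i. r) y \<partial>lborel)"

lemma norm_le_of_components:
  fixes x :: R3 assumes "\<And>i. \<bar>x $ i\<bar> \<le> r" shows "norm x \<le> 3 * r"
proof -
  have "norm x \<le> (\<Sum>i\<in>UNIV. \<bar>x $ i\<bar>)" by (rule norm_le_l1_cart)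
  also have "\<dots> \<le> (\<Sum>i\<in>(UNIV::3 set). r)" by (intro sum_mono assms)
  finally show ?thesis by simp
qed

lemma mollifier:
  assumes "r > 0"
  shows "elem_smooth (mollifier r)" "\<And>x. 0 \<le> mollifier r x" "\<And>x. norm x > 3 * r \<Longrightarrow> mollifier r x = 0"
    "integrable lborel (mollifier r)" "(\<integral>y. mollifier r y \<partial>lborel) = 1"
proof -
  define B where "B = bump 1 (\<chi> i. - r) (\<chi> i. r)"
  define c where "c = (\<integral>y. B y \<partial>lborel)"
  have m: "mollifier r = (\<lambda>x. B x / c)" by (simp add: fun_eq_iff mollifier_def B_def c_def)
  have B0: "B x = 0" if "norm x > 3 * r" for x
  proof -
    have "x \<notin> box (\<chi> i. - r) (\<chi> i. r)"
    proof
      assume "x \<in> box (\<chi> i. - r) (\<chi> i. r)"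
      then have "\<bar>x $ i\<bar> \<le> r" for i by (auto simp: mem_box_cart abs_le_iff less_imp_le) (metis less_imp_le minus_less_iff)
      from norm_le_of_components[OF this] that show False by simp
    qed
    then show ?thesis unfolding B_def by (intro bump_eq_0) auto
  qed
  have Bc: "continuous_on S B" for S unfolding B_def by (intro elem_smooth_continuous_on elem_smooth_bump)
  have Bi: "integrable lborel B" using B0 by (intro continuous_bounded_support_integrable[of _ "3 * r"] Bc)
  have Bn: "0 \<le> B x" for x by (simp add: B_def bump_nonneg)
  \<comment> \<open>The bump is positive on a non-empty open box, which is not a null set.\<close>
  have "c \<noteq> 0"
  proof
    assume "c = 0"
    then have "AE x in lborel. B x = 0"
      unfolding c_def using Bi Bn by (subst (asm) integral_nonneg_eq_0_iff_AE) auto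
    then have "AE x in (lborel :: R3 measure). x \<notin> box (\<chi> i. - r) (\<chi> i. r)"
    proof eventually_elim
      case (elim x)
      then show ?case using bump_pos[of 1 x "\<chi> i. - r" "\<chi> i. r"] by (auto simp: B_def)
    qed
    then have "box (\<chi> i. - r) (\<chi> i. r) \<in> null_sets (lborel :: R3 measure)"
      by (subst (asm) AE_iff_null_sets[symmetric]) auto
    then have "negligible (box (\<chi> i. - r) (\<chi> i. r) :: R3 set)"
      by (simp add: negligible_iff_null_sets null_sets_completionI)
    moreover have "(0::R3) \<in> box (\<chi> i. - r) (\<chi> i. r)" using assms by (simp add: mem_box_cart)
    ultimately show False using open_not_negligible[OF open_box] by blast
  qed
  moreover have "0 \<le> c" unfolding c_def using Bn by simp
  ultimately have c: "0 < c" by simp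
  show "elem_smooth (mollifier r)"
    unfolding m B_def divide_inverse by (intro elem_smooth.mult elem_smooth_bump elem_smooth.const)
  show "0 \<le> mollifier r x" for x using Bn c by (simp add: m)
  show "mollifier r x = 0" if "norm x > 3 * r" for x using B0[OF that] by (simp add: m)
  show "integrable lborel (mollifier r)" unfolding m using Bi by simp
  show "(\<integral>y. mollifier r y \<partial>lborel) = 1" unfolding m using c by (simp add: c_def)
qed

lemma lborel_integral_reflect:
  fixes f :: "R3 \<Rightarrow> real"
  assumes [measurable]: "f \<in> borel_measurable borel"
  shows "(\<integral>y. f (x - y) \<partial>lborel) = (\<integral>y. f y \<partial>lborel)"
proof -
  have e: "lborel = distr lborel borel (\<lambda>y::R3. x + (-1) *\<^sub>R y)"
    using lborel_affine[of "-1" x] by (simp add: density_1)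
  have "(\<integral>y. f y \<partial>lborel) = (\<integral>y. f y \<partial>distr lborel borel (\<lambda>y::R3. x + (-1) *\<^sub>R y))" using e by simp
  also have "\<dots> = (\<integral>y. f (x + (-1) *\<^sub>R y) \<partial>lborel)" by (subst integral_distr) auto
  finally show ?thesis by simp
qed

context
  fixes r :: real assumes r: "r > 0"
begin

lemma mollifier_reflect:
  shows "integrable lebesgue (\<lambda>y. mollifier r (x - y))" "(LINT y|lebesgue. mollifier r (x - y)) = 1"
    "C1 (mollifier r)"
proof -
  note M = mollifier[OF r]
  show C: "C1 (mollifier r)" by (intro smooth_C1 elem_smooth_imp_smooth M)
  have [measurable]: "mollifier r \<in> borel_measurable borel"
    by (intro borel_measurable_continuous_onI C1_continuous_on C)
  have c: "continuous_on UNIV (\<lambda>y. mollifier r (x - y))"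
    by (intro C1_continuous_on C1_reflect C)
  have "integrable lborel (\<lambda>y. mollifier r (x - y))"
  proof (rule continuous_bounded_support_integrable[OF c, of "norm x + 3 * r"])
    fix y :: R3 assume "norm x + 3 * r < norm y"
    then have "norm (x - y) > 3 * r" using norm_triangle_ineq2[of y x] by (simp add: norm_minus_commute)
    then show "mollifier r (x - y) = 0" by (rule M)
  qed
  then show "integrable lebesgue (\<lambda>y. mollifier r (x - y))" by (simp add: integrable_completion)
  have "(LINT y|lebesgue. mollifier r (x - y)) = (\<integral>y. mollifier r (x - y) \<partial>lborel)"
    by (rule integral_completion) measurable
  also have "\<dots> = 1" using lborel_integral_reflect[of "mollifier r" x] M(5) by simp
  finally show "(LINT y|lebesgue. mollifier r (x - y)) = 1" .
qed

lemma integrable_mollified: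
  assumes w: "w \<in> borel_measurable lebesgue" and B: "AE y in lebesgue. \<bar>w y\<bar> \<le> B"
  shows "integrable lebesgue (\<lambda>y. w y * mollifier r (x - y))"
proof (rule Bochner_Integration.integrable_bound)
  show "integrable lebesgue (\<lambda>y. B * mollifier r (x - y))" using mollifier_reflect(1) by simp
  show "(\<lambda>y. w y * mollifier r (x - y)) \<in> borel_measurable lebesgue"
    using w mollifier_reflect(1)[of x] by (intro borel_measurable_times) auto
  show "AE y in lebesgue. norm (w y * mollifier r (x - y)) \<le> norm (B * mollifier r (x - y))"
    using B by eventually_elim (auto simp: abs_mult intro!: mult_right_mono)
qed

lemma mollified_bound:
  assumes w: "w \<in> borel_measurable lebesgue" and B: "AE y in lebesgue. \<bar>w y\<bar> \<le> B"
  shows "\<bar>LINT y|lebesgue. w y * mollifier r (x - y)\<bar> \<le> B"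
proof -
  have "\<bar>LINT y|lebesgue. w y * mollifier r (x - y)\<bar> \<le> (LINT y|lebesgue. \<bar>w y * mollifier r (x - y)\<bar>)"
    by (rule integral_abs_bound)
  also have "\<dots> \<le> (LINT y|lebesgue. B * mollifier r (x - y))"
  proof (rule integral_mono_AE)
    show "AE y in lebesgue. \<bar>w y * mollifier r (x - y)\<bar> \<le> B * mollifier r (x - y)"
      using B by eventually_elim (auto simp: abs_mult mollifier(2)[OF r] intro!: mult_right_mono)
  qed (use integrable_mollified[OF assms] mollifier_reflect(1) in auto)
  also have "\<dots> = B" using mollifier_reflect(2) by simp
  finally show ?thesis .
qed

text \<open>The kernel has mass one, so the difference is an average of \<open>w y - w x\<close>
  over points y within \<open>3 * r\<close> of x.\<close>

lemma mollified_close: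
  assumes w: "w \<in> borel_measurable lebesgue" and B: "AE y in lebesgue. \<bar>w y\<bar> \<le> B"
    and e: "\<And>y. norm (x - y) \<le> 3 * r \<Longrightarrow> \<bar>w y - w x\<bar> \<le> e"
  shows "\<bar>(LINT y|lebesgue. w y * mollifier r (x - y)) - w x\<bar> \<le> e"
proof -
  note I = integrable_mollified[OF w B, of x] mollifier_reflect(1)[of x]
  have "(LINT y|lebesgue. w y * mollifier r (x - y)) - w x
      = (LINT y|lebesgue. w y * mollifier r (x - y)) - (LINT y|lebesgue. w x * mollifier r (x - y))"
    using mollifier_reflect(2)[of x] by simp
  also have "\<dots> = (LINT y|lebesgue. w y * mollifier r (x - y) - w x * mollifier r (x - y))"
    using I by (intro Bochner_Integration.integral_diff[symmetric]) auto
  also have "\<bar>\<dots>\<bar> \<le> (LINT y|lebesgue. \<bar>w y * mollifier r (x - y) - w x * mollifier r (x - y)\<bar>)"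
    by (rule integral_abs_bound)
  also have "\<dots> \<le> (LINT y|lebesgue. e * mollifier r (x - y))"
  proof (rule integral_mono)
    fix y
    show "\<bar>w y * mollifier r (x - y) - w x * mollifier r (x - y)\<bar> \<le> e * mollifier r (x - y)"
    proof (cases "norm (x - y) \<le> 3 * r")
      case True
      then show ?thesis using e[OF True] mollifier(2)[OF r, of "x - y"]
        by (simp add: left_diff_distrib[symmetric] abs_mult mult_right_mono)
    next
      case False
      then show ?thesis using mollifier(3)[OF r, of "x - y"] by simp
    qed
  qed (use I in auto)
  also have "\<dots> = e" using mollifier_reflect(2)[of x] by simp
  finally show ?thesis .
qed

end

text \<open>Continuity at the single point x suffices, so this applies to partial derivatives that
  jump across a null set.\<close>

lemma mollified_tendsto:
  assumes w: "w \<in> borel_measurable lebesgue" and B: "AE y in lebesgue. \<bar>w y\<bar> \<le> B"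
    and c: "isCont w x" and r: "\<And>n. \<rho> n > 0" "\<rho> \<longlonglongrightarrow> 0"
  shows "(\<lambda>n. LINT y|lebesgue. w y * mollifier (\<rho> n) (x - y)) \<longlonglongrightarrow> w x"
proof (rule LIMSEQ_I)
  fix e :: real assume "e > 0"
  then obtain d where d: "d > 0" "\<And>y. dist y x < d \<Longrightarrow> dist (w y) (w x) < e / 2"
    using c unfolding continuous_at_eps_delta by (metis half_gt_zero)
  have "\<forall>\<^sub>F n in sequentially. \<rho> n < d / 3" using r(2) d(1) by (intro order_tendstoD) auto
  then obtain n0 where n0: "\<And>n. n \<ge> n0 \<Longrightarrow> \<rho> n < d / 3" unfolding eventually_sequentially by blast
  have "norm ((LINT y|lebesgue. w y * mollifier (\<rho> n) (x - y)) - w x) < e" if "n \<ge> n0" for n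
  proof -
    have "\<bar>(LINT y|lebesgue. w y * mollifier (\<rho> n) (x - y)) - w x\<bar> \<le> e / 2"
    proof (rule mollified_close[OF r(1) w B])
      fix y assume "norm (x - y) \<le> 3 * \<rho> n"
      then have "dist y x < d" using n0[OF that] by (simp add: dist_norm norm_minus_commute)
      from d(2)[OF this] show "\<bar>w y - w x\<bar> \<le> e / 2" by (simp add: dist_real_def)
    qed
    then show ?thesis using \<open>e > 0\<close> by simp
  qed
  then show "\<exists>n0. \<forall>n\<ge>n0. norm ((LINT y|lebesgue. w y * mollifier (\<rho> n) (x - y)) - w x) < e" by blast
qed

section \<open>Lipschitz functions vanishing outside the domain belong to \<open>H01\<close>\<close>

context
  fixes \<Omega> :: "R3 set"
  assumes open_dom: "open \<Omega>" and bounded_dom: "bounded \<Omega>"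
begin

text \<open>Mollification at a scale below the distance of the support to the boundary gives test
  functions. Their partials are the mollified partials of u, which converge wherever the partials of
  u are continuous, that is a.e.\<close>

lemma H1_approx_compact_support:
  assumes u: "piecewise_C1 u" and S: "compact S" "S \<subseteq> \<Omega>" "\<And>x. x \<notin> S \<Longrightarrow> u x = 0" and "e > 0"
  shows "\<exists>\<phi>\<in>test_fun \<Omega>. (H1_norm \<Omega> (\<lambda>x. u x - \<phi> x))\<^sup>2 < e"
proof -
  note dom = open_dom bounded_dom
  obtain d where d: "d > 0" "(\<Union>x\<in>S. ball x d) \<subseteq> \<Omega>"
    using compact_subset_open_imp_ball_epsilon_subset[OF S(1) open_dom S(2)] by blast
  obtain a b where ab: "S \<subseteq> cbox a b" using bounded_subset_cbox_symmetric[OF compact_imp_bounded[OF S(1)]] by blast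
  \<comment> \<open>At most a quarter of the margin d, since the kernel of parameter \<rho> reaches
    as far as 3 \<rho>.\<close>
  define \<rho> where "\<rho> n = d / 4 * inverse (real (Suc n))" for n
  have \<rho>: "\<rho> n > 0" "3 * \<rho> n < d" for n
  proof -
    show "\<rho> n > 0" using d(1) by (simp add: \<rho>_def)
    have "inverse (real (Suc n)) \<le> 1" by (simp add: field_simps)
    then have "\<rho> n \<le> d / 4 * 1" unfolding \<rho>_def using d(1) by (intro mult_left_mono) auto
    then show "3 * \<rho> n < d" using d(1) by simp
  qed
  have \<rho>0: "\<rho> \<longlonglongrightarrow> 0"
    unfolding \<rho>_def using tendsto_mult[OF tendsto_const LIMSEQ_inverse_real_of_nat, of "d/4"] by simp
  define w where "w n = conv_box a b u (mollifier (\<rho> n))" for n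
  have uc: "continuous_on T u" for T by (rule piecewise_C1_continuous_on[OF u])
  have mc: "continuous_on UNIV (\<lambda>y. g (x - y))" if "C1 g" for g x
    by (rule C1_continuous_on[OF C1_reflect[OF that]])
  \<comment> \<open>u vanishes outside the box, so the gauge integral over the box is a Lebesgue
    integral over the whole space.\<close>
  have conv_lebesgue: "conv_box a b u g x = (LINT y|lebesgue. u y * g (x - y))" if "continuous_on UNIV g" for g x
  proof -
    have c: "continuous_on T (\<lambda>y. u y * g (x - y))" for T
      by (intro continuous_intros uc continuous_on_compose2[OF that]) auto
    have "(\<lambda>y. u y * g (x - y)) absolutely_integrable_on cbox a b"
      by (rule absolutely_integrable_continuous[OF c])
    then have "conv_box a b u g x = (LINT y:cbox a b|lebesgue. u y * g (x - y))"
      unfolding conv_box_def by (rule set_lebesgue_integral_eq_integral(2)[symmetric])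
    also have "\<dots> = (LINT y|lebesgue. u y * g (x - y))"
      unfolding set_lebesgue_integral_def using S(3) ab
      by (intro Bochner_Integration.integral_cong) (auto simp: indicator_def)
    finally show ?thesis .
  qed
  have w_eq: "w n x = (LINT y|lebesgue. u y * mollifier (\<rho> n) (x - y))" for n x
    unfolding w_def using mollifier_reflect(3)[OF \<rho>(1)] by (intro conv_lebesgue C1_continuous_on)
  have wpd: "pd i (w n) x = (LINT y|lebesgue. pd i u y * mollifier (\<rho> n) (x - y))" for i n x
  proof -
    have C: "C1 (mollifier (\<rho> n))" by (rule mollifier_reflect(3)[OF \<rho>(1)])
    have "pd i (w n) x = conv_box a b u (pd i (mollifier (\<rho> n))) x"
      unfolding w_def by (rule conv_box_pd(2)[OF uc C])
    also have "\<dots> = (LINT y|lebesgue. u y * pd i (mollifier (\<rho> n)) (x - y))"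
      by (intro conv_lebesgue C1_pd_continuous_on C)
    \<comment> \<open>The reflected argument and the integration by parts contribute a minus sign
      each; together they shift the derivative from the kernel to u.\<close>
    also have "\<dots> = - (LINT y|lebesgue. u y * pd i (\<lambda>y. mollifier (\<rho> n) (x - y)) y)"
      by (simp add: pd_reflect(1)[OF C])
    also have "\<dots> = (LINT y|lebesgue. pd i u y * mollifier (\<rho> n) (x - y))"
    proof (subst integration_by_parts[OF u C1_reflect[OF C], of "norm x + 3 * \<rho> n"])
      fix y :: R3 assume "norm x + 3 * \<rho> n < norm y"
      then have "norm (x - y) > 3 * \<rho> n" using norm_triangle_ineq2[of y x] by (simp add: norm_minus_commute)
      then show "mollifier (\<rho> n) (x - y) = 0" by (rule mollifier(3)[OF \<rho>(1)])
    qed simp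
    finally show ?thesis .
  qed
  have w_test: "w n \<in> test_fun \<Omega>" for n
  proof -
    define K where "K = {y + z | y z. y \<in> S \<and> z \<in> cball 0 (3 * \<rho> n)}"
    have "smooth (w n)" unfolding w_def by (rule smooth_conv_box[OF uc mollifier(1)[OF \<rho>(1)]])
    moreover have "compact K" unfolding K_def by (rule compact_sums[OF S(1) compact_cball])
    moreover have "K \<subseteq> \<Omega>"
    proof
      fix x assume "x \<in> K"
      then obtain y z where "y \<in> S" "norm z \<le> 3 * \<rho> n" "x = y + z" by (auto simp: K_def)
      then have "x \<in> ball y d" using \<rho>(2)[of n] by (simp add: dist_norm)
      then show "x \<in> \<Omega>" using d(2) \<open>y \<in> S\<close> by blast
    qed
    moreover have "w n x = 0" if "x \<notin> K" for x
    proof -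
      have z: "u y * mollifier (\<rho> n) (x - y) = 0" for y
      proof (cases "y \<in> S")
        case True
        have "norm (x - y) > 3 * \<rho> n"
        proof (rule ccontr)
          assume "\<not> norm (x - y) > 3 * \<rho> n"
          then have "x \<in> K" unfolding K_def using True by (intro CollectI exI[of _ y] exI[of _ "x - y"]) auto
          then show False using that by simp
        qed
        then show ?thesis using mollifier(3)[OF \<rho>(1)] by simp
      qed (use S(3) in simp)
      show ?thesis unfolding w_eq z by simp
    qed
    ultimately show ?thesis unfolding test_fun_def by blast
  qed
  have um: "u \<in> borel_measurable lebesgue" by (rule continuous_borel_measurable_lebesgue[OF uc])
  obtain B0 where "\<And>x. x \<in> \<Omega> \<Longrightarrow> \<bar>u x\<bar> \<le> B0" using piecewise_C1_bounded_on[OF dom u] by blast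
  \<comment> \<open>The 0 in the maximum covers the points outside S, where u vanishes.\<close>
  then have B0: "\<bar>u x\<bar> \<le> max 0 B0" for x using S(2,3) by (cases "x \<in> S") (auto intro: max.coboundedI2)
  obtain N L where N: "negligible N" "0 < L" "\<And>x i. x \<notin> N \<Longrightarrow> isCont (pd i u) x" "\<And>x i. x \<notin> N \<Longrightarrow> \<bar>pd i u x\<bar> \<le> L"
    using u by (rule piecewise_C1_E) blast
  have L: "AE x in lebesgue. \<bar>pd i u x\<bar> \<le> L" for i
    using AE_not_in_negligible[OF N(1)] by eventually_elim (rule N)
  define B where "B = max (max 0 B0) L"
  have uB: "AE x in lebesgue. \<bar>u x\<bar> \<le> B" using B0 by (intro AE_I2) (auto simp: B_def intro: max.coboundedI1)
  have LB: "AE x in lebesgue. \<bar>pd i u x\<bar> \<le> B" for i using L[of i] by eventually_elim (auto simp: B_def)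
  have "(\<lambda>n. (H1_norm \<Omega> (\<lambda>x. u x - w n x))\<^sup>2) \<longlonglongrightarrow> 0"
  proof (rule H1_norm_diff_tendsto_0[OF dom u test_fun_piecewise_C1[OF w_test]])
    show "(\<lambda>n. w n x) \<longlonglongrightarrow> u x" for x
      unfolding w_eq using uc[of UNIV]
      by (intro mollified_tendsto[OF um uB _ \<rho>(1) \<rho>0]) (simp add: continuous_on_eq_continuous_at)
    show "AE x in lebesgue_on \<Omega>. (\<lambda>n. pd i (w n) x) \<longlonglongrightarrow> pd i u x" for i
    proof (rule AE_lebesgue_on[OF _ dom_lmeasurable(2)[OF dom]])
      show "AE x in lebesgue. (\<lambda>n. pd i (w n) x) \<longlonglongrightarrow> pd i u x"
        using AE_not_in_negligible[OF N(1)] unfolding wpd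
        by eventually_elim (intro mollified_tendsto[OF piecewise_C1_pd_measurable[OF u] LB _ \<rho>(1) \<rho>0] N(3))
    qed
    show "\<bar>w n x\<bar> \<le> B" for n x unfolding w_eq by (rule mollified_bound[OF \<rho>(1) um uB])
    show "AE x in lebesgue. \<bar>pd i (w n) x\<bar> \<le> B" for n i
      unfolding wpd by (intro AE_I2 mollified_bound[OF \<rho>(1) piecewise_C1_pd_measurable[OF u] LB])
  qed
  then have "\<forall>\<^sub>F n in sequentially. (H1_norm \<Omega> (\<lambda>x. u x - w n x))\<^sup>2 < e"
    using \<open>e > 0\<close> by (intro order_tendstoD) auto
  then obtain n where "(H1_norm \<Omega> (\<lambda>x. u x - w n x))\<^sup>2 < e" unfolding eventually_sequentially by blast
  then show ?thesis using w_test by blast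
qed

text \<open>The gradients of the truncations tend to that of u where u is non-zero and to 0 on the
  zero set, where the gradient of u is 0 a.e. as well.\<close>

lemma H1_approx_truncation:
  assumes u: "piecewise_C1 u" and "e > 0"
  shows "\<exists>\<delta>>0. (H1_norm \<Omega> (\<lambda>x. u x - trunc \<delta> (u x)))\<^sup>2 < e"
proof -
  note dom = open_dom bounded_dom
  define w where "w n x = trunc (inverse (real (Suc n))) (u x)" for n x
  have w: "piecewise_C1 (w n)" for n unfolding w_def by (rule piecewise_C1_trunc[OF u]) simp
  obtain B0 where B0: "\<And>x. x \<in> \<Omega> \<Longrightarrow> \<bar>u x\<bar> \<le> B0" using piecewise_C1_bounded_on[OF dom u] by blast
  obtain L where L: "\<And>i. AE x in lebesgue. \<bar>pd i u x\<bar> \<le> L" using piecewise_C1_AE_pd_bounded[OF u] by blast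
  define B where "B = max B0 (5 * L)"
  have d: "AE x in lebesgue. \<forall>n. pd i (w n) x = trunc_deriv (inverse (real (Suc n))) (u x) * pd i u x" for i
    unfolding AE_all_countable w_def by (intro allI pd_trunc_AE[OF u]) simp
  have "(\<lambda>n. (H1_norm \<Omega> (\<lambda>x. u x - w n x))\<^sup>2) \<longlonglongrightarrow> 0"
  proof (rule H1_norm_diff_tendsto_0[OF dom u w])
    show "(\<lambda>n. w n x) \<longlonglongrightarrow> u x" for x unfolding w_def by (rule trunc_tendsto)
    show "AE x in lebesgue_on \<Omega>. (\<lambda>n. pd i (w n) x) \<longlonglongrightarrow> pd i u x" for i
      using AE_lebesgue_on[OF d[of i] dom_lmeasurable(2)[OF dom]] pd_zero_on_zero_set[OF dom u, of i]
    proof eventually_elim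
      case (elim x)
      have "(\<lambda>n. trunc_deriv (inverse (real (Suc n))) (u x) * pd i u x) \<longlonglongrightarrow>
          (if u x = 0 then 0 else 1) * pd i u x"
        by (intro tendsto_mult tendsto_const trunc_deriv_tendsto)
      then show ?case using elim by (simp split: if_splits)
    qed
    show "\<bar>w n x\<bar> \<le> B" if "x \<in> \<Omega>" for n x
      using order_trans[OF abs_trunc_le B0[OF that]] by (auto simp: B_def w_def intro: max.coboundedI1)
    show "AE x in lebesgue. \<bar>pd i (w n) x\<bar> \<le> B" for n i
      using d[of i] L[of i]
    proof eventually_elim
      case (elim x)
      have "\<bar>pd i (w n) x\<bar> \<le> 5 * L"
        using elim trunc_deriv_bounds[of "inverse (real (Suc n))" "u x"]
        by (simp add: abs_mult) (intro mult_mono, auto)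
      then show ?case by (simp add: B_def)
    qed
  qed
  then have "\<forall>\<^sub>F n in sequentially. (H1_norm \<Omega> (\<lambda>x. u x - w n x))\<^sup>2 < e"
    using \<open>e > 0\<close> by (intro order_tendstoD) auto
  then obtain n where "(H1_norm \<Omega> (\<lambda>x. u x - w n x))\<^sup>2 < e" unfolding eventually_sequentially by blast
  then show ?thesis unfolding w_def by (intro exI[of _ "inverse (real (Suc n))"]) simp
qed

text \<open>Truncating the values takes the place of a cut-off near the boundary: the truncation
  lives on {\<delta> \<le> |u|}, a set that is closed by continuity and inside the domain since u
  vanishes elsewhere, hence compact.\<close>

lemma piecewise_C1_H01:
  assumes u: "piecewise_C1 u" and 0: "\<And>x. x \<notin> \<Omega> \<Longrightarrow> u x = 0"
  shows "u \<in> H01 \<Omega>"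
  unfolding H01_def
proof (intro CollectI conjI allI impI piecewise_C1_H1[OF open_dom bounded_dom u])
  note dom = open_dom bounded_dom
  fix e :: real assume "e > 0"
  \<comment> \<open>Two errors, each entering the squared norm with the factor 2.\<close>
  then have e: "e\<^sup>2 / 4 > 0" by simp
  obtain \<delta> where \<delta>: "\<delta> > 0" "(H1_norm \<Omega> (\<lambda>x. u x - trunc \<delta> (u x)))\<^sup>2 < e\<^sup>2 / 4"
    using H1_approx_truncation[OF u e] by blast
  define v where "v x = trunc \<delta> (u x)" for x
  have v: "piecewise_C1 v" unfolding v_def by (rule piecewise_C1_trunc[OF u \<delta>(1)])
  define S where "S = {x. \<delta> \<le> \<bar>u x\<bar>}"
  have S: "S \<subseteq> \<Omega>" using 0 \<delta>(1) by (force simp: S_def)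
  have "closed S" unfolding S_def
    by (intro closed_Collect_le continuous_intros piecewise_C1_continuous_on[OF u])
  then have "compact S" using S bounded_dom bounded_subset compact_eq_bounded_closed by blast
  moreover have "v x = 0" if "x \<notin> S" for x using that by (simp add: S_def v_def trunc_eq_0)
  ultimately obtain \<phi> where \<phi>: "\<phi> \<in> test_fun \<Omega>" "(H1_norm \<Omega> (\<lambda>x. v x - \<phi> x))\<^sup>2 < e\<^sup>2 / 4"
    using H1_approx_compact_support[OF v _ S _ e] by blast
  have "(H1_norm \<Omega> (\<lambda>x. (u x - v x) + (v x - \<phi> x)))\<^sup>2
      \<le> 2 * (H1_norm \<Omega> (\<lambda>x. u x - v x))\<^sup>2 + 2 * (H1_norm \<Omega> (\<lambda>x. v x - \<phi> x))\<^sup>2"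
    by (intro H1_norm_add_squared[OF dom] piecewise_C1_H1[OF dom] piecewise_C1_diff u v test_fun_piecewise_C1[OF \<phi>(1)])
  also have "(\<lambda>x. (u x - v x) + (v x - \<phi> x)) = (\<lambda>x. u x - \<phi> x)" by auto
  finally have "(H1_norm \<Omega> (\<lambda>x. u x - \<phi> x))\<^sup>2 < e\<^sup>2"
    using \<delta>(2) \<phi>(2) unfolding v_def[symmetric] by linarith
  then have "H1_norm \<Omega> (\<lambda>x. u x - \<phi> x) < e" 
    by (rule power_less_imp_less_base) (use \<open>e > 0\<close> in simp)
  then show "\<exists>\<phi>\<in>test_fun \<Omega>. H1_norm \<Omega> (\<lambda>x. u x - \<phi> x) < e" using \<phi>(1) by blast
qed

text \<open>Admits the bubble polynomial of a cell, which is not zero outside that cell: inside it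
  equals its extension by zero, to which the criterion above applies.\<close>

lemma H01_cong:
  assumes "\<And>x. x \<in> \<Omega> \<Longrightarrow> u x = v x" "v \<in> H01 \<Omega>" shows "u \<in> H01 \<Omega>"
proof -
  have p: "is_weak_partial \<Omega> i f = is_weak_partial \<Omega> i g" if "\<And>x. x \<in> \<Omega> \<Longrightarrow> f x = g x" for f g i
  proof
    fix v
    have "l2_inner \<Omega> f h = l2_inner \<Omega> g h" for h by (rule l2_inner_cong[OF that]) auto
    then show "is_weak_partial \<Omega> i f v = is_weak_partial \<Omega> i g v" by (simp add: is_weak_partial_def)
  qed
  have n: "H1_norm \<Omega> f = H1_norm \<Omega> g" if eq: "\<And>x. x \<in> \<Omega> \<Longrightarrow> f x = g x" for f g
  proof -
    have "weak_grad \<Omega> f = weak_grad \<Omega> g"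
      using p[OF eq] by (simp add: weak_grad_def fun_eq_iff weak_partial_def)
    moreover have "l2_norm \<Omega> f = l2_norm \<Omega> g" unfolding l2_norm_def using l2_inner_cong[OF eq eq] by simp
    ultimately show ?thesis by (simp add: H1_norm_def)
  qed
  have "u \<in> L2 \<Omega> \<longleftrightarrow> v \<in> L2 \<Omega>"
  proof -
    have "u \<in> borel_measurable (lebesgue_on \<Omega>) \<longleftrightarrow> v \<in> borel_measurable (lebesgue_on \<Omega>)"
      using assms(1) by (intro measurable_cong) auto
    moreover have "integrable (lebesgue_on \<Omega>) (\<lambda>x. (norm (u x))\<^sup>2) = integrable (lebesgue_on \<Omega>) (\<lambda>x. (norm (v x))\<^sup>2)"
      using assms(1) by (intro Bochner_Integration.integrable_cong) auto
    ultimately show ?thesis by (simp add: L2_def)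
  qed
  moreover have "H1_norm \<Omega> (\<lambda>x. u x - \<phi> x) = H1_norm \<Omega> (\<lambda>x. v x - \<phi> x)" for \<phi>
    using assms(1) by (intro n) simp
  ultimately show ?thesis using assms(2) p[OF assms(1)] by (simp add: H01_def H1_def)
qed

end

section \<open>Exterior balls of a polyhedral domain\<close>

text \<open>The hyperplanes spanned by the faces of the polytopes divide space into finitely many open
  convex cells; every boundary point lies in the closure of a cell outside the domain, and shrinking a
  ball in that cell towards the boundary point keeps it inside the cell.\<close>

lemma polyhedral_domain_exterior_balls:
  assumes \<Omega>: "polyhedral_domain \<Omega>" and "D > 0"
  shows "\<exists>\<kappa>>0. \<exists>M\<ge>0. \<forall>z\<in>frontier \<Omega>. \<forall>r. 0 < r \<and> r \<le> D \<longrightarrow>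
     (\<exists>z'. dist z z' \<le> M * r \<and> ball z' (\<kappa> * r) \<inter> \<Omega> = {})"
proof -
  have "open \<Omega>" "bounded \<Omega>" and int_cl: "interior (closure \<Omega>) = \<Omega>"
    using \<Omega> by (auto simp: polyhedral_domain_def)
  obtain P where P: "finite P" "\<And>p. p \<in> P \<Longrightarrow> polytope p" "closure \<Omega> = \<Union>P"
    using \<Omega> by (auto simp: polyhedral_domain_def)
  have "\<exists>F. finite F \<and> p = \<Inter> F \<and> (\<forall>h \<in> F. \<exists>a b. a \<noteq> 0 \<and> h = {x. a \<bullet> x \<le> b})" if "p \<in> P" for p
    using polytope_imp_polyhedron[OF P(2)[OF that]] by (simp add: polyhedron_def)
  then obtain F where F: "\<And>p. p \<in> P \<Longrightarrow> finite (F p)" "\<And>p. p \<in> P \<Longrightarrow> p = \<Inter> (F p)"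
    "\<And>p h. p \<in> P \<Longrightarrow> h \<in> F p \<Longrightarrow> \<exists>a b. a \<noteq> 0 \<and> h = {x. a \<bullet> x \<le> b}" by metis
  define HS where "HS = (\<Union>p\<in>P. F p)"
  have fin: "finite HS" using P(1) F(1) by (simp add: HS_def)
  have hs: "closed h" "convex h" "convex (- h)" "negligible (frontier h)" if hHS: "h \<in> HS" for h
  proof -
    obtain a b where h: "h = {x. a \<bullet> x \<le> b}" using hHS F(3) unfolding HS_def by blast
    show "closed h" "convex h" unfolding h by (auto intro: closed_halfspace_le convex_halfspace_le)
    then show "negligible (frontier h)" by (intro negligible_convex_frontier)
    have "- h = {x. a \<bullet> x > b}" unfolding h by auto
    then show "convex (- h)" by (simp add: convex_halfspace_gt)
  qed
  \<comment> \<open>The cell of the arrangement with a given sign pattern: strictly inside the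
    half-spaces of G and strictly outside the others.\<close>
  define C where "C G = (\<Inter>h\<in>G. interior h) \<inter> (\<Inter>h\<in>HS - G. - h)" for G
  have C: "open (C G)" "convex (C G)" if "G \<subseteq> HS" for G
  proof -
    have "finite G" using that fin finite_subset by blast
    then show "open (C G)" unfolding C_def using hs(1) fin by (intro open_Int open_INT) auto
    show "convex (C G)" unfolding C_def using hs(2,3) that
      by (intro convex_Int convex_INT) (auto intro: convex_interior)
  qed
  define A where "A = {G \<in> Pow HS. C G \<noteq> {} \<and> C G \<inter> closure \<Omega> = {}}"
  have "finite A" unfolding A_def using fin by auto
  have "\<forall>G\<in>A. \<exists>y \<rho>. 0 < \<rho> \<and> ball y \<rho> \<subseteq> C G"
  proof
    fix G assume "G \<in> A"
    then obtain y where "y \<in> C G" "open (C G)" using C by (auto simp: A_def)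
    then show "\<exists>y \<rho>. 0 < \<rho> \<and> ball y \<rho> \<subseteq> C G" using open_contains_ball by blast
  qed
  then obtain y \<rho> where y\<rho>: "\<And>G. G \<in> A \<Longrightarrow> 0 < \<rho> G" "\<And>G. G \<in> A \<Longrightarrow> ball (y G) (\<rho> G) \<subseteq> C G" by metis
  define \<kappa>0 where "\<kappa>0 = Min (insert 1 (\<rho> ` A))"
  have \<kappa>0: "\<kappa>0 > 0" "\<And>G. G \<in> A \<Longrightarrow> \<kappa>0 \<le> \<rho> G" unfolding \<kappa>0_def using \<open>finite A\<close> y\<rho>(1) by auto
  have "bounded (frontier \<Omega> \<union> y ` A)" using \<open>bounded \<Omega>\<close> \<open>finite A\<close> by (auto simp: frontier_def intro: bounded_diff finite_imp_bounded)
  then obtain R where R: "R > 0" "\<And>z. z \<in> frontier \<Omega> \<union> y ` A \<Longrightarrow> norm z \<le> R" by (auto simp: bounded_pos)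
  have near: "\<exists>G\<in>A. z \<in> closure (C G)" if z: "z \<in> frontier \<Omega>" for z
  proof (rule ccontr)
    assume "\<not> ?thesis"
    then have "z \<in> - (\<Union>G\<in>A. closure (C G))" by blast
    moreover have "open (- (\<Union>G\<in>A. closure (C G)))" using \<open>finite A\<close> by (intro open_Compl closed_UN) auto
    ultimately obtain e where e: "e > 0" "ball z e \<subseteq> - (\<Union>G\<in>A. closure (C G))" by (meson open_contains_ball)
    have "z \<notin> \<Omega>" using z \<open>open \<Omega>\<close> by (simp add: frontier_def interior_open)
    \<comment> \<open>The domain lies on one side of its boundary: otherwise z would be interior to
      the closure and hence in the domain.\<close>
    then have "\<not> ball z e \<subseteq> closure \<Omega>" using int_cl e(1) by (metis mem_interior)
    then have "ball z e - closure \<Omega> \<noteq> {}" by blast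
    moreover have "open (ball z e - closure \<Omega>)" by (intro open_Diff) auto
    \<comment> \<open>A non-empty open set is not covered by finitely many hyperplanes; this yields
      a point w that belongs to a cell.\<close>
    ultimately have "\<not> negligible (ball z e - closure \<Omega>)" by (rule open_not_negligible[rotated])
    moreover have "negligible (\<Union>h\<in>HS. frontier h)" using fin hs(4) by (intro negligible_Union) auto
    ultimately have "\<not> ball z e - closure \<Omega> \<subseteq> (\<Union>h\<in>HS. frontier h)" using negligible_subset by blast
    then obtain w where w: "w \<in> ball z e" "w \<notin> closure \<Omega>" "\<And>h. h \<in> HS \<Longrightarrow> w \<notin> frontier h" by blast
    define G where "G = {h \<in> HS. w \<in> h}"
    have "w \<in> interior h" if "h \<in> G" for h
      using that w(3)[of h] hs(1)[of h] by (auto simp: G_def frontier_def)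
    then have wC: "w \<in> C G" by (auto simp: C_def G_def)
    \<comment> \<open>A defining half-space of a polytope p that misses w is not in G; the whole
      cell avoids it and therefore avoids p.\<close>
    have "C G \<inter> closure \<Omega> = {}"
    proof (rule ccontr)
      assume "C G \<inter> closure \<Omega> \<noteq> {}"
      then obtain x p where x: "x \<in> C G" "p \<in> P" "x \<in> p" using P(3) by auto
      have "w \<notin> p" using w(2) P(3) x(2) by blast
      then obtain h where h: "h \<in> F p" "w \<notin> h" using F(2)[OF x(2)] by blast
      then have "h \<in> HS - G" using x(2) by (auto simp: HS_def G_def)
      then have "x \<notin> h" using x(1) by (auto simp: C_def)
      then show False using h(1) F(2)[OF x(2)] x(3) by blast
    qed
    then have "G \<in> A" using wC by (auto simp: A_def G_def)
    then show False using e(2) w(1) wC closure_subset by blast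
  qed
  show ?thesis
  \<comment> \<open>The homothety with centre z and ratio t = r / D \<le> 1 takes the ball of radius
    \<open>\<kappa>0\<close> around \<open>y G\<close> to the required one. Both z and
    \<open>y G\<close> have norm at most R, whence \<open>2 * R / D\<close>.\<close>
  proof (rule exI[of _ "\<kappa>0 / D"], rule conjI, goal_cases)
    case 1
    show ?case using \<kappa>0(1) \<open>D > 0\<close> by simp
  next
    case 2
    show ?case
  proof (rule exI[of _ "2 * R / D"], intro conjI ballI allI impI)
    show "0 \<le> 2 * R / D" using \<open>D > 0\<close> R(1) by simp
    fix z r assume z: "z \<in> frontier \<Omega>" and r: "0 < r \<and> r \<le> D"
    obtain G where G: "G \<in> A" "z \<in> closure (C G)" using near[OF z] by blast
    define t where "t = r / D"
    have t: "0 < t" "t \<le> 1" using r \<open>D > 0\<close> by (auto simp: t_def)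
    define z' where "z' = z + t *\<^sub>R (y G - z)"
    have "dist z z' = t * norm (y G - z)" using t by (simp add: z'_def dist_norm)
    also have "\<dots> \<le> t * (2 * R)"
    proof (rule mult_left_mono)
      show "norm (y G - z) \<le> 2 * R"
        using norm_triangle_ineq4[of "y G" z] R(2)[of z] R(2)[of "y G"] z G(1) by simp
    qed (use t in simp)
    finally have "dist z z' \<le> 2 * R / D * r" by (simp add: t_def mult.commute)
    moreover have "ball z' (\<kappa>0 / D * r) \<subseteq> C G"
    proof
      fix p assume "p \<in> ball z' (\<kappa>0 / D * r)"
      then have p: "norm (p - z') < t * \<kappa>0" by (simp add: dist_norm norm_minus_commute t_def mult.commute)
      define c where "c = y G + (1 / t) *\<^sub>R (p - z')"
      have "norm (p - z') / t < \<kappa>0" using p t by (simp add: divide_less_eq mult.commute)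
      then have "c \<in> ball (y G) (\<rho> G)" using \<kappa>0(2)[OF G(1)] t by (simp add: c_def dist_norm)
      then have "c \<in> interior (C G)" using y\<rho>(2)[OF G(1)] C(1) G(1) by (auto simp: A_def interior_open)
      then have "z - t *\<^sub>R (z - c) \<in> interior (C G)"
        using C(2) G t by (intro mem_interior_closure_convex_shrink) (auto simp: A_def)
      moreover have "z - t *\<^sub>R (z - c) = p" using t by (simp add: c_def z'_def algebra_simps)
      ultimately show "p \<in> C G" using interior_subset by blast
    qed
    moreover have "C G \<inter> \<Omega> = {}" using G(1) closure_subset by (auto simp: A_def)
    ultimately show "\<exists>z'. dist z z' \<le> 2 * R / D * r \<and> ball z' (\<kappa>0 / D * r) \<inter> \<Omega> = {}" by blast
  qed
  qed
qed

section \<open>Barycentric coordinates\<close>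

text \<open>The coordinates are kept as \<open>c v + g v \<bullet> x\<close> with explicit
  gradients, because the estimates compare the norm of \<open>g v\<close> with inscribed balls and
  with the diameter.\<close>

locale tetrahedron =
  fixes V :: "R3 set" and c :: "R3 \<Rightarrow> real" and g :: "R3 \<Rightarrow> R3"
  assumes card_V: "card V = 4" and indep: "\<not> affine_dependent V"
    and kronecker: "\<And>v w. v \<in> V \<Longrightarrow> w \<in> V \<Longrightarrow> c v + g v \<bullet> w = (if v = w then 1 else 0)"
begin

definition lam :: "R3 \<Rightarrow> R3 \<Rightarrow> real" where "lam v x = c v + g v \<bullet> x"

lemma finite_V: "finite V" by (rule aff_independent_finite[OF indep])

lemma lam_vertex: "v \<in> V \<Longrightarrow> w \<in> V \<Longrightarrow> lam v w = (if v = w then 1 else 0)"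
  by (simp add: lam_def kronecker)

lemma lam_affine_combination:
  assumes "finite S" "sum u S = 1" shows "lam v (\<Sum>w\<in>S. u w *\<^sub>R w) = (\<Sum>w\<in>S. u w * lam v w)"
proof -
  have "lam v (\<Sum>w\<in>S. u w *\<^sub>R w) = sum u S * c v + (\<Sum>w\<in>S. u w * (g v \<bullet> w))"
    by (simp add: lam_def inner_sum_right assms(2))
  also have "\<dots> = (\<Sum>w\<in>S. u w * lam v w)"
    by (simp add: lam_def distrib_left sum.distrib sum_distrib_right[symmetric])
  finally show ?thesis .
qed

lemma lam_convex: "lam v ((1 - t) *\<^sub>R x + t *\<^sub>R y) = (1 - t) * lam v x + t * lam v y"
  by (simp add: lam_def algebra_simps)

lemma coordinates_eq_lam:
  assumes "sum u V = 1" "v \<in> V" shows "lam v (\<Sum>w\<in>V. u w *\<^sub>R w) = u v"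
proof -
  have "lam v (\<Sum>w\<in>V. u w *\<^sub>R w) = (\<Sum>w\<in>V. if w = v then u w else 0)"
    unfolding lam_affine_combination[OF finite_V assms(1)]
    by (rule sum.cong) (auto simp: lam_vertex[OF assms(2)])
  then show ?thesis using finite_V assms(2) by simp
qed

lemma sum_lam: "(\<Sum>v\<in>V. lam v x) = 1" "(\<Sum>v\<in>V. lam v x *\<^sub>R v) = x"
proof -
  have "affine hull V = UNIV" using indep card_V by (intro affine_independent_span_eq) simp_all
  then obtain u where u: "sum u V = 1" "(\<Sum>v\<in>V. u v *\<^sub>R v) = x"
    using affine_hull_finite[OF finite_V] by blast
  have "lam v x = u v" if "v \<in> V" for v using coordinates_eq_lam[OF u(1) that] u(2) by simp
  then show "(\<Sum>v\<in>V. lam v x) = 1" "(\<Sum>v\<in>V. lam v x *\<^sub>R v) = x" using u by (simp_all cong: sum.cong)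
qed

lemma mem_hull_iff: "x \<in> convex hull V \<longleftrightarrow> (\<forall>v\<in>V. 0 \<le> lam v x)"
proof
  assume "x \<in> convex hull V"
  then obtain u where u: "\<forall>v\<in>V. 0 \<le> u v" "sum u V = 1" "(\<Sum>v\<in>V. u v *\<^sub>R v) = x"
    using convex_hull_finite[OF finite_V] by blast
  then show "\<forall>v\<in>V. 0 \<le> lam v x" using coordinates_eq_lam[OF u(2)] by auto
next
  assume "\<forall>v\<in>V. 0 \<le> lam v x"
  then show "x \<in> convex hull V" unfolding convex_hull_finite[OF finite_V]
    using sum_lam[of x] by (intro CollectI exI[of _ "\<lambda>v. lam v x"]) auto
qed

lemma lam_le_1: "x \<in> convex hull V \<Longrightarrow> v \<in> V \<Longrightarrow> lam v x \<le> 1"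
  using sum_lam(1)[of x] member_le_sum[of v V "\<lambda>v. lam v x"] finite_V mem_hull_iff by auto

lemma continuous_lam: "continuous_on S (lam v)"
  unfolding lam_def[abs_def] by (intro continuous_intros)

lemma interior_hull: "(\<And>v. v \<in> V \<Longrightarrow> 0 < lam v x) \<Longrightarrow> x \<in> interior (convex hull V)"
proof (rule interiorI[of "\<Inter>v\<in>V. {x. 0 < lam v x}"])
  show "open (\<Inter>v\<in>V. {x. 0 < lam v x})"
    using finite_V by (intro open_INT ballI open_Collect_less continuous_lam) auto
qed (auto simp: mem_hull_iff less_imp_le)

text \<open>The zero set of an affine function is convex, so with the points of C it contains their
  hull.\<close>

lemma lam_zero_on_face:
  assumes "C \<subseteq> V" "v \<in> V - C" "x \<in> convex hull C" shows "lam v x = 0"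
proof -
  have "C \<subseteq> {x. lam v x = 0}" using assms lam_vertex by auto
  moreover have "convex {x. lam v x = 0}"
    unfolding convex_alt using lam_convex by auto
  ultimately have "convex hull C \<subseteq> {x. lam v x = 0}" by (rule hull_minimal)
  then show ?thesis using assms(3) by blast
qed

section \<open>The bubble, and bounds for barycentric gradients\<close>

definition tet_bubble :: "R3 \<Rightarrow> real" where "tet_bubble x = (\<Prod>v\<in>V. lam v x)"

lemma tet_bubble_bounds: "x \<in> convex hull V \<Longrightarrow> 0 \<le> tet_bubble x \<and> tet_bubble x \<le> 1"
  unfolding tet_bubble_def using mem_hull_iff lam_le_1 by (auto intro!: prod_nonneg prod_le_1)

lemma tet_bubble_interior:
  assumes "x \<in> convex hull V" "tet_bubble x \<noteq> 0" shows "x \<in> interior (convex hull V)"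
proof (rule interior_hull)
  fix v assume "v \<in> V"
  then have "lam v x \<noteq> 0" using assms(2) finite_V by (auto simp: tet_bubble_def)
  then show "0 < lam v x" using assms(1) \<open>v \<in> V\<close> mem_hull_iff by (auto simp: order_less_le)
qed

lemma C1_lam: "C1 (lam v)" unfolding lam_def[abs_def] by (rule C1_affine)

lemma C1_tet_bubble: "C1 tet_bubble"
proof -
  have "C1 (\<lambda>x. \<Prod>v\<in>S. lam v x)" if "finite S" for S
    using that by (induction S) (auto intro: C1_const C1_mult C1_lam)
  then show ?thesis unfolding tet_bubble_def[abs_def] using finite_V by blast
qed

lemma compact_hull: "compact (convex hull V)"
  using finite_V by (simp add: finite_imp_compact_convex_hull)

lemma grad_nonzero: assumes "v \<in> V" shows "g v \<noteq> 0"
proof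
  assume "g v = 0"
  have "V \<noteq> {v}" using card_V by auto
  then obtain w where "w \<in> V" "w \<noteq> v" using assms by blast
  then show False using lam_vertex[OF assms assms] lam_vertex[OF assms, of w] \<open>g v = 0\<close> by (simp add: lam_def)
qed

text \<open>Product rule over four factors: each term has one gradient component, and the remaining
  factors lie in the unit interval.\<close>

lemma pd_tet_bubble_bound:
  assumes x: "x \<in> convex hull V" and G: "\<And>v. v \<in> V \<Longrightarrow> norm (g v) \<le> G"
  shows "\<bar>pd i tet_bubble x\<bar> \<le> 4 * G"
proof -
  have G0: "0 \<le> G"
  proof -
    obtain v where "v \<in> V" using card_V by fastforce
    then show ?thesis using G[of v] norm_ge_zero[of "g v"] by linarith
  qed
  have main: "\<bar>pd i (\<lambda>x. \<Prod>v\<in>S. lam v x) x\<bar> \<le> real (card S) * G \<and> C1 (\<lambda>x. \<Prod>v\<in>S. lam v x)" if "S \<subseteq> V" for S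
    using finite_subset[OF that finite_V] that
  proof (induction S rule: finite_induct)
    case empty then show ?case by (simp add: C1_const)
  next
    case (insert v S)
    have pdl: "pd i (lam v) x = g v $ i" unfolding lam_def[abs_def] by (rule pd_affine)
    have l: "0 \<le> lam v x" "lam v x \<le> 1" using insert x mem_hull_iff lam_le_1 by auto
    have p: "0 \<le> (\<Prod>v\<in>S. lam v x)" "(\<Prod>v\<in>S. lam v x) \<le> 1"
      using insert x mem_hull_iff lam_le_1 by (auto intro!: prod_nonneg prod_le_1)
    have e: "(\<lambda>x. \<Prod>v\<in>insert v S. lam v x) = (\<lambda>x. lam v x * (\<Prod>v\<in>S. lam v x))" using insert by simp
    have eq: "pd i (\<lambda>x. lam v x * (\<Prod>v\<in>S. lam v x)) x
        = lam v x * pd i (\<lambda>x. \<Prod>v\<in>S. lam v x) x + g v $ i * (\<Prod>v\<in>S. lam v x)"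
      using insert by (subst pd_mult) (auto intro: C1_differentiable C1_lam simp: pdl)
    have "\<bar>pd i (\<lambda>x. lam v x * (\<Prod>v\<in>S. lam v x)) x\<bar>
        \<le> \<bar>lam v x\<bar> * \<bar>pd i (\<lambda>x. \<Prod>v\<in>S. lam v x) x\<bar> + \<bar>g v $ i\<bar> * \<bar>\<Prod>v\<in>S. lam v x\<bar>"
      unfolding eq by (rule order_trans[OF abs_triangle_ineq]) (simp only: abs_mult order_refl)
    also have "\<dots> \<le> 1 * (real (card S) * G) + G * 1"
      using insert l p component_le_norm_cart[of "g v" i] G[of v] G0
      by (intro add_mono mult_mono) (auto intro: order_trans)
    also have "\<dots> = real (card (insert v S)) * G" using insert by (simp add: algebra_simps)
    finally show ?case unfolding e using insert by (auto intro!: C1_mult C1_lam)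
  qed
  show ?thesis using main[of V] card_V by (simp add: tet_bubble_def[abs_def])
qed

text \<open>Along the diameter of the ball in direction \<open>g v\<close> the coordinate changes by
  \<open>2 * (\<rho> * norm (g v))\<close>, yet it stays between 0 and 1. That it is still
  non-negative at the lower end bounds it from below at the centre.\<close>

lemma grad_upper:
  assumes "cball x0 \<rho> \<subseteq> convex hull V" "\<rho> > 0" "v \<in> V"
  shows "norm (g v) \<le> 1 / (2 * \<rho>)" "\<rho> * norm (g v) \<le> lam v x0"
proof -
  define d where "d = (\<rho> / norm (g v)) *\<^sub>R g v"
  have n: "norm (g v) > 0" using grad_nonzero[OF assms(3)] by simp
  have "norm d = \<rho>" using n assms(2) by (simp add: d_def)
  then have "x0 + d \<in> convex hull V" "x0 - d \<in> convex hull V"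
    using assms(1) by (auto simp: subset_iff dist_norm)
  then have b: "lam v (x0 + d) \<le> 1" "0 \<le> lam v (x0 - d)" using lam_le_1 assms(3) mem_hull_iff by auto
  have gd: "g v \<bullet> d = \<rho> * norm (g v)"
    using n by (simp add: d_def power2_norm_eq_inner[symmetric] power2_eq_square)
  have "lam v (x0 + d) - lam v (x0 - d) = 2 * (\<rho> * norm (g v))" by (simp add: lam_def algebra_simps gd)
  then show "norm (g v) \<le> 1 / (2 * \<rho>)" using b assms(2) by (simp add: field_simps)
  have "lam v (x0 - d) = lam v x0 - \<rho> * norm (g v)" by (simp add: lam_def algebra_simps gd)
  then show "\<rho> * norm (g v) \<le> lam v x0" using b by simp
qed

text \<open>From v to another vertex, over a distance of at most h, the coordinate drops from 1 to
  0.\<close>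

lemma grad_lower:
  assumes "diameter (convex hull V) \<le> h" "h > 0" "v \<in> V" shows "1 / h \<le> norm (g v)"
proof -
  have "V \<noteq> {v}" using card_V by auto
  then obtain w where w: "w \<in> V" "w \<noteq> v" using assms(3) by blast
  have "1 = lam v v - lam v w" using w assms(3) by (simp add: lam_vertex)
  also have "\<dots> = g v \<bullet> (v - w)" by (simp add: lam_def algebra_simps)
  also have "\<dots> \<le> norm (g v) * norm (v - w)" by (rule norm_cauchy_schwarz)
  also have "norm (v - w) \<le> h"
    using diameter_bounded_bound[OF compact_imp_bounded[OF compact_hull], of v w] assms(1,3) w(1)
    by (simp add: dist_norm hull_inc)
  finally have "1 \<le> norm (g v) * h" by (simp add: mult_left_mono)
  then show ?thesis using assms(2) by (simp add: divide_le_eq)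
qed

text \<open>At the centre a coordinate is at least \<open>\<rho> * norm (g v)\<close>; within \<rho>
  / 2 of it at most half of this is lost, and the gradient is at least 1 / h. The exponent counts
  the factors.\<close>

lemma tet_bubble_lower:
  assumes B: "cball x0 \<rho> \<subseteq> convex hull V" "\<rho> > 0" and h: "diameter (convex hull V) \<le> h" "h > 0"
    and x: "x \<in> ball x0 (\<rho> / 2)"
  shows "(\<rho> / (2 * h)) ^ 4 \<le> tet_bubble x"
proof -
  have "\<rho> / (2 * h) \<le> lam v x" if v: "v \<in> V" for v
  proof -
    have "lam v x0 - lam v x = g v \<bullet> (x0 - x)" by (simp add: lam_def algebra_simps)
    also have "\<dots> \<le> norm (g v) * norm (x0 - x)" by (rule norm_cauchy_schwarz)
    also have "\<dots> \<le> norm (g v) * (\<rho> / 2)" using x by (intro mult_left_mono) (auto simp: dist_norm)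
    finally have "\<rho> / 2 * norm (g v) \<le> lam v x" using grad_upper(2)[OF B v] by (simp add: algebra_simps)
    moreover have "\<rho> / 2 * (1 / h) \<le> \<rho> / 2 * norm (g v)" using grad_lower[OF h v] B(2) by (intro mult_left_mono) auto
    ultimately show ?thesis by simp
  qed
  then have "(\<Prod>v\<in>V. \<rho> / (2 * h)) \<le> tet_bubble x"
    unfolding tet_bubble_def using B(2) h(2) by (intro prod_mono) auto
  then show ?thesis by (simp add: card_V)
qed

end

text \<open>The edges issuing from a vertex v0 other than v are linearly independent, so some linear
  functional is 1 on the edge to v and 0 on the others; \<open>adjoint f 1\<close> is its
  representing vector.\<close>

lemma simplex_tetrahedron:
  assumes "3 simplex (K :: R3 set)"
  shows "\<exists>V c g. tetrahedron V c g \<and> K = convex hull V"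
proof -
  obtain V where V: "\<not> affine_dependent V" "card V = 4" "K = convex hull V"
    using assms by (auto simp: simplex_def)
  have "\<exists>c g. \<forall>w\<in>V. c + g \<bullet> w = (if v = w then 1 else 0)" if v: "v \<in> V" for v
  proof -
    have "V \<noteq> {v}" using V(2) by auto
    then obtain v0 where v0: "v0 \<in> V" "v0 \<noteq> v" using v by blast
    have "independent ((\<lambda>x. - v0 + x) ` (V - {v0}))"
      using affine_dependent_iff_dependent2[OF v0(1)] V(1) by simp
    from linear_independent_extend[OF this, of "\<lambda>b. if b = v - v0 then 1 else 0 :: real"]
    obtain f :: "R3 \<Rightarrow> real" where f: "linear f" "\<forall>x\<in>(\<lambda>x. - v0 + x) ` (V - {v0}). f x = (if x = v - v0 then 1 else 0)"
      by auto
    have fg: "f x = adjoint f 1 \<bullet> x" for x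
      using adjoint_works[OF f(1), of x 1] by (simp add: inner_commute)
    have "- f v0 + adjoint f 1 \<bullet> w = (if v = w then 1 else 0)" if "w \<in> V" for w
    proof -
      have "- f v0 + adjoint f 1 \<bullet> w = f (- v0 + w)"
        using linear_diff[OF f(1), of w v0] by (simp add: fg[symmetric])
      also have "\<dots> = (if v = w then 1 else 0)"
      proof (cases "w = v0")
        case True
        then show ?thesis using v0 linear_0[OF f(1)] by simp
      next
        case False
        then have "f (- v0 + w) = (if - v0 + w = v - v0 then 1 else 0)" using that f(2) by blast
        then show ?thesis by auto
      qed
      finally show ?thesis .
    qed
    then show ?thesis by blast
  qed
  then obtain c g where "\<And>v w. v \<in> V \<Longrightarrow> w \<in> V \<Longrightarrow> c v + g v \<bullet> w = (if v = w then 1 else 0)" by metis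
  then have "tetrahedron V c g" using V by unfold_locales auto
  then show ?thesis using V(3) by blast
qed

section \<open>Gluing on a triangulation\<close>

text \<open>u is known to be Lipschitz on each piece only. Along a segment the preimages of the
  pieces are finitely many closed sets that cover the parameter interval, and this makes a common
  constant global. Off the frontiers of the cells u is locally one of the \<open>F K\<close>, or
  zero.\<close>

lemma glue_piecewise_C1:
  assumes T: "finite T" "\<And>K. K \<in> T \<Longrightarrow> compact K" "\<And>K. K \<in> T \<Longrightarrow> convex K"
    and F: "\<And>K. K \<in> T \<Longrightarrow> C1 (F K)" "\<And>K x. K \<in> T \<Longrightarrow> x \<in> K \<Longrightarrow> u x = F K x"
    and Z: "closed Z" "\<And>x. x \<in> Z \<Longrightarrow> u x = 0" "Z \<union> \<Union>T = UNIV"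
  shows "piecewise_C1 u"
proof -
  have "\<exists>L. L-lipschitz_on K (F K)" if "K \<in> T" for K
    using C1_lipschitz_on_compact[OF F(1) T(2) T(3)] that by blast
  then obtain L where L: "\<And>K. K \<in> T \<Longrightarrow> (L K)-lipschitz_on K (F K)" by metis
  \<comment> \<open>The sum dominates every \<open>L K\<close> and also makes sense for an empty
    T.\<close>
  define B where "B = (\<Sum>K\<in>T. L K)"
  have L0: "0 \<le> L K" if "K \<in> T" for K using lipschitz_on_nonneg[OF L[OF that]] .
  have B0: "0 \<le> B" unfolding B_def using L0 by (intro sum_nonneg)
  have LB: "B-lipschitz_on A u" if A: "A \<in> insert Z T" for A
  proof (cases "A \<in> T")
    case True
    have "L A \<le> B" unfolding B_def using True L0 T(1) by (intro member_le_sum) auto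
    then have "B-lipschitz_on A (F A)" using L[OF True] lipschitz_on_le by blast
    then show ?thesis using F(2)[OF True] by (rule lipschitz_on_transform)
  next
    case False
    then show ?thesis using A B0 Z(2) by (intro lipschitz_onI) auto
  qed
  have cl: "closed A" if "A \<in> insert Z T" for A using that T(2) Z(1) by (auto intro: compact_imp_closed)
  have "B-lipschitz_on UNIV u"
  proof (rule lipschitz_onI)
    fix x y :: R3
    define p where "p t = x + t *\<^sub>R (y - x)" for t :: real
    have pl: "(norm (y - x))-lipschitz_on S p" for S
    proof (rule lipschitz_onI)
      fix s t :: real
      have "p s - p t = (s - t) *\<^sub>R (y - x)" by (simp add: p_def algebra_simps)
      then show "dist (p s) (p t) \<le> norm (y - x) * dist s t" by (simp add: dist_norm)
    qed simp
    have "(B * norm (y - x))-lipschitz_on {0..1} (\<lambda>t. u (p t))"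
    proof (rule lipschitz_on_closed_Union[where I="insert Z T" and U="\<lambda>A. p -` A"])
      show "(B * norm (y - x))-lipschitz_on (p -` A) (\<lambda>t. u (p t))" if "A \<in> insert Z T" for A
        by (rule lipschitz_on_compose2[OF pl]) (rule lipschitz_on_subset[OF LB[OF that]], auto)
      show "closed (p -` A)" if "A \<in> insert Z T" for A
        using cl[OF that] unfolding p_def by (intro closed_vimage continuous_intros)
      show "{0..1} \<subseteq> (\<Union>A\<in>insert Z T. p -` A)" using Z(3) by auto
    qed (use T(1) B0 in auto)
    from lipschitz_onD[OF this, of 0 1] show "dist (u x) (u y) \<le> B * dist x y"
      by (simp add: p_def dist_norm norm_minus_commute)
  qed (rule B0)
  moreover have "\<exists>G. C1 G \<and> (\<forall>\<^sub>F y in nhds x. u y = G y)" if x: "x \<notin> (\<Union>K\<in>T. frontier K)" for x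
  proof (cases "x \<in> \<Union>T")
    case True
    then obtain K where K: "K \<in> T" "x \<in> K" by blast
    then have "x \<in> interior K" using x cl[of K] by (auto simp: frontier_def)
    then have "\<forall>\<^sub>F y in nhds x. y \<in> interior K" by (intro eventually_nhds_in_open) auto
    then have "\<forall>\<^sub>F y in nhds x. u y = F K y"
      by eventually_elim (use F(2)[OF K(1)] interior_subset in blast)
    then show ?thesis using F(1)[OF K(1)] by blast
  next
    case False
    have "open (- \<Union>T)" using T(1) cl by (intro open_Compl closed_Union) auto
    then have "\<forall>\<^sub>F y in nhds x. y \<in> - \<Union>T" using False by (intro eventually_nhds_in_open) auto
    then have "\<forall>\<^sub>F y in nhds x. u y = 0" by eventually_elim (use Z in blast)
    then show ?thesis using C1_const[of 0] by blast
  qed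
  moreover have "closed (\<Union>K\<in>T. frontier K)" using T(1) by (intro closed_UN) auto
  moreover have "negligible (\<Union>K\<in>T. frontier K)"
    using T(1,3) by (intro negligible_Union) (auto intro: negligible_convex_frontier)
  ultimately show ?thesis unfolding piecewise_C1_def by blast
qed

section \<open>Polynomials\<close>

lemma finite_exponents: "finite {(i, j, l). i + j + l \<le> (k::nat)}"
  by (rule finite_subset[of _ "{..k} \<times> {..k} \<times> {..k}"]) auto

lemma P_deg_monomial:
  assumes "i + j + l \<le> k" shows "(\<lambda>x. a * (x $ 1) ^ i * (x $ 2) ^ j * (x $ 3) ^ l) \<in> P_deg k"
proof -
  define c where "c i' j' l' = (if (i', j', l') = (i, j, l) then a else 0)" for i' j' l'
  have "(\<Sum>(i', j', l')\<in>{(i, j, l). i + j + l \<le> k}. c i' j' l' * (x $ 1) ^ i' * (x $ 2) ^ j' * (x $ 3) ^ l')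
     = (\<Sum>p\<in>{(i, j, l). i + j + l \<le> k}. if p = (i, j, l) then a * (x $ 1) ^ i * (x $ 2) ^ j * (x $ 3) ^ l else 0)" for x :: R3
    by (rule sum.cong) (auto simp: c_def split: if_splits)
  also have "\<dots> x = a * (x $ 1) ^ i * (x $ 2) ^ j * (x $ 3) ^ l" for x :: R3
    using assms by (simp add: finite_exponents)
  finally show ?thesis unfolding P_deg_def by (intro CollectI exI[of _ c]) (simp add: fun_eq_iff)
qed

lemma P_deg_add: assumes "p \<in> P_deg k" "q \<in> P_deg k" shows "(\<lambda>x. p x + q x) \<in> P_deg k"
proof -
  obtain c d where c: "p = (\<lambda>x. \<Sum>(i, j, l)\<in>{(i, j, l). i + j + l \<le> k}. c i j l * (x $ 1) ^ i * (x $ 2) ^ j * (x $ 3) ^ l)"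
    and d: "q = (\<lambda>x. \<Sum>(i, j, l)\<in>{(i, j, l). i + j + l \<le> k}. d i j l * (x $ 1) ^ i * (x $ 2) ^ j * (x $ 3) ^ l)"
    using assms by (auto simp: P_deg_def)
  show ?thesis unfolding P_deg_def c d
    by (intro CollectI exI[of _ "\<lambda>i j l. c i j l + d i j l"])
       (simp add: sum.distrib[symmetric] fun_eq_iff split_beta algebra_simps)
qed

lemma P_deg_0: "(\<lambda>x. 0) \<in> P_deg k"
  using P_deg_monomial[of 0 0 0 k 0] by simp

lemma P_deg_sum: assumes "\<And>i. i \<in> I \<Longrightarrow> p i \<in> P_deg k" shows "(\<lambda>x. \<Sum>i\<in>I. p i x) \<in> P_deg k"
  using assms by (induction I rule: infinite_finite_induct) (auto intro: P_deg_0 P_deg_add)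

lemma P_deg_mult: assumes "p \<in> P_deg m" "q \<in> P_deg n" shows "(\<lambda>x. p x * q x) \<in> P_deg (m + n)"
proof -
  obtain c d where c: "p = (\<lambda>x. \<Sum>(i, j, l)\<in>{(i, j, l). i + j + l \<le> m}. c i j l * (x $ 1) ^ i * (x $ 2) ^ j * (x $ 3) ^ l)"
    and d: "q = (\<lambda>x. \<Sum>(i, j, l)\<in>{(i, j, l). i + j + l \<le> n}. d i j l * (x $ 1) ^ i * (x $ 2) ^ j * (x $ 3) ^ l)"
    using assms by (auto simp: P_deg_def)
  have eq: "p x * q x = (\<Sum>s\<in>{(i, j, l). i + j + l \<le> m}. \<Sum>t\<in>{(i, j, l). i + j + l \<le> n}.
       case s of (i, j, l) \<Rightarrow> case t of (i', j', l') \<Rightarrow>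
       c i j l * d i' j' l' * (x $ 1) ^ (i + i') * (x $ 2) ^ (j + j') * (x $ 3) ^ (l + l'))" for x
    unfolding c d sum_product by (intro sum.cong refl) (auto simp: power_add)
  show ?thesis unfolding eq
    by (intro P_deg_sum) (auto simp: split_beta intro!: P_deg_monomial)
qed

lemma P_deg_affine: "(\<lambda>x. c + g \<bullet> x) \<in> P_deg 1"
proof -
  have "(\<lambda>x. c * (x $ 1) ^ 0 * (x $ 2) ^ 0 * (x $ 3) ^ 0 + (g $ 1 * (x $ 1) ^ 1 * (x $ 2) ^ 0 * (x $ 3) ^ 0
     + (g $ 2 * (x $ 1) ^ 0 * (x $ 2) ^ 1 * (x $ 3) ^ 0 + g $ 3 * (x $ 1) ^ 0 * (x $ 2) ^ 0 * (x $ 3) ^ 1))) \<in> P_deg 1"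
    by (intro P_deg_add P_deg_monomial) auto
  then show ?thesis by (simp add: inner_vec_def sum_3 add.assoc)
qed

lemma P_deg_1_imp_affine: assumes "p \<in> P_deg 1" shows "\<exists>c g. p = (\<lambda>x. c + g \<bullet> x)"
proof -
  have e: "{(i, j, l). i + j + l \<le> (1::nat)} = {(0,0,0), (1,0,0), (0,1,0), (0,0,1)}" by auto
  obtain c where "p = (\<lambda>x. \<Sum>(i, j, l)\<in>{(i, j, l). i + j + l \<le> 1}. c i j l * (x $ 1) ^ i * (x $ 2) ^ j * (x $ 3) ^ l)"
    using assms by (auto simp: P_deg_def)
  then have "p = (\<lambda>x. c 0 0 0 + vector [c 1 0 0, c 0 1 0, c 0 0 1] \<bullet> x)"
    unfolding e by (simp add: inner_vec_def sum_3 fun_eq_iff)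
  then show ?thesis by blast
qed

lemma P_deg_const: "(\<lambda>x. c) \<in> P_deg k"
  using P_deg_monomial[of 0 0 0 k c] by simp

section \<open>Finite element functions on a mesh\<close>

locale tet_mesh =
  fixes \<Omega> :: "R3 set" and T :: "R3 set set"
    and V :: "R3 set \<Rightarrow> R3 set" and c :: "R3 set \<Rightarrow> R3 \<Rightarrow> real" and g :: "R3 set \<Rightarrow> R3 \<Rightarrow> R3"
  assumes open_dom: "open \<Omega>" and bounded_dom: "bounded \<Omega>" and int_cl: "interior (closure \<Omega>) = \<Omega>"
    and tri: "triangulation T" and cover: "\<Union>T = closure \<Omega>"
    and tet: "\<And>K. K \<in> T \<Longrightarrow> tetrahedron (V K) (c K) (g K)"
    and hull: "\<And>K. K \<in> T \<Longrightarrow> K = convex hull (V K)"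
begin

abbreviation lam where "lam K \<equiv> tetrahedron.lam (c K) (g K)"
abbreviation bub where "bub K \<equiv> tetrahedron.tet_bubble (V K) (c K) (g K)"

lemma finite_T: "finite T" using tri by (simp add: triangulation_def)

lemma cell: assumes "K \<in> T" shows "compact K" "convex K" "closed K" "interior K \<subseteq> \<Omega>"
proof -
  interpret t: tetrahedron "V K" "c K" "g K" by (rule tet[OF assms])
  show "compact K" using t.compact_hull hull[OF assms] by simp
  then show "closed K" by (rule compact_imp_closed)
  show "convex K" using hull[OF assms] convex_convex_hull by metis
  have "K \<subseteq> closure \<Omega>" using assms cover by blast
  then show "interior K \<subseteq> \<Omega>" using interior_mono int_cl by blast
qed

text \<open>The intersection is a face of both cells, hence the hull of some vertices of each. Both
  vertex sets consist of the extreme points of the intersection, so they coincide.\<close>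

lemma common_face:
  assumes "K \<in> T" "K' \<in> T"
  shows "\<exists>C. C \<subseteq> V K \<and> C \<subseteq> V K' \<and> K \<inter> K' = convex hull C"
proof -
  interpret t: tetrahedron "V K" "c K" "g K" by (rule tet[OF assms(1)])
  interpret t': tetrahedron "V K'" "c K'" "g K'" by (rule tet[OF assms(2)])
  have f: "(K \<inter> K') face_of K" "(K \<inter> K') face_of K'"
    using tri assms unfolding triangulation_def by (blast, metis Int_commute)
  obtain C where C: "C \<subseteq> V K" "K \<inter> K' = convex hull C"
    using f(1) face_of_convex_hull_affine_independent[OF t.indep] hull[OF assms(1)] by auto
  obtain C' where C': "C' \<subseteq> V K'" "K \<inter> K' = convex hull C'"
    using f(2) face_of_convex_hull_affine_independent[OF t'.indep] hull[OF assms(2)] by auto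
  have "\<not> affine_dependent C" "\<not> affine_dependent C'"
    using C(1) C'(1) t.indep t'.indep affine_independent_subset by blast+
  then have "C = C'" using C(2) C'(2) extreme_point_of_convex_hull_affine_independent by (metis subsetI subset_antisym)
  then show ?thesis using C C' by blast
qed

text \<open>If the common face had all four vertices of K, these would be the four vertices of the
  other cell too.\<close>

lemma common_face_proper:
  assumes "K \<in> T" "K' \<in> T" "K \<noteq> K'"
  shows "\<exists>v\<in>V K. \<forall>x\<in>K \<inter> K'. lam K v x = 0"
proof -
  interpret t: tetrahedron "V K" "c K" "g K" by (rule tet[OF assms(1)])
  interpret t': tetrahedron "V K'" "c K'" "g K'" by (rule tet[OF assms(2)])
  obtain C where C: "C \<subseteq> V K" "C \<subseteq> V K'" "K \<inter> K' = convex hull C"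
    using common_face[OF assms(1,2)] by blast
  have "C \<noteq> V K"
  proof
    assume "C = V K"
    then have "V K = V K'" using C(2) card_subset_eq[OF t'.finite_V, of "V K"] t.card_V t'.card_V by simp
    then show False using hull assms by metis
  qed
  then obtain v where v: "v \<in> V K - C" using C(1) by blast
  then show ?thesis using t.lam_zero_on_face[OF C(1) v] C(3) by blast
qed

text \<open>Some barycentric coordinate vanishes on the intersection, which therefore lies in a
  hyperplane.\<close>

lemma negligible_overlap:
  assumes "K \<in> T" "K' \<in> T" "K \<noteq> K'" shows "negligible (K \<inter> K')"
proof -
  interpret t: tetrahedron "V K" "c K" "g K" by (rule tet[OF assms(1)])
  obtain v where v: "v \<in> V K" "\<And>x. x \<in> K \<inter> K' \<Longrightarrow> lam K v x = 0" using common_face_proper[OF assms] by blast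
  have "K \<inter> K' \<subseteq> {x. g K v \<bullet> x = - c K v}" using v(2) by (force simp: t.lam_def)
  then show ?thesis using negligible_hyperplane[of "g K v"] t.grad_nonzero[OF v(1)] negligible_subset by blast
qed

lemma bub_overlap:
  assumes "K \<in> T" "K' \<in> T" "K \<noteq> K'" "x \<in> K \<inter> K'" shows "bub K x = 0"
proof -
  interpret t: tetrahedron "V K" "c K" "g K" by (rule tet[OF assms(1)])
  show ?thesis using common_face_proper[OF assms(1-3)] assms(4) t.finite_V by (auto simp: t.tet_bubble_def)
qed

text \<open>If \<open>x1\<close> is a point of the domain in the relative interior of a face, then the cells around \<open>x1\<close>
  all contain that face, and a dilation with centre on the face moves a neighbourhood of \<open>x1\<close> to one
  of any other point \<open>x\<close> in the relative interior of the face.\<close>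

lemma vertex_outside:
  assumes K: "K \<in> T" and x: "x \<in> K" "x \<notin> \<Omega>" and v: "v \<in> V K" "lam K v x \<noteq> 0"
  shows "v \<notin> \<Omega>"
proof
  assume "v \<in> \<Omega>"
  interpret t: tetrahedron "V K" "c K" "g K" by (rule tet[OF K])
  have xnn: "\<And>w. w \<in> V K \<Longrightarrow> 0 \<le> lam K w x" using t.mem_hull_iff x(1) hull[OF K] by auto
  have xle: "\<And>w. w \<in> V K \<Longrightarrow> lam K w x \<le> 1" using t.lam_le_1 x(1) hull[OF K] by auto
  define S where "S = {w \<in> V K. lam K w x > 0}"
  have S: "finite S" "S \<subseteq> V K" "v \<in> S" using t.finite_V v xnn[OF v(1)] by (auto simp: S_def)
  obtain \<eta> where \<eta>: "\<eta> > 0" "ball v \<eta> \<subseteq> \<Omega>" using \<open>v \<in> \<Omega>\<close> open_dom open_contains_ball by blast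
  \<comment> \<open>Keeps x1, a point between v and x, within \<eta> / 2 of v; being at most 1/2 it
    leaves v a positive coordinate. The + 1 avoids a zero denominator.\<close>
  define s where "s = min (1/2) (\<eta> / (2 * (norm (x - v) + 1)))"
  have "0 < \<eta> / (2 * (norm (x - v) + 1))" using \<eta>(1) by (intro divide_pos_pos mult_pos_pos add_nonneg_pos) auto
  then have s: "0 < s" "s \<le> 1/2" unfolding s_def by (simp, intro min.cobounded1)
  define x1 where "x1 = (1 - s) *\<^sub>R v + s *\<^sub>R x"
  have "norm (x1 - v) = s * norm (x - v)"
  proof -
    have "x1 - v = s *\<^sub>R (x - v)" by (simp add: x1_def algebra_simps)
    then show ?thesis using s by simp
  qed
  also have "\<dots> \<le> \<eta> / (2 * (norm (x - v) + 1)) * (norm (x - v) + 1)"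
    using \<eta>(1) by (intro mult_mono) (auto simp: s_def)
  also have "\<dots> = \<eta> / 2"
  proof -
    have "norm (x - v) + 1 \<noteq> 0" using norm_ge_zero[of "x - v"] by linarith
    then show ?thesis by (simp only: divide_divide_eq_left[symmetric] nonzero_eq_divide_eq times_divide_eq_left) simp
  qed
  also have "\<dots> < \<eta>" using \<eta>(1) by simp
  finally have x1\<Omega>: "x1 \<in> \<Omega>" using \<eta>(2) by (auto simp: dist_norm norm_minus_commute subset_iff)
  have l1: "lam K w x1 = (1 - s) * lam K w v + s * lam K w x" for w
    unfolding x1_def by (rule t.lam_convex)
  have l1pos: "lam K w x1 > 0" if "w \<in> S" for w
    unfolding l1 using that s S(2) v(1) t.lam_vertex[of w v] by (auto simp: S_def intro!: add_nonneg_pos)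
  have l1zero: "lam K w x1 = 0" if "w \<in> V K - S" for w
  proof -
    have "lam K w x = 0" using that xnn[of w] by (auto simp: S_def)
    moreover have "w \<noteq> v" using that S(3) by blast
    ultimately show ?thesis unfolding l1 using that v(1) t.lam_vertex[of w v] by simp
  qed
  have x1nn: "\<And>w. w \<in> V K \<Longrightarrow> 0 \<le> lam K w x1" using l1pos l1zero by (metis DiffI less_imp_le order_refl)
  then have x1K: "x1 \<in> K" using t.mem_hull_iff hull[OF K] by auto
  have x1le: "lam K w x1 \<le> 1" if "w \<in> V K" for w using t.lam_le_1 x1K hull[OF K] that by auto
  \<comment> \<open>x1 has positive coordinates on S, so a common face through x1 contains every
    vertex in S.\<close>
  have face: "convex hull S \<subseteq> K'" if K': "K' \<in> T" "x1 \<in> K'" for K'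
  proof -
    obtain C where C: "C \<subseteq> V K" "C \<subseteq> V K'" "K \<inter> K' = convex hull C" using common_face[OF K K'(1)] by blast
    have "S \<subseteq> C"
    proof
      fix w assume w: "w \<in> S"
      show "w \<in> C"
      proof (rule ccontr)
        assume "w \<notin> C"
        then have "lam K w x1 = 0" using t.lam_zero_on_face[OF C(1), of w x1] w S(2) C(3) x1K K'(2) by auto
        then show False using l1pos[OF w] by simp
      qed
    qed
    then show ?thesis using C(3) hull_mono[of S C convex] by blast
  qed
  have "closed (\<Union>{K' \<in> T. x1 \<notin> K'})" using finite_T cell(3) by (intro closed_Union) auto
  then have "open (\<Omega> \<inter> - (\<Union>{K' \<in> T. x1 \<notin> K'}))" using open_dom by (intro open_Int open_Compl) auto
  \<comment> \<open>The cells that miss x1 are finitely many closed sets, so near x1 only cells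
    through x1 occur.\<close>
  then obtain \<zeta> where \<zeta>: "\<zeta> > 0" "ball x1 \<zeta> \<subseteq> \<Omega> \<inter> - (\<Union>{K' \<in> T. x1 \<notin> K'})"
    using x1\<Omega> open_contains_ball by (metis (no_types, lifting) Compl_iff Int_iff UnionE mem_Collect_eq)
  \<comment> \<open>x is pushed away from x1 within the face: a coordinate on S is at least t and
    drops by at most t.\<close>
  define t where "t = Min ((\<lambda>w. lam K w x) ` S)"
  have "\<And>w. w \<in> S \<Longrightarrow> 0 < lam K w x" by (simp add: S_def)
  then have t: "0 < t" "\<And>w. w \<in> S \<Longrightarrow> t \<le> lam K w x"
    unfolding t_def using S(1,3) by (subst Min_gr_iff, auto)
  define y' where "y' = x + t *\<^sub>R (x - x1)"
  have ly: "lam K w y' = lam K w x + t * (lam K w x - lam K w x1)" for w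
    by (simp add: y'_def t.lam_def algebra_simps)
  have ynn: "0 \<le> lam K w y'" if "w \<in> V K" for w
  proof (cases "w \<in> S")
    case True
    have "t * lam K w x1 \<le> t * 1" using x1le[OF that] t(1) by (intro mult_left_mono) auto
    moreover have "0 \<le> t * lam K w x" using t(1) xnn[OF that] by simp
    ultimately show ?thesis unfolding ly using t(2)[OF True] by (simp add: algebra_simps)
  next
    case False
    then show ?thesis unfolding ly using that l1zero[of w] xnn[OF that] t(1) by (simp add: S_def)
  qed
  have yS: "y' \<in> convex hull S"
  proof -
    have y0: "lam K w y' = 0" if "w \<in> V K - S" for w
      unfolding ly using that l1zero[OF that] xnn[of w] by (simp add: S_def)
    have "(\<Sum>w\<in>S. lam K w y') = (\<Sum>w\<in>V K. lam K w y')"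
      using y0 S t.finite_V by (intro sum.mono_neutral_left) auto
    moreover have "(\<Sum>w\<in>S. lam K w y' *\<^sub>R w) = (\<Sum>w\<in>V K. lam K w y' *\<^sub>R w)"
      using y0 S t.finite_V by (intro sum.mono_neutral_left) auto
    ultimately show ?thesis unfolding convex_hull_finite[OF S(1)]
      using ynn S(2) t.sum_lam[of y'] by (intro CollectI exI[of _ "\<lambda>w. lam K w y'"]) auto
  qed
  \<comment> \<open>The homothety with centre y' and ratio \<sigma> takes x1 to x, and it maps each
    cell through x1 into itself, such a cell being convex and containing y'.\<close>
  define \<sigma> where "\<sigma> = t / (1 + t)"
  have \<sigma>: "\<sigma> > 0" "\<sigma> \<le> 1" using t(1) by (auto simp: \<sigma>_def field_simps)
  have "ball x (\<sigma> * \<zeta>) \<subseteq> closure \<Omega>"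
  proof
    fix p assume "p \<in> ball x (\<sigma> * \<zeta>)"
    then have p: "norm (p - x) < \<sigma> * \<zeta>" by (simp add: dist_norm norm_minus_commute)
    define d where "d = (1 / \<sigma>) *\<^sub>R (p - x)"
    have "norm d < \<zeta>" using p \<sigma> by (simp add: d_def divide_less_eq mult.commute)
    then have xd: "x1 + d \<in> ball x1 \<zeta>" by (simp add: dist_norm)
    then have "x1 + d \<in> \<Union>T" using \<zeta>(2) cover closure_subset by blast
    then obtain K' where K': "K' \<in> T" "x1 + d \<in> K'" by blast
    then have "x1 \<in> K'" using \<zeta>(2) xd by blast
    then have "y' \<in> K'" using face[OF K'(1)] yS by blast
    then have "(1 - \<sigma>) *\<^sub>R y' + \<sigma> *\<^sub>R (x1 + d) \<in> K'"
      using cell(2)[OF K'(1)] K'(2) \<sigma> unfolding convex_alt by simp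
    moreover have "(1 - \<sigma>) *\<^sub>R y' + \<sigma> *\<^sub>R (x1 + d) = p"
    proof -
      have e1: "1 - \<sigma> = 1 / (1 + t)" using t(1) by (simp add: \<sigma>_def field_simps)
      have e2: "y' = (1 + t) *\<^sub>R x - t *\<^sub>R x1" by (simp add: y'_def algebra_simps)
      have "(1 - \<sigma>) *\<^sub>R y' = (1 / (1 + t)) *\<^sub>R ((1 + t) *\<^sub>R x - t *\<^sub>R x1)"
        unfolding e1 e2 ..
      also have "\<dots> = x - \<sigma> *\<^sub>R x1" using t(1) by (simp add: \<sigma>_def scaleR_diff_right)
      finally show ?thesis using \<sigma>(1) by (simp add: d_def algebra_simps)
    qed
    ultimately show "p \<in> closure \<Omega>" using K'(1) cover by blast
  qed
  moreover have "\<sigma> * \<zeta> > 0" using \<sigma> \<zeta> by simp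
  ultimately have "x \<in> interior (closure \<Omega>)" using mem_interior by blast
  then show False using int_cl x(2) by simp
qed

section \<open>Continuous finite element functions with bubbles\<close>

text \<open>The values a belong to vertices and are shared by neighbouring cells, the coefficients
  \<beta> to single cells. The polynomial is taken on the whole space, as the gluing lemma
  expects.\<close>

definition local_fe :: "(R3 \<Rightarrow> real) \<Rightarrow> (R3 set \<Rightarrow> real) \<Rightarrow> R3 set \<Rightarrow> R3 \<Rightarrow> real" where
  "local_fe a \<beta> K x = (\<Sum>v\<in>V K. a v * lam K v x) + \<beta> K * bub K x"

lemma nodal_affine:
  assumes "K \<in> T"
  shows "(\<Sum>v\<in>V K. a v * lam K v x) = (\<Sum>v\<in>V K. a v * c K v) + (\<Sum>v\<in>V K. a v *\<^sub>R g K v) \<bullet> x"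
proof -
  interpret t: tetrahedron "V K" "c K" "g K" by (rule tet[OF assms])
  show ?thesis by (simp add: t.lam_def inner_sum_left sum.distrib algebra_simps)
qed

lemma C1_local_fe: assumes "K \<in> T" shows "C1 (local_fe a \<beta> K)"
proof -
  interpret t: tetrahedron "V K" "c K" "g K" by (rule tet[OF assms])
  show ?thesis unfolding local_fe_def[abs_def] nodal_affine[OF assms]
    by (intro C1_add C1_affine C1_mult C1_const t.C1_tet_bubble)
qed

text \<open>On the common face both bubbles vanish, and the difference of the nodal parts is affine
  and zero at the vertices of that face.\<close>

lemma local_fe_agree:
  assumes K: "K \<in> T" "K' \<in> T" and x: "x \<in> K" "x \<in> K'"
  shows "local_fe a \<beta> K x = local_fe a \<beta> K' x"
proof (cases "K = K'")
  case False
  interpret t: tetrahedron "V K" "c K" "g K" by (rule tet[OF K(1)])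
  interpret t': tetrahedron "V K'" "c K'" "g K'" by (rule tet[OF K(2)])
  have b: "bub K x = 0" "bub K' x = 0" using bub_overlap False K x by auto
  obtain C where C: "C \<subseteq> V K" "C \<subseteq> V K'" "K \<inter> K' = convex hull C" using common_face[OF K] by blast
  define f where "f y = (\<Sum>v\<in>V K. a v * lam K v y) - (\<Sum>v\<in>V K'. a v * lam K' v y)" for y
  have "f w = 0" if "w \<in> C" for w
  proof -
    have "(\<Sum>v\<in>V K. a v * lam K v w) = (\<Sum>v\<in>V K. if v = w then a v else 0)"
      using that C(1) t.lam_vertex by (intro sum.cong) auto
    moreover have "(\<Sum>v\<in>V K'. a v * lam K' v w) = (\<Sum>v\<in>V K'. if v = w then a v else 0)"
      using that C(2) t'.lam_vertex by (intro sum.cong) auto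
    ultimately show ?thesis using that C t.finite_V t'.finite_V by (auto simp: f_def)
  qed
  then have "C \<subseteq> {y. f y = 0}" by blast
  moreover have "f ((1 - s) *\<^sub>R y + s *\<^sub>R z) = (1 - s) * f y + s * f z" for s y z
    unfolding f_def t.lam_convex t'.lam_convex
    by (simp add: algebra_simps sum.distrib sum_distrib_left sum_subtractf)
  then have "convex {y. f y = 0}" unfolding convex_alt by simp
  ultimately have "convex hull C \<subseteq> {y. f y = 0}" by (rule hull_minimal)
  then have "f x = 0" using x C(3) by blast
  then show ?thesis using b by (simp add: local_fe_def f_def)
qed simp

text \<open>Every vertex with a non-zero coordinate at x lies outside the domain itself, where a
  vanishes; on its cell the bubble is non-zero in the interior only.\<close>

lemma local_fe_outside:
  assumes K: "K \<in> T" and x: "x \<in> K" "x \<notin> \<Omega>" and a: "\<And>v. v \<notin> \<Omega> \<Longrightarrow> a v = 0"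
  shows "local_fe a \<beta> K x = 0"
proof -
  interpret t: tetrahedron "V K" "c K" "g K" by (rule tet[OF K])
  have "bub K x = 0" using t.tet_bubble_interior[of x] x cell(4)[OF K] hull[OF K] by auto
  moreover have "a v * lam K v x = 0" if "v \<in> V K" for v
    using vertex_outside[OF K x that] a[of v] by (cases "lam K v x = 0") auto
  then have "(\<Sum>v\<in>V K. a v * lam K v x) = 0" by (intro sum.neutral) blast
  ultimately show ?thesis by (simp add: local_fe_def)
qed

lemma fe_function:
  assumes a: "\<And>v. v \<notin> \<Omega> \<Longrightarrow> a v = 0"
  shows "\<exists>u. piecewise_C1 u \<and> (\<forall>x. x \<notin> \<Omega> \<longrightarrow> u x = 0) \<and> (\<forall>K\<in>T. \<forall>x\<in>K. u x = local_fe a \<beta> K x)"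
proof -
  define u where "u x = (if x \<in> \<Union>T then local_fe a \<beta> (SOME K. K \<in> T \<and> x \<in> K) x else 0)" for x
  have uK: "u x = local_fe a \<beta> K x" if "K \<in> T" "x \<in> K" for K x
  proof -
    have "(SOME K. K \<in> T \<and> x \<in> K) \<in> T \<and> x \<in> (SOME K. K \<in> T \<and> x \<in> K)"
      by (rule someI[of "\<lambda>K. K \<in> T \<and> x \<in> K" K]) (use that in blast)
    then have "local_fe a \<beta> (SOME K. K \<in> T \<and> x \<in> K) x = local_fe a \<beta> K x"
      using that by (intro local_fe_agree) auto
    moreover have "x \<in> \<Union>T" using that by blast
    ultimately show ?thesis by (simp add: u_def)
  qed
  have u0: "u x = 0" if "x \<notin> \<Omega>" for x
  proof (cases "x \<in> \<Union>T")
    case True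
    then obtain K where "K \<in> T" "x \<in> K" by blast
    then show ?thesis using uK local_fe_outside[OF _ _ that a] by simp
  qed (simp add: u_def)
  have "piecewise_C1 u"
  \<comment> \<open>The complement of the domain meets the cells along the boundary, where both
    prescriptions give 0.\<close>
  proof (rule glue_piecewise_C1[where T=T and F="local_fe a \<beta>" and Z="- \<Omega>"])
    show "- \<Omega> \<union> \<Union>T = UNIV" using cover closure_subset by blast
  qed (use finite_T cell C1_local_fe uK u0 open_dom in auto)
  then show ?thesis using u0 uK by blast
qed

lemma nodal_P_deg: assumes "K \<in> T" shows "(\<lambda>x. \<Sum>v\<in>V K. a v * lam K v x) \<in> P_deg 1"
  unfolding nodal_affine[OF assms] by (rule P_deg_affine)

lemma bub_B4: assumes K: "K \<in> T" shows "(\<lambda>x. b * bub K x) \<in> B4 K"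
proof -
  interpret t: tetrahedron "V K" "c K" "g K" by (rule tet[OF K])
  have "(\<lambda>x. \<Prod>v\<in>S. lam K v x) \<in> P_deg (card S)" if "finite S" for S
    using that
  proof induction
    case (insert v S)
    have "lam K v \<in> P_deg 1" unfolding t.lam_def[abs_def] by (rule P_deg_affine)
    from P_deg_mult[OF this insert.IH] show ?case using insert by simp
  qed (simp add: P_deg_const)
  from P_deg_mult[OF P_deg_const[of b 0] this[OF t.finite_V]]
  have "(\<lambda>x. b * bub K x) \<in> P_deg 4" by (simp add: t.tet_bubble_def t.card_V)
  moreover have "(\<lambda>x. b * bub K x) \<in> H01 (interior K)"
  proof (rule H01_cong)
    \<comment> \<open>The cut-off is continuous because the bubble vanishes on the faces.\<close>
    define u where "u x = (if x \<in> K then b * bub K x else 0)" for x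
    have u0: "u x = 0" if "x \<notin> interior K" for x
      using t.tet_bubble_interior[of x] that hull[OF K] by (auto simp: u_def)
    show "open (interior K)" "bounded (interior K)" using cell(1)[OF K] by (auto intro: compact_imp_bounded bounded_interior)
    have "piecewise_C1 u"
    proof (rule glue_piecewise_C1[where T="{K}" and F="\<lambda>_ x. b * bub K x" and Z="- interior K"])
      show "- interior K \<union> \<Union>{K} = UNIV" using interior_subset by auto
    qed (use cell(1,2)[OF K] u0 in \<open>auto simp: u_def intro!: C1_mult C1_const t.C1_tet_bubble\<close>)
    then show "u \<in> H01 (interior K)" using u0 cell(1)[OF K]
      by (intro piecewise_C1_H01) (auto intro: compact_imp_bounded bounded_interior)
    show "b * bub K x = u x" if "x \<in> interior K" for x using that interior_subset by (auto simp: u_def)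
  qed
  ultimately show ?thesis by (simp add: B4_def)
qed

section \<open>Integrals over the domain as sums over cells\<close>

text \<open>The null set off which each point of the domain lies in the interior of exactly one
  cell.\<close>

definition skeleton :: "R3 set" where
  "skeleton = (\<Union>K\<in>T. frontier K) \<union> (\<Union>(K, K')\<in>{(K, K'). K \<in> T \<and> K' \<in> T \<and> K \<noteq> K'}. K \<inter> K')"

lemma negligible_skeleton: "negligible skeleton"
proof -
  have "finite {(K, K'). K \<in> T \<and> K' \<in> T \<and> K \<noteq> K'}"
    by (rule finite_subset[of _ "T \<times> T"]) (use finite_T in auto)
  then show ?thesis unfolding skeleton_def using finite_T cell(2) negligible_overlap
    by (intro negligible_Un negligible_Union) (auto intro: negligible_convex_frontier)
qed

lemma indicator_domain:
  assumes "x \<notin> skeleton" shows "indicator \<Omega> x = (\<Sum>K\<in>T. indicator (interior K) x :: real)"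
proof (cases "x \<in> \<Omega>")
  case True
  then obtain K where K: "K \<in> T" "x \<in> K" using cover closure_subset by blast
  then have "x \<in> interior K" using assms cell(3)[OF K(1)] by (auto simp: skeleton_def frontier_def)
  moreover have "x \<notin> interior K'" if "K' \<in> T" "K' \<noteq> K" for K'
    using assms that K interior_subset[of K'] by (auto simp: skeleton_def)
  ultimately have "(\<Sum>K'\<in>T. indicator (interior K') x) = (\<Sum>K'\<in>T. if K' = K then 1 else 0 :: real)"
    by (intro sum.cong) (auto simp: indicator_def)
  then show ?thesis using True finite_T K(1) by simp
next
  case False
  then have "indicator (interior K) x = (0::real)" if "K \<in> T" for K using cell(4)[OF that] by (auto simp: indicator_def)
  then show ?thesis using False by simp
qed

lemma integral_sum_cells:
  fixes f :: "R3 \<Rightarrow> real"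
  assumes f: "integrable (lebesgue_on \<Omega>) f"
  shows "(LINT x|lebesgue_on \<Omega>. f x) = (\<Sum>K\<in>T. LINT x|lebesgue_on (interior K). f x)"
proof -
  have \<Omega>: "\<Omega> \<in> sets lebesgue" using open_dom by simp
  have f': "integrable lebesgue (\<lambda>x. indicator \<Omega> x * f x)"
    using f \<Omega> by (simp add: integrable_restrict_space)
  have i: "integrable lebesgue (\<lambda>x. indicator (interior K) x * (indicator \<Omega> x * f x))" for K
    using integrable_mult_indicator[OF _ f', of "interior K"] by simp
  have "(LINT x|lebesgue_on \<Omega>. f x) = (LINT x|lebesgue. indicator \<Omega> x * f x)"
    using \<Omega> by (simp add: integral_restrict_space)
  also have "\<dots> = (LINT x|lebesgue. (\<Sum>K\<in>T. indicator (interior K) x * (indicator \<Omega> x * f x)))"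
  proof (rule integral_cong_AE)
    show "AE x in lebesgue. indicator \<Omega> x * f x = (\<Sum>K\<in>T. indicator (interior K) x * (indicator \<Omega> x * f x))"
      using AE_not_in_negligible[OF negligible_skeleton]
    proof eventually_elim
      case (elim x)
      have "(\<Sum>K\<in>T. indicator (interior K) x * (indicator \<Omega> x * f x)) = indicator \<Omega> x * (indicator \<Omega> x * f x)"
        unfolding sum_distrib_right[symmetric] indicator_domain[OF elim, symmetric] ..
      then show ?case by (simp add: indicator_def)
    qed
  qed (use f' i in auto)
  also have "\<dots> = (\<Sum>K\<in>T. LINT x|lebesgue. indicator (interior K) x * (indicator \<Omega> x * f x))"
    using i by (intro Bochner_Integration.integral_sum)
  also have "\<dots> = (\<Sum>K\<in>T. LINT x|lebesgue_on (interior K). f x)"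
  proof (rule sum.cong)
    fix K assume "K \<in> T"
    then have "(\<lambda>x. indicator (interior K) x * (indicator \<Omega> x * f x)) = (\<lambda>x. indicator (interior K) x * f x)"
      using cell(4) by (auto simp: indicator_def fun_eq_iff)
    then show "(LINT x|lebesgue. indicator (interior K) x * (indicator \<Omega> x * f x)) = (LINT x|lebesgue_on (interior K). f x)"
      by (simp add: integral_restrict_space)
  qed simp
  finally show ?thesis .
qed

end

section \<open>Translation estimates\<close>

lemma nn_integral_lborel_translate:
  fixes f :: "R3 \<Rightarrow> ennreal"
  assumes [measurable]: "f \<in> borel_measurable borel"
  shows "(\<integral>\<^sup>+x. f (x + w) \<partial>lborel) = (\<integral>\<^sup>+x. f x \<partial>lborel)"
proof -
  have "(\<integral>\<^sup>+x. f x \<partial>lborel) = (\<integral>\<^sup>+x. f x \<partial>distr lborel borel ((+) w))" by (simp add: lborel_distr_plus)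
  also have "\<dots> = (\<integral>\<^sup>+x. f (w + x) \<partial>lborel)" by (subst nn_integral_distr) auto
  finally show ?thesis by (simp add: add.commute)
qed

text \<open>The fundamental theorem of calculus along the segment from x to x + w, then
  Cauchy-Schwarz twice: in the coordinates of w, and in t against the indicator of the unit
  interval.\<close>

lemma translation_difference_squared_le:
  assumes \<phi>: "C1 \<phi>"
  shows "(\<phi> (x + w) - \<phi> x)\<^sup>2
     \<le> (\<integral>t. indicator {0..1} t * ((norm w)\<^sup>2 * (\<Sum>i\<in>UNIV. (pd i \<phi> (x + t *\<^sub>R w))\<^sup>2)) \<partial>lborel)"
    and "integrable lborel (\<lambda>t::real. indicator {0..1} t * ((norm w)\<^sup>2 * (\<Sum>i\<in>UNIV. (pd i \<phi> (x + t *\<^sub>R w))\<^sup>2)))"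
proof -
  define D where "D t = (\<Sum>i\<in>UNIV. w $ i * pd i \<phi> (x + t *\<^sub>R w))" for t
  define G where "G t = (norm w)\<^sup>2 * (\<Sum>i\<in>UNIV. (pd i \<phi> (x + t *\<^sub>R w))\<^sup>2)" for t
  have pc: "continuous_on S (\<lambda>t. pd i \<phi> (x + t *\<^sub>R w))" for S i
    by (intro continuous_on_compose2[OF C1_pd_continuous_on[OF \<phi>, of UNIV]] continuous_intros) auto
  have Dc: "continuous_on S D" for S unfolding D_def by (intro continuous_intros pc)
  have Gc: "continuous_on S G" for S unfolding G_def by (intro continuous_intros pc)
  have GI: "integrable lborel (\<lambda>t. indicator {0..1} t *\<^sub>R G t)"
    by (rule borel_integrable_compact[OF compact_Icc Gc])
  then show "integrable lborel (\<lambda>t::real. indicator {0..1} t * ((norm w)\<^sup>2 * (\<Sum>i\<in>UNIV. (pd i \<phi> (x + t *\<^sub>R w))\<^sup>2)))"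
    by (simp add: G_def)
  have DG: "(D t)\<^sup>2 \<le> G t" for t
    using Cauchy_Schwarz_ineq_sum[of "\<lambda>i. w $ i" "\<lambda>i. pd i \<phi> (x + t *\<^sub>R w)" UNIV]
    by (simp add: D_def G_def norm_vec_def L2_set_def sum_nonneg)
  have deriv: "((\<lambda>t. \<phi> (x + t *\<^sub>R w)) has_real_derivative D t) (at t)" for t
  proof -
    have "((\<lambda>t. x + t *\<^sub>R w) has_derivative (\<lambda>t. t *\<^sub>R w)) (at t)" by (auto intro!: derivative_eq_intros)
    from has_derivative_compose[OF this has_derivative_pd[OF C1_differentiable[OF \<phi>]]]
    show ?thesis unfolding has_field_derivative_def
      by (rule has_derivative_eq_rhs) (simp add: D_def fun_eq_iff sum_distrib_left sum_distrib_right ac_simps)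
  qed
  have h: "(\<integral>t. D t * indicator {0..1} t \<partial>lborel) = \<phi> (x + 1 *\<^sub>R w) - \<phi> (x + 0 *\<^sub>R w)"
    using Dc[of UNIV] by (intro integral_FTC_Icc_real deriv) (auto simp: continuous_on_eq_continuous_at)
  have e: "(\<lambda>t. (indicator {0..1} t * D t) \<bullet> (indicator {0..1} t :: real)) = (\<lambda>t. D t * indicator {0..1} t)"
    by (auto simp: fun_eq_iff indicator_def)
  have "(\<phi> (x + w) - \<phi> x)\<^sup>2 = (\<integral>t. (indicator {0..1} t * D t) \<bullet> (indicator {0..1} t :: real) \<partial>lborel)\<^sup>2"
    unfolding e h by simp
  also have "\<dots> \<le> (\<integral>t. (norm (indicator {0..1} t * D t))\<^sup>2 \<partial>lborel) * (\<integral>t. (norm (indicator {0..1::real} t :: real))\<^sup>2 \<partial>lborel)"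
  proof (rule integral_Cauchy_Schwarz)
    have [measurable]: "D \<in> borel_measurable borel" using Dc by (intro borel_measurable_continuous_onI)
    show "(\<lambda>t. indicator {0..1} t * D t) \<in> borel_measurable lborel" by measurable
    have "integrable lborel (\<lambda>t. indicator {0..1} t *\<^sub>R (D t)\<^sup>2)"
      by (intro borel_integrable_compact continuous_intros Dc) auto
    moreover have "(\<lambda>t. (norm (indicator {0..1} t * D t))\<^sup>2) = (\<lambda>t. indicator {0..1} t *\<^sub>R (D t)\<^sup>2)"
      by (auto simp: fun_eq_iff indicator_def)
    ultimately show "integrable lborel (\<lambda>t. (norm (indicator {0..1} t * D t))\<^sup>2)" by simp
    have "(\<lambda>t. (norm (indicator {0..1::real} t :: real))\<^sup>2) = indicator {0..1}" by (auto simp: fun_eq_iff indicator_def)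
    then show "integrable lborel (\<lambda>t. (norm (indicator {0..1::real} t :: real))\<^sup>2)" by simp
  qed measurable
  also have "(\<lambda>t. (norm (indicator {0..1::real} t :: real))\<^sup>2) = indicator {0..1}" by (auto simp: fun_eq_iff indicator_def)
  also have "(\<integral>t. indicator {0..1::real} t \<partial>lborel) = (1::real)" by simp
  also have "(\<integral>t. (norm (indicator {0..1} t * D t))\<^sup>2 \<partial>lborel) * 1 \<le> (\<integral>t. indicator {0..1} t * G t \<partial>lborel)"
  proof -
    have "(\<integral>t. (norm (indicator {0..1} t * D t))\<^sup>2 \<partial>lborel) \<le> (\<integral>t. indicator {0..1} t * G t \<partial>lborel)"
    proof (rule integral_mono')
      show "integrable lborel (\<lambda>t. indicator {0..1} t * G t)" using GI by simp
      show "(norm (indicator {0..1} t * D t))\<^sup>2 \<le> indicator {0..1} t * G t" for t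
        using DG[of t] by (simp add: indicator_def)
      show "0 \<le> indicator {0..1} t * G t" for t by (simp add: G_def sum_nonneg)
    qed
    then show ?thesis by simp
  qed
  finally show "(\<phi> (x + w) - \<phi> x)\<^sup>2
     \<le> (\<integral>t. indicator {0..1} t * ((norm w)\<^sup>2 * (\<Sum>i\<in>UNIV. (pd i \<phi> (x + t *\<^sub>R w))\<^sup>2)) \<partial>lborel)"
    by (simp add: G_def)
qed

text \<open>After exchanging the integrals, translation invariance removes the shift by t w for each
  t. Integrals of non-negative functions make the exchange free of integrability conditions.\<close>

lemma translation_estimate:
  assumes \<phi>: "C1 \<phi>" and R: "\<And>x. norm x > R \<Longrightarrow> \<phi> x = 0"
  shows "(\<integral>\<^sup>+x. ennreal ((\<phi> x - \<phi> (x + w))\<^sup>2) \<partial>lborel)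
     \<le> ennreal ((norm w)\<^sup>2 * (\<Sum>i\<in>UNIV. \<integral>x. (pd i \<phi> x)\<^sup>2 \<partial>lborel))"
proof -
  define G where "G x = (\<Sum>i\<in>UNIV. (pd i \<phi> x)\<^sup>2)" for x
  have Gc: "continuous_on UNIV G" unfolding G_def by (intro continuous_intros C1_pd_continuous_on[OF \<phi>])
  have [measurable]: "G \<in> borel_measurable borel" by (rule borel_measurable_continuous_onI[OF Gc])
  have G0: "0 \<le> G x" for x by (simp add: G_def sum_nonneg)
  have pI: "integrable lborel (\<lambda>x. (pd i \<phi> x)\<^sup>2)" for i
    using pd_zero_outside[OF R] by (intro continuous_bounded_support_integrable[of _ R] continuous_intros C1_pd_continuous_on[OF \<phi>]) auto
  have GI: "integrable lborel G" unfolding G_def using pI by simp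
  have "(\<integral>\<^sup>+x. ennreal ((\<phi> x - \<phi> (x + w))\<^sup>2) \<partial>lborel)
      \<le> (\<integral>\<^sup>+x. \<integral>\<^sup>+t. ennreal (indicator {0..1::real} t * ((norm w)\<^sup>2 * G (x + t *\<^sub>R w))) \<partial>lborel \<partial>lborel)"
  proof (rule nn_integral_mono)
    fix x
    have "ennreal ((\<phi> x - \<phi> (x + w))\<^sup>2) \<le> ennreal (\<integral>t. indicator {0..1} t * ((norm w)\<^sup>2 * G (x + t *\<^sub>R w)) \<partial>lborel)"
      using translation_difference_squared_le(1)[OF \<phi>, of x w]
      by (intro ennreal_leI) (simp add: G_def power2_commute)
    also have "\<dots> = (\<integral>\<^sup>+t. ennreal (indicator {0..1::real} t * ((norm w)\<^sup>2 * G (x + t *\<^sub>R w))) \<partial>lborel)"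
      using translation_difference_squared_le(2)[OF \<phi>, of w x] G0
      by (intro nn_integral_eq_integral[symmetric]) (auto simp: G_def)
    finally show "ennreal ((\<phi> x - \<phi> (x + w))\<^sup>2)
        \<le> (\<integral>\<^sup>+t. ennreal (indicator {0..1::real} t * ((norm w)\<^sup>2 * G (x + t *\<^sub>R w))) \<partial>lborel)" .
  qed
  also have "\<dots> = (\<integral>\<^sup>+t. \<integral>\<^sup>+x. ennreal (indicator {0..1::real} t * ((norm w)\<^sup>2 * G (x + t *\<^sub>R w))) \<partial>lborel \<partial>lborel)"
    by (rule lborel_pair.Fubini'[symmetric]) measurable
  also have "\<dots> = (\<integral>\<^sup>+t. indicator {0..1::real} t * ennreal ((norm w)\<^sup>2 * (\<integral>x. G x \<partial>lborel)) \<partial>lborel)"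
  proof (rule nn_integral_cong)
    fix t :: real
    have "(\<integral>\<^sup>+x. ennreal (indicator {0..1::real} t * ((norm w)\<^sup>2 * G (x + t *\<^sub>R w))) \<partial>lborel)
       = (\<integral>\<^sup>+x. ennreal (indicator {0..1::real} t * ((norm w)\<^sup>2 * G x)) \<partial>lborel)"
      using nn_integral_lborel_translate[of "\<lambda>x. ennreal (indicator {0..1::real} t * ((norm w)\<^sup>2 * G x))" "t *\<^sub>R w"] by simp
    also have "\<dots> = ennreal (\<integral>x. indicator {0..1::real} t * ((norm w)\<^sup>2 * G x) \<partial>lborel)"
      using GI G0 by (intro nn_integral_eq_integral) auto
    also have "\<dots> = indicator {0..1::real} t * ennreal ((norm w)\<^sup>2 * (\<integral>x. G x \<partial>lborel))"
      by (simp add: indicator_def)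
    finally show "(\<integral>\<^sup>+x. ennreal (indicator {0..1::real} t * ((norm w)\<^sup>2 * G (x + t *\<^sub>R w))) \<partial>lborel)
       = indicator {0..1::real} t * ennreal ((norm w)\<^sup>2 * (\<integral>x. G x \<partial>lborel))" .
  qed
  also have "\<dots> = ennreal ((norm w)\<^sup>2 * (\<integral>x. G x \<partial>lborel))"
    by (subst nn_integral_multc) auto
  also have "(\<integral>x. G x \<partial>lborel) = (\<Sum>i\<in>UNIV. \<integral>x. (pd i \<phi> x)\<^sup>2 \<partial>lborel)"
    unfolding G_def using pI by (intro Bochner_Integration.integral_sum)
  finally show ?thesis .
qed

text \<open>The counterpart without derivatives; its left-hand side is the same, so both estimates
  feed the same oscillation bound.\<close>

lemma translation_estimate_0:
  assumes c: "continuous_on UNIV \<phi>" and R: "\<And>x::R3. norm x > R \<Longrightarrow> \<phi> x = 0"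
  shows "(\<integral>\<^sup>+x. ennreal ((\<phi> x - \<phi> (x + w))\<^sup>2) \<partial>lborel) \<le> ennreal (4 * (\<integral>x. (\<phi> x)\<^sup>2 \<partial>lborel))"
proof -
  have [measurable]: "\<phi> \<in> borel_measurable borel" by (rule borel_measurable_continuous_onI[OF c])
  have I: "integrable lborel (\<lambda>x. (\<phi> x)\<^sup>2)"
    using R by (intro continuous_bounded_support_integrable[of _ R] continuous_intros c) auto
  have "(\<integral>\<^sup>+x. ennreal ((\<phi> x - \<phi> (x + w))\<^sup>2) \<partial>lborel)
      \<le> (\<integral>\<^sup>+x. ennreal (2 * (\<phi> x)\<^sup>2) + ennreal (2 * (\<phi> (x + w))\<^sup>2) \<partial>lborel)"
  proof (rule nn_integral_mono)
    fix x
    have "(\<phi> x - \<phi> (x + w))\<^sup>2 \<le> 2 * (\<phi> x)\<^sup>2 + 2 * (\<phi> (x + w))\<^sup>2"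
      using norm_add_squared_le[of "\<phi> x" "- \<phi> (x + w)"] by simp
    then show "ennreal ((\<phi> x - \<phi> (x + w))\<^sup>2) \<le> ennreal (2 * (\<phi> x)\<^sup>2) + ennreal (2 * (\<phi> (x + w))\<^sup>2)"
      by (simp add: ennreal_plus[symmetric] ennreal_leI del: ennreal_plus)
  qed
  also have "\<dots> = (\<integral>\<^sup>+x. ennreal (2 * (\<phi> x)\<^sup>2) \<partial>lborel) + (\<integral>\<^sup>+x. ennreal (2 * (\<phi> (x + w))\<^sup>2) \<partial>lborel)"
    by (rule nn_integral_add) measurable
  also have "(\<integral>\<^sup>+x. ennreal (2 * (\<phi> (x + w))\<^sup>2) \<partial>lborel) = (\<integral>\<^sup>+x. ennreal (2 * (\<phi> x)\<^sup>2) \<partial>lborel)"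
    using nn_integral_lborel_translate[of "\<lambda>x. ennreal (2 * (\<phi> x)\<^sup>2)" w] by simp
  also have "(\<integral>\<^sup>+x. ennreal (2 * (\<phi> x)\<^sup>2) \<partial>lborel) = ennreal (\<integral>x. 2 * (\<phi> x)\<^sup>2 \<partial>lborel)"
    using I by (intro nn_integral_eq_integral) auto
  also have "\<dots> + \<dots> = ennreal (4 * (\<integral>x. (\<phi> x)\<^sup>2 \<partial>lborel))"
    by (simp add: ennreal_plus[symmetric] del: ennreal_plus)
  finally show ?thesis .
qed

section \<open>Mean-square oscillation\<close>

text \<open>Left unnormalised, because it is divided by the volume of a smaller averaging ball and
  not by that of \<open>cball x r\<close>.\<close>

definition osc :: "(R3 \<Rightarrow> real) \<Rightarrow> real \<Rightarrow> R3 \<Rightarrow> real" where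
  "osc \<phi> r x = (\<integral>y. indicator (cball x r) y * (\<phi> x - \<phi> y)\<^sup>2 \<partial>lborel)"

context
  fixes \<phi> :: "R3 \<Rightarrow> real" assumes c: "continuous_on UNIV \<phi>"
begin

lemma osc_integrand: "integrable lborel (\<lambda>y. indicator (cball z s) y * (\<phi> x - \<phi> y)\<^sup>2)"
proof -
  have "continuous_on (cball z s) (\<lambda>y. (\<phi> x - \<phi> y)\<^sup>2)"
    by (intro continuous_intros continuous_on_subset[OF c]) auto
  from borel_integrable_compact[OF compact_cball this] show ?thesis by simp
qed

lemma osc_nonneg: "0 \<le> osc \<phi> r x"
  unfolding osc_def by (intro integral_nonneg_AE AE_I2) auto

text \<open>\<phi> x minus an average is the average of \<phi> x - \<phi> y, whose square is at most
  the mean of the squares by Cauchy-Schwarz; a larger ball only enlarges the integral.\<close>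

lemma average_close:
  assumes s: "s > 0" and sub: "cball z s \<subseteq> cball x r"
  shows "(\<phi> x - (\<integral>y. indicator (cball z s) y * \<phi> y \<partial>lborel) / measure lborel (cball z s))\<^sup>2 \<le> osc \<phi> r x / measure lborel (cball z s)"
proof -
  define A where "A = measure lborel (cball z s)"
  have A: "A > 0" using s content_cball_pos[of s z] by (simp add: A_def)
  have iA: "integrable lborel (indicator (cball z s) :: R3 \<Rightarrow> real)" using emeasure_lborel_cball_finite[of z s] by (simp add: integrable_indicator_iff)
  have intA: "(\<integral>y. indicator (cball z s) y \<partial>lborel) = A" by (simp add: A_def)
  have i\<phi>: "integrable lborel (\<lambda>y. indicator (cball z s) y * \<phi> y)"
    using borel_integrable_compact[OF compact_cball continuous_on_subset[OF c], of z s] by simp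
  have [measurable]: "\<phi> \<in> borel_measurable borel" by (rule borel_measurable_continuous_onI[OF c])
  have "A * (\<phi> x - (\<integral>y. indicator (cball z s) y * \<phi> y \<partial>lborel) / A)
     = (\<integral>y. \<phi> x * indicator (cball z s) y \<partial>lborel) - (\<integral>y. indicator (cball z s) y * \<phi> y \<partial>lborel)"
  proof -
    have "(\<integral>y. \<phi> x * indicator (cball z s) y \<partial>lborel) = \<phi> x * A"
      by (subst integral_mult_right_zero) (simp only: intA)
    then show ?thesis using A by (simp add: right_diff_distrib mult.commute A_def[symmetric])
  qed
  also have "\<dots> = (\<integral>y. \<phi> x * indicator (cball z s) y - indicator (cball z s) y * \<phi> y \<partial>lborel)"
    using iA i\<phi> by (intro Bochner_Integration.integral_diff[symmetric]) auto
  also have "\<dots> = (\<integral>y. (indicator (cball z s) y * (\<phi> x - \<phi> y)) \<bullet> (indicator (cball z s) y :: real) \<partial>lborel)"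
    by (rule Bochner_Integration.integral_cong) (auto simp: indicator_def)
  finally have "(A * (\<phi> x - (\<integral>y. indicator (cball z s) y * \<phi> y \<partial>lborel) / A))\<^sup>2
     = (\<integral>y. (indicator (cball z s) y * (\<phi> x - \<phi> y)) \<bullet> (indicator (cball z s) y :: real) \<partial>lborel)\<^sup>2" by simp
  also have "\<dots> \<le> (\<integral>y. (norm (indicator (cball z s) y * (\<phi> x - \<phi> y)))\<^sup>2 \<partial>lborel) * (\<integral>y. (norm (indicator (cball z s) y :: real))\<^sup>2 \<partial>lborel)"
  proof (rule integral_Cauchy_Schwarz)
    have "(\<lambda>y. (norm (indicator (cball z s) y * (\<phi> x - \<phi> y)))\<^sup>2) = (\<lambda>y. indicator (cball z s) y * (\<phi> x - \<phi> y)\<^sup>2)"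
      by (auto simp: indicator_def fun_eq_iff)
    then show "integrable lborel (\<lambda>y. (norm (indicator (cball z s) y * (\<phi> x - \<phi> y)))\<^sup>2)" using osc_integrand by simp
    have "(\<lambda>y. (norm (indicator (cball z s) y :: real))\<^sup>2) = indicator (cball z s)" by (auto simp: indicator_def fun_eq_iff)
    then show "integrable lborel (\<lambda>y. (norm (indicator (cball z s) y :: real))\<^sup>2)" using iA by simp
    show "(indicator (cball z s) :: R3 \<Rightarrow> real) \<in> borel_measurable lborel" using iA by (rule borel_measurable_integrable)
    then show "(\<lambda>y. indicator (cball z s) y * (\<phi> x - \<phi> y)) \<in> borel_measurable lborel"
      using borel_measurable_continuous_onI[OF c] by (intro borel_measurable_times borel_measurable_diff) auto
  qed
  also have "(\<lambda>y. (norm (indicator (cball z s) y :: real))\<^sup>2) = indicator (cball z s)" by (auto simp: indicator_def fun_eq_iff)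
  also have "(\<lambda>y. (norm (indicator (cball z s) y * (\<phi> x - \<phi> y)))\<^sup>2) = (\<lambda>y. indicator (cball z s) y * (\<phi> x - \<phi> y)\<^sup>2)"
    by (auto simp: indicator_def fun_eq_iff)
  also have "(\<integral>y. indicator (cball z s) y * (\<phi> x - \<phi> y)\<^sup>2 \<partial>lborel) * (\<integral>y. indicator (cball z s) y \<partial>lborel) \<le> osc \<phi> r x * A"
    unfolding intA osc_def using sub A osc_integrand
    by (intro mult_right_mono integral_mono) (auto simp: indicator_def)
  finally have "A\<^sup>2 * (\<phi> x - (\<integral>y. indicator (cball z s) y * \<phi> y \<partial>lborel) / A)\<^sup>2 \<le> osc \<phi> r x * A"
    by (simp add: power_mult_distrib)
  then have "A * (\<phi> x - (\<integral>y. indicator (cball z s) y * \<phi> y \<partial>lborel) / A)\<^sup>2 \<le> osc \<phi> r x"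
    using A by (simp add: power2_eq_square mult.commute mult.left_commute)
  then show ?thesis using A by (simp add: A_def[symmetric] field_simps)
qed

text \<open>In w = y - x the double integral runs over shifts w of translation errors. The bound c0
  stays open so that the value estimate and the gradient estimate can both be inserted.\<close>

lemma osc_integrable:
  assumes c0: "\<And>w. norm w \<le> r \<Longrightarrow> (\<integral>\<^sup>+x. ennreal ((\<phi> x - \<phi> (x + w))\<^sup>2) \<partial>lborel) \<le> ennreal c0" and "0 \<le> c0"
  shows "integrable lborel (osc \<phi> r)" "(\<integral>x. osc \<phi> r x \<partial>lborel) \<le> measure lborel (cball (0::R3) r) * c0"
proof -
  have [measurable]: "\<phi> \<in> borel_measurable borel" by (rule borel_measurable_continuous_onI[OF c])
  have ind: "indicator (cball x r) y = (indicator {..r} (dist x y) :: real)" for x y :: R3 by (simp add: indicator_def)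
  have m: "osc \<phi> r \<in> borel_measurable lborel"
    unfolding osc_def[abs_def] ind by (rule lborel.borel_measurable_lebesgue_integral) measurable
  have "(\<integral>\<^sup>+x. ennreal (osc \<phi> r x) \<partial>lborel)
     = (\<integral>\<^sup>+x. \<integral>\<^sup>+w. ennreal (indicator {..r} (norm w) * (\<phi> x - \<phi> (x + w))\<^sup>2) \<partial>lborel \<partial>lborel)"
  proof (rule nn_integral_cong)
    fix x
    have "ennreal (osc \<phi> r x) = (\<integral>\<^sup>+y. ennreal (indicator (cball x r) y * (\<phi> x - \<phi> y)\<^sup>2) \<partial>lborel)"
      unfolding osc_def using osc_integrand by (intro nn_integral_eq_integral[symmetric]) auto
    also have "\<dots> = (\<integral>\<^sup>+w. ennreal (indicator (cball x r) (w + x) * (\<phi> x - \<phi> (w + x))\<^sup>2) \<partial>lborel)"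
    proof (rule nn_integral_lborel_translate[symmetric])
      have "(\<lambda>y. indicator (cball x r) y * (\<phi> x - \<phi> y)\<^sup>2) \<in> borel_measurable borel"
        using borel_measurable_integrable[OF osc_integrand] by simp
      then show "(\<lambda>y. ennreal (indicator (cball x r) y * (\<phi> x - \<phi> y)\<^sup>2)) \<in> borel_measurable borel"
        by (rule measurable_compose[OF _ measurable_ennreal])
    qed
    also have "\<dots> = (\<integral>\<^sup>+w. ennreal (indicator {..r} (norm w) * (\<phi> x - \<phi> (x + w))\<^sup>2) \<partial>lborel)"
      by (rule nn_integral_cong) (auto simp: indicator_def dist_norm add.commute)
    finally show "ennreal (osc \<phi> r x) = (\<integral>\<^sup>+w. ennreal (indicator {..r} (norm w) * (\<phi> x - \<phi> (x + w))\<^sup>2) \<partial>lborel)" .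
  qed
  also have "\<dots> = (\<integral>\<^sup>+w. \<integral>\<^sup>+x. ennreal (indicator {..r} (norm w) * (\<phi> x - \<phi> (x + w))\<^sup>2) \<partial>lborel \<partial>lborel)"
    by (rule lborel_pair.Fubini'[symmetric]) measurable
  also have "\<dots> \<le> (\<integral>\<^sup>+w. ennreal c0 * indicator (cball (0::R3) r) w \<partial>lborel)"
  proof (rule nn_integral_mono)
    fix w :: R3
    show "(\<integral>\<^sup>+x. ennreal (indicator {..r} (norm w) * (\<phi> x - \<phi> (x + w))\<^sup>2) \<partial>lborel) \<le> ennreal c0 * indicator (cball (0::R3) r) w"
      using c0[of w] by (cases "norm w \<le> r") auto
  qed
  also have "\<dots> = ennreal (measure lborel (cball (0::R3) r) * c0)"
    using \<open>0 \<le> c0\<close> emeasure_lborel_cball_finite[of "0::R3" r]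
    by (simp add: nn_integral_cmult_indicator emeasure_eq_ennreal_measure ennreal_mult' mult.commute)
  finally have b: "(\<integral>\<^sup>+x. ennreal (osc \<phi> r x) \<partial>lborel) \<le> ennreal (measure lborel (cball (0::R3) r) * c0)" .
  show I: "integrable lborel (osc \<phi> r)"
    using m b osc_nonneg by (intro integrableI_nonneg) (auto simp: less_top[symmetric] top_unique)
  have "ennreal (\<integral>x. osc \<phi> r x \<partial>lborel) \<le> ennreal (measure lborel (cball (0::R3) r) * c0)"
    using b I osc_nonneg by (simp add: nn_integral_eq_integral)
  then show "(\<integral>x. osc \<phi> r x \<partial>lborel) \<le> measure lborel (cball (0::R3) r) * c0"
    using \<open>0 \<le> c0\<close> by (subst (asm) ennreal_le_iff) auto
qed

end

lemma content_cball_ratio: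
  assumes "0 < s" "0 < r"
  shows "measure lborel (cball (y::R3) r) / measure lborel (cball (z::R3) s) = (r / s) ^ 3"
proof -
  have "measure lborel (ball (0::R3) 1) > 0" by (simp add: content_ball_pos)
  then show ?thesis using assms content_ball_conv_unit_ball[of r y] content_ball_conv_unit_ball[of s z]
    by (simp add: content_cball_conv_ball power_divide)
qed

section \<open>The quasi-interpolation operator with bubble correction\<close>

lemma continuous_L2:
  fixes f :: "R3 \<Rightarrow> real"
  assumes "open \<Omega>" "bounded \<Omega>" "continuous_on UNIV f" shows "f \<in> L2 \<Omega>"
proof -
  have "compact (f ` closure \<Omega>)"
    using assms by (intro compact_continuous_image continuous_on_subset[OF assms(3)]) (auto simp: compact_closure)
  then have "bounded (f ` closure \<Omega>)" by (rule compact_imp_bounded)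
  then obtain B where "\<And>x. x \<in> closure \<Omega> \<Longrightarrow> \<bar>f x\<bar> \<le> B" by (auto simp: bounded_iff)
  then have "norm (f x) \<le> B" if "x \<in> \<Omega>" for x using closure_subset that by auto
  then show ?thesis using lmeasurable_open[OF assms(2,1)]
    by (intro L2_bounded[of _ _ B] measurable_restrict_space1 continuous_borel_measurable_lebesgue assms(3)) auto
qed

lemma continuous_integrable_on:
  fixes f :: "R3 \<Rightarrow> real"
  assumes "open \<Omega>" "bounded \<Omega>" "continuous_on UNIV f" shows "integrable (lebesgue_on \<Omega>) f"
  by (rule L2_integrable[OF lmeasurable_open[OF assms(2,1)] continuous_L2[OF assms]])

text \<open>\<open>shape_bound \<gamma>\<close> bounds the square of the volume of a cell divided by the integral of its
  bubble, and \<open>patch_ratio \<kappa> M\<close> is the ratio of the volume of the ball over which the oscillation is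
  measured to that of the balls over which the nodal averages are taken.\<close>

definition shape_bound :: "real \<Rightarrow> real" where "shape_bound \<gamma> = ((2 / \<gamma>) ^ 7)\<^sup>2"

definition patch_ratio :: "real \<Rightarrow> real \<Rightarrow> real" where "patch_ratio \<kappa> M = ((1 + M + \<kappa>) / (\<kappa> / 2)) ^ 3"

section \<open>Estimates on a single cell\<close>

context tet_mesh
begin

text \<open>On the cell the interpolant is a convex combination of nodal values within
  \<open>sqrt w\<close> of y, so its range has length at most \<open>2 * sqrt w\<close>; across an
  inscribed ball of radius \<rho> this limits the gradient.\<close>

lemma nodal_estimate:
  assumes K: "K \<in> T" and a: "\<And>v. v \<in> V K \<Longrightarrow> (y - a v)\<^sup>2 \<le> w"
  shows "x \<in> K \<Longrightarrow> (y - (\<Sum>v\<in>V K. a v * lam K v x))\<^sup>2 \<le> w"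
    and "cball x0 \<rho> \<subseteq> K \<Longrightarrow> \<rho> > 0 \<Longrightarrow> (norm (\<Sum>v\<in>V K. a v *\<^sub>R g K v))\<^sup>2 \<le> w / \<rho>\<^sup>2"
proof -
  interpret t: tetrahedron "V K" "c K" "g K" by (rule tet[OF K])
  obtain v0 where "v0 \<in> V K" using t.card_V by fastforce
  then have w: "0 \<le> w" using a[of v0] zero_le_power2[of "y - a v0"] by linarith
  define f where "f x = (\<Sum>v\<in>V K. a v * lam K v x)" for x
  have av: "\<bar>y - a v\<bar> \<le> sqrt w" if "v \<in> V K" for v
    using real_sqrt_le_mono[OF a[OF that]] by simp
  have b: "\<bar>y - f p\<bar> \<le> sqrt w" if p: "p \<in> K" for p
  proof -
    have l: "0 \<le> lam K v p" if "v \<in> V K" for v using p t.mem_hull_iff hull[OF K] that by auto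
    have "y - f p = (\<Sum>v\<in>V K. lam K v p * (y - a v))"
    proof -
      have "(\<Sum>v\<in>V K. lam K v p * (y - a v)) = (\<Sum>v\<in>V K. lam K v p * y) - (\<Sum>v\<in>V K. lam K v p * a v)"
        by (simp add: right_diff_distrib sum_subtractf)
      also have "(\<Sum>v\<in>V K. lam K v p * y) = y" by (simp add: sum_distrib_right[symmetric] t.sum_lam(1))
      finally show ?thesis by (simp add: f_def mult.commute)
    qed
    also have "\<bar>\<dots>\<bar> \<le> (\<Sum>v\<in>V K. \<bar>lam K v p * (y - a v)\<bar>)" by (rule sum_abs)
    also have "\<dots> \<le> (\<Sum>v\<in>V K. lam K v p * sqrt w)"
      using l av by (intro sum_mono) (auto simp: abs_mult intro!: mult_left_mono)
    also have "\<dots> = sqrt w" by (simp add: sum_distrib_right[symmetric] t.sum_lam(1))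
    finally show ?thesis .
  qed
  show "(y - (\<Sum>v\<in>V K. a v * lam K v x))\<^sup>2 \<le> w" if "x \<in> K"
    using power_mono[OF b[OF that], of 2] w by (simp add: f_def)
  define G where "G = (\<Sum>v\<in>V K. a v *\<^sub>R g K v)"
  show "(norm (\<Sum>v\<in>V K. a v *\<^sub>R g K v))\<^sup>2 \<le> w / \<rho>\<^sup>2" if B: "cball x0 \<rho> \<subseteq> K" "\<rho> > 0"
  proof (cases "G = 0")
    case False
    define d where "d = (\<rho> / norm G) *\<^sub>R G"
    have "norm d = \<rho>" using False B(2) by (simp add: d_def)
    then have m: "x0 + d \<in> K" "x0 - d \<in> K" using B(1) by (auto simp: subset_iff dist_norm)
    have Gd: "G \<bullet> d = \<rho> * norm G" using False by (simp add: d_def power2_norm_eq_inner[symmetric] power2_eq_square)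
    have "f (x0 + d) - f (x0 - d) = 2 * (\<rho> * norm G)"
      unfolding f_def nodal_affine[OF K] by (simp add: G_def[symmetric] algebra_simps Gd)
    then have "\<rho> * norm G \<le> sqrt w" using b[OF m(1)] b[OF m(2)] by linarith
    then have "(\<rho> * norm G)\<^sup>2 \<le> w" using power_mono[of "\<rho> * norm G" "sqrt w" 2] w B(2) by simp
    then show ?thesis using B(2) by (simp add: G_def[symmetric] field_simps power_mult_distrib)
  qed (use w in \<open>simp add: G_def\<close>)
qed

lemma pd_local_fe:
  assumes K: "K \<in> T"
  shows "pd i (local_fe a \<beta> K) x = (\<Sum>v\<in>V K. a v *\<^sub>R g K v) $ i + \<beta> K * pd i (bub K) x"
proof -
  interpret t: tetrahedron "V K" "c K" "g K" by (rule tet[OF K])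
  have d: "(\<lambda>x. (\<Sum>v\<in>V K. a v * c K v) + (\<Sum>v\<in>V K. a v *\<^sub>R g K v) \<bullet> x) differentiable at x" "bub K differentiable at x"
    using C1_affine t.C1_tet_bubble C1_differentiable by blast+
  have "(\<lambda>x. \<beta> K * bub K x) differentiable at x" using C1_mult[OF C1_const t.C1_tet_bubble] C1_differentiable by blast
  then show ?thesis unfolding local_fe_def[abs_def] nodal_affine[OF K]
    using d by (simp add: pd_add pd_affine pd_cmult)
qed

text \<open>The exponent is 7 = 3 + 4. The cell lies in a ball of radius h around a vertex, whose
  volume is (2 / \<gamma>)^3 times that of the ball of radius \<gamma> h / 2 around x0; on the
  latter the bubble is at least (\<gamma> / 2)^4.\<close>

lemma bubble_integral:
  assumes K: "K \<in> T" and h: "h > 0" "diameter K \<le> h" and \<gamma>: "\<gamma> > 0" "cball x0 (\<gamma> * h) \<subseteq> K"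
  shows "measure lebesgue (interior K) \<le> (2 / \<gamma>) ^ 7 * (LINT x|lebesgue_on (interior K). bub K x)"
    and "0 < (LINT x|lebesgue_on (interior K). bub K x)"
proof -
  interpret t: tetrahedron "V K" "c K" "g K" by (rule tet[OF K])
  define I where "I = interior K"
  have I: "open I" "bounded I" "I \<in> lmeasurable" "I \<in> sets lebesgue"
    using cell(1)[OF K] lmeasurable_open[of I] by (auto simp: I_def compact_imp_bounded bounded_interior)
  define B where "B = ball x0 (\<gamma> * h / 2)"
  have \<gamma>h: "\<gamma> * h > 0" using h \<gamma> by simp
  have BI: "B \<subseteq> I"
  proof -
    have "B \<subseteq> cball x0 (\<gamma> * h)" using \<gamma>h by (auto simp: B_def)
    then show ?thesis unfolding I_def using \<gamma>(2) by (intro interior_maximal) (auto simp: B_def)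
  qed
  have mB: "0 < measure lborel B" using \<gamma>h by (simp add: B_def content_ball_pos)
  obtain v where v: "v \<in> V K" using t.card_V by fastforce
  then have vK: "v \<in> K" using hull[OF K] hull_inc by metis
  have "I \<subseteq> cball v h"
  proof
    fix x assume "x \<in> I"
    then have "x \<in> K" using interior_subset by (auto simp: I_def)
    then show "x \<in> cball v h"
      using diameter_bounded_bound[OF compact_imp_bounded[OF cell(1)[OF K]] vK, of x] h(2) by simp
  qed
  then have "measure lebesgue I \<le> measure lebesgue (cball v h)" using I by (intro measure_mono_fmeasurable) auto
  also have "\<dots> = (2 / \<gamma>) ^ 3 * measure lborel B"
  proof -
    have "measure lborel (cball v h) / measure lborel (cball x0 (\<gamma> * h / 2)) = (h / (\<gamma> * h / 2)) ^ 3"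
      using h \<gamma>h by (intro content_cball_ratio) auto
    also have "h / (\<gamma> * h / 2) = 2 / \<gamma>" using h(1) by simp
    finally show ?thesis using mB by (simp add: B_def content_cball_conv_ball field_simps)
  qed
  finally have m: "measure lebesgue I \<le> (2 / \<gamma>) ^ 3 * measure lborel B" .
  have "(\<gamma> / 2) ^ 4 * measure lborel B = (LINT x|lebesgue. (\<gamma> / 2) ^ 4 * indicator B x)"
    by (simp add: B_def)
  also have "\<dots> \<le> (LINT x|lebesgue. indicator I x * bub K x)"
  proof (rule integral_mono)
    have "emeasure lborel B < \<infinity>" unfolding B_def by (rule emeasure_bounded_finite) simp
    then show "integrable lebesgue (\<lambda>x. (\<gamma> / 2) ^ 4 * indicator B x)" by (simp add: B_def)
    have "integrable (lebesgue_on I) (bub K)"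
      by (intro continuous_integrable_on I C1_continuous_on t.C1_tet_bubble)
    then show "integrable lebesgue (\<lambda>x. indicator I x * bub K x)" using I by (simp add: integrable_restrict_space)
    show "(\<gamma> / 2) ^ 4 * indicator B x \<le> indicator I x * bub K x" for x
    proof (cases "x \<in> B")
      case True
      have "(\<gamma> * h / (2 * h)) ^ 4 \<le> bub K x"
      proof (rule t.tet_bubble_lower[of x0])
        show "cball x0 (\<gamma> * h) \<subseteq> convex hull V K" "diameter (convex hull V K) \<le> h"
          using \<gamma>(2) h(2) hull[OF K] by simp_all
        show "x \<in> ball x0 (\<gamma> * h / 2)" using True by (simp add: B_def)
      qed (use \<gamma>h h(1) in auto)
      then show ?thesis using True BI h(1) by (auto simp: indicator_def)
    next
      case False
      have "0 \<le> indicator I x * bub K x"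
        using t.tet_bubble_bounds[of x] hull[OF K] interior_subset[of K] by (auto simp: indicator_def I_def)
      then show ?thesis using False by simp
    qed
  qed
  also have "\<dots> = (LINT x|lebesgue_on I. bub K x)" using I by (simp add: integral_restrict_space)
  finally have J: "(\<gamma> / 2) ^ 4 * measure lborel B \<le> (LINT x|lebesgue_on I. bub K x)" .
  have "0 < (\<gamma> / 2) ^ 4 * measure lborel B" using mB \<gamma>(1) by simp
  then show "0 < (LINT x|lebesgue_on (interior K). bub K x)" using J by (simp add: I_def)
  have "(2 / \<gamma>) ^ 3 * measure lborel B = (2 / \<gamma>) ^ 7 * ((\<gamma> / 2) ^ 4 * measure lborel B)"
    using \<gamma>(1) by (simp add: power_divide field_simps)
  also have "\<dots> \<le> (2 / \<gamma>) ^ 7 * (LINT x|lebesgue_on I. bub K x)"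
    using J \<gamma>(1) by (intro mult_left_mono) auto
  finally show "measure lebesgue (interior K) \<le> (2 / \<gamma>) ^ 7 * (LINT x|lebesgue_on (interior K). bub K x)"
    using m by (simp add: I_def)
qed

text \<open>The coefficient \<beta> K is the integrated defect of the nodal part divided by the
  bubble integral, which makes the integrals match. Cauchy-Schwarz bounds the squared defect by the
  volume times the integral of w, and the volume is at most Cb times the bubble integral; so the
  bubble term is controlled by w as well. The denominator of the gradient bound is that of the usual
  inverse estimate.\<close>

lemma cell_estimate:
  assumes K: "K \<in> T" and h: "h > 0" "diameter K \<le> h" and \<gamma>: "\<gamma> > 0" "cball x0 (\<gamma> * h) \<subseteq> K"
    and \<phi>: "continuous_on UNIV \<phi>" and w: "integrable (lebesgue_on (interior K)) w"
    and a: "\<And>x v. x \<in> K \<Longrightarrow> v \<in> V K \<Longrightarrow> (\<phi> x - a v)\<^sup>2 \<le> w x"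
    and \<beta>: "\<beta> K = (LINT x|lebesgue_on (interior K). \<phi> x - (\<Sum>v\<in>V K. a v * lam K v x)) / (LINT x|lebesgue_on (interior K). bub K x)"
  defines "Cb \<equiv> (2 / \<gamma>) ^ 7"
  shows "(LINT x|lebesgue_on (interior K). local_fe a \<beta> K x) = (LINT x|lebesgue_on (interior K). \<phi> x)"
    and "(LINT x|lebesgue_on (interior K). (local_fe a \<beta> K x)\<^sup>2)
      \<le> 3 * (LINT x|lebesgue_on (interior K). (\<phi> x)\<^sup>2) + (3 + 3 * Cb\<^sup>2) * (LINT x|lebesgue_on (interior K). w x)"
    and "(LINT x|lebesgue_on (interior K). (\<Sum>i\<in>UNIV. (pd i (local_fe a \<beta> K) x)\<^sup>2))
      \<le> (2 + 24 * Cb\<^sup>2) / (\<gamma> * h)\<^sup>2 * (LINT x|lebesgue_on (interior K). w x)"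
proof -
  interpret t: tetrahedron "V K" "c K" "g K" by (rule tet[OF K])
  define I where "I = interior K"
  have I: "open I" "bounded I" "I \<in> lmeasurable" "I \<in> sets lebesgue"
    using cell(1)[OF K] lmeasurable_open[of I] by (auto simp: I_def compact_imp_bounded bounded_interior)
  interpret finite_measure "lebesgue_on I" by (rule finite_measure_lebesgue_on[OF I(3)])
  have IK: "x \<in> K" if "x \<in> I" for x using that interior_subset by (auto simp: I_def)
  define f where "f x = (\<Sum>v\<in>V K. a v * lam K v x)" for x
  define J where "J = (LINT x|lebesgue_on I. bub K x)"
  define D where "D = (LINT x|lebesgue_on I. \<phi> x - f x)"
  define W where "W = (LINT x|lebesgue_on I. w x)"
  define m where "m = measure lebesgue I"
  have \<beta>D: "\<beta> K = D / J" using \<beta> by (simp add: D_def J_def I_def f_def)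
  have fe: "local_fe a \<beta> K x = f x + \<beta> K * bub K x" for x by (simp add: local_fe_def f_def)
  have fC: "C1 f" unfolding f_def nodal_affine[OF K] by (rule C1_affine)
  have bC: "C1 (bub K)" by (rule t.C1_tet_bubble)
  have ci: "integrable (lebesgue_on I) k" if "continuous_on UNIV k" for k :: "R3 \<Rightarrow> real"
    by (rule continuous_integrable_on[OF I(1,2) that])
  note fc = C1_continuous_on[OF fC] and bc = C1_continuous_on[OF bC]
  have wI: "integrable (lebesgue_on I) w" using w by (simp add: I_def)
  have J: "m \<le> Cb * J" "0 < J"
    using bubble_integral[OF K h \<gamma>] by (auto simp: m_def J_def I_def Cb_def)
  have m0: "0 \<le> m" by (simp add: m_def)
  have meas1: "measure (lebesgue_on I) (space (lebesgue_on I)) = m"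
    using I(4) by (simp add: m_def measure_restrict_space)
  have fw: "(\<phi> x - f x)\<^sup>2 \<le> w x" if "x \<in> I" for x
    unfolding f_def using nodal_estimate(1)[OF K a[OF IK[OF that]] IK[OF that]] .
  have w0: "0 \<le> w x" if "x \<in> I" for x using fw[OF that] zero_le_power2[of "\<phi> x - f x"] by linarith
  show "(LINT x|lebesgue_on (interior K). local_fe a \<beta> K x) = (LINT x|lebesgue_on (interior K). \<phi> x)"
  proof -
    have "(LINT x|lebesgue_on I. f x + \<beta> K * bub K x) = (LINT x|lebesgue_on I. f x) + \<beta> K * J"
      using ci[OF fc] ci[OF bc] by (simp add: J_def)
    also have "\<beta> K * J = (LINT x|lebesgue_on I. \<phi> x) - (LINT x|lebesgue_on I. f x)"
      using J(2) ci[OF fc] ci[OF \<phi>] by (simp add: \<beta>D D_def)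
    finally show ?thesis by (simp add: fe I_def)
  qed
  have D2: "D\<^sup>2 \<le> m * W"
  proof -
    have dc: "continuous_on UNIV (\<lambda>x. \<phi> x - f x)" by (intro continuous_intros \<phi> fc)
    have "D\<^sup>2 = (LINT x|lebesgue_on I. (\<phi> x - f x) \<bullet> 1)\<^sup>2" by (simp add: D_def)
    also have "\<dots> \<le> (LINT x|lebesgue_on I. (norm (\<phi> x - f x))\<^sup>2) * (LINT x|lebesgue_on I. (norm (1::real))\<^sup>2)"
      using ci[OF dc] ci[OF continuous_on_power[OF dc, of 2]] by (intro integral_Cauchy_Schwarz) auto
    also have "(LINT x|lebesgue_on I. (norm (1::real))\<^sup>2) = m" using meas1 by simp
    also have "(LINT x|lebesgue_on I. (norm (\<phi> x - f x))\<^sup>2) * m \<le> W * m"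
      unfolding W_def using ci[OF continuous_on_power[OF dc, of 2]] wI fw m0
      by (intro mult_right_mono integral_mono) auto
    finally show ?thesis by (simp add: mult.commute)
  qed
  have W0: "0 \<le> W" unfolding W_def using w0 by (intro integral_nonneg_AE AE_I2) simp
  have b2: "(\<beta> K)\<^sup>2 * m \<le> Cb\<^sup>2 * W"
  proof -
    have "(\<beta> K)\<^sup>2 * m * J\<^sup>2 = D\<^sup>2 * m" using J(2) by (simp add: \<beta>D power_divide)
    also have "\<dots> \<le> (m * W) * m" using D2 m0 by (intro mult_right_mono) auto
    also have "\<dots> = m\<^sup>2 * W" by (simp add: power2_eq_square)
    also have "\<dots> \<le> (Cb * J)\<^sup>2 * W" using J(1) m0 W0 by (intro mult_right_mono power_mono) auto
    also have "\<dots> = Cb\<^sup>2 * W * J\<^sup>2" by (simp add: power_mult_distrib)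
    finally show ?thesis using J(2) by simp
  qed
  \<comment> \<open>Both remaining estimates have an integrand of this shape: a multiple of w plus a
    multiple of \<open>(\<beta> K)^2\<close>.\<close>
  have c2: "(LINT x|lebesgue_on I. A * w x + (\<beta> K)\<^sup>2 * B) \<le> (A + B * Cb\<^sup>2) * W" if "0 \<le> B" for A B
  proof -
    have "(LINT x|lebesgue_on I. A * w x + (\<beta> K)\<^sup>2 * B) = A * W + B * ((\<beta> K)\<^sup>2 * m)"
      using wI meas1 by (simp add: W_def)
    also have "\<dots> \<le> A * W + B * (Cb\<^sup>2 * W)" using b2 that by (intro add_left_mono mult_left_mono)
    finally show ?thesis by (simp add: algebra_simps)
  qed
  show "(LINT x|lebesgue_on (interior K). (local_fe a \<beta> K x)\<^sup>2)
      \<le> 3 * (LINT x|lebesgue_on (interior K). (\<phi> x)\<^sup>2) + (3 + 3 * Cb\<^sup>2) * (LINT x|lebesgue_on (interior K). w x)"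
  proof -
    have "(LINT x|lebesgue_on I. (local_fe a \<beta> K x)\<^sup>2)
        \<le> (LINT x|lebesgue_on I. 3 * (\<phi> x)\<^sup>2 + (3 * w x + (\<beta> K)\<^sup>2 * 3))"
    proof (rule integral_mono)
      show "integrable (lebesgue_on I) (\<lambda>x. (local_fe a \<beta> K x)\<^sup>2)"
        by (intro ci continuous_intros C1_continuous_on C1_local_fe K)
      show "integrable (lebesgue_on I) (\<lambda>x. 3 * (\<phi> x)\<^sup>2 + (3 * w x + (\<beta> K)\<^sup>2 * 3))"
        using ci[OF continuous_on_power[OF \<phi>, of 2]] wI by simp
      fix x assume "x \<in> space (lebesgue_on I)"
      then have x: "x \<in> I" by simp
      have "(bub K x)\<^sup>2 \<le> 1" using t.tet_bubble_bounds[of x] IK[OF x] hull[OF K] by (auto intro: power_le_one)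
      then have "(\<beta> K * bub K x)\<^sup>2 \<le> (\<beta> K)\<^sup>2" by (simp add: power_mult_distrib mult_left_le)
      moreover have "(local_fe a \<beta> K x)\<^sup>2 \<le> 3 * (\<phi> x)\<^sup>2 + 3 * (\<phi> x - f x)\<^sup>2 + 3 * (\<beta> K * bub K x)\<^sup>2"
      proof -
        have "(p + q + r)\<^sup>2 \<le> 3 * p\<^sup>2 + 3 * q\<^sup>2 + 3 * r\<^sup>2" for p q r :: real
          using zero_le_power2[of "p - q"] zero_le_power2[of "q - r"] zero_le_power2[of "p - r"]
          by (simp add: power2_eq_square algebra_simps)
        from this[of "\<phi> x" "f x - \<phi> x" "\<beta> K * bub K x"] show ?thesis
          by (simp add: fe power2_commute[of "f x"])
      qed
      ultimately show "(local_fe a \<beta> K x)\<^sup>2 \<le> 3 * (\<phi> x)\<^sup>2 + (3 * w x + (\<beta> K)\<^sup>2 * 3)" using fw[OF x] by linarith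
    qed
    also have "\<dots> = 3 * (LINT x|lebesgue_on I. (\<phi> x)\<^sup>2) + (LINT x|lebesgue_on I. 3 * w x + (\<beta> K)\<^sup>2 * 3)"
      using ci[OF continuous_on_power[OF \<phi>, of 2]] wI by (subst Bochner_Integration.integral_add) auto
    also have "\<dots> \<le> 3 * (LINT x|lebesgue_on I. (\<phi> x)\<^sup>2) + (3 + 3 * Cb\<^sup>2) * W" by (intro add_left_mono c2) simp
    finally show ?thesis by (simp add: I_def W_def)
  qed
  show "(LINT x|lebesgue_on (interior K). (\<Sum>i\<in>UNIV. (pd i (local_fe a \<beta> K) x)\<^sup>2))
      \<le> (2 + 24 * Cb\<^sup>2) / (\<gamma> * h)\<^sup>2 * (LINT x|lebesgue_on (interior K). w x)"
  proof -
    define \<rho> where "\<rho> = \<gamma> * h"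
    have \<rho>: "\<rho> > 0" "cball x0 \<rho> \<subseteq> K" using \<gamma> h by (auto simp: \<rho>_def)
    define G where "G = (\<Sum>v\<in>V K. a v *\<^sub>R g K v)"
    have "(LINT x|lebesgue_on I. (\<Sum>i\<in>UNIV. (pd i (local_fe a \<beta> K) x)\<^sup>2))
        \<le> (LINT x|lebesgue_on I. (2 / \<rho>\<^sup>2) * w x + (\<beta> K)\<^sup>2 * (24 / \<rho>\<^sup>2))"
    proof (rule integral_mono)
      show "integrable (lebesgue_on I) (\<lambda>x. \<Sum>i\<in>UNIV. (pd i (local_fe a \<beta> K) x)\<^sup>2)"
        by (intro ci continuous_intros C1_pd_continuous_on C1_local_fe K)
      show "integrable (lebesgue_on I) (\<lambda>x. (2 / \<rho>\<^sup>2) * w x + (\<beta> K)\<^sup>2 * (24 / \<rho>\<^sup>2))" using wI by simp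
      fix x assume "x \<in> space (lebesgue_on I)"
      then have x: "x \<in> I" by simp
      \<comment> \<open>Four factors times the gradient bound 1 / (2 \<rho>).\<close>
      have pb: "\<bar>pd i (bub K) x\<bar> \<le> 2 / \<rho>" for i
        using t.pd_tet_bubble_bound[of x "1 / (2 * \<rho>)" i] IK[OF x] hull[OF K] t.grad_upper(1)[of x0 \<rho>] \<rho> by auto
      \<comment> \<open>The 8 is 2 from the square of a sum times 4 from \<open>pb\<close>; summing
        over three partials makes it 24.\<close>
      have "(pd i (local_fe a \<beta> K) x)\<^sup>2 \<le> 2 * (G $ i)\<^sup>2 + (\<beta> K)\<^sup>2 * (8 / \<rho>\<^sup>2)" for i
      proof -
        have "(pd i (bub K) x)\<^sup>2 \<le> (2 / \<rho>)\<^sup>2" using power_mono[OF pb[of i], of 2] by simp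
        then have "(\<beta> K)\<^sup>2 * (pd i (bub K) x)\<^sup>2 \<le> (\<beta> K)\<^sup>2 * (2 / \<rho>)\<^sup>2" by (rule mult_left_mono) simp
        then have "2 * (\<beta> K * pd i (bub K) x)\<^sup>2 \<le> 2 * ((\<beta> K)\<^sup>2 * (2 / \<rho>)\<^sup>2)"
          by (simp add: power_mult_distrib)
        also have "\<dots> = (\<beta> K)\<^sup>2 * (8 / \<rho>\<^sup>2)" by (simp add: power_divide)
        finally have "2 * (\<beta> K * pd i (bub K) x)\<^sup>2 \<le> (\<beta> K)\<^sup>2 * (8 / \<rho>\<^sup>2)" .
        moreover have "(G $ i + \<beta> K * pd i (bub K) x)\<^sup>2 \<le> 2 * (G $ i)\<^sup>2 + 2 * (\<beta> K * pd i (bub K) x)\<^sup>2"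
          using norm_add_squared_le[of "G $ i" "\<beta> K * pd i (bub K) x"] by simp
        ultimately show ?thesis unfolding pd_local_fe[OF K] G_def[symmetric] by linarith
      qed
      then have "(\<Sum>i\<in>UNIV. (pd i (local_fe a \<beta> K) x)\<^sup>2) \<le> (\<Sum>i\<in>UNIV. 2 * (G $ i)\<^sup>2 + (\<beta> K)\<^sup>2 * (8 / \<rho>\<^sup>2))"
        by (rule sum_mono)
      also have "\<dots> = 2 * (norm G)\<^sup>2 + (\<beta> K)\<^sup>2 * (24 / \<rho>\<^sup>2)"
        by (simp add: sum.distrib sum_distrib_left[symmetric] norm_vec_def L2_set_def sum_nonneg)
      also have "\<dots> \<le> 2 * (w x / \<rho>\<^sup>2) + (\<beta> K)\<^sup>2 * (24 / \<rho>\<^sup>2)"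
      proof -
        have "(norm G)\<^sup>2 \<le> w x / \<rho>\<^sup>2"
          unfolding G_def by (rule nodal_estimate(2)[OF K _ \<rho>(2,1)]) (rule a[OF IK[OF x]])
        then show ?thesis by simp
      qed
      finally show "(\<Sum>i\<in>UNIV. (pd i (local_fe a \<beta> K) x)\<^sup>2) \<le> (2 / \<rho>\<^sup>2) * w x + (\<beta> K)\<^sup>2 * (24 / \<rho>\<^sup>2)" by simp
    qed
    also have "\<dots> \<le> (2 / \<rho>\<^sup>2 + 24 / \<rho>\<^sup>2 * Cb\<^sup>2) * W" by (rule c2) simp
    also have "2 / \<rho>\<^sup>2 + 24 / \<rho>\<^sup>2 * Cb\<^sup>2 = (2 + 24 * Cb\<^sup>2) / \<rho>\<^sup>2" by (simp add: add_divide_distrib)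
    finally show ?thesis by (simp add: I_def W_def \<rho>_def)
  qed
qed

section \<open>The operator on the whole mesh\<close>

text \<open>Each gradient estimate on a cell costs a factor h^(-2). The patch radius is proportional
  to h, so the translation estimate with derivatives returns h^2; for the values the estimate
  without derivatives is enough and no power of h arises.\<close>

lemma fortin_function:
  assumes \<phi>: "\<phi> \<in> test_fun \<Omega>" and h: "h > 0" "\<And>K. K \<in> T \<Longrightarrow> diameter K \<le> h"
    and \<gamma>: "\<gamma> > 0" "\<And>K. K \<in> T \<Longrightarrow> \<exists>x0. cball x0 (\<gamma> * h) \<subseteq> K"
    and \<kappa>: "\<kappa> > 0" "M \<ge> 0" "\<And>z. z \<in> frontier \<Omega> \<Longrightarrow> \<exists>z'. dist z z' \<le> M * h \<and> ball z' (\<kappa> * h) \<inter> \<Omega> = {}"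
  shows "\<exists>u. piecewise_C1 u \<and> (\<forall>x. x \<notin> \<Omega> \<longrightarrow> u x = 0) \<and>
     (\<forall>K\<in>T. \<exists>p\<in>P_deg 1. \<exists>b\<in>B4 K. \<forall>x\<in>K. u x = p x + b x) \<and>
     (\<forall>K\<in>T. (LINT x|lebesgue_on (interior K). u x) = (LINT x|lebesgue_on (interior K). \<phi> x)) \<and>
     (l2_norm \<Omega> u)\<^sup>2 \<le> (3 + 12 * (1 + shape_bound \<gamma>) * patch_ratio \<kappa> M) * (l2_norm \<Omega> \<phi>)\<^sup>2 \<and>
     (\<Sum>i\<in>UNIV. (l2_norm \<Omega> (pd i u))\<^sup>2)
       \<le> ((2 + 24 * shape_bound \<gamma>) / \<gamma>\<^sup>2 * patch_ratio \<kappa> M * (1 + M + \<kappa>)\<^sup>2) * (\<Sum>i\<in>UNIV. (l2_norm \<Omega> (pd i \<phi>))\<^sup>2)"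
proof -
  note dom = open_dom bounded_dom
  \<comment> \<open>From a point of a cell to a vertex it is at most h, from there at most
    \<open>M * h\<close> to the centre of the averaging ball of radius s. Half of
    \<open>\<kappa> * h\<close> is taken for s so that the closed ball fits into the open exterior
    one.\<close>
  define r where "r = (1 + M + \<kappa>) * h"
  define s where "s = \<kappa> * h / 2"
  have rs: "r > 0" "s > 0" using h \<kappa> by (auto simp: r_def s_def)
  define A where "A = measure lborel (cball (0::R3) s)"
  have A: "A > 0" "measure lborel (cball (z::R3) s) = A" for z
  proof -
    show "A > 0" using rs(2) by (simp add: A_def content_cball_pos)
    then show "measure lborel (cball (z::R3) s) = A"
      using content_cball_ratio[OF rs(2) rs(2), of z 0] rs(2) by (simp add: A_def)
  qed
  have \<phi>C1: "C1 \<phi>" by (rule test_fun_D(1)[OF \<phi>])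
  obtain R where R: "\<And>x. norm x > R \<Longrightarrow> \<phi> x = 0" using test_fun_D(3)[OF \<phi>] by blast
  have \<phi>c: "continuous_on S \<phi>" for S by (rule C1_continuous_on[OF \<phi>C1])
  have \<phi>0: "\<phi> x = 0" if "x \<notin> \<Omega>" for x by (rule test_fun_D(4)[OF \<phi> that])
  define avg where "avg z = (\<integral>y. indicator (cball z s) y * \<phi> y \<partial>lborel) / A" for z
  define a where "a z = (if z \<in> \<Omega> then avg z else 0)" for z
  define w where "w x = osc \<phi> r x / A" for x
  have aw: "(\<phi> x - a v)\<^sup>2 \<le> w x" if K: "K \<in> T" and x: "x \<in> K" and v: "v \<in> V K" for K x v
  proof -
    have vK: "v \<in> K" using hull[OF K] hull_inc[of v "V K"] v by metis
    have "\<exists>z'. dist v z' \<le> M * h \<and> a v = avg z'"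
    proof (cases "v \<in> \<Omega>")
      case True
      then show ?thesis using \<kappa>(2) h(1) by (intro exI[of _ v]) (simp add: a_def)
    next
      case False
      then have "v \<in> frontier \<Omega>" using vK K cover open_dom by (auto simp: frontier_def interior_open)
      then obtain z' where z': "dist v z' \<le> M * h" "ball z' (\<kappa> * h) \<inter> \<Omega> = {}" using \<kappa>(3) by blast
      have "cball z' s \<subseteq> ball z' (\<kappa> * h)" using mult_pos_pos[OF \<kappa>(1) h(1)] by (auto simp: s_def)
      then have "y \<notin> \<Omega>" if "y \<in> cball z' s" for y using z'(2) that by blast
      then have z0: "indicator (cball z' s) y * \<phi> y = 0" for y
        using \<phi>0[of y] by (cases "y \<in> cball z' s") auto
      have "avg z' = 0" unfolding avg_def z0 by simp
      then show ?thesis using False z'(1) by (auto simp: a_def)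
    qed
    then obtain z' where z': "dist v z' \<le> M * h" "a v = avg z'" by blast
    have xv: "dist x v \<le> h"
      using diameter_bounded_bound[OF compact_imp_bounded[OF cell(1)[OF K]] x vK] h(2)[OF K] by simp
    have "cball z' s \<subseteq> cball x r"
    proof
      fix y assume "y \<in> cball z' s"
      then have "dist x y \<le> h + M * h + s"
        using xv z'(1) dist_triangle[of x y v] dist_triangle[of v y z'] by simp
      also have "\<dots> \<le> r" using \<kappa>(1) h(1) by (simp add: r_def s_def algebra_simps)
      finally show "y \<in> cball x r" by simp
    qed
    from average_close[OF \<phi>c rs(2) this] show ?thesis by (simp add: A(2) avg_def z'(2) w_def)
  qed
  have \<phi>m: "integrable lebesgue (osc \<phi> r) \<and> (LINT x|lebesgue. osc \<phi> r x) \<le> measure lborel (cball (0::R3) r) * c0"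
    if c0: "\<And>w. norm w \<le> r \<Longrightarrow> (\<integral>\<^sup>+x. ennreal ((\<phi> x - \<phi> (x + w))\<^sup>2) \<partial>lborel) \<le> ennreal c0" "0 \<le> c0" for c0
  proof -
    note O = osc_integrable[OF \<phi>c c0]
    show ?thesis using O borel_measurable_integrable[OF O(1)]
      by (simp add: integrable_completion integral_completion)
  qed
  have lebint: "(\<integral>x. (k x)\<^sup>2 \<partial>lborel) = (l2_norm \<Omega> k)\<^sup>2"
    if k: "continuous_on UNIV k" "\<And>x. x \<notin> \<Omega> \<Longrightarrow> k x = 0" for k :: "R3 \<Rightarrow> real"
  proof -
    have "(l2_norm \<Omega> k)\<^sup>2 = (LINT x|lebesgue_on \<Omega>. (k x)\<^sup>2)" by (simp add: l2_norm_squared)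
    also have "\<dots> = (LINT x|lebesgue. (k x)\<^sup>2)"
      using dom_lmeasurable(2)[OF dom] k(2) by (intro integral_lebesgue_on_eq) auto
    also have "\<dots> = (\<integral>x. (k x)\<^sup>2 \<partial>lborel)"
      using borel_measurable_continuous_onI[OF k(1)] by (intro integral_completion) simp
    finally show ?thesis by simp
  qed
  have W: "integrable (lebesgue_on \<Omega>) w \<and> (LINT x|lebesgue_on \<Omega>. w x) \<le> patch_ratio \<kappa> M * c0"
    if c0: "\<And>w. norm w \<le> r \<Longrightarrow> (\<integral>\<^sup>+x. ennreal ((\<phi> x - \<phi> (x + w))\<^sup>2) \<partial>lborel) \<le> ennreal c0" "0 \<le> c0" for c0
  proof -
    have I: "integrable lebesgue w" unfolding w_def[abs_def] using \<phi>m[OF c0] by simp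
    have w0: "0 \<le> w x" for x using osc_nonneg[OF \<phi>c] A(1) by (simp add: w_def)
    have I\<Omega>: "integrable lebesgue (\<lambda>x. indicator \<Omega> x * w x)"
      using integrable_mult_indicator[OF dom_lmeasurable(2)[OF dom] I] by simp
    have "(LINT x|lebesgue_on \<Omega>. w x) = (LINT x|lebesgue. indicator \<Omega> x * w x)"
      using dom_lmeasurable(2)[OF dom] by (simp add: integral_restrict_space)
    also have "\<dots> \<le> (LINT x|lebesgue. w x)"
      using I I\<Omega> w0 by (intro integral_mono) (auto simp: indicator_def)
    also have "\<dots> = (LINT x|lebesgue. osc \<phi> r x) / A" by (simp add: w_def)
    also have "\<dots> \<le> measure lborel (cball (0::R3) r) * c0 / A" using \<phi>m[OF c0] A(1) by (simp add: divide_right_mono)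
    also have "\<dots> = measure lborel (cball (0::R3) r) / measure lborel (cball (0::R3) s) * c0" by (simp add: A_def)
    also have "\<dots> = patch_ratio \<kappa> M * c0"
      unfolding content_cball_ratio[OF rs(2,1)] using h(1) by (simp add: patch_ratio_def r_def s_def)
    finally show ?thesis using I\<Omega> dom_lmeasurable(2)[OF dom] by (simp add: integrable_restrict_space)
  qed
  \<comment> \<open>First choice of c0, free of h; the 4 comes from the square of a
    difference.\<close>
  have W0: "integrable (lebesgue_on \<Omega>) w" "(LINT x|lebesgue_on \<Omega>. w x) \<le> patch_ratio \<kappa> M * (4 * (l2_norm \<Omega> \<phi>)\<^sup>2)"
    using W[of "4 * (l2_norm \<Omega> \<phi>)\<^sup>2"] translation_estimate_0[OF \<phi>c R] lebint[OF \<phi>c \<phi>0] by auto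
  define E where "E = (\<Sum>i\<in>UNIV. (l2_norm \<Omega> (pd i \<phi>))\<^sup>2)"
  have E0: "0 \<le> E" by (simp add: E_def sum_nonneg)
  \<comment> \<open>Second choice of c0: shifts of length at most r contribute the factor r^2, hence
    h^2.\<close>
  have W1: "(LINT x|lebesgue_on \<Omega>. w x) \<le> patch_ratio \<kappa> M * (r\<^sup>2 * E)"
  proof -
    have "(\<integral>\<^sup>+x. ennreal ((\<phi> x - \<phi> (x + w))\<^sup>2) \<partial>lborel) \<le> ennreal (r\<^sup>2 * E)" if "norm w \<le> r" for w
    proof -
      have "(\<Sum>i\<in>UNIV. \<integral>x. (pd i \<phi> x)\<^sup>2 \<partial>lborel) = E"
        unfolding E_def using test_fun_D(5)[OF \<phi>] by (intro sum.cong refl lebint C1_pd_continuous_on[OF \<phi>C1])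
      then have "(\<integral>\<^sup>+x. ennreal ((\<phi> x - \<phi> (x + w))\<^sup>2) \<partial>lborel) \<le> ennreal ((norm w)\<^sup>2 * E)"
        using translation_estimate[OF \<phi>C1 R, where w=w] by simp
      also have "\<dots> \<le> ennreal (r\<^sup>2 * E)" using that E0 by (intro ennreal_leI mult_right_mono power_mono) auto
      finally show ?thesis .
    qed
    then show ?thesis using W[of "r\<^sup>2 * E"] E0 by auto
  qed
  define \<beta> where "\<beta> K = (LINT x|lebesgue_on (interior K). \<phi> x - (\<Sum>v\<in>V K. a v * lam K v x)) / (LINT x|lebesgue_on (interior K). bub K x)" for K
  have wK: "integrable (lebesgue_on (interior K)) w" if K: "K \<in> T" for K
  proof -
    have "integrable lebesgue (\<lambda>x. indicator (interior K) x * (indicator \<Omega> x * w x))"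
      using W0(1) dom_lmeasurable(2)[OF dom] integrable_mult_indicator[of "interior K" lebesgue "\<lambda>x. indicator \<Omega> x * w x"]
      by (simp add: integrable_restrict_space)
    moreover have "(\<lambda>x. indicator (interior K) x * (indicator \<Omega> x * w x)) = (\<lambda>x. indicator (interior K) x * w x)"
      using cell(4)[OF K] by (auto simp: indicator_def fun_eq_iff)
    ultimately show ?thesis by (simp add: integrable_restrict_space)
  qed
  obtain u where u: "piecewise_C1 u" "\<And>x. x \<notin> \<Omega> \<Longrightarrow> u x = 0" "\<And>K x. K \<in> T \<Longrightarrow> x \<in> K \<Longrightarrow> u x = local_fe a \<beta> K x"
    using fe_function[of a \<beta>] by (auto simp: a_def)
  have est: "(LINT x|lebesgue_on (interior K). u x) = (LINT x|lebesgue_on (interior K). \<phi> x)"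
    "(LINT x|lebesgue_on (interior K). (u x)\<^sup>2) \<le> 3 * (LINT x|lebesgue_on (interior K). (\<phi> x)\<^sup>2)
        + (3 + 3 * shape_bound \<gamma>) * (LINT x|lebesgue_on (interior K). w x)"
    "(LINT x|lebesgue_on (interior K). (\<Sum>i\<in>UNIV. (pd i u x)\<^sup>2))
        \<le> (2 + 24 * shape_bound \<gamma>) / (\<gamma> * h)\<^sup>2 * (LINT x|lebesgue_on (interior K). w x)" if K: "K \<in> T" for K
  proof -
    obtain x0 where x0: "cball x0 (\<gamma> * h) \<subseteq> K" using \<gamma>(2)[OF K] by blast
    have uK: "u x = local_fe a \<beta> K x" if "x \<in> interior K" for x
      using u(3)[OF K, of x] interior_subset[of K] that by blast
    have pK: "pd i u x = pd i (local_fe a \<beta> K) x" if "x \<in> interior K" for i x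
    proof (rule pd_cong)
      have "\<forall>\<^sub>F y in nhds x. y \<in> interior K" using that by (intro eventually_nhds_in_open) auto
      then show "\<forall>\<^sub>F y in nhds x. u y = local_fe a \<beta> K y" by eventually_elim (rule uK)
    qed
    note ce = cell_estimate[where K=K and \<phi>=\<phi> and w=w and a=a and \<beta>=\<beta>,
        OF K h(1) h(2)[OF K] \<gamma>(1) x0 \<phi>c wK[OF K] aw[OF K] \<beta>_def[of K], folded shape_bound_def]
    have e1: "(LINT x|lebesgue_on (interior K). k (u x)) = (LINT x|lebesgue_on (interior K). k (local_fe a \<beta> K x))" for k :: "real \<Rightarrow> real"
      by (rule Bochner_Integration.integral_cong) (auto simp: uK)
    have e2: "(LINT x|lebesgue_on (interior K). (\<Sum>i\<in>UNIV. (pd i u x)\<^sup>2)) = (LINT x|lebesgue_on (interior K). (\<Sum>i\<in>UNIV. (pd i (local_fe a \<beta> K) x)\<^sup>2))"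
      by (rule Bochner_Integration.integral_cong) (auto simp: pK)
    show "(LINT x|lebesgue_on (interior K). u x) = (LINT x|lebesgue_on (interior K). \<phi> x)"
      using ce(1) e1[of "\<lambda>t. t"] by simp
    show "(LINT x|lebesgue_on (interior K). (u x)\<^sup>2) \<le> 3 * (LINT x|lebesgue_on (interior K). (\<phi> x)\<^sup>2)
        + (3 + 3 * shape_bound \<gamma>) * (LINT x|lebesgue_on (interior K). w x)"
      using ce(2) e1[of "\<lambda>t. t\<^sup>2"] by simp
    show "(LINT x|lebesgue_on (interior K). (\<Sum>i\<in>UNIV. (pd i u x)\<^sup>2))
        \<le> (2 + 24 * shape_bound \<gamma>) / (\<gamma> * h)\<^sup>2 * (LINT x|lebesgue_on (interior K). w x)"
      using ce(3) e2 by simp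
  qed
  have sb: "0 \<le> shape_bound \<gamma>" by (simp add: shape_bound_def)
  have L2i: "integrable (lebesgue_on \<Omega>) (\<lambda>x. (k x)\<^sup>2)" if "k \<in> L2 \<Omega>" for k :: "R3 \<Rightarrow> real"
    using L2_D(2)[OF that] by simp
  have uL: "u \<in> L2 \<Omega>" "pd i u \<in> L2 \<Omega>" for i using piecewise_C1_L2[OF dom u(1)] by auto
  have "(l2_norm \<Omega> u)\<^sup>2 = (\<Sum>K\<in>T. LINT x|lebesgue_on (interior K). (u x)\<^sup>2)"
    using integral_sum_cells[OF L2i[OF uL(1)]] by (simp add: l2_norm_squared)
  also have "\<dots> \<le> (\<Sum>K\<in>T. 3 * (LINT x|lebesgue_on (interior K). (\<phi> x)\<^sup>2)
        + (3 + 3 * shape_bound \<gamma>) * (LINT x|lebesgue_on (interior K). w x))"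
    by (rule sum_mono) (rule est(2))
  also have "\<dots> = 3 * (l2_norm \<Omega> \<phi>)\<^sup>2 + (3 + 3 * shape_bound \<gamma>) * (LINT x|lebesgue_on \<Omega>. w x)"
    using integral_sum_cells[OF L2i[OF test_fun_L2(1)[OF dom \<phi>]]] integral_sum_cells[OF W0(1)]
    by (simp add: l2_norm_squared sum.distrib sum_distrib_left[symmetric])
  also have "\<dots> \<le> 3 * (l2_norm \<Omega> \<phi>)\<^sup>2 + (3 + 3 * shape_bound \<gamma>) * (patch_ratio \<kappa> M * (4 * (l2_norm \<Omega> \<phi>)\<^sup>2))"
    using W0(2) sb by (intro add_left_mono mult_left_mono) auto
  also have "\<dots> = (3 + 12 * (1 + shape_bound \<gamma>) * patch_ratio \<kappa> M) * (l2_norm \<Omega> \<phi>)\<^sup>2"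
    by (simp add: algebra_simps)
  finally have n1: "(l2_norm \<Omega> u)\<^sup>2 \<le> (3 + 12 * (1 + shape_bound \<gamma>) * patch_ratio \<kappa> M) * (l2_norm \<Omega> \<phi>)\<^sup>2" .
  have "(\<Sum>i\<in>UNIV. (l2_norm \<Omega> (pd i u))\<^sup>2) = (LINT x|lebesgue_on \<Omega>. (\<Sum>i\<in>UNIV. (pd i u x)\<^sup>2))"
    using L2i[OF uL(2)] by (simp add: l2_norm_squared)
  also have "\<dots> = (\<Sum>K\<in>T. LINT x|lebesgue_on (interior K). (\<Sum>i\<in>UNIV. (pd i u x)\<^sup>2))"
    using L2i[OF uL(2)] by (intro integral_sum_cells) auto
  also have "\<dots> \<le> (\<Sum>K\<in>T. (2 + 24 * shape_bound \<gamma>) / (\<gamma> * h)\<^sup>2 * (LINT x|lebesgue_on (interior K). w x))"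
    by (rule sum_mono) (rule est(3))
  also have "\<dots> = (2 + 24 * shape_bound \<gamma>) / (\<gamma> * h)\<^sup>2 * (LINT x|lebesgue_on \<Omega>. w x)"
    unfolding integral_sum_cells[OF W0(1)] by (rule sum_distrib_left[symmetric])
  also have "\<dots> \<le> (2 + 24 * shape_bound \<gamma>) / (\<gamma> * h)\<^sup>2 * (patch_ratio \<kappa> M * (r\<^sup>2 * E))"
    using W1 sb by (intro mult_left_mono) auto
  \<comment> \<open>r^2 / h^2 is \<open>(1 + M + \<kappa>)^2\<close>: the mesh size drops
    out.\<close>
  also have "\<dots> = ((2 + 24 * shape_bound \<gamma>) / \<gamma>\<^sup>2 * patch_ratio \<kappa> M * (1 + M + \<kappa>)\<^sup>2) * E"
    using h(1) by (simp add: r_def power_mult_distrib)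
  finally have n2: "(\<Sum>i\<in>UNIV. (l2_norm \<Omega> (pd i u))\<^sup>2)
     \<le> ((2 + 24 * shape_bound \<gamma>) / \<gamma>\<^sup>2 * patch_ratio \<kappa> M * (1 + M + \<kappa>)\<^sup>2) * E" .
  have poly: "\<exists>p\<in>P_deg 1. \<exists>b\<in>B4 K. \<forall>x\<in>K. u x = p x + b x" if K: "K \<in> T" for K
    using nodal_P_deg[OF K, of a] bub_B4[OF K, of "\<beta> K"] u(3)[OF K]
    by (intro bexI[of _ "\<lambda>x. \<Sum>v\<in>V K. a v * lam K v x"] bexI[of _ "\<lambda>x. \<beta> K * bub K x"]) (auto simp: local_fe_def)
  show ?thesis using u(1,2) poly est(1) n1 n2 unfolding E_def by (intro exI[of _ u] conjI) auto
qed

end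

section \<open>Weak divergence and weak curl\<close>

text \<open>D i j stands for the i-th partial of component j; leaving D open lets classical and weak
  partials share one formula.\<close>

definition curl_matrix :: "(3 \<Rightarrow> 3 \<Rightarrow> R3 \<Rightarrow> real) \<Rightarrow> R3 \<Rightarrow> R3" where
  "curl_matrix D x = vector [D 2 3 x - D 3 2 x, D 3 1 x - D 1 3 x, D 1 2 x - D 2 1 x]"

lemma curl_matrix_component:
  "curl_matrix D x $ 1 = D 2 3 x - D 3 2 x" "curl_matrix D x $ 2 = D 3 1 x - D 1 3 x"
  "curl_matrix D x $ 3 = D 1 2 x - D 2 1 x"
  by (simp_all add: curl_matrix_def)

lemma curl_eq_curl_matrix: "curl \<phi> = curl_matrix (\<lambda>i j. pd i (\<lambda>y. \<phi> y $ j))"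
  by (simp add: fun_eq_iff curl_def curl_matrix_def)

lemma zero_test_fun: "(\<lambda>x. 0) \<in> test_fun \<Omega>"
proof -
  have "smooth (\<lambda>x. 0)" by (rule elem_smooth_imp_smooth[OF elem_smooth.const])
  then show ?thesis by (auto simp: test_fun_def intro!: exI[of _ "{}"])
qed

lemma single_test_field:
  assumes "\<phi> \<in> test_fun \<Omega>" shows "(\<lambda>x. \<chi> i. if i = k then \<phi> x else 0) \<in> test_field \<Omega>"
  unfolding test_field_def
proof (intro CollectI allI)
  fix i show "(\<lambda>x. (\<chi> i. if i = k then \<phi> x else 0) $ i) \<in> test_fun \<Omega>"
    using assms zero_test_fun by (cases "i = k") auto
qed

lemma l2_norm_squared_le_diff:
  assumes "a \<in> L2 \<Omega>" "b \<in> L2 \<Omega>"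
  shows "(l2_norm \<Omega> b)\<^sup>2 \<le> 2 * (l2_norm \<Omega> a)\<^sup>2 + 2 * (l2_norm \<Omega> (\<lambda>x. a x - b x))\<^sup>2"
  using l2_norm_add_squared[OF assms(1) L2_minus[OF L2_diff[OF assms]]]
  by (simp add: l2_norm_squared norm_minus_commute)

lemma l2_inner_restrict:
  assumes "\<Omega>' \<subseteq> \<Omega>" "\<Omega> \<in> sets lebesgue" "\<Omega>' \<in> sets lebesgue" "\<And>x. x \<notin> \<Omega>' \<Longrightarrow> \<phi> x = 0"
  shows "l2_inner \<Omega> f \<phi> = l2_inner \<Omega>' f \<phi>"
proof -
  have "\<phi> x = 0" if "x \<notin> \<Omega>" for x using that assms by blast
  then show ?thesis unfolding l2_inner_def using assms
    by (simp add: integral_lebesgue_on_eq)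
qed

context
  fixes \<Omega> :: "R3 set"
  assumes dom: "open \<Omega>" "bounded \<Omega>"
begin

lemma test_field_component: "\<eta> \<in> test_field \<Omega> \<Longrightarrow> (\<lambda>x. \<eta> x $ i) \<in> test_fun \<Omega>"
  by (simp add: test_field_def)

lemma test_field_L2: "\<eta> \<in> test_field \<Omega> \<Longrightarrow> \<eta> \<in> L2 \<Omega>"
  by (intro L2_vec test_fun_L2(1)[OF dom] test_field_component)

lemma curl_matrix_L2:
  assumes "\<And>i j. D i j \<in> L2 \<Omega>" shows "curl_matrix D \<in> L2 \<Omega>"
proof (rule L2_vec)
  fix i :: 3
  show "(\<lambda>x. curl_matrix D x $ i) \<in> L2 \<Omega>"
    using exhaust_3[of i] assms by (auto simp: curl_matrix_component intro!: L2_diff)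
qed

lemma curl_test_field_L2: "\<eta> \<in> test_field \<Omega> \<Longrightarrow> curl \<eta> \<in> L2 \<Omega>"
  unfolding curl_eq_curl_matrix by (intro curl_matrix_L2 test_fun_L2(2)[OF dom] test_field_component)

lemma is_weak_curl_curl_matrix:
  assumes q: "q \<in> L2 \<Omega>" and D: "\<And>i j. is_weak_partial \<Omega> i (\<lambda>x. q x $ j) (D i j)"
  shows "is_weak_curl \<Omega> q (curl_matrix D)"
  unfolding is_weak_curl_def
proof (intro conjI ballI)
  have DL: "D i j \<in> L2 \<Omega>" for i j using D[of i j] by (simp add: is_weak_partial_def)
  show cL: "curl_matrix D \<in> L2 \<Omega>" using DL by (rule curl_matrix_L2)
  fix \<eta> assume \<eta>: "\<eta> \<in> test_field \<Omega>"
  define t where "t j = (\<lambda>x. \<eta> x $ j)" for j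
  have t: "t j \<in> test_fun \<Omega>" for j using test_field_component[OF \<eta>] by (simp add: t_def)
  have tL: "t j \<in> L2 \<Omega>" "pd i (t j) \<in> L2 \<Omega>" for i j using test_fun_L2[OF dom t] by auto
  have qL: "(\<lambda>x. q x $ j) \<in> L2 \<Omega>" for j by (rule L2_component[OF q])
  have w: "l2_inner \<Omega> (\<lambda>x. q x $ j) (pd i (t k)) = - l2_inner \<Omega> (D i j) (t k)" for i j k
    using D[of i j] t[of k] by (simp add: is_weak_partial_def)
  have d2: "l2_inner \<Omega> f (\<lambda>x. a x - b x) = l2_inner \<Omega> f a - l2_inner \<Omega> f b"
    if "f \<in> L2 \<Omega>" "a \<in> L2 \<Omega>" "b \<in> L2 \<Omega>" for f a b :: "R3 \<Rightarrow> real"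
    using l2_inner_diff[OF that(2,3,1)] by (simp add: l2_inner_commute)
  have "l2_inner \<Omega> q (curl \<eta>) = (\<Sum>i\<in>UNIV. l2_inner \<Omega> (\<lambda>x. q x $ i) (\<lambda>x. curl \<eta> x $ i))"
    by (rule l2_inner_vec[OF q curl_test_field_L2[OF \<eta>]])
  also have "\<dots> = (\<Sum>i\<in>UNIV. l2_inner \<Omega> (\<lambda>x. curl_matrix D x $ i) (\<lambda>x. \<eta> x $ i))"
    unfolding curl_eq_curl_matrix t_def[symmetric]
    by (simp add: sum_3 curl_matrix_component d2[OF qL tL(2) tL(2)] w l2_inner_diff[OF DL DL tL(1)])
  also have "\<dots> = l2_inner \<Omega> (curl_matrix D) \<eta>"
    by (rule l2_inner_vec[OF cL test_field_L2[OF \<eta>], symmetric])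
  finally show "l2_inner \<Omega> q (curl \<eta>) = l2_inner \<Omega> (curl_matrix D) \<eta>" .
qed

text \<open>Test fields with a single non-zero component reduce this to scalar test
  functions.\<close>

lemma is_weak_curl_unique:
  assumes "is_weak_curl \<Omega> q a" "is_weak_curl \<Omega> q b"
  shows "AE x in lebesgue_on \<Omega>. a x = b x"
proof -
  have L: "a \<in> L2 \<Omega>" "b \<in> L2 \<Omega>" using assms by (auto simp: is_weak_curl_def)
  have "AE x in lebesgue_on \<Omega>. a x $ k = b x $ k" for k
  proof (rule AE_eq_if_equal_on_test_funs[OF dom L2_component[OF L(1)] L2_component[OF L(2)]])
    fix \<phi> assume \<phi>: "\<phi> \<in> test_fun \<Omega>"
    define \<eta> :: "R3 \<Rightarrow> R3" where "\<eta> x = (\<chi> i. if i = k then \<phi> x else 0)" for x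
    have \<eta>: "\<eta> \<in> test_field \<Omega>" unfolding \<eta>_def by (rule single_test_field[OF \<phi>])
    have e: "l2_inner \<Omega> c \<eta> = l2_inner \<Omega> (\<lambda>x. c x $ k) \<phi>" for c
      unfolding l2_inner_def
      by (rule Bochner_Integration.integral_cong)
         (simp_all add: \<eta>_def inner_vec_def if_distrib if_distribR sum.delta cong: if_cong)
    have "l2_inner \<Omega> a \<eta> = l2_inner \<Omega> b \<eta>" using assms \<eta> by (metis is_weak_curl_def)
    then show "l2_inner \<Omega> (\<lambda>x. a x $ k) \<phi> = l2_inner \<Omega> (\<lambda>x. b x $ k) \<phi>" by (simp add: e)
  qed
  then have "AE x in lebesgue_on \<Omega>. \<forall>k. a x $ k = b x $ k" by (simp add: AE_all_countable)
  then show ?thesis by eventually_elim (simp add: vec_eq_iff)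
qed

lemma weak_curl_AE:
  assumes "is_weak_curl \<Omega> q a"
  shows "is_weak_curl \<Omega> q (weak_curl \<Omega> q)" "AE x in lebesgue_on \<Omega>. weak_curl \<Omega> q x = a x"
    "weak_curl \<Omega> q \<in> L2 \<Omega>"
proof -
  show w: "is_weak_curl \<Omega> q (weak_curl \<Omega> q)"
    unfolding weak_curl_def using assms by (rule someI[of "is_weak_curl \<Omega> q"])
  from is_weak_curl_unique[OF w assms] show "AE x in lebesgue_on \<Omega>. weak_curl \<Omega> q x = a x" .
  show "weak_curl \<Omega> q \<in> L2 \<Omega>" using w by (simp add: is_weak_curl_def)
qed

lemma is_weak_div_sum:
  assumes q: "q \<in> L2 \<Omega>" and D: "\<And>i. is_weak_partial \<Omega> i (\<lambda>x. q x $ i) (D i)"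
  shows "is_weak_div \<Omega> q (\<lambda>x. \<Sum>i\<in>UNIV. D i x)"
  unfolding is_weak_div_def
proof (intro conjI ballI)
  have DL: "D i \<in> L2 \<Omega>" for i using D[of i] by (simp add: is_weak_partial_def)
  then show "(\<lambda>x. \<Sum>i\<in>UNIV. D i x) \<in> L2 \<Omega>" by (intro L2_sum) auto
  fix \<phi> assume \<phi>: "\<phi> \<in> test_fun \<Omega>"
  have "(\<lambda>x. \<chi> i. pd i \<phi> x) \<in> L2 \<Omega>" by (rule L2_vec) (simp add: test_fun_L2(2)[OF dom \<phi>])
  then have "l2_inner \<Omega> q (\<lambda>x. \<chi> i. pd i \<phi> x) = (\<Sum>i\<in>UNIV. l2_inner \<Omega> (\<lambda>x. q x $ i) (pd i \<phi>))"
    using l2_inner_vec[OF q] by simp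
  also have "\<dots> = - (\<Sum>i\<in>UNIV. l2_inner \<Omega> (D i) \<phi>)"
    using D \<phi> by (simp add: is_weak_partial_def sum_negf)
  also have "(\<Sum>i\<in>UNIV. l2_inner \<Omega> (D i) \<phi>) = l2_inner \<Omega> (\<lambda>x. \<Sum>i\<in>UNIV. D i x) \<phi>"
    using L2_inner_integrable[OF DL test_fun_L2(1)[OF dom \<phi>]]
    by (simp add: l2_inner_def sum_distrib_right Bochner_Integration.integral_sum)
  finally show "l2_inner \<Omega> q (\<lambda>x. \<chi> i. pd i \<phi> x) = - l2_inner \<Omega> (\<lambda>x. \<Sum>i\<in>UNIV. D i x) \<phi>" .
qed

lemma is_weak_div_unique:
  assumes "is_weak_div \<Omega> q a" "is_weak_div \<Omega> q b"
  shows "AE x in lebesgue_on \<Omega>. a x = b x"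
  using assms by (intro AE_eq_if_equal_on_test_funs[OF dom]) (auto simp: is_weak_div_def)

lemma H1_field_weak_partials:
  assumes "q \<in> H1_field \<Omega>"
  shows "q \<in> L2 \<Omega>" "\<exists>D. \<forall>i j. is_weak_partial \<Omega> i (\<lambda>x. q x $ j) (D i j)"
proof -
  have h: "(\<lambda>x. q x $ j) \<in> H1 \<Omega>" for j using assms by (simp add: H1_field_def)
  then show "q \<in> L2 \<Omega>" by (intro L2_vec) (simp add: H1_def)
  have "\<exists>v. is_weak_partial \<Omega> i (\<lambda>x. q x $ j) v" for i j using h[of j] by (simp add: H1_def)
  then have "is_weak_partial \<Omega> i (\<lambda>x. q x $ j) (SOME v. is_weak_partial \<Omega> i (\<lambda>x. q x $ j) v)" for i j
    by (rule someI_ex)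
  then show "\<exists>D. \<forall>i j. is_weak_partial \<Omega> i (\<lambda>x. q x $ j) (D i j)"
    by (rule_tac x="\<lambda>i j. SOME v. is_weak_partial \<Omega> i (\<lambda>x. q x $ j) v" in exI) simp
qed

lemma H01_field_H1_field: "q \<in> H01_field \<Omega> \<Longrightarrow> q \<in> H1_field \<Omega>"
  by (simp add: H01_field_def H1_field_def H01_def)

lemma grad_norm_squared:
  assumes "\<And>i j. is_weak_partial \<Omega> i (\<lambda>x. q x $ j) (D i j)"
  shows "(grad_norm \<Omega> q)\<^sup>2 = (\<Sum>j\<in>UNIV. \<Sum>i\<in>UNIV. (l2_norm \<Omega> (D i j))\<^sup>2)"
  unfolding grad_norm_def using l2_norm_weak_grad_squared(2)[OF dom assms] by (simp add: sum_nonneg)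

section \<open>Density of test fields\<close>

text \<open>The components are approximated separately with tolerance e, so the values of the three
  together are off by at most \<open>3 * e^2\<close>.\<close>

lemma H01_field_approx:
  assumes \<psi>: "\<psi> \<in> H01_field \<Omega>" and D: "\<And>i j. is_weak_partial \<Omega> i (\<lambda>x. \<psi> x $ j) (D i j)" and "e > 0"
  shows "\<exists>\<eta>\<in>test_field \<Omega>. (l2_norm \<Omega> (\<lambda>x. \<psi> x - \<eta> x))\<^sup>2 \<le> 3 * e\<^sup>2 \<and>
    (\<forall>j. (\<Sum>i\<in>UNIV. (l2_norm \<Omega> (\<lambda>x. D i j x - pd i (\<lambda>y. \<eta> y $ j) x))\<^sup>2) \<le> e\<^sup>2)"
proof -
  have "\<exists>\<phi>\<in>test_fun \<Omega>. H1_norm \<Omega> (\<lambda>x. \<psi> x $ j - \<phi> x) < e" for j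
    using \<psi> \<open>e > 0\<close> unfolding H01_field_def H01_def by blast
  then obtain \<phi> where \<phi>: "\<And>j. \<phi> j \<in> test_fun \<Omega>" "\<And>j. H1_norm \<Omega> (\<lambda>x. \<psi> x $ j - \<phi> j x) < e" by metis
  define \<eta> :: "R3 \<Rightarrow> R3" where "\<eta> x = (\<chi> j. \<phi> j x)" for x
  have \<eta>j: "(\<lambda>y. \<eta> y $ j) = \<phi> j" for j by (simp add: \<eta>_def)
  have \<eta>: "\<eta> \<in> test_field \<Omega>" unfolding test_field_def using \<phi>(1) by (simp add: \<eta>j)
  have \<psi>L: "\<psi> \<in> L2 \<Omega>" by (rule H1_field_weak_partials(1)[OF H01_field_H1_field[OF \<psi>]])
  have b: "(l2_norm \<Omega> (\<lambda>x. \<psi> x $ j - \<phi> j x))\<^sup>2 + (\<Sum>i\<in>UNIV. (l2_norm \<Omega> (\<lambda>x. D i j x - pd i (\<phi> j) x))\<^sup>2) \<le> e\<^sup>2" for j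
  proof -
    have "is_weak_partial \<Omega> i (\<lambda>x. \<psi> x $ j - \<phi> j x) (\<lambda>x. D i j x - pd i (\<phi> j) x)" for i
      by (intro is_weak_partial_diff[OF dom] L2_component[OF \<psi>L] test_fun_L2[OF dom \<phi>(1)] D
          is_weak_partial_pd[OF dom] test_fun_piecewise_C1[OF \<phi>(1)])
    from H1_norm_squared[OF dom this]
    have "(l2_norm \<Omega> (\<lambda>x. \<psi> x $ j - \<phi> j x))\<^sup>2 + (\<Sum>i\<in>UNIV. (l2_norm \<Omega> (\<lambda>x. D i j x - pd i (\<phi> j) x))\<^sup>2)
        = (H1_norm \<Omega> (\<lambda>x. \<psi> x $ j - \<phi> j x))\<^sup>2" by simp
    also have "\<dots> \<le> e\<^sup>2" using \<phi>(2)[of j] by (intro power_mono) (auto simp: H1_norm_def)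
    finally show ?thesis .
  qed
  have nn: "0 \<le> (\<Sum>i\<in>UNIV. (l2_norm \<Omega> (\<lambda>x. D i j x - pd i (\<phi> j) x))\<^sup>2)" for j by (simp add: sum_nonneg)
  have "(l2_norm \<Omega> (\<lambda>x. \<psi> x - \<eta> x))\<^sup>2 = (\<Sum>j\<in>UNIV. (l2_norm \<Omega> (\<lambda>x. \<psi> x $ j - \<phi> j x))\<^sup>2)"
    using l2_norm_vec_squared[OF L2_diff[OF \<psi>L test_field_L2[OF \<eta>]]] by (simp add: \<eta>_def)
  also have "\<dots> \<le> (\<Sum>j\<in>(UNIV::3 set). e\<^sup>2)"
  proof (rule sum_mono)
    fix j show "(l2_norm \<Omega> (\<lambda>x. \<psi> x $ j - \<phi> j x))\<^sup>2 \<le> e\<^sup>2" using b[of j] nn[of j] by linarith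
  qed
  finally have 1: "(l2_norm \<Omega> (\<lambda>x. \<psi> x - \<eta> x))\<^sup>2 \<le> 3 * e\<^sup>2" by simp
  have "(\<Sum>i\<in>UNIV. (l2_norm \<Omega> (\<lambda>x. D i j x - pd i (\<phi> j) x))\<^sup>2) \<le> e\<^sup>2" for j
    using b[of j] zero_le_power2[of "l2_norm \<Omega> (\<lambda>x. \<psi> x $ j - \<phi> j x)"] by linarith
  then show ?thesis using 1 \<eta> by (intro bexI[of _ \<eta>]) (auto simp: \<eta>j)
qed

text \<open>For test fields this is the definition of the weak curl of q, and density does the rest.
  It turns both forms of \<open>b1\<close> into the same pairing with the curl of q.\<close>

lemma weak_curl_symmetric:
  assumes \<psi>: "\<psi> \<in> H01_field \<Omega>" and q: "q \<in> L2 \<Omega>" and c: "is_weak_curl \<Omega> q c"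
  shows "l2_inner \<Omega> (weak_curl \<Omega> \<psi>) q = l2_inner \<Omega> \<psi> c"
proof -
  obtain D where D: "\<And>i j. is_weak_partial \<Omega> i (\<lambda>x. \<psi> x $ j) (D i j)" and \<psi>L: "\<psi> \<in> L2 \<Omega>"
    using H1_field_weak_partials[OF H01_field_H1_field[OF \<psi>]] by blast
  have DL: "D i j \<in> L2 \<Omega>" for i j using D[of i j] by (simp add: is_weak_partial_def)
  have cL: "c \<in> L2 \<Omega>" using c by (simp add: is_weak_curl_def)
  note wc = weak_curl_AE[OF is_weak_curl_curl_matrix[OF \<psi>L D]]
  have e1: "l2_inner \<Omega> (weak_curl \<Omega> \<psi>) q = l2_inner \<Omega> (curl_matrix D) q"
    using wc(2,3) curl_matrix_L2[OF DL] q by (intro l2_inner_cong_AE) (auto simp: L2_def)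
  define C where "C = 4 * l2_norm \<Omega> q + 4 * l2_norm \<Omega> c"
  have main: "\<bar>l2_inner \<Omega> (curl_matrix D) q - l2_inner \<Omega> \<psi> c\<bar> \<le> e * C" if e: "e > 0" for e
  proof -
    obtain \<eta> where \<eta>: "\<eta> \<in> test_field \<Omega>" "(l2_norm \<Omega> (\<lambda>x. \<psi> x - \<eta> x))\<^sup>2 \<le> 3 * e\<^sup>2"
      "\<And>j. (\<Sum>i\<in>UNIV. (l2_norm \<Omega> (\<lambda>x. D i j x - pd i (\<lambda>y. \<eta> y $ j) x))\<^sup>2) \<le> e\<^sup>2"
      using H01_field_approx[OF \<psi> D e] by blast
    define t where "t j = (\<lambda>x. \<eta> x $ j)" for j
    define P where "P i j = (\<lambda>x. D i j x - pd i (t j) x)" for i j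
    have tL: "pd i (t j) \<in> L2 \<Omega>" for i j
      unfolding t_def by (rule test_fun_L2(2)[OF dom test_field_component[OF \<eta>(1)]])
    have PL: "P i j \<in> L2 \<Omega>" for i j unfolding P_def by (rule L2_diff[OF DL tL])
    have Pn: "(l2_norm \<Omega> (P i j))\<^sup>2 \<le> e\<^sup>2" for i j
      using \<eta>(3)[of j] member_le_sum[of i UNIV "\<lambda>i. (l2_norm \<Omega> (P i j))\<^sup>2"]
      by (simp add: P_def t_def)
    have eq: "(\<lambda>x. curl_matrix D x - curl \<eta> x) = curl_matrix P"
      unfolding curl_eq_curl_matrix t_def[symmetric]
      by (rule ext) (simp add: vec_eq_iff forall_3 curl_matrix_component P_def)
    \<comment> \<open>A curl component is a difference of two errors of size e:
      \<open>4 * e^2\<close> each, \<open>12 * e^2\<close> for the three of them, rounded up to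
      \<open>(4 * e)^2\<close>.\<close>
    have Pd: "(l2_norm \<Omega> (\<lambda>x. P i j x - P k l x))\<^sup>2 \<le> 4 * e\<^sup>2" for i j k l
      using l2_norm_add_squared[OF PL L2_minus[OF PL], of i j k l] Pn[of i j] Pn[of k l]
      by (simp add: l2_norm_squared)
    have "(l2_norm \<Omega> (curl_matrix P))\<^sup>2 \<le> 12 * e\<^sup>2"
      unfolding l2_norm_vec_squared[OF curl_matrix_L2[OF PL]]
      using Pd[of 2 3 3 2] Pd[of 3 1 1 3] Pd[of 1 2 2 1] by (simp add: sum_3 curl_matrix_component)
    also have "12 * e\<^sup>2 \<le> (4 * e)\<^sup>2" by (simp add: power_mult_distrib)
    finally have n1: "l2_norm \<Omega> (curl_matrix P) \<le> 4 * e" by (rule power2_le_imp_le) (use e in simp)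
    have n3: "3 * e\<^sup>2 \<le> (4 * e)\<^sup>2" by (simp add: power_mult_distrib)
    have n2: "l2_norm \<Omega> (\<lambda>x. \<psi> x - \<eta> x) \<le> 4 * e" 
      by (rule power2_le_imp_le[OF order_trans[OF \<eta>(2) n3]]) (use e in simp)
    have \<eta>L: "\<eta> \<in> L2 \<Omega>" "curl \<eta> \<in> L2 \<Omega>" by (rule test_field_L2[OF \<eta>(1)], rule curl_test_field_L2[OF \<eta>(1)])
    have "l2_inner \<Omega> (curl_matrix P) q = l2_inner \<Omega> (curl_matrix D) q - l2_inner \<Omega> (curl \<eta>) q"
      unfolding eq[symmetric] by (rule l2_inner_diff[OF curl_matrix_L2[OF DL] \<eta>L(2) q])
    moreover have "l2_inner \<Omega> (curl \<eta>) q = l2_inner \<Omega> \<eta> c"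
      using c \<eta>(1) by (simp add: is_weak_curl_def l2_inner_commute)
    moreover have "l2_inner \<Omega> (\<lambda>x. \<psi> x - \<eta> x) c = l2_inner \<Omega> \<psi> c - l2_inner \<Omega> \<eta> c"
      by (rule l2_inner_diff[OF \<psi>L \<eta>L(1) cL])
    moreover have "\<bar>l2_inner \<Omega> (curl_matrix P) q\<bar> \<le> 4 * e * l2_norm \<Omega> q"
      by (rule order_trans[OF l2_inner_Cauchy_Schwarz[OF curl_matrix_L2[OF PL] q]]) (intro mult_right_mono n1, simp)
    moreover have "\<bar>l2_inner \<Omega> (\<lambda>x. \<psi> x - \<eta> x) c\<bar> \<le> 4 * e * l2_norm \<Omega> c"
      by (rule order_trans[OF l2_inner_Cauchy_Schwarz[OF L2_diff[OF \<psi>L \<eta>L(1)] cL]]) (intro mult_right_mono n2, simp)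
    ultimately show ?thesis unfolding C_def by (simp add: algebra_simps)
  qed
  have "0 \<le> C" by (simp add: C_def)
  have "\<bar>l2_inner \<Omega> (curl_matrix D) q - l2_inner \<Omega> \<psi> c\<bar> \<le> 0"
  proof (rule field_le_epsilon)
    fix \<delta> :: real assume "\<delta> > 0"
    have "\<bar>l2_inner \<Omega> (curl_matrix D) q - l2_inner \<Omega> \<psi> c\<bar> \<le> \<delta> / (C + 1) * C"
      using \<open>\<delta> > 0\<close> \<open>0 \<le> C\<close> by (intro main) simp
    also have "\<dots> \<le> \<delta>" using \<open>\<delta> > 0\<close> \<open>0 \<le> C\<close> by (simp add: field_simps)
    finally show "\<bar>l2_inner \<Omega> (curl_matrix D) q - l2_inner \<Omega> \<psi> c\<bar> \<le> 0 + \<delta>" by simp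
  qed
  then show ?thesis using e1 by simp
qed

lemma V_norm_squared: "(V_norm \<Omega> \<epsilon> \<psi>)\<^sup>2 = (if \<epsilon> > 0 then \<epsilon>\<^sup>2 * (grad_norm \<Omega> \<psi>)\<^sup>2 else 0) + (l2_norm \<Omega> \<psi>)\<^sup>2"
  by (simp add: V_norm_def)

lemma l2_norm_le_V_norm: "l2_norm \<Omega> \<psi> \<le> V_norm \<Omega> \<epsilon> \<psi>"
  by (rule power2_le_imp_le) (simp_all add: V_norm_squared V_norm_def)

lemma V_norm_test_field:
  assumes "\<epsilon> > 0" "\<And>j. piecewise_C1 (\<lambda>x. \<psi> x $ j)"
  shows "(V_norm \<Omega> \<epsilon> \<psi>)\<^sup>2 = \<epsilon>\<^sup>2 * (\<Sum>j\<in>UNIV. \<Sum>i\<in>UNIV. (l2_norm \<Omega> (pd i (\<lambda>x. \<psi> x $ j)))\<^sup>2)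
     + (\<Sum>j\<in>UNIV. (l2_norm \<Omega> (\<lambda>x. \<psi> x $ j))\<^sup>2)"
proof -
  have "\<psi> \<in> L2 \<Omega>" using piecewise_C1_L2(1)[OF dom assms(2)] by (rule L2_vec)
  then show ?thesis
    using assms(1) grad_norm_squared[OF is_weak_partial_pd[OF dom assms(2)]]
    by (simp add: V_norm_squared l2_norm_vec_squared)
qed

text \<open>Test fields are dense, so a bound for them extends to all of \<open>H01_field\<close>; the factor 3 absorbs
  the error of the approximation in the norm.\<close>

lemma bound_on_H01_field:
  assumes "\<epsilon> > 0" and c: "c \<in> L2 \<Omega>" and B: "0 \<le> B"
    and test: "\<And>\<eta>. \<eta> \<in> test_field \<Omega> \<Longrightarrow> l2_inner \<Omega> \<eta> c \<le> B * V_norm \<Omega> \<epsilon> \<eta>"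
    and \<psi>: "\<psi> \<in> H01_field \<Omega>" "\<not> ae_zero \<Omega> \<psi>"
  shows "l2_inner \<Omega> \<psi> c \<le> sqrt 3 * B * V_norm \<Omega> \<epsilon> \<psi>"
proof (rule field_le_epsilon)
  fix \<delta> :: real assume "\<delta> > 0"
  obtain D where D: "\<And>i j. is_weak_partial \<Omega> i (\<lambda>x. \<psi> x $ j) (D i j)" and \<psi>L: "\<psi> \<in> L2 \<Omega>"
    using H1_field_weak_partials[OF H01_field_H1_field[OF \<psi>(1)]] by blast
  have DL: "D i j \<in> L2 \<Omega>" for i j using D[of i j] by (simp add: is_weak_partial_def)
  define N where "N = V_norm \<Omega> \<epsilon> \<psi>"
  have "0 < l2_norm \<Omega> \<psi>" using l2_norm_eq_0_iff[OF \<psi>L] \<psi>(2) l2_norm_nonneg[of \<Omega> \<psi>] by linarith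
  then have N: "N > 0" using l2_norm_le_V_norm[of \<psi> \<epsilon>] by (simp add: N_def)
  \<comment> \<open>As \<psi> is non-zero, N > 0 leaves room for an error. The first term gives
    \<open>6 * e^2 * (\<epsilon>^2 + 1) \<le> N^2\<close>, which keeps the norm of \<eta> under
    control; the second limits the error of the pairing to \<delta>.\<close>
  define e where "e = min (N / sqrt (6 * (\<epsilon>\<^sup>2 + 1))) (\<delta> / (2 * (l2_norm \<Omega> c + 1)))"
  have s6: "sqrt (6 * (\<epsilon>\<^sup>2 + 1)) > 0" by (simp add: add_nonneg_pos)
  have c1: "l2_norm \<Omega> c + 1 > 0" using l2_norm_nonneg[of \<Omega> c] by linarith
  have e: "e > 0" unfolding e_def using N s6 c1 \<open>\<delta> > 0\<close> by simp
  have "e * sqrt (6 * (\<epsilon>\<^sup>2 + 1)) \<le> N" using s6 by (simp add: e_def min_le_iff_disj pos_le_divide_eq[symmetric])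
  then have "(e * sqrt (6 * (\<epsilon>\<^sup>2 + 1)))\<^sup>2 \<le> N\<^sup>2" using e s6 by (intro power_mono) auto
  then have e1: "6 * e\<^sup>2 * (\<epsilon>\<^sup>2 + 1) \<le> N\<^sup>2" by (simp add: power_mult_distrib add_nonneg_nonneg algebra_simps)
  have "e * (2 * (l2_norm \<Omega> c + 1)) \<le> \<delta>" using c1 by (simp add: e_def min_le_iff_disj pos_le_divide_eq[symmetric])
  then have e2: "2 * e * l2_norm \<Omega> c \<le> \<delta>" using e by (simp add: algebra_simps)
  obtain \<eta> where \<eta>: "\<eta> \<in> test_field \<Omega>" "(l2_norm \<Omega> (\<lambda>x. \<psi> x - \<eta> x))\<^sup>2 \<le> 3 * e\<^sup>2"
    "\<And>j. (\<Sum>i\<in>UNIV. (l2_norm \<Omega> (\<lambda>x. D i j x - pd i (\<lambda>y. \<eta> y $ j) x))\<^sup>2) \<le> e\<^sup>2"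
    using H01_field_approx[OF \<psi>(1) D e] by blast
  have \<eta>L: "\<eta> \<in> L2 \<Omega>" by (rule test_field_L2[OF \<eta>(1)])
  have tp: "piecewise_C1 (\<lambda>x. \<eta> x $ j)" for j by (rule test_fun_piecewise_C1[OF test_field_component[OF \<eta>(1)]])
  have tL: "pd i (\<lambda>x. \<eta> x $ j) \<in> L2 \<Omega>" for i j by (rule piecewise_C1_L2(2)[OF dom tp])
  \<comment> \<open>3 = 2 + 1: the square of a sum, and the choice of e.\<close>
  have "(V_norm \<Omega> \<epsilon> \<eta>)\<^sup>2 \<le> 3 * N\<^sup>2"
  proof -
    have "(\<Sum>j\<in>UNIV. \<Sum>i\<in>UNIV. (l2_norm \<Omega> (pd i (\<lambda>x. \<eta> x $ j)))\<^sup>2)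
        \<le> (\<Sum>j\<in>UNIV. \<Sum>i\<in>UNIV. 2 * (l2_norm \<Omega> (D i j))\<^sup>2 + 2 * (l2_norm \<Omega> (\<lambda>x. D i j x - pd i (\<lambda>y. \<eta> y $ j) x))\<^sup>2)"
      by (intro sum_mono l2_norm_squared_le_diff DL tL)
    also have "\<dots> = 2 * (grad_norm \<Omega> \<psi>)\<^sup>2
        + 2 * (\<Sum>j\<in>UNIV. \<Sum>i\<in>UNIV. (l2_norm \<Omega> (\<lambda>x. D i j x - pd i (\<lambda>y. \<eta> y $ j) x))\<^sup>2)"
      by (simp add: grad_norm_squared[OF D] sum.distrib sum_distrib_left)
    also have "\<dots> \<le> 2 * (grad_norm \<Omega> \<psi>)\<^sup>2 + 2 * (\<Sum>j\<in>(UNIV::3 set). e\<^sup>2)"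
      using \<eta>(3) by (intro add_left_mono mult_left_mono sum_mono) auto
    finally have g: "(\<Sum>j\<in>UNIV. \<Sum>i\<in>UNIV. (l2_norm \<Omega> (pd i (\<lambda>x. \<eta> x $ j)))\<^sup>2) \<le> 2 * (grad_norm \<Omega> \<psi>)\<^sup>2 + 6 * e\<^sup>2"
      by simp
    have "(V_norm \<Omega> \<epsilon> \<eta>)\<^sup>2 = \<epsilon>\<^sup>2 * (\<Sum>j\<in>UNIV. \<Sum>i\<in>UNIV. (l2_norm \<Omega> (pd i (\<lambda>x. \<eta> x $ j)))\<^sup>2) + (l2_norm \<Omega> \<eta>)\<^sup>2"
      unfolding V_norm_test_field[OF assms(1) tp] l2_norm_vec_squared[OF \<eta>L] ..
    also have "\<dots> \<le> \<epsilon>\<^sup>2 * (2 * (grad_norm \<Omega> \<psi>)\<^sup>2 + 6 * e\<^sup>2) + (2 * (l2_norm \<Omega> \<psi>)\<^sup>2 + 2 * (3 * e\<^sup>2))"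
      using g l2_norm_squared_le_diff[OF \<psi>L \<eta>L] \<eta>(2) by (intro add_mono mult_left_mono) auto
    also have "\<dots> = 2 * N\<^sup>2 + 6 * e\<^sup>2 * (\<epsilon>\<^sup>2 + 1)"
      using assms(1) by (simp add: N_def V_norm_squared algebra_simps)
    also have "\<dots> \<le> 3 * N\<^sup>2" using e1 by simp
    finally show ?thesis .
  qed
  then have "(V_norm \<Omega> \<epsilon> \<eta>)\<^sup>2 \<le> (sqrt 3 * N)\<^sup>2" by (simp add: power_mult_distrib)
  then have Vn: "V_norm \<Omega> \<epsilon> \<eta> \<le> sqrt 3 * N" by (rule power2_le_imp_le) (use N in simp)
  have n3: "3 * e\<^sup>2 \<le> (2 * e)\<^sup>2" by (simp add: power_mult_distrib)
  have n2: "l2_norm \<Omega> (\<lambda>x. \<psi> x - \<eta> x) \<le> 2 * e" 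
    by (rule power2_le_imp_le[OF order_trans[OF \<eta>(2) n3]]) (use e in simp)
  have "l2_inner \<Omega> \<psi> c = l2_inner \<Omega> \<eta> c + l2_inner \<Omega> (\<lambda>x. \<psi> x - \<eta> x) c"
    using l2_inner_diff[OF \<psi>L \<eta>L c] by simp
  also have "l2_inner \<Omega> \<eta> c \<le> B * (sqrt 3 * N)"
    by (rule order_trans[OF test[OF \<eta>(1)]]) (intro mult_left_mono Vn B)
  also have "l2_inner \<Omega> (\<lambda>x. \<psi> x - \<eta> x) c \<le> 2 * e * l2_norm \<Omega> c"
  proof -
    have "\<bar>l2_inner \<Omega> (\<lambda>x. \<psi> x - \<eta> x) c\<bar> \<le> 2 * e * l2_norm \<Omega> c"
      by (rule order_trans[OF l2_inner_Cauchy_Schwarz[OF L2_diff[OF \<psi>L \<eta>L] c]]) (intro mult_right_mono n2, simp)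
    then show ?thesis by simp
  qed
  finally show "l2_inner \<Omega> \<psi> c \<le> sqrt 3 * B * V_norm \<Omega> \<epsilon> \<psi> + \<delta>"
    using e2 by (simp add: N_def mult_ac)
qed

end

section \<open>The inf-sup condition\<close>

lemma AE_lebesgue_on_subset:
  assumes "AE x in lebesgue_on A. P x" "B \<subseteq> A" "A \<in> sets lebesgue" "B \<in> sets lebesgue"
  shows "AE x in lebesgue_on B. P x"
  using assms by (subst (asm) AE_restrict_space_iff, simp, subst AE_restrict_space_iff) (auto elim: eventually_mono)

lemma V_sp_L2: "open \<Omega> \<Longrightarrow> bounded \<Omega> \<Longrightarrow> \<psi> \<in> V_sp \<Omega> \<epsilon> \<Longrightarrow> \<psi> \<in> L2 \<Omega>"
  using H1_field_weak_partials(1)[OF _ _ H01_field_H1_field] by (auto simp: V_sp_def split: if_splits)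

context tet_mesh
begin

lemmas dom = open_dom bounded_dom

lemma cell_interior:
  assumes "K \<in> T"
  shows "open (interior K)" "bounded (interior K)" "interior K \<in> sets lebesgue" "\<Omega> \<in> sets lebesgue" "K \<in> sets lebesgue"
  using cell(1,3)[OF assms] open_dom by (auto simp: compact_imp_bounded bounded_interior borel_closed)

section \<open>Cellwise constant curl and divergence\<close>

lemma Q_h_affine:
  assumes q: "q \<in> Q_h \<Omega> T" and K: "K \<in> T"
  shows "\<exists>\<alpha> G. AE x in lebesgue_on (interior K). q x = (\<chi> i. \<alpha> i + G i \<bullet> x)"
proof -
  note I = cell_interior[OF K]
  \<comment> \<open>Constant and gradient are paired so that a single choice selects both for all
    components.\<close>
  have "\<forall>i. \<exists>p. AE x in lebesgue_on (interior K). q x $ i = fst p + snd p \<bullet> x"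
  proof
    fix i
    obtain p where p: "p \<in> P_deg 1" "AE x in lebesgue_on K. q x $ i = p x"
      using q K by (auto simp: Q_h_def)
    obtain \<alpha> G where pe: "p = (\<lambda>x. \<alpha> + G \<bullet> x)" using P_deg_1_imp_affine[OF p(1)] by blast
    have "AE x in lebesgue_on (interior K). q x $ i = \<alpha> + G \<bullet> x"
      using AE_lebesgue_on_subset[OF p(2) interior_subset I(5,3)] by (simp add: pe)
    then show "\<exists>p. AE x in lebesgue_on (interior K). q x $ i = fst p + snd p \<bullet> x"
      by (intro exI[of _ "(\<alpha>, G)"]) simp
  qed
  from choice[OF this] obtain P where "\<And>i. AE x in lebesgue_on (interior K). q x $ i = fst (P i) + snd (P i) \<bullet> x"
    by blast
  then have "\<And>i. AE x in lebesgue_on (interior K). q x $ i = (fst \<circ> P) i + (snd \<circ> P) i \<bullet> x" by simp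
  then obtain \<alpha> G where "\<And>i. AE x in lebesgue_on (interior K). q x $ i = \<alpha> i + G i \<bullet> x" by blast
  then have "AE x in lebesgue_on (interior K). \<forall>i. q x $ i = \<alpha> i + G i \<bullet> x" by (simp add: AE_all_countable)
  then have "AE x in lebesgue_on (interior K). q x = (\<chi> i. \<alpha> i + G i \<bullet> x)"
    by eventually_elim (simp add: vec_eq_iff)
  then show ?thesis by blast
qed

text \<open>Test fields supported in the interior of K are test fields of the domain, so the weak
  curl restricts to K. There q is a.e. an affine field, whose weak curl is the classical, constant
  one; uniqueness identifies the two.\<close>

lemma weak_curl_cellwise_const:
  assumes q: "q \<in> Q_h \<Omega> T" and K: "K \<in> T" and qL: "q \<in> L2 \<Omega>" and w: "is_weak_curl \<Omega> q a"
  shows "\<exists>k. AE x in lebesgue_on (interior K). a x = k"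
proof -
  note I = cell_interior[OF K] and sub = cell(4)[OF K]
  obtain \<alpha> G where AE: "AE x in lebesgue_on (interior K). q x = (\<chi> i. \<alpha> i + G i \<bullet> x)"
    using Q_h_affine[OF q K] by blast
  define p :: "R3 \<Rightarrow> R3" where "p x = (\<chi> i. \<alpha> i + G i \<bullet> x)" for x
  define D where "D i j = pd i (\<lambda>x. \<alpha> j + G j \<bullet> x)" for i j
  have pj: "(\<lambda>x. p x $ j) = (\<lambda>x. \<alpha> j + G j \<bullet> x)" for j by (simp add: p_def)
  have pL: "p \<in> L2 (interior K)" by (rule L2_vec) (simp add: pj piecewise_C1_L2(1)[OF I(1,2) affine_piecewise_C1])
  have qLI: "q \<in> L2 (interior K)" by (rule L2_subset[OF qL sub I(3,4)])
  have wp: "is_weak_curl (interior K) p (curl_matrix D)"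
    by (rule is_weak_curl_curl_matrix[OF I(1,2) pL]) (simp add: pj D_def is_weak_partial_pd[OF I(1,2) affine_piecewise_C1])
  have "is_weak_curl (interior K) p a"
    unfolding is_weak_curl_def
  proof (intro conjI ballI)
    have aL: "a \<in> L2 \<Omega>" using w by (simp add: is_weak_curl_def)
    show "a \<in> L2 (interior K)" by (rule L2_subset[OF aL sub I(3,4)])
    fix \<eta> assume \<eta>: "\<eta> \<in> test_field (interior K)"
    then have \<eta>\<Omega>: "\<eta> \<in> test_field \<Omega>" using test_fun_mono[OF sub] by (auto simp: test_field_def)
    have \<eta>j: "(\<lambda>x. \<eta> x $ j) \<in> test_fun (interior K)" for j using \<eta> by (simp add: test_field_def)
    have z: "\<eta> x = 0" "curl \<eta> x = 0" if "x \<notin> interior K" for x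
      using test_fun_D(4,5)[OF \<eta>j that] by (simp_all add: vec_eq_iff forall_3 curl_eq_curl_matrix curl_matrix_component)
    have "l2_inner (interior K) p (curl \<eta>) = l2_inner (interior K) q (curl \<eta>)"
      using AE pL qLI curl_test_field_L2[OF I(1,2) \<eta>]
      by (intro l2_inner_cong_AE) (auto simp: L2_def p_def elim!: eventually_mono)
    also have "\<dots> = l2_inner \<Omega> q (curl \<eta>)" using sub I z by (intro l2_inner_restrict[symmetric]) auto
    also have "\<dots> = l2_inner \<Omega> a \<eta>" using w \<eta>\<Omega> by (simp add: is_weak_curl_def)
    also have "\<dots> = l2_inner (interior K) a \<eta>" using sub I z by (intro l2_inner_restrict) auto
    finally show "l2_inner (interior K) p (curl \<eta>) = l2_inner (interior K) a \<eta>" .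
  qed
  from is_weak_curl_unique[OF I(1,2) this wp]
  \<comment> \<open>The argument 0 is arbitrary, these partials being constant functions.\<close>
  have "AE x in lebesgue_on (interior K). a x = curl_matrix (\<lambda>i j x. G j $ i) 0"
    by eventually_elim (simp add: D_def pd_affine curl_matrix_def)
  then show ?thesis by blast
qed

text \<open>The same localisation, with scalar test functions in place of fields.\<close>

lemma weak_div_cellwise_const:
  assumes q: "q \<in> Q_h \<Omega> T" and K: "K \<in> T" and qL: "q \<in> L2 \<Omega>" and w: "is_weak_div \<Omega> q a"
  shows "\<exists>k. AE x in lebesgue_on (interior K). a x = k"
proof -
  note I = cell_interior[OF K] and sub = cell(4)[OF K]
  obtain \<alpha> G where AE: "AE x in lebesgue_on (interior K). q x = (\<chi> i. \<alpha> i + G i \<bullet> x)"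
    using Q_h_affine[OF q K] by blast
  define p :: "R3 \<Rightarrow> R3" where "p x = (\<chi> i. \<alpha> i + G i \<bullet> x)" for x
  have pj: "(\<lambda>x. p x $ j) = (\<lambda>x. \<alpha> j + G j \<bullet> x)" for j by (simp add: p_def)
  have pL: "p \<in> L2 (interior K)" by (rule L2_vec) (simp add: pj piecewise_C1_L2(1)[OF I(1,2) affine_piecewise_C1])
  have qLI: "q \<in> L2 (interior K)" by (rule L2_subset[OF qL sub I(3,4)])
  have wp: "is_weak_div (interior K) p (\<lambda>x. \<Sum>i\<in>UNIV. pd i (\<lambda>x. \<alpha> i + G i \<bullet> x) x)"
    by (rule is_weak_div_sum[OF I(1,2) pL]) (simp add: pj is_weak_partial_pd[OF I(1,2) affine_piecewise_C1])
  have "is_weak_div (interior K) p a"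
    unfolding is_weak_div_def
  proof (intro conjI ballI)
    have aL: "a \<in> L2 \<Omega>" using w by (simp add: is_weak_div_def)
    show "a \<in> L2 (interior K)" by (rule L2_subset[OF aL sub I(3,4)])
    fix \<phi> assume \<phi>: "\<phi> \<in> test_fun (interior K)"
    then have \<phi>\<Omega>: "\<phi> \<in> test_fun \<Omega>" using test_fun_mono[OF sub] by blast
    define Gr :: "R3 \<Rightarrow> R3" where "Gr x = (\<chi> i. pd i \<phi> x)" for x
    have GL: "Gr \<in> L2 (interior K)" by (rule L2_vec) (simp add: Gr_def test_fun_L2(2)[OF I(1,2) \<phi>])
    have z: "\<phi> x = 0" "Gr x = 0" if "x \<notin> interior K" for x
      using test_fun_D(4,5)[OF \<phi> that] by (simp_all add: vec_eq_iff Gr_def)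
    have "l2_inner (interior K) p Gr = l2_inner (interior K) q Gr"
      using AE pL qLI GL by (intro l2_inner_cong_AE) (auto simp: L2_def p_def elim!: eventually_mono)
    also have "\<dots> = l2_inner \<Omega> q Gr" using sub I z by (intro l2_inner_restrict[symmetric]) auto
    also have "\<dots> = - l2_inner \<Omega> a \<phi>" using w \<phi>\<Omega> unfolding Gr_def by (simp add: is_weak_div_def)
    also have "l2_inner \<Omega> a \<phi> = l2_inner (interior K) a \<phi>" using sub I z by (intro l2_inner_restrict) auto
    finally show "l2_inner (interior K) p (\<lambda>x. \<chi> i. pd i \<phi> x) = - l2_inner (interior K) a \<phi>"
      by (simp add: Gr_def)
  qed
  from is_weak_div_unique[OF I(1,2) this wp]
  have "AE x in lebesgue_on (interior K). a x = (\<Sum>i\<in>UNIV. G i $ i)"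
    by eventually_elim (simp add: pd_affine)
  then show ?thesis by blast
qed

lemma Q_h_curl:
  assumes q: "q \<in> Q_h \<Omega> T"
  shows "q \<in> L2 \<Omega>" "is_weak_curl \<Omega> q (weak_curl \<Omega> q)" "weak_curl \<Omega> q \<in> L2 \<Omega>"
    "\<And>K. K \<in> T \<Longrightarrow> \<exists>k. AE x in lebesgue_on (interior K). weak_curl \<Omega> q x = k"
proof -
  have "q \<in> H1_field \<Omega>" using q by (simp add: Q_h_def)
  then obtain D where qL: "q \<in> L2 \<Omega>" and D: "\<And>i j. is_weak_partial \<Omega> i (\<lambda>x. q x $ j) (D i j)"
    using H1_field_weak_partials[OF dom] by blast
  note w = weak_curl_AE[OF dom is_weak_curl_curl_matrix[OF dom qL D]]
  show "q \<in> L2 \<Omega>" "is_weak_curl \<Omega> q (weak_curl \<Omega> q)" "weak_curl \<Omega> q \<in> L2 \<Omega>" by (fact qL w)+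
  show "\<exists>k. AE x in lebesgue_on (interior K). weak_curl \<Omega> q x = k" if "K \<in> T" for K
    by (rule weak_curl_cellwise_const[OF q that qL w(1)])
qed

lemma cell_AE:
  assumes K: "K \<in> T" and "AE x in lebesgue_on (interior K). P x" shows "AE x in lebesgue_on K. P x"
proof -
  note I = cell_interior[OF K]
  have "AE x in lebesgue. x \<in> interior K \<longrightarrow> P x" using assms(2) I(3) by (subst (asm) AE_restrict_space_iff) auto
  moreover have "AE x in lebesgue. x \<notin> frontier K"
    by (rule AE_not_in_negligible[OF negligible_convex_frontier[OF cell(2)[OF K]]])
  ultimately have "AE x in lebesgue. x \<in> K \<longrightarrow> P x"
    by eventually_elim (use cell(3)[OF K] in \<open>auto simp: frontier_def\<close>)
  then show ?thesis using I(5) by (subst AE_restrict_space_iff) auto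
qed

lemma Q_h_div:
  assumes q: "q \<in> Q_h \<Omega> T"
  shows "weak_div \<Omega> q \<in> L2 \<Omega>" "weak_div \<Omega> q \<in> R_h \<Omega> T"
proof -
  have qL: "q \<in> L2 \<Omega>" by (rule Q_h_curl(1)[OF q])
  have h0: "q \<in> H0div \<Omega>" using q by (simp add: Q_h_def)
  then have "\<exists>d. is_weak_div \<Omega> q d" by (simp add: H0div_def Hdiv_def)
  then have w: "is_weak_div \<Omega> q (weak_div \<Omega> q)" unfolding weak_div_def by (rule someI_ex)
  then show dL: "weak_div \<Omega> q \<in> L2 \<Omega>" by (simp add: is_weak_div_def)
  \<comment> \<open>The constant 1 in affine form, to which the results on affine functions apply;
    against it the normal trace is the mean of the divergence.\<close>
  define o1 :: "R3 \<Rightarrow> real" where "o1 = (\<lambda>x. 1 + 0 \<bullet> x)"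
  have o1: "piecewise_C1 o1" unfolding o1_def by (rule affine_piecewise_C1)
  have pd1: "pd i o1 = (\<lambda>x. 0)" for i unfolding o1_def by (rule ext) (simp add: pd_affine)
  have wg: "weak_grad \<Omega> o1 \<in> L2 \<Omega>" "(l2_norm \<Omega> (weak_grad \<Omega> o1))\<^sup>2 = 0"
    using l2_norm_weak_grad_squared[OF dom is_weak_partial_pd[OF dom o1]]
    by (simp_all add: pd1 l2_norm_squared)
  \<comment> \<open>\<open>weak_grad\<close> is an unspecified representative, so this term is shown
    to vanish through its norm and not pointwise.\<close>
  have "\<bar>l2_inner \<Omega> q (weak_grad \<Omega> o1)\<bar> \<le> l2_norm \<Omega> q * l2_norm \<Omega> (weak_grad \<Omega> o1)"
    by (rule l2_inner_Cauchy_Schwarz[OF qL wg(1)])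
  then have "l2_inner \<Omega> q (weak_grad \<Omega> o1) = 0" using wg(2) by simp
  moreover have "normal_trace \<Omega> q o1 = 0" using h0 piecewise_C1_H1[OF dom o1] by (simp add: H0div_def)
  ultimately have "l2_inner \<Omega> (weak_div \<Omega> q) o1 = 0" by (simp add: normal_trace_def)
  then have "weak_div \<Omega> q \<in> L2_mean0 \<Omega>" using dL by (simp add: L2_mean0_def l2_inner_def o1_def)
  moreover have "\<exists>p\<in>P_deg 0. AE x in lebesgue_on K. weak_div \<Omega> q x = p x" if K: "K \<in> T" for K
  proof -
    obtain k where "AE x in lebesgue_on (interior K). weak_div \<Omega> q x = k"
      using weak_div_cellwise_const[OF q K qL w] by blast
    from cell_AE[OF K this] show ?thesis by (intro bexI[of _ "\<lambda>x. k"] P_deg_const)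
  qed
  ultimately show "weak_div \<Omega> q \<in> R_h \<Omega> T" by (simp add: R_h_def)
qed

section \<open>Pairings with cellwise constants, and discrete test functions\<close>

lemma l2_inner_cellwise_const:
  assumes f: "f \<in> L2 \<Omega>" and e: "e \<in> L2 \<Omega>" and k: "\<And>K. K \<in> T \<Longrightarrow> AE x in lebesgue_on (interior K). e x = k K"
  shows "l2_inner \<Omega> f e = (\<Sum>K\<in>T. k K * (LINT x|lebesgue_on (interior K). f x))"
proof -
  have "l2_inner \<Omega> f e = (\<Sum>K\<in>T. LINT x|lebesgue_on (interior K). f x * e x)"
    using integral_sum_cells[OF L2_inner_integrable[OF f e]] by (simp add: l2_inner_def)
  also have "\<dots> = (\<Sum>K\<in>T. k K * (LINT x|lebesgue_on (interior K). f x))"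
  proof (rule sum.cong)
    fix K assume K: "K \<in> T"
    note I = cell_interior[OF K]
    have "f \<in> L2 (interior K)" "e \<in> L2 (interior K)" by (intro L2_subset[OF f cell(4)[OF K] I(3,4)] L2_subset[OF e cell(4)[OF K] I(3,4)])+
    then have "(LINT x|lebesgue_on (interior K). f x * e x) = (LINT x|lebesgue_on (interior K). k K * f x)"
      using k[OF K] by (intro integral_cong_AE) (auto simp: L2_def elim: eventually_mono)
    then show "(LINT x|lebesgue_on (interior K). f x * e x) = k K * (LINT x|lebesgue_on (interior K). f x)" by simp
  qed simp
  finally show ?thesis .
qed

lemma l2_inner_same_cell_means:
  fixes f f' e :: "R3 \<Rightarrow> R3"
  assumes f: "f \<in> L2 \<Omega>" "f' \<in> L2 \<Omega>" and e: "e \<in> L2 \<Omega>"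
    and k: "\<And>K. K \<in> T \<Longrightarrow> \<exists>k. AE x in lebesgue_on (interior K). e x = k"
    and m: "\<And>K j. K \<in> T \<Longrightarrow> (LINT x|lebesgue_on (interior K). f x $ j) = (LINT x|lebesgue_on (interior K). f' x $ j)"
  shows "l2_inner \<Omega> f e = l2_inner \<Omega> f' e"
proof -
  obtain k where k: "\<And>K. K \<in> T \<Longrightarrow> AE x in lebesgue_on (interior K). e x = k K" using k by metis
  have kj: "AE x in lebesgue_on (interior K). e x $ j = k K $ j" if "K \<in> T" for K j
    using k[OF that] by (rule eventually_mono) simp
  have "l2_inner \<Omega> (\<lambda>x. f x $ j) (\<lambda>x. e x $ j) = l2_inner \<Omega> (\<lambda>x. f' x $ j) (\<lambda>x. e x $ j)" for j
    using l2_inner_cellwise_const[OF L2_component[OF f(1)] L2_component[OF e] kj]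
      l2_inner_cellwise_const[OF L2_component[OF f(2)] L2_component[OF e] kj] m by simp
  then show ?thesis by (simp add: l2_inner_vec[OF f(1) e] l2_inner_vec[OF f(2) e])
qed

lemma V_h_memI:
  assumes u: "\<And>j. piecewise_C1 (u j)" "\<And>j x. x \<notin> \<Omega> \<Longrightarrow> u j x = 0"
    and p: "\<And>j K. K \<in> T \<Longrightarrow> \<exists>p\<in>P_deg 1. \<exists>b\<in>B4 K. \<forall>x\<in>K. u j x = p x + b x"
  shows "(\<lambda>x. \<chi> j. u j x) \<in> V_h \<Omega> \<epsilon> T"
proof -
  have "(\<lambda>x. \<chi> j. u j x) \<in> V_sp \<Omega> \<epsilon>"
  proof (cases "\<epsilon> > 0")
    case True
    then show ?thesis using piecewise_C1_H01[OF dom u(1) u(2)] by (simp add: V_sp_def H01_field_def)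
  next
    case False
    have "(\<lambda>x. \<chi> j. u j x) \<in> L2 \<Omega>" by (rule L2_vec) (simp add: piecewise_C1_L2(1)[OF dom u(1)])
    then show ?thesis using False by (simp add: V_sp_def)
  qed
  moreover have "\<exists>p\<in>P_deg 1. \<exists>b\<in>B4 K. AE x in lebesgue_on K. (\<chi> j. u j x) $ i = p x + b x" if K: "K \<in> T" for K i
  proof -
    obtain q b where "q \<in> P_deg 1" "b \<in> B4 K" "\<forall>x\<in>K. u i x = q x + b x" using p[OF K] by blast
    then show ?thesis by (intro bexI[of _ q] bexI[of _ b] AE_I2) auto
  qed
  ultimately show ?thesis by (simp add: V_h_def)
qed

lemma b1_eq:
  assumes "q \<in> Q_h \<Omega> T" "\<psi> \<in> V_sp \<Omega> \<epsilon>" shows "b1 \<Omega> \<epsilon> \<psi> q = l2_inner \<Omega> \<psi> (weak_curl \<Omega> q)"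
  using weak_curl_symmetric[OF dom _ Q_h_curl(1,2)[OF assms(1)]] assms(2)
  by (simp add: b1_def V_sp_def split: if_splits)

text \<open>Provides a non-zero member of the sets behind both suprema at which the quotient is
  non-negative; without it the suprema could not be bounded below by 0. One of the two signs of a
  fixed bubble function works.\<close>

lemma nonneg_bubble:
  assumes "T \<noteq> {}" and h: "h > 0" "\<And>K. K \<in> T \<Longrightarrow> diameter K \<le> h"
    and \<gamma>: "\<gamma> > 0" "\<And>K. K \<in> T \<Longrightarrow> \<exists>x0. cball x0 (\<gamma> * h) \<subseteq> K"
  shows "\<exists>\<psi>\<in>V_h \<Omega> \<epsilon> T. \<not> ae_zero \<Omega> \<psi> \<and> 0 \<le> l2_inner \<Omega> \<psi> e"
proof -
  obtain u where u: "piecewise_C1 u" "\<And>x. x \<notin> \<Omega> \<Longrightarrow> u x = 0"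
    "\<And>K x. K \<in> T \<Longrightarrow> x \<in> K \<Longrightarrow> u x = local_fe (\<lambda>_. 0) (\<lambda>_. 1) K x"
    using fe_function[of "\<lambda>_. 0" "\<lambda>_. 1"] by auto
  have uK: "u x = bub K x" if "K \<in> T" "x \<in> K" for K x using u(3)[OF that] by (simp add: local_fe_def)
  define \<psi> :: "real \<Rightarrow> R3 \<Rightarrow> R3" where "\<psi> \<sigma> = (\<lambda>x. \<chi> j. \<sigma> * u x)" for \<sigma>
  have \<psi>V: "\<psi> \<sigma> \<in> V_h \<Omega> \<epsilon> T" for \<sigma>
    unfolding \<psi>_def
  proof (rule V_h_memI)
    show "piecewise_C1 (\<lambda>x. \<sigma> * u x)" by (rule piecewise_C1_cmult[OF u(1)])
    show "\<sigma> * u x = 0" if "x \<notin> \<Omega>" for x using u(2)[OF that] by simp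
    show "\<exists>p\<in>P_deg 1. \<exists>b\<in>B4 K. \<forall>x\<in>K. \<sigma> * u x = p x + b x" if K: "K \<in> T" for K
      using bub_B4[OF K, of \<sigma>] uK[OF K] by (intro bexI[of _ "\<lambda>x. 0"] bexI[of _ "\<lambda>x. \<sigma> * bub K x"] P_deg_0) auto
  qed
  have nz: "\<not> ae_zero \<Omega> (\<psi> \<sigma>)" if "\<sigma> \<noteq> 0" for \<sigma>
  proof
    assume "ae_zero \<Omega> (\<psi> \<sigma>)"
    then have z: "AE x in lebesgue_on \<Omega>. u x = 0"
      unfolding ae_zero_def by (rule eventually_mono) (use that in \<open>simp add: \<psi>_def vec_eq_iff\<close>)
    obtain K where K: "K \<in> T" using assms(1) by blast
    obtain x0 where x0: "cball x0 (\<gamma> * h) \<subseteq> K" using \<gamma>(2)[OF K] by blast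
    note I = cell_interior[OF K]
    have "AE x in lebesgue_on (interior K). u x = 0" by (rule AE_lebesgue_on_subset[OF z cell(4)[OF K] I(4,3)])
    then have "(LINT x|lebesgue_on (interior K). u x) = (LINT x|lebesgue_on (interior K). 0)"
      using piecewise_C1_L2(1)[OF I(1,2) u(1)] by (intro integral_cong_AE) (auto simp: L2_def)
    moreover have "(LINT x|lebesgue_on (interior K). u x) = (LINT x|lebesgue_on (interior K). bub K x)"
      using uK[OF K] interior_subset[of K] by (intro Bochner_Integration.integral_cong) auto
    ultimately show False using bubble_integral(2)[OF K h(1) h(2)[OF K] \<gamma>(1) x0] by simp
  qed
  have "\<psi> (-1) = (\<lambda>x. - \<psi> 1 x)" by (simp add: \<psi>_def fun_eq_iff vec_eq_iff)
  then have "l2_inner \<Omega> (\<psi> (-1)) e = - l2_inner \<Omega> (\<psi> 1) e" by (simp add: l2_inner_minus)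
  then have "0 \<le> l2_inner \<Omega> (\<psi> 1) e \<or> 0 \<le> l2_inner \<Omega> (\<psi> (-1)) e" by linarith
  then show ?thesis using \<psi>V nz[of 1] nz[of "-1"] by auto
qed

lemma fortin_field:
  assumes \<eta>: "\<eta> \<in> test_field \<Omega>" and h: "h > 0" "\<And>K. K \<in> T \<Longrightarrow> diameter K \<le> h"
    and \<gamma>: "\<gamma> > 0" "\<And>K. K \<in> T \<Longrightarrow> \<exists>x0. cball x0 (\<gamma> * h) \<subseteq> K"
    and \<kappa>: "\<kappa> > 0" "M \<ge> 0" "\<And>z. z \<in> frontier \<Omega> \<Longrightarrow> \<exists>z'. dist z z' \<le> M * h \<and> ball z' (\<kappa> * h) \<inter> \<Omega> = {}"
    and "\<epsilon> > 0"
  defines "A1 \<equiv> 3 + 12 * (1 + shape_bound \<gamma>) * patch_ratio \<kappa> M"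
    and "A2 \<equiv> (2 + 24 * shape_bound \<gamma>) / \<gamma>\<^sup>2 * patch_ratio \<kappa> M * (1 + M + \<kappa>)\<^sup>2"
  shows "\<exists>\<psi>\<in>V_h \<Omega> \<epsilon> T. (\<forall>K\<in>T. \<forall>j. (LINT x|lebesgue_on (interior K). \<psi> x $ j) = (LINT x|lebesgue_on (interior K). \<eta> x $ j))
     \<and> (V_norm \<Omega> \<epsilon> \<psi>)\<^sup>2 \<le> (A1 + A2) * (V_norm \<Omega> \<epsilon> \<eta>)\<^sup>2"
proof -
  have t: "(\<lambda>x. \<eta> x $ j) \<in> test_fun \<Omega>" for j using \<eta> by (simp add: test_field_def)
  have pr: "0 \<le> patch_ratio \<kappa> M" "0 \<le> shape_bound \<gamma>" using \<kappa> by (simp_all add: patch_ratio_def shape_bound_def)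
  have C: "0 \<le> A1" "0 \<le> A2" using pr by (auto simp: A1_def A2_def)
  have "\<forall>j. \<exists>u. piecewise_C1 u \<and> (\<forall>x. x \<notin> \<Omega> \<longrightarrow> u x = 0) \<and>
     (\<forall>K\<in>T. \<exists>p\<in>P_deg 1. \<exists>b\<in>B4 K. \<forall>x\<in>K. u x = p x + b x) \<and>
     (\<forall>K\<in>T. (LINT x|lebesgue_on (interior K). u x) = (LINT x|lebesgue_on (interior K). \<eta> x $ j)) \<and>
     (l2_norm \<Omega> u)\<^sup>2 \<le> A1 * (l2_norm \<Omega> (\<lambda>x. \<eta> x $ j))\<^sup>2 \<and>
     (\<Sum>i\<in>UNIV. (l2_norm \<Omega> (pd i u))\<^sup>2) \<le> A2 * (\<Sum>i\<in>UNIV. (l2_norm \<Omega> (pd i (\<lambda>x. \<eta> x $ j)))\<^sup>2)"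
    unfolding A1_def A2_def using fortin_function[OF t h \<gamma> \<kappa>] by blast
  from choice[OF this] obtain u where u: "\<And>j. piecewise_C1 (u j)" "\<And>j x. x \<notin> \<Omega> \<Longrightarrow> u j x = 0"
    "\<And>j K. K \<in> T \<Longrightarrow> \<exists>p\<in>P_deg 1. \<exists>b\<in>B4 K. \<forall>x\<in>K. u j x = p x + b x"
    "\<And>j K. K \<in> T \<Longrightarrow> (LINT x|lebesgue_on (interior K). u j x) = (LINT x|lebesgue_on (interior K). \<eta> x $ j)"
    "\<And>j. (l2_norm \<Omega> (u j))\<^sup>2 \<le> A1 * (l2_norm \<Omega> (\<lambda>x. \<eta> x $ j))\<^sup>2"
    "\<And>j. (\<Sum>i\<in>UNIV. (l2_norm \<Omega> (pd i (u j)))\<^sup>2) \<le> A2 * (\<Sum>i\<in>UNIV. (l2_norm \<Omega> (pd i (\<lambda>x. \<eta> x $ j)))\<^sup>2)"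
    by blast
  define \<psi> :: "R3 \<Rightarrow> R3" where "\<psi> = (\<lambda>x. \<chi> j. u j x)"
  have \<psi>j: "(\<lambda>x. \<psi> x $ j) = u j" for j by (simp add: \<psi>_def)
  have \<psi>: "\<psi> \<in> V_h \<Omega> \<epsilon> T" unfolding \<psi>_def using u(1-3) by (rule V_h_memI)
  have p1: "piecewise_C1 (\<lambda>x. \<psi> x $ j)" for j using u(1) by (simp add: \<psi>j)
  have p2: "piecewise_C1 (\<lambda>x. \<eta> x $ j)" for j by (rule test_fun_piecewise_C1[OF t])
  define A where "A = (\<Sum>j\<in>UNIV. \<Sum>i\<in>UNIV. (l2_norm \<Omega> (pd i (\<lambda>x. \<eta> x $ j)))\<^sup>2)"
  define B where "B = (\<Sum>j\<in>UNIV. (l2_norm \<Omega> (\<lambda>x. \<eta> x $ j))\<^sup>2)"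
  have AB: "0 \<le> A" "0 \<le> B" by (simp_all add: A_def B_def sum_nonneg)
  have "(\<Sum>j\<in>UNIV. \<Sum>i\<in>UNIV. (l2_norm \<Omega> (pd i (u j)))\<^sup>2)
      \<le> (\<Sum>j\<in>UNIV. A2 * (\<Sum>i\<in>UNIV. (l2_norm \<Omega> (pd i (\<lambda>x. \<eta> x $ j)))\<^sup>2))"
    by (rule sum_mono) (rule u(6))
  also have "\<dots> = A2 * A" unfolding A_def by (rule sum_distrib_left[symmetric])
  finally have "(\<Sum>j\<in>UNIV. \<Sum>i\<in>UNIV. (l2_norm \<Omega> (pd i (u j)))\<^sup>2) \<le> A2 * A" .
  moreover have "(\<Sum>j\<in>UNIV. (l2_norm \<Omega> (u j))\<^sup>2) \<le> A1 * B"
    unfolding B_def sum_distrib_left by (intro sum_mono u(5))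
  ultimately have "(V_norm \<Omega> \<epsilon> \<psi>)\<^sup>2 \<le> \<epsilon>\<^sup>2 * (A2 * A) + A1 * B"
    unfolding V_norm_test_field[OF dom \<open>\<epsilon> > 0\<close> p1] \<psi>j by (intro add_mono mult_left_mono) auto
  \<comment> \<open>The sum dominates both constants; the weight \<epsilon>^2 passes through because
    values and gradients are bounded separately.\<close>
  also have "\<dots> \<le> (A1 + A2) * (\<epsilon>\<^sup>2 * A + B)"
    using C AB by (simp add: algebra_simps)
  also have "\<epsilon>\<^sup>2 * A + B = (V_norm \<Omega> \<epsilon> \<eta>)\<^sup>2"
    unfolding V_norm_test_field[OF dom \<open>\<epsilon> > 0\<close> p2] A_def B_def ..
  finally have "(V_norm \<Omega> \<epsilon> \<psi>)\<^sup>2 \<le> (A1 + A2) * (V_norm \<Omega> \<epsilon> \<eta>)\<^sup>2" .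
  then show ?thesis using \<psi> u(4) by (intro bexI[of _ \<psi>]) (auto simp: \<psi>_def)
qed

section \<open>The inf-sup condition on one mesh\<close>

text \<open>With X the discrete and S the continuous supremum, X bounds the norm of the divergence
  and \<open>sqrt (3 * Cf) * X\<close> bounds S; adding squares gives the constant.\<close>

lemma mesh_inf_sup:
  assumes "T \<noteq> {}" and h: "h > 0" "\<And>K. K \<in> T \<Longrightarrow> diameter K \<le> h"
    and \<gamma>: "\<gamma> > 0" "\<And>K. K \<in> T \<Longrightarrow> \<exists>x0. cball x0 (\<gamma> * h) \<subseteq> K"
    and \<kappa>: "\<kappa> > 0" "M \<ge> 0" "\<And>z. z \<in> frontier \<Omega> \<Longrightarrow> \<exists>z'. dist z z' \<le> M * h \<and> ball z' (\<kappa> * h) \<inter> \<Omega> = {}"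
    and \<epsilon>: "0 \<le> \<epsilon>" and q: "q \<in> Q_h \<Omega> T"
  defines "Cf \<equiv> (3 + 12 * (1 + shape_bound \<gamma>) * patch_ratio \<kappa> M)
      + (2 + 24 * shape_bound \<gamma>) / \<gamma>\<^sup>2 * patch_ratio \<kappa> M * (1 + M + \<kappa>)\<^sup>2"
  shows "1 / sqrt (3 * Cf + 1) * Q_norm \<Omega> \<epsilon> q \<le>
     (SUP (\<psi>, s)\<in>{(\<psi>, s). \<psi> \<in> V_h \<Omega> \<epsilon> T \<and> s \<in> R_h \<Omega> T \<and> \<not> (ae_zero \<Omega> \<psi> \<and> ae_zero \<Omega> s)}.
              (b1 \<Omega> \<epsilon> \<psi> q + b2 \<Omega> s q) / VR_norm \<Omega> \<epsilon> \<psi> s)"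
proof -
  define cq where "cq = weak_curl \<Omega> q"
  define dq where "dq = weak_div \<Omega> q"
  define A where "A = {(\<psi>, s). \<psi> \<in> V_h \<Omega> \<epsilon> T \<and> s \<in> R_h \<Omega> T \<and> \<not> (ae_zero \<Omega> \<psi> \<and> ae_zero \<Omega> s)}"
  define F where "F = (\<lambda>(\<psi>, s). (b1 \<Omega> \<epsilon> \<psi> q + b2 \<Omega> s q) / VR_norm \<Omega> \<epsilon> \<psi> s)"
  define X where "X = (SUP p\<in>A. F p)"
  have qL: "q \<in> L2 \<Omega>" and cL: "cq \<in> L2 \<Omega>" and dL: "dq \<in> L2 \<Omega>" and dR: "dq \<in> R_h \<Omega> T"
    and ck: "\<And>K. K \<in> T \<Longrightarrow> \<exists>k. AE x in lebesgue_on (interior K). cq x = k"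
    using Q_h_curl[OF q] Q_h_div[OF q] by (auto simp: cq_def dq_def)
  have b1: "b1 \<Omega> \<epsilon> \<psi> q = l2_inner \<Omega> \<psi> cq" if "\<psi> \<in> V_sp \<Omega> \<epsilon>" for \<psi>
    unfolding cq_def by (rule b1_eq[OF q that])
  have b2: "b2 \<Omega> s q = l2_inner \<Omega> s dq" for s by (simp add: b2_def dq_def)
  have Vh: "\<psi> \<in> V_sp \<Omega> \<epsilon>" "\<psi> \<in> L2 \<Omega>" if "\<psi> \<in> V_h \<Omega> \<epsilon> T" for \<psi>
    using that V_sp_L2[OF dom] by (auto simp: V_h_def)
  have Rh: "s \<in> L2 \<Omega>" if "s \<in> R_h \<Omega> T" for s using that by (simp add: R_h_def L2_mean0_def)
  have pos: "0 < l2_norm \<Omega> f" if "f \<in> L2 \<Omega>" "\<not> ae_zero \<Omega> f" for f :: "R3 \<Rightarrow> R3"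
    using l2_norm_eq_0_iff[OF that(1)] that(2) l2_norm_nonneg[of \<Omega> f] by linarith
  have z0: "l2_norm \<Omega> (\<lambda>x. 0 :: real) = 0" "l2_norm \<Omega> (\<lambda>x. 0 :: R3) = 0" by (simp_all add: l2_norm_def l2_inner_def)
  have V0: "V_norm \<Omega> \<epsilon> \<psi> \<ge> 0" for \<psi> by (simp add: V_norm_def)
  have VR: "VR_norm \<Omega> \<epsilon> \<psi> s \<ge> V_norm \<Omega> \<epsilon> \<psi>" "VR_norm \<Omega> \<epsilon> \<psi> s \<ge> l2_norm \<Omega> s" for \<psi> s
    unfolding VR_norm_def by (rule real_le_rsqrt, simp)+
  \<comment> \<open>A real supremum dominates the members of its set only if the set is bounded
    above. This bound may depend on q.\<close>
  have F_le: "F p \<le> l2_norm \<Omega> cq + l2_norm \<Omega> dq" if pA: "p \<in> A" for p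
  proof -
    obtain \<psi> s where p: "p = (\<psi>, s)" "\<psi> \<in> V_h \<Omega> \<epsilon> T" "s \<in> R_h \<Omega> T" using pA by (auto simp: A_def)
    define N where "N = VR_norm \<Omega> \<epsilon> \<psi> s"
    have N: "l2_norm \<Omega> \<psi> \<le> N" "l2_norm \<Omega> s \<le> N"
      using VR(1)[of \<psi> s] VR(2)[of s \<psi>] l2_norm_le_V_norm[OF dom, of \<psi> \<epsilon>] by (auto simp: N_def)
    have N0: "0 \<le> N" by (simp add: N_def VR_norm_def)
    have "l2_inner \<Omega> \<psi> cq \<le> N * l2_norm \<Omega> cq"
      using l2_inner_Cauchy_Schwarz[OF Vh(2)[OF p(2)] cL] mult_right_mono[OF N(1), of "l2_norm \<Omega> cq"] by simp
    moreover have "l2_inner \<Omega> s dq \<le> N * l2_norm \<Omega> dq"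
      using l2_inner_Cauchy_Schwarz[OF Rh[OF p(3)] dL] mult_right_mono[OF N(2), of "l2_norm \<Omega> dq"] by simp
    ultimately have "b1 \<Omega> \<epsilon> \<psi> q + b2 \<Omega> s q \<le> N * (l2_norm \<Omega> cq + l2_norm \<Omega> dq)"
      using b1[OF Vh(1)[OF p(2)]] b2 by (simp add: algebra_simps)
    \<comment> \<open>If N = 0, the quotient is 0 by the convention for division.\<close>
    then show ?thesis using N0 by (cases "N = 0") (auto simp: F_def p(1) N_def[symmetric] divide_le_eq mult.commute)
  qed
  have XU: "F p \<le> X" if "p \<in> A" for p
    unfolding X_def by (rule cSUP_upper[OF that]) (use F_le in \<open>auto intro!: bdd_aboveI2\<close>)
  have R0: "(\<lambda>x. 0) \<in> R_h \<Omega> T"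
    by (auto simp: R_h_def L2_mean0_def L2_def intro!: bexI[of _ "\<lambda>x. 0"] P_deg_0)
  have VX: "l2_inner \<Omega> \<psi> cq \<le> X * V_norm \<Omega> \<epsilon> \<psi>" "V_norm \<Omega> \<epsilon> \<psi> > 0"
    if \<psi>: "\<psi> \<in> V_h \<Omega> \<epsilon> T" "\<not> ae_zero \<Omega> \<psi>" for \<psi>
  proof -
    show Vpos: "V_norm \<Omega> \<epsilon> \<psi> > 0" using pos[OF Vh(2)[OF \<psi>(1)] \<psi>(2)] l2_norm_le_V_norm[OF dom, of \<psi> \<epsilon>] by linarith
    have "F (\<psi>, \<lambda>x. 0) \<le> X" using \<psi> R0 by (intro XU) (simp add: A_def)
    moreover have "F (\<psi>, \<lambda>x. 0) = l2_inner \<Omega> \<psi> cq / V_norm \<Omega> \<epsilon> \<psi>"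
      using V0 by (simp add: F_def b1[OF Vh(1)[OF \<psi>(1)]] b2 VR_norm_def z0 l2_inner_def)
    ultimately show "l2_inner \<Omega> \<psi> cq \<le> X * V_norm \<Omega> \<epsilon> \<psi>" using Vpos by (simp add: divide_le_eq)
  qed
  obtain \<psi>0 where \<psi>0: "\<psi>0 \<in> V_h \<Omega> \<epsilon> T" "\<not> ae_zero \<Omega> \<psi>0" "0 \<le> l2_inner \<Omega> \<psi>0 cq"
    using nonneg_bubble[OF assms(1) h \<gamma>] by blast
  have X0: "0 \<le> X"
  proof -
    have "0 \<le> X * V_norm \<Omega> \<epsilon> \<psi>0" using VX(1)[OF \<psi>0(1,2)] \<psi>0(3) by linarith
    then show ?thesis using VX(2)[OF \<psi>0(1,2)] by (simp add: zero_le_mult_iff)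
  qed
  \<comment> \<open>The discrete counterpart of a test field may vanish, so the bound has to cover
    zero \<psi> as well; this uses \<open>X0\<close>.\<close>
  have VX': "l2_inner \<Omega> \<psi> cq \<le> X * V_norm \<Omega> \<epsilon> \<psi>" if \<psi>: "\<psi> \<in> V_h \<Omega> \<epsilon> T" for \<psi>
  proof (cases "ae_zero \<Omega> \<psi>")
    case True
    then have "l2_norm \<Omega> \<psi> = 0" using l2_norm_eq_0_iff[OF Vh(2)[OF \<psi>]] by simp
    then have "l2_inner \<Omega> \<psi> cq \<le> 0" using l2_inner_Cauchy_Schwarz[OF Vh(2)[OF \<psi>] cL] by simp
    also have "0 \<le> X * V_norm \<Omega> \<epsilon> \<psi>" using X0 V0 by simp
    finally show ?thesis .
  qed (use VX(1)[OF \<psi>] in simp)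
  have dX: "l2_norm \<Omega> dq \<le> X"
  proof (cases "ae_zero \<Omega> dq")
    case True
    then show ?thesis using l2_norm_eq_0_iff[OF dL] X0 by simp
  next
    case False
    then have dpos: "l2_norm \<Omega> dq > 0" using l2_norm_eq_0_iff[OF dL] l2_norm_nonneg[of \<Omega> dq] by linarith
    have p0: "piecewise_C1 (\<lambda>x. 0)" using affine_piecewise_C1[of 0 0] by simp
    have V: "(\<lambda>x. \<chi> j. 0) \<in> V_h \<Omega> \<epsilon> T"
    proof (rule V_h_memI[OF p0])
      show "\<exists>p\<in>P_deg 1. \<exists>b\<in>B4 K. \<forall>x\<in>K. 0 = p x + b x" if K: "K \<in> T" for K
        using bub_B4[OF K, of 0] by (intro bexI[of _ "\<lambda>x. 0"] P_deg_0) auto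
    qed simp
    have V0': "V_norm \<Omega> \<epsilon> (\<lambda>x. \<chi> j. 0) = 0"
    proof (cases "\<epsilon> > 0")
      case True
      have e: "pd i (\<lambda>x. 0) = (\<lambda>x. 0)" for i by (rule ext) simp
      have "(V_norm \<Omega> \<epsilon> (\<lambda>x. \<chi> j. 0))\<^sup>2 = 0"
        by (subst V_norm_test_field[OF dom True]) (simp_all add: p0 e z0)
      then show ?thesis by simp
    next
      case False
      have "l2_norm \<Omega> (\<lambda>x. (\<chi> j. 0) :: R3) = 0" by (simp add: l2_norm_def l2_inner_def inner_vec_def)
      then show ?thesis using False by (simp add: V_norm_def)
    qed
    have "F (\<lambda>x. \<chi> j. 0, dq) \<le> X" using V dR False by (intro XU) (simp add: A_def)
    moreover have "F (\<lambda>x. \<chi> j. 0, dq) = l2_norm \<Omega> dq"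
    proof -
      have "l2_inner \<Omega> (\<lambda>x. \<chi> j. 0) cq = 0" by (simp add: l2_inner_def inner_vec_def)
      moreover have "l2_inner \<Omega> dq dq = (l2_norm \<Omega> dq)\<^sup>2" by (simp add: l2_norm_def l2_inner_def)
      ultimately show ?thesis using dpos
        by (simp add: F_def b1[OF Vh(1)[OF V]] b2 VR_norm_def V0' power2_eq_square)
    qed
    ultimately show ?thesis by simp
  qed
  have pr: "0 \<le> patch_ratio \<kappa> M" "0 \<le> shape_bound \<gamma>" using \<kappa> by (simp_all add: patch_ratio_def shape_bound_def)
  have Cf: "3 \<le> Cf" using pr by (simp add: Cf_def)
  \<comment> \<open>The bound for test fields; passing to all of \<open>H01_field\<close> multiplies
    it by \<open>sqrt 3\<close>.\<close>
  define B where "B = sqrt Cf * X"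
  have B0: "0 \<le> B" using X0 Cf by (simp add: B_def)
  have SB: "l2_inner \<Omega> \<psi> cq \<le> sqrt 3 * B * V_norm \<Omega> \<epsilon> \<psi>" if \<psi>: "\<psi> \<in> V_sp \<Omega> \<epsilon>" "\<not> ae_zero \<Omega> \<psi>" for \<psi>
  proof (cases "\<epsilon> > 0")
    case True
    show ?thesis
    proof (rule bound_on_H01_field[OF dom True cL B0])
      fix \<eta> assume \<eta>: "\<eta> \<in> test_field \<Omega>"
      obtain \<psi>h where \<psi>h: "\<psi>h \<in> V_h \<Omega> \<epsilon> T"
        "\<And>K j. K \<in> T \<Longrightarrow> (LINT x|lebesgue_on (interior K). \<psi>h x $ j) = (LINT x|lebesgue_on (interior K). \<eta> x $ j)"
        "(V_norm \<Omega> \<epsilon> \<psi>h)\<^sup>2 \<le> Cf * (V_norm \<Omega> \<epsilon> \<eta>)\<^sup>2"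
        using fortin_field[OF \<eta> h \<gamma> \<kappa> True] unfolding Cf_def by blast
      have "V_norm \<Omega> \<epsilon> \<psi>h \<le> sqrt Cf * V_norm \<Omega> \<epsilon> \<eta>"
      proof (rule power2_le_imp_le)
        show "(V_norm \<Omega> \<epsilon> \<psi>h)\<^sup>2 \<le> (sqrt Cf * V_norm \<Omega> \<epsilon> \<eta>)\<^sup>2"
          using \<psi>h(3) Cf by (simp add: power_mult_distrib)
        show "0 \<le> sqrt Cf * V_norm \<Omega> \<epsilon> \<eta>" using V0 Cf by simp
      qed
      then have "X * V_norm \<Omega> \<epsilon> \<psi>h \<le> X * (sqrt Cf * V_norm \<Omega> \<epsilon> \<eta>)" using X0 by (rule mult_left_mono)
      moreover have "l2_inner \<Omega> \<eta> cq = l2_inner \<Omega> \<psi>h cq"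
        using \<psi>h(2) by (intro l2_inner_same_cell_means test_field_L2[OF dom \<eta>] Vh(2)[OF \<psi>h(1)] cL ck) auto
      ultimately show "l2_inner \<Omega> \<eta> cq \<le> B * V_norm \<Omega> \<epsilon> \<eta>" using VX'[OF \<psi>h(1)] by (simp add: B_def mult_ac)
    qed (use \<psi> True in \<open>auto simp: V_sp_def\<close>)
  next
    case False
    have Vn: "V_norm \<Omega> \<epsilon> \<psi>' = l2_norm \<Omega> \<psi>'" for \<psi>' using False by (simp add: V_norm_def)
    have cV: "cq \<in> V_h \<Omega> \<epsilon> T"
    proof -
      have "\<exists>p\<in>P_deg 1. \<exists>b\<in>B4 K. AE x in lebesgue_on K. cq x $ i = p x + b x" if K: "K \<in> T" for K i
      proof -
        obtain k where "AE x in lebesgue_on (interior K). cq x = k" using ck[OF K] by blast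
        then have k: "AE x in lebesgue_on K. cq x = k" by (rule cell_AE[OF K])
        show ?thesis using bub_B4[OF K, of 0] k
          by (intro bexI[of _ "\<lambda>x. k $ i"] bexI[of _ "\<lambda>x. 0"] P_deg_const) (auto elim: eventually_mono)
      qed
      then show ?thesis using cL False by (simp add: V_h_def V_sp_def)
    qed
    have cX: "l2_norm \<Omega> cq \<le> X"
    proof (cases "l2_norm \<Omega> cq = 0")
      case False
      then have "l2_norm \<Omega> cq > 0" using l2_norm_nonneg[of \<Omega> cq] by linarith
      moreover have "l2_norm \<Omega> cq * l2_norm \<Omega> cq \<le> X * l2_norm \<Omega> cq"
        using VX'[OF cV] by (simp add: Vn l2_norm_def l2_inner_def)
      ultimately show ?thesis by simp
    qed (use X0 in simp)
    have "l2_inner \<Omega> \<psi> cq \<le> l2_norm \<Omega> \<psi> * l2_norm \<Omega> cq"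
      using l2_inner_Cauchy_Schwarz[OF V_sp_L2[OF dom \<psi>(1)] cL] by simp
    also have "\<dots> \<le> l2_norm \<Omega> \<psi> * (sqrt 3 * B)"
    proof (rule mult_left_mono)
      \<comment> \<open>For \<epsilon> = 0 the constant 1 would do; it is weakened to the common
        one.\<close>
      have "1 \<le> sqrt 3 * sqrt Cf" using Cf by (simp add: real_sqrt_mult[symmetric])
      from mult_right_mono[OF this X0] show "l2_norm \<Omega> cq \<le> sqrt 3 * B" using cX by (simp add: B_def mult_ac)
    qed simp
    finally show ?thesis by (simp add: Vn mult_ac)
  qed
  define S where "S = (SUP \<psi>\<in>{\<psi> \<in> V_sp \<Omega> \<epsilon>. \<not> ae_zero \<Omega> \<psi>}. b1 \<Omega> \<epsilon> \<psi> q / V_norm \<Omega> \<epsilon> \<psi>)"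
  have ratio: "b1 \<Omega> \<epsilon> \<psi> q / V_norm \<Omega> \<epsilon> \<psi> \<le> sqrt 3 * B" if \<psi>: "\<psi> \<in> V_sp \<Omega> \<epsilon>" "\<not> ae_zero \<Omega> \<psi>" for \<psi>
  proof -
    have "V_norm \<Omega> \<epsilon> \<psi> > 0"
      using pos[OF V_sp_L2[OF dom \<psi>(1)] \<psi>(2)] l2_norm_le_V_norm[OF dom, of \<psi> \<epsilon>] by linarith
    then show ?thesis using SB[OF \<psi>] b1[OF \<psi>(1)] by (simp add: divide_le_eq)
  qed
  have \<psi>0V: "\<psi>0 \<in> {\<psi> \<in> V_sp \<Omega> \<epsilon>. \<not> ae_zero \<Omega> \<psi>}" using \<psi>0 Vh(1) by simp
  have "S \<le> sqrt 3 * B" unfolding S_def using \<psi>0V ratio by (intro cSUP_least) auto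
  \<comment> \<open>An upper bound for S may be squared only because S is non-negative.\<close>
  moreover have "0 \<le> S"
  proof -
    have "0 \<le> b1 \<Omega> \<epsilon> \<psi>0 q / V_norm \<Omega> \<epsilon> \<psi>0" using \<psi>0(3) V0 b1[OF Vh(1)[OF \<psi>0(1)]] by simp
    also have "\<dots> \<le> S" unfolding S_def
      by (rule cSUP_upper[OF \<psi>0V]) (use ratio in \<open>auto intro!: bdd_aboveI2\<close>)
    finally show ?thesis .
  qed
  ultimately have "S\<^sup>2 \<le> (sqrt 3 * B)\<^sup>2" by (intro power_mono)
  also have "(sqrt 3 * B)\<^sup>2 = 3 * Cf * X\<^sup>2" using Cf by (simp add: B_def power_mult_distrib)
  finally have "S\<^sup>2 + (l2_norm \<Omega> dq)\<^sup>2 \<le> (3 * Cf + 1) * X\<^sup>2"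
    using power_mono[OF dX l2_norm_nonneg, of 2] by (simp add: algebra_simps)
  then have "sqrt (S\<^sup>2 + (l2_norm \<Omega> dq)\<^sup>2) \<le> sqrt ((3 * Cf + 1) * X\<^sup>2)" by (rule real_sqrt_le_mono)
  also have "\<dots> = sqrt (3 * Cf + 1) * X" using X0 by (simp add: real_sqrt_mult)
  finally have "Q_norm \<Omega> \<epsilon> q \<le> sqrt (3 * Cf + 1) * X" by (simp add: Q_norm_def S_def dq_def)
  moreover have "0 < sqrt (3 * Cf + 1)" using Cf by simp
  ultimately have "1 / sqrt (3 * Cf + 1) * Q_norm \<Omega> \<epsilon> q \<le> X" by (simp add: divide_le_eq mult.commute)
  then show ?thesis by (simp add: X_def A_def F_def)
qed

end

section \<open>From mesh families to uniform constants\<close>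

lemma triangulation_tet_mesh:
  assumes \<Omega>: "polyhedral_domain \<Omega>" and T: "conforming_triangulation \<Omega> T"
  shows "\<exists>V c g. tet_mesh \<Omega> T V c g"
proof -
  have "\<forall>K\<in>T. \<exists>V c g. tetrahedron V c g \<and> K = convex hull V"
    using T simplex_tetrahedron by (simp add: conforming_triangulation_def)
  then obtain V c g where "\<And>K. K \<in> T \<Longrightarrow> tetrahedron (V K) (c K) (g K) \<and> K = convex hull (V K)" by metis
  then have "tet_mesh \<Omega> T V c g"
    using assms unfolding tet_mesh_def polyhedral_domain_def conforming_triangulation_def by blast
  then show ?thesis by blast
qed

text \<open>The two regularity conditions give
  \<open>h \<le> \<tau> * \<sigma> * inball_diameter K\<close>. The inball diameter is a supremum,
  so half of this value is taken to lie strictly below it and be exceeded by an actual ball; another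
  factor 2 turns the diameter into a radius.\<close>

lemma shape_regular_cball:
  assumes K: "K \<noteq> {}" and \<sigma>: "\<sigma> > 0" "diameter K \<le> \<sigma> * inball_diameter K"
    and \<tau>: "\<tau> > 0" "h \<le> \<tau> * diameter K" and "h > 0"
  shows "\<exists>x0. cball x0 (1 / (4 * \<sigma> * \<tau>) * h) \<subseteq> K"
proof -
  define R where "R = {2 * r | r. r \<ge> 0 \<and> (\<exists>x. cball x r \<subseteq> K)}"
  have "R \<noteq> {}"
  proof -
    obtain x where "x \<in> K" using K by blast
    then have "cball x 0 \<subseteq> K" by simp
    then show ?thesis unfolding R_def by blast
  qed
  have "h \<le> \<tau> * (\<sigma> * inball_diameter K)" using \<sigma>(2) \<tau> by (meson mult_left_mono less_imp_le order_trans)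
  then have "h / (2 * \<sigma> * \<tau>) * 2 \<le> inball_diameter K" using \<sigma>(1) \<tau>(1) by (simp add: field_simps)
  moreover have "h / (2 * \<sigma> * \<tau>) > 0" using assms by simp
  ultimately have "h / (2 * \<sigma> * \<tau>) < Sup R" unfolding inball_diameter_def R_def[symmetric] by linarith
  then obtain y where "y \<in> R" "h / (2 * \<sigma> * \<tau>) < y" using less_cSupD[OF \<open>R \<noteq> {}\<close>] by blast
  then obtain r x where r: "cball x r \<subseteq> K" "h / (2 * \<sigma> * \<tau>) < 2 * r" by (auto simp: R_def)
  have "1 / (4 * \<sigma> * \<tau>) * h \<le> r" using r(2) \<sigma>(1) \<tau>(1) by (simp add: field_simps)
  then have "cball x (1 / (4 * \<sigma> * \<tau>) * h) \<subseteq> cball x r" by (rule subset_cball)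
  then show ?thesis using r(1) by blast
qed

theorem lemma3p3:
  fixes \<Omega> :: "R3 set" and \<epsilon>0 :: real and H :: "real set" and \<T> :: "real \<Rightarrow> R3 set set"
  assumes "polyhedral_domain \<Omega>"
    and "\<epsilon>0 > 0"
    and "H \<subseteq> {0<..}"
    and "\<And>h. h \<in> H \<Longrightarrow> conforming_triangulation \<Omega> (\<T> h)"
    and "\<And>h. h \<in> H \<Longrightarrow> mesh_size (\<T> h) = h"
    and "shape_regular H \<T>"
    and "quasi_uniform H \<T>"
  shows "\<exists>C>0. \<forall>\<epsilon>. 0 \<le> \<epsilon> \<and> \<epsilon> \<le> \<epsilon>0 \<longrightarrow> (\<forall>h\<in>H. \<forall>q\<in>Q_h \<Omega> (\<T> h).
           (SUP (\<psi>, s)\<in>{(\<psi>, s). \<psi> \<in> V_h \<Omega> \<epsilon> (\<T> h) \<and> s \<in> R_h \<Omega> (\<T> h) \<and>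
                                 \<not> (ae_zero \<Omega> \<psi> \<and> ae_zero \<Omega> s)}.
              (b1 \<Omega> \<epsilon> \<psi> q + b2 \<Omega> s q) / VR_norm \<Omega> \<epsilon> \<psi> s)
           \<ge> C * Q_norm \<Omega> \<epsilon> q)"
proof -
  obtain \<sigma> where \<sigma>: "\<sigma> > 0" "\<And>h K. h \<in> H \<Longrightarrow> K \<in> \<T> h \<Longrightarrow> diameter K \<le> \<sigma> * inball_diameter K"
    using assms(6) by (auto simp: shape_regular_def)
  obtain \<tau> where \<tau>: "\<tau> > 0" "\<And>h K. h \<in> H \<Longrightarrow> K \<in> \<T> h \<Longrightarrow> mesh_size (\<T> h) \<le> \<tau> * diameter K"
    using assms(7) by (auto simp: quasi_uniform_def)
  \<comment> \<open>Bounds all mesh sizes, so that the exterior balls exist at every scale h; the +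
    1 makes it positive.\<close>
  define D where "D = diameter (closure \<Omega>) + 1"
  have bd: "bounded (closure \<Omega>)" using assms(1) by (simp add: polyhedral_domain_def bounded_closure)
  have "D > 0" using diameter_ge_0[OF bd] by (simp add: D_def)
  note ext = polyhedral_domain_exterior_balls[OF assms(1) this]
  obtain \<kappa> where \<kappa>0: "\<kappa> > 0 \<and> (\<exists>M\<ge>0. \<forall>z\<in>frontier \<Omega>. \<forall>r. 0 < r \<and> r \<le> D \<longrightarrow>
     (\<exists>z'. dist z z' \<le> M * r \<and> ball z' (\<kappa> * r) \<inter> \<Omega> = {}))"
    using ext by (rule exE)
  from \<kappa>0[THEN conjunct2] obtain M where M: "M \<ge> 0 \<and> (\<forall>z\<in>frontier \<Omega>. \<forall>r. 0 < r \<and> r \<le> D \<longrightarrow>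
     (\<exists>z'. dist z z' \<le> M * r \<and> ball z' (\<kappa> * r) \<inter> \<Omega> = {}))"
    by (rule exE)
  have \<kappa>: "\<kappa> > 0" "M \<ge> 0"
    "\<And>z r. z \<in> frontier \<Omega> \<Longrightarrow> 0 < r \<Longrightarrow> r \<le> D \<Longrightarrow> \<exists>z'. dist z z' \<le> M * r \<and> ball z' (\<kappa> * r) \<inter> \<Omega> = {}"
    using \<kappa>0 M by simp_all
  define \<gamma> where "\<gamma> = 1 / (4 * \<sigma> * \<tau>)"
  have \<gamma>: "\<gamma> > 0" using \<sigma>(1) \<tau>(1) by (simp add: \<gamma>_def)
  define Cf where "Cf = (3 + 12 * (1 + shape_bound \<gamma>) * patch_ratio \<kappa> M)
      + (2 + 24 * shape_bound \<gamma>) / \<gamma>\<^sup>2 * patch_ratio \<kappa> M * (1 + M + \<kappa>)\<^sup>2"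
  have "0 \<le> patch_ratio \<kappa> M" "0 \<le> shape_bound \<gamma>" using \<kappa>(1,2) by (simp_all add: patch_ratio_def shape_bound_def)
  then have "0 < 3 * Cf + 1" by (simp add: Cf_def add_nonneg_pos add_pos_nonneg)
  then have "1 / sqrt (3 * Cf + 1) > 0" by simp
  moreover have "1 / sqrt (3 * Cf + 1) * Q_norm \<Omega> \<epsilon> q \<le>
       (SUP (\<psi>, s)\<in>{(\<psi>, s). \<psi> \<in> V_h \<Omega> \<epsilon> (\<T> h) \<and> s \<in> R_h \<Omega> (\<T> h) \<and> \<not> (ae_zero \<Omega> \<psi> \<and> ae_zero \<Omega> s)}.
              (b1 \<Omega> \<epsilon> \<psi> q + b2 \<Omega> s q) / VR_norm \<Omega> \<epsilon> \<psi> s)"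
    if "0 \<le> \<epsilon>" "h \<in> H" "q \<in> Q_h \<Omega> (\<T> h)" for \<epsilon> h q
  proof -
    have h0: "h > 0" using assms(3) that(2) by auto
    have T: "conforming_triangulation \<Omega> (\<T> h)" by (rule assms(4)[OF that(2)])
    obtain V c g where "tet_mesh \<Omega> (\<T> h) V c g" using triangulation_tet_mesh[OF assms(1) T] by blast
    then interpret tet_mesh \<Omega> "\<T> h" V c g .
    have ne: "\<T> h \<noteq> {}" using cover assms(1) by (auto simp: polyhedral_domain_def)
    have fin: "finite (diameter ` \<T> h)" using finite_T by simp
    have diam: "diameter K \<le> h" if "K \<in> \<T> h" for K
      using Max_ge[OF fin] that assms(5)[OF \<open>h \<in> H\<close>] by (auto simp: mesh_size_def)
    \<comment> \<open>The mesh size is attained by a cell, and a cell lies in the closure of the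
      domain, whence h \<le> D.\<close>
    have "h \<in> diameter ` \<T> h" using Max_in[OF fin] ne assms(5)[OF \<open>h \<in> H\<close>] by (simp add: mesh_size_def)
    then obtain K where K: "K \<in> \<T> h" "h = diameter K" by blast
    have "K \<subseteq> closure \<Omega>" using K(1) cover by blast
    from diameter_subset[OF this bd] K(2) have hD: "h \<le> D" by (simp add: D_def)
    show ?thesis unfolding Cf_def
    proof (rule mesh_inf_sup[OF ne h0 diam \<gamma> _ \<kappa>(1,2) _ that(1,3)])
      show "\<exists>x0. cball x0 (\<gamma> * h) \<subseteq> K" if K: "K \<in> \<T> h" for K
        unfolding \<gamma>_def
      proof (rule shape_regular_cball[OF _ \<sigma>(1) \<sigma>(2)[OF \<open>h \<in> H\<close> K] \<tau>(1) _ h0])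
        interpret t: tetrahedron "V K" "c K" "g K" by (rule tet[OF K])
        have "V K \<noteq> {}" using t.card_V by auto
        then show "K \<noteq> {}" using hull[OF K] convex_hull_eq_empty by metis
        show "h \<le> \<tau> * diameter K" using \<tau>(2)[OF \<open>h \<in> H\<close> K] assms(5)[OF \<open>h \<in> H\<close>] by simp
      qed
      show "\<exists>z'. dist z z' \<le> M * h \<and> ball z' (\<kappa> * h) \<inter> \<Omega> = {}" if "z \<in> frontier \<Omega>" for z
        by (rule \<kappa>(3)[OF that h0 hD])
    qed
  qed
  ultimately show ?thesis by (intro exI[of _ "1 / sqrt (3 * Cf + 1)"]) auto
qed

end
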